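(* Fix integers $n,n_1,\dots,n_m\ge 1$ and exponents $\mathbf{p}=(p_j)_{j=1}^m\in[0,1]^m$. There exist $N\in\mathbb{N}$ and $\delta_0>0$ such that for every $\delta\in(0,\delta_0)$ and every admissible $\mathbf{L}=(L_j)_{j=1}^m$, $$\inf_{\mathbf{A}}\ \mathrm{BL}_{\mathrm{g}}(\mathbf{L},\mathbf{p};\mathbf{A})^{-2}\ \leq\ \mathrm{BL}(\mathbf{L},\mathbf{p})^{-2}+\delta\prod_{j=1}^m\det(L_jL_j^* )^{p_j},$$ where, with $C_j=(L_jL_j^* )^{1/2}$, the infimum is taken over all $m$-tuples $\mathbf{A}=(A_j)_{j=1}^m$ of positive definite $n_j\times n_j$ matrices satisfying $\|C_j^*A_jC_j\|\leq\delta^{-N}$ and $\|(C_j^*A_jC_j)^{-1}\|\leq\delta^{-N}$ for all $1\le j\le m$. (The constants $N,\delta_0$ depend only on $\mathbf{p}$ and $n,n_1,\dots,n_m$, not on $\mathbf{L}$.)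
   Context: An $m$-tuple $\mathbf{L}=(L_j)_{j=1}^m$ of linear maps $L_j:\mathbb{R}^n\to\mathbb{R}^{n_j}$ is admissible if each $L_j$ is surjective. The Brascamp--Lieb constant $\mathrm{BL}(\mathbf{L},\mathbf{p})\in(0,\infty]$ is the smallest constant $C$ for which $\int_{\mathbb{R}^n}\prod_{j=1}^m f_j(L_jx)^{p_j}\,dx\leq C\prod_{j=1}^m\big(\int_{\mathbb{R}^{n_j}}f_j\big)^{p_j}$ for all nonnegative integrable $f_j$ on $\mathbb{R}^{n_j}$. For positive definite (real symmetric) $n_j\times n_j$ matrices $A_j$, $$\mathrm{BL}_{\mathrm{g}}(\mathbf{L},\mathbf{p};\mathbf{A})=\frac{\prod_{j=1}^m\det(A_j)^{p_j/2}}{\det\left(\sum_{j=1}^mp_jL_j^*A_jL_j\right)^{1/2}},$$ with value $\infty$ if the denominator vanishes. The convention $\infty^{-2}=0$ is used, and $\|\cdot\|$ is the operator norm. *)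

theory Defs
  imports
    "HOL-Analysis.Analysis"
    "Jordan_Normal_Form.Determinant"
    "Jordan_Normal_Form.Gauss_Jordan_Elimination"
begin

unbundle no vec_syntax
unbundle no inner_syntax
hide_type (open) Finite_Cartesian_Product.vec
hide_const (open) Finite_Cartesian_Product.vec Finite_Cartesian_Product.mat
  Finite_Cartesian_Product.row Finite_Cartesian_Product.column
  Determinants.det

text \<open>
  The dimensions \<open>d j\<close> vary with the index \<open>j\<close>, so \<open>\<real>\<^sup>k\<close> is rendered as
  \<^term>\<open>carrier_vec k :: real vec set\<close>. A linear map from \<open>\<real>\<^sup>n\<close> to \<open>\<real>\<^sup>k\<close> is its
  matrix in \<^term>\<open>carrier_mat k n :: real mat set\<close>, and its adjoint is the transpose.
  Tuples \<open>(x\<^sub>j)\<close> with \<open>m\<close> entries are functions on \<^typ>\<open>nat\<close> of which only the values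
  at \<open>j < m\<close> matter.
\<close>

text \<open>
  \<^term>\<open>vec k\<close> is injective on the space of the product measure, which consists of
  functions that are \<^term>\<open>undefined\<close> outside \<open>{..<k}\<close>; its image is
  \<^term>\<open>carrier_vec k\<close>.
\<close>
definition lborel_vec :: "nat \<Rightarrow> real vec measure" where
  "lborel_vec k = embed_measure (\<Pi>\<^sub>M i\<in>{..<k}. lborel) (vec k)"

definition pos_def_mat :: "nat \<Rightarrow> real mat \<Rightarrow> bool" where
  "pos_def_mat k A \<longleftrightarrow> A \<in> carrier_mat k k \<and> transpose_mat A = A \<and>
     (\<forall>v\<in>carrier_vec k. v \<noteq> 0\<^sub>v k \<longrightarrow> 0 < v \<bullet> (A *\<^sub>v v))"

definition pos_semidef_mat :: "nat \<Rightarrow> real mat \<Rightarrow> bool" where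
  "pos_semidef_mat k A \<longleftrightarrow> A \<in> carrier_mat k k \<and> transpose_mat A = A \<and>
     (\<forall>v\<in>carrier_vec k. 0 \<le> v \<bullet> (A *\<^sub>v v))"

text \<open>Meaningful for positive semidefinite arguments, whose root is unique.\<close>
definition sqrt_mat :: "real mat \<Rightarrow> real mat" where
  "sqrt_mat A = (THE C. pos_semidef_mat (dim_row A) C \<and> C * C = A)"

definition op_norm_mat :: "real mat \<Rightarrow> real" where
  "op_norm_mat A = (SUP v\<in>{v \<in> carrier_vec (dim_col A). v \<bullet> v \<le> 1}. sqrt ((A *\<^sub>v v) \<bullet> (A *\<^sub>v v)))"

text \<open>Meaningful for invertible arguments.\<close>
definition inv_mat :: "real mat \<Rightarrow> real mat" where
  "inv_mat A = the (mat_inverse A)"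

definition admissible :: "nat \<Rightarrow> nat \<Rightarrow> (nat \<Rightarrow> nat) \<Rightarrow> (nat \<Rightarrow> real mat) \<Rightarrow> bool" where
  "admissible n m d L \<longleftrightarrow> (\<forall>j<m. L j \<in> carrier_mat (d j) n \<and>
     (\<forall>y\<in>carrier_vec (d j). \<exists>x\<in>carrier_vec n. L j *\<^sub>v x = y))"

text \<open>Differs from \<open>powr\<close> only in that \<open>0\<^sup>0 = 1\<close>, whereas \<open>0 powr 0 = 0\<close>.\<close>
definition rpow :: "real \<Rightarrow> real \<Rightarrow> real" where
  "rpow x a = (if a = 0 then 1 else x powr a)"

text \<open>
  The set contains its infimum, which is therefore the smallest constant. Taking the \<open>f j\<close>
  Borel rather than Lebesgue measurable does not change it, since null sets have null preimages
  under surjective linear maps.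
\<close>
definition BL :: "nat \<Rightarrow> nat \<Rightarrow> (nat \<Rightarrow> nat) \<Rightarrow> (nat \<Rightarrow> real mat) \<Rightarrow> (nat \<Rightarrow> real) \<Rightarrow> ennreal" where
  "BL n m d L p = Inf {C. \<forall>f :: nat \<Rightarrow> real vec \<Rightarrow> real.
     (\<forall>j<m. integrable (lborel_vec (d j)) (f j) \<and> (\<forall>y\<in>carrier_vec (d j). 0 \<le> f j y)) \<longrightarrow>
     (\<integral>\<^sup>+ x. ennreal (\<Prod>j<m. rpow (f j (L j *\<^sub>v x)) (p j)) \<partial>lborel_vec n)
       \<le> C * ennreal (\<Prod>j<m. rpow (\<integral> y. f j y \<partial>lborel_vec (d j)) (p j))}"

text \<open>The matrix of \<open>\<Sum>\<^sub>j p\<^sub>j L\<^sub>j\<^sup>* A\<^sub>j L\<^sub>j\<close>, summed entrywise because \<^typ>\<open>real mat\<close> is not a monoid.\<close>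
definition BL_form :: "nat \<Rightarrow> nat \<Rightarrow> (nat \<Rightarrow> real mat) \<Rightarrow> (nat \<Rightarrow> real) \<Rightarrow> (nat \<Rightarrow> real mat) \<Rightarrow> real mat" where
  "BL_form n m L p A =
     mat n n (\<lambda>ik. \<Sum>j<m. p j * (transpose_mat (L j) * A j * L j) $$ ik)"

definition BL_g :: "nat \<Rightarrow> nat \<Rightarrow> (nat \<Rightarrow> real mat) \<Rightarrow> (nat \<Rightarrow> real) \<Rightarrow> (nat \<Rightarrow> real mat) \<Rightarrow> ennreal" where
  "BL_g n m L p A =
     (if det (BL_form n m L p A) = 0 then \<infinity>
      else ennreal ((\<Prod>j<m. det (A j) powr (p j / 2)) / sqrt (det (BL_form n m L p A))))"

text \<open>\<open>x\<^sup>-\<^sup>2\<close> on \<open>[0, \<infinity>]\<close>, with \<open>\<infinity>\<^sup>-\<^sup>2 = 0\<close>.\<close>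
definition inv_sq :: "ennreal \<Rightarrow> ennreal" where
  "inv_sq x = (inverse x)\<^sup>2"

definition bounded_tuples ::
  "nat \<Rightarrow> (nat \<Rightarrow> nat) \<Rightarrow> (nat \<Rightarrow> real mat) \<Rightarrow> real \<Rightarrow> (nat \<Rightarrow> real mat) set" where
  "bounded_tuples m d L R = {A. \<forall>j<m. pos_def_mat (d j) (A j) \<and>
     (let C = sqrt_mat (L j * transpose_mat (L j)); B = transpose_mat C * A j * C
      in op_norm_mat B \<le> R \<and> op_norm_mat (inv_mat B) \<le> R)}"

end

(*
Write gform A for BL_g(L,p;A)^(-2). Diagonalising the A_j turns det(sum_j p_j L_j^* A_j L_j) into a
posynomial in the eigenvalues whose coefficients are Gram determinants (Cauchy-Binet). When
L_j L_j^* = 1 these are bounded, and linear elimination in the logarithms of the eigenvalues shows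
that moving all eigenvalues into [delta^N, delta^(-N)] increases gform by at most delta; the
substitution A_j -> C_j A_j C_j reduces the general case to this one.

It remains to see that BL^(-2) is at least I = inf gform, which is Lieb's theorem. If
A_j^(-1) = L_j M^(-1) L_j^* with M = Q + sum_j p_j L_j^* A_j L_j, then evolving f_j by the heat flow
of A_j is monotone for the Brascamp-Lieb functional with the Gaussian kernel exp(-pi <Qz,z>), whose
constant is therefore attained at A. The system for A is solved by a monotone iteration. To keep it
bounded, L_j x is replaced by L_j x + mu w_j with auxiliary variables w_j and p_j by theta p_j; the
determinants that arise are compared with I, and the limit mu -> 0, theta -> 1, Q -> 0 in the
variables x gives the inequality for continuous compactly supported f_j, hence for all f_j.
*)

theory Submission
  imports Defs "HOL-Probability.Distributions" "Jordan_Normal_Form.Spectral_Radius"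
begin

unbundle no vec_syntax
unbundle no inner_syntax
hide_type (open) Finite_Cartesian_Product.vec
hide_const (open) Finite_Cartesian_Product.vec Finite_Cartesian_Product.mat
 Finite_Cartesian_Product.row Finite_Cartesian_Product.column
 Determinants.det

section \<open>Real symmetric matrices\<close>

text \<open>Uniformity in \<open>L\<close> rests on one fact: the exponents of the posynomial depend
  on \<open>p\<close> and the dimensions alone, while \<open>L\<close> enters only through
  nonnegative coefficients of bounded sum. A constant extracted from the exponents therefore serves
  all \<open>L\<close>. In Lieb's theorem the obstacle is that the infimum of \<open>gform\<close>
  need not be attained, so the system for A may have no solution for the given maps. A positive
  definite Q bounds the iterates from below; the variables w_j and the factor theta < 1 bound them
  from above, through the supersolution R = 1 / (mu^2 (1 - theta)), and this is where p_j <= 1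
  enters. The price is a comparison of the exponents theta p_j and p_j, which costs a factor
  kappa^((1 - theta) D) with kappa of the order of 1/epsilon. It disappears when 1 - theta tends to
  0 faster than 1 / ln kappa. The flow runs in small time steps and is never differentiated: a
  second order expansion of one step reduces monotonicity to a covariance inequality for a Gaussian
  vector.\<close>

abbreviation rvec :: "nat \<Rightarrow> real vec set" where "rvec \<equiv> carrier_vec"
abbreviation rmat :: "nat \<Rightarrow> nat \<Rightarrow> real mat set" where "rmat \<equiv> carrier_mat"
abbreviation nsq :: "real vec \<Rightarrow> real" where "nsq v \<equiv> v \<bullet> v"
abbreviation vnorm :: "real vec \<Rightarrow> real" where "vnorm v \<equiv> sqrt (nsq v)"
abbreviation leb :: "nat \<Rightarrow> real vec measure" where "leb \<equiv> lborel_vec"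
abbreviation bmeas :: "nat \<Rightarrow> (real vec \<Rightarrow> 'a :: topological_space) set" where
 "bmeas k \<equiv> borel_measurable (leb k)"

lemmas integral_cong_refl = Bochner_Integration.integral_cong[OF refl]

lemma mult_vec_index:
 assumes "A \<in> carrier_mat n k" "v \<in> carrier_vec k" "i < n"
 shows "(A *\<^sub>v v) $ i = (\<Sum>j<k. A $$ (i, j) * v $ j)"
 using assms by (auto simp: scalar_prod_def row_def lessThan_atLeast0 intro!: sum.cong)

lemma mult_mat_index:
 assumes "A \<in> carrier_mat n k" "B \<in> carrier_mat k l" "i < n" "j < l"
 shows "(A * B) $$ (i, j) = (\<Sum>t<k. A $$ (i, t) * B $$ (t, j))"
 using assms by (auto simp: scalar_prod_def row_def lessThan_atLeast0 intro!: sum.cong)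

lemma scalar_prod_eq_sum:
 assumes "y \<in> carrier_vec k"
 shows "x \<bullet> y = (\<Sum>j<k. x $ j * y $ j)"
 using assms by (auto simp: scalar_prod_def lessThan_atLeast0 intro!: sum.cong)

lemma nsq_nonneg: "0 \<le> nsq v"
 by (auto simp: scalar_prod_def intro!: sum_nonneg)

lemma nsq_eq_0:
 assumes "(v :: real vec) \<in> rvec k"
 shows "nsq v = 0 \<longleftrightarrow> v = 0\<^sub>v k"
proof
 assume "nsq v = 0"
 hence "(\<Sum>j<k. v $ j * v $ j) = 0"
  using scalar_prod_eq_sum[OF assms] by simp
 hence "\<forall>j<k. v $ j = 0"
  by (subst (asm) sum_nonneg_eq_0_iff) auto
 with assms show "v = 0\<^sub>v k" by auto
qed (use assms in auto)

lemma scalar_prod_mult_mat_vec_commute: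
 assumes "(A :: real mat) \<in> rmat n n" "A\<^sup>T = A"
  "x \<in> rvec n" "y \<in> rvec n"
 shows "x \<bullet> (A *\<^sub>v y) = y \<bullet> (A *\<^sub>v x)"
 using assms by (metis comm_scalar_prod mult_mat_vec_carrier transpose_vec_mult_scalar)

text \<open>For a complex eigenvalue \<open>k\<close> with eigenvector a + i b, pairing the two real
  equations through the symmetry of \<open>A\<close> gives Im k (|a|^2 + |b|^2) = 0. Hence
  \<open>k\<close> is real, and whichever of a and b is nonzero is a real eigenvector.\<close>

lemma real_symmetric_eigenvector:
 assumes A: "(A :: real mat) \<in> carrier_mat n n" "transpose_mat A = A" and n: "0 < n"
 obtains e v where "v \<in> carrier_vec n" "nsq v = 1" "A *\<^sub>v v = e \<cdot>\<^sub>v v"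
proof -
 define B where "B = map_mat complex_of_real A"
 have B: "B \<in> carrier_mat n n" using A by (simp add: B_def)
 obtain k where "k \<in> spectrum B" using spectrum_non_empty[OF B n] by blast
 then obtain w where w: "w \<in> carrier_vec n" "w \<noteq> 0\<^sub>v n" "B *\<^sub>v w = k \<cdot>\<^sub>v w"
  using B by (auto simp: spectrum_def eigenvalue_def eigenvector_def)
 define a b where "a = map_vec Re w" and "b = map_vec Im w"
 have ab: "a \<in> carrier_vec n" "b \<in> carrier_vec n" using w by (auto simp: a_def b_def)
 have eq: "(\<Sum>j<n. complex_of_real (A $$ (i, j)) * w $ j) = k * w $ i" if "i < n" for i
  using arg_cong[OF w(3), of "\<lambda>v. v $ i"] that w(1) A
  by (subst (asm) mult_vec_index[OF B w(1) that]) (auto simp: B_def)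
 have "A *\<^sub>v a = Re k \<cdot>\<^sub>v a - Im k \<cdot>\<^sub>v b"
 proof (rule eq_vecI)
  fix i assume "i < dim_vec (Re k \<cdot>\<^sub>v a - Im k \<cdot>\<^sub>v b)"
  hence i: "i < n" using ab by auto
  show "(A *\<^sub>v a) $ i = (Re k \<cdot>\<^sub>v a - Im k \<cdot>\<^sub>v b) $ i"
   using arg_cong[OF eq[OF i], of Re] i w(1) ab
   by (subst mult_vec_index[OF A(1) ab(1) i]) (auto simp: a_def b_def)
 qed (use A ab in auto)
 moreover have Ab: "A *\<^sub>v b = Re k \<cdot>\<^sub>v b + Im k \<cdot>\<^sub>v a"
 proof (rule eq_vecI)
  fix i assume "i < dim_vec (Re k \<cdot>\<^sub>v b + Im k \<cdot>\<^sub>v a)"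
  hence i: "i < n" using ab by auto
  show "(A *\<^sub>v b) $ i = (Re k \<cdot>\<^sub>v b + Im k \<cdot>\<^sub>v a) $ i"
   using arg_cong[OF eq[OF i], of Im] i w(1) ab
   by (subst mult_vec_index[OF A(1) ab(2) i]) (auto simp: a_def b_def)
 qed (use A ab in auto)
 ultimately have "a \<bullet> (Re k \<cdot>\<^sub>v b + Im k \<cdot>\<^sub>v a) = b \<bullet> (Re k \<cdot>\<^sub>v a - Im k \<cdot>\<^sub>v b)"
  using scalar_prod_mult_mat_vec_commute[OF A ab] by simp
 hence "Im k * (nsq a + nsq b) = 0"
  using ab comm_scalar_prod[OF ab]
  by (simp add: scalar_prod_add_distrib[of _ n] scalar_prod_minus_distrib[of _ n] algebra_simps)
 moreover have ne: "a \<noteq> 0\<^sub>v n \<or> b \<noteq> 0\<^sub>v n"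
 proof (rule ccontr)
  assume "\<not> ?thesis"
  hence *: "a = 0\<^sub>v n" "b = 0\<^sub>v n" by auto
  have "w $ i = 0" if "i < n" for i
   using arg_cong[OF *(1), of "\<lambda>v. v $ i"] arg_cong[OF *(2), of "\<lambda>v. v $ i"] that w(1)
   by (auto simp: a_def b_def complex_eq_iff)
  thus False using w by auto
 qed
 hence "nsq a + nsq b > 0"
  using nsq_eq_0[OF ab(1)] nsq_eq_0[OF ab(2)]
   nsq_nonneg[of a] nsq_nonneg[of b] by linarith
 ultimately have "Im k = 0" by auto
 with \<open>A *\<^sub>v a = _\<close> Ab ab have ev: "A *\<^sub>v a = Re k \<cdot>\<^sub>v a" "A *\<^sub>v b = Re k \<cdot>\<^sub>v b" by auto
 obtain u where u: "u \<in> carrier_vec n" "u \<noteq> 0\<^sub>v n" "A *\<^sub>v u = Re k \<cdot>\<^sub>v u"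
  using ne ev ab by blast
 have pos: "nsq u > 0"
  using nsq_eq_0[OF u(1)] u(2) nsq_nonneg[of u] by linarith
 show thesis
 proof (rule that)
  let ?v = "(1 / vnorm u) \<cdot>\<^sub>v u"
  show "?v \<in> carrier_vec n" using u by simp
  show "nsq ?v = 1" using u pos by (simp add: field_simps)
  show "A *\<^sub>v ?v = Re k \<cdot>\<^sub>v ?v"
   using u A by (simp add: mult_mat_vec[of _ n n] smult_smult_assoc mult.commute)
 qed
qed

text \<open>The reflection in the hyperplane orthogonal to w = v - e_0 exchanges the two unit
  vectors v and e_0.\<close>

lemma householder:
 assumes v: "(v :: real vec) \<in> rvec n" "nsq v = 1" and n: "0 < n"
 obtains H where "H \<in> rmat n n" "H\<^sup>T = H" "H * H = 1\<^sub>m n"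
  "H *\<^sub>v v = unit_vec n 0"
proof (cases "v = unit_vec n 0")
 case True
 thus thesis using that[of "1\<^sub>m n"] by auto
next
 case False
 define w where "w = v - unit_vec n 0"
 have w: "w \<in> rvec n" using v by (simp add: w_def)
 have "w \<noteq> 0\<^sub>v n"
 proof
  assume "w = 0\<^sub>v n"
  hence "v $ i = unit_vec n 0 $ i" if "i < n" for i
  proof -
   have "w $ i = v $ i - unit_vec n 0 $ i" using that v by (simp add: w_def)
   thus ?thesis using \<open>w = 0\<^sub>v n\<close> that by simp
  qed
  thus False using False v by auto
 qed
 hence s: "nsq w > 0"
  using nsq_eq_0[OF w] nsq_nonneg[of w] by linarith
 define c where "c = 2 / nsq w"
 define H where "H = mat n n (\<lambda>(i, j). (if i = j then 1 else 0) - c * w $ i * w $ j)"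
 have H: "H \<in> rmat n n" by (simp add: H_def)
 have sumw: "(\<Sum>t<n. w $ t * w $ t) = nsq w" using scalar_prod_eq_sum[OF w] by simp
 show thesis
 proof (rule that[OF H])
  show "H\<^sup>T = H" by (rule eq_matI) (auto simp: H_def)
  show "H * H = 1\<^sub>m n"
  proof (rule eq_matI)
   fix i j assume "i < dim_row (1\<^sub>m n :: real mat)" "j < dim_col (1\<^sub>m n :: real mat)"
   hence ij: "i < n" "j < n" by auto
   have "(H * H) $$ (i, j) = (\<Sum>t<n. H $$ (i, t) * H $$ (t, j))"
    by (rule mult_mat_index[OF H H ij])
   also have "... = (\<Sum>t<n. (if i = t then if t = j then 1 else 0 else 0)
     - (if i = t then c * w $ t * w $ j else 0) - (if t = j then c * w $ i * w $ t else 0)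
     + c * c * w $ i * w $ j * (w $ t * w $ t))"
    using ij by (intro sum.cong) (auto simp: H_def algebra_simps)
   also have "... = (if i = j then 1 else 0) - 2 * c * w $ i * w $ j
     + c * c * w $ i * w $ j * nsq w"
    using ij by (simp add: sum.distrib sum_subtractf sum_distrib_left[symmetric] sumw)
   also have "... = (if i = j then 1 else 0)"
    using s by (simp add: c_def)
   finally show "(H * H) $$ (i, j) = 1\<^sub>m n $$ (i, j)" using ij by simp
  qed (use H in auto)
  show "H *\<^sub>v v = unit_vec n 0"
  proof (rule eq_vecI)
   fix i assume "i < dim_vec (unit_vec n 0 :: real vec)"
   hence i: "i < n" by simp
   have wv: "w \<bullet> v = 1 - v $ 0"
    using v n by (simp add: w_def minus_scalar_prod_distrib[of _ n])
   \<comment> \<open>Together with \<open>wv\<close> this says |w|^2 = 2 (w . v), so the multiple of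
     w that the reflection subtracts from v is exactly w.\<close>
   have ww: "nsq w = 2 - 2 * v $ 0"
   proof -
    have "nsq w = w \<bullet> v - w \<bullet> unit_vec n 0"
     using v w by (subst (2) w_def) (simp add: scalar_prod_minus_distrib[of _ n])
    also have "w \<bullet> unit_vec n 0 = v $ 0 - 1" using n w v by (simp add: w_def)
    finally show ?thesis using wv by simp
   qed
   have "(H *\<^sub>v v) $ i = (\<Sum>j<n. H $$ (i, j) * v $ j)"
    by (rule mult_vec_index[OF H v(1) i])
   also have "... = (\<Sum>j<n. (if i = j then v $ j else 0) - c * w $ i * (w $ j * v $ j))"
    using i by (intro sum.cong) (auto simp: H_def algebra_simps)
   also have "... = v $ i - c * w $ i * (w \<bullet> v)"
    using i by (simp add: sum_subtractf sum_distrib_left[symmetric] scalar_prod_eq_sum[OF v(1)])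
   also have "c * (w \<bullet> v) = 1" using s ww wv by (simp add: c_def field_simps)
   hence "v $ i - c * w $ i * (w \<bullet> v) = v $ i - w $ i"
    by (metis mult.assoc mult.commute mult_1)
   also have "v $ i - w $ i = unit_vec n 0 $ i" using i v by (simp add: w_def)
   finally show "(H *\<^sub>v v) $ i = unit_vec n 0 $ i" .
  qed (use H in auto)
 qed
qed

definition diagm :: "nat \<Rightarrow> (nat \<Rightarrow> real) \<Rightarrow> real mat" where
 "diagm n l = mat n n (\<lambda>(i, j). if i = j then l i else 0)"

lemma diagm_carrier [simp]: "diagm n l \<in> rmat n n"
 by (simp add: diagm_def)

lemma four_block_diag_mult:
 fixes A1 :: "real mat"
 assumes "A1 \<in> rmat a a" "A2 \<in> rmat a a" "D1 \<in> rmat n n" "D2 \<in> rmat n n"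
 shows "four_block_mat A1 (0\<^sub>m a n) (0\<^sub>m n a) D1 * four_block_mat A2 (0\<^sub>m a n) (0\<^sub>m n a) D2
  = four_block_mat (A1 * A2) (0\<^sub>m a n) (0\<^sub>m n a) (D1 * D2)"
 using assms by (subst mult_four_block_mat[of _ a a _ n _ n _ _ a _ n]) auto

text \<open>Deflation: after a reflection that moves a unit eigenvector to e_0, the first column is
  a multiple of e_0, and by symmetry so is the first row. What remains is a symmetric block of size
  n, to which the induction hypothesis applies.\<close>

lemma spectral_theorem:
 assumes A: "(A :: real mat) \<in> rmat n n" "A\<^sup>T = A"
 obtains U l where "U \<in> rmat n n" "U * U\<^sup>T = 1\<^sub>m n"
  "U\<^sup>T * U = 1\<^sub>m n" "A = U * diagm n l * U\<^sup>T"
proof -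
 have "\<exists>U l. U \<in> rmat n n \<and> U * U\<^sup>T = 1\<^sub>m n \<and>
  A = U * diagm n l * U\<^sup>T"
  using A
 proof (induction n arbitrary: A)
  case 0
  thus ?case by (intro exI[of _ "1\<^sub>m 0"] exI[of _ "\<lambda>_. 0"]) auto
 next
  case (Suc n)
  let ?n = "Suc n"
  obtain e v where v: "v \<in> rvec ?n" "nsq v = 1" "A *\<^sub>v v = e \<cdot>\<^sub>v v"
   using real_symmetric_eigenvector[OF Suc.prems] by blast
  obtain H where H: "H \<in> rmat ?n ?n" "H\<^sup>T = H" "H * H = 1\<^sub>m ?n"
   "H *\<^sub>v v = unit_vec ?n 0"
   using householder[OF v(1,2)] by blast
  define A' where "A' = H * A * H"
  have A': "A' \<in> rmat ?n ?n" using H Suc.prems by (simp add: A'_def)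
  have A's: "A'\<^sup>T = A'"
   using H Suc.prems by (simp add: A'_def transpose_mult[of _ ?n ?n _ ?n] assoc_mult_mat[of _ ?n ?n _ ?n _ ?n])
  have "H *\<^sub>v unit_vec ?n 0 = v"
   using H v by (metis assoc_mult_mat_vec one_mult_mat_vec)
  hence "A' *\<^sub>v unit_vec ?n 0 = e \<cdot>\<^sub>v unit_vec ?n 0"
   using H v Suc.prems
   by (simp add: A'_def assoc_mult_mat_vec[of _ ?n ?n _ ?n] mult_mat_vec[of _ ?n ?n])
  hence col: "A' $$ (i, 0) = (if i = 0 then e else 0)" if "i < ?n" for i
  proof -
   have "A' $$ (i, 0) = (A' *\<^sub>v unit_vec ?n 0) $ i"
    using A' that by simp
   also have "... = (if i = 0 then e else 0)"
    unfolding \<open>A' *\<^sub>v unit_vec ?n 0 = _\<close> using that by (simp add: unit_vec_def)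
   finally show ?thesis .
  qed
  have rw: "A' $$ (0, i) = (if i = 0 then e else 0)" if "i < ?n" for i
   using col[OF that] arg_cong[OF A's, of "\<lambda>M. M $$ (i, 0)"] that A' by auto
  define C where "C = mat n n (\<lambda>(i, j). A' $$ (Suc i, Suc j))"
  have C: "C \<in> rmat n n" by (simp add: C_def)
  have Cs: "C\<^sup>T = C"
  proof (rule eq_matI)
   fix i j assume "i < dim_row C" "j < dim_col C"
   hence ij: "i < n" "j < n" using C by auto
   show "C\<^sup>T $$ (i, j) = C $$ (i, j)"
    using arg_cong[OF A's, of "\<lambda>M. M $$ (Suc i, Suc j)"] ij A' by (simp add: C_def)
  qed (use C in auto)
  obtain V l where V: "V \<in> rmat n n" "V * V\<^sup>T = 1\<^sub>m n"
   "C = V * diagm n l * V\<^sup>T" using Suc.IH[OF C Cs] by blast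
  define W where "W = four_block_mat (1\<^sub>m 1) (0\<^sub>m 1 n) (0\<^sub>m n 1) V"
  define l' where "l' = case_nat e l"
  have W: "W \<in> rmat ?n ?n" 
   using four_block_carrier_mat[of "1\<^sub>m 1 :: real mat" 1 1 V n n] V(1) by (simp add: W_def)
  have WT: "W\<^sup>T = four_block_mat (1\<^sub>m 1) (0\<^sub>m 1 n) (0\<^sub>m n 1) (V\<^sup>T)"
   unfolding W_def using V by (subst transpose_four_block_mat[of _ 1 1 _ n _ n]) auto
  have D: "diagm ?n l' = four_block_mat (diagm 1 (\<lambda>_. e)) (0\<^sub>m 1 n) (0\<^sub>m n 1) (diagm n l)"
   by (rule eq_matI) (auto simp: diagm_def l'_def split: nat.split)
  have A'D: "A' = four_block_mat (diagm 1 (\<lambda>_. e)) (0\<^sub>m 1 n) (0\<^sub>m n 1) C"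
  proof (rule eq_matI)
   fix i j assume "i < dim_row (four_block_mat (diagm 1 (\<lambda>_. e)) (0\<^sub>m 1 n) (0\<^sub>m n 1) C)"
    "j < dim_col (four_block_mat (diagm 1 (\<lambda>_. e)) (0\<^sub>m 1 n) (0\<^sub>m n 1) C)"
   hence "i < ?n" "j < ?n" using C by (auto simp: diagm_def)
   thus "A' $$ (i, j) = four_block_mat (diagm 1 (\<lambda>_. e)) (0\<^sub>m 1 n) (0\<^sub>m n 1) C $$ (i, j)"
    using col rw C by (auto simp: diagm_def C_def)
  qed (use A' C in \<open>auto simp: diagm_def\<close>)
  have WW: "W * W\<^sup>T = 1\<^sub>m ?n"
   unfolding WT unfolding W_def using V
   by (subst four_block_diag_mult[of _ 1 _ _ n]) (auto intro!: eq_matI)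
  have VD: "V * diagm n l \<in> rmat n n" "V\<^sup>T \<in> rmat n n"
   using V by auto
  have WDW: "W * diagm ?n l' * W\<^sup>T = A'"
   unfolding WT D A'D unfolding W_def
   by (subst four_block_diag_mult[of _ 1 _ _ n], simp, simp, rule V, simp,
     subst four_block_diag_mult[of _ 1 _ _ n], simp_all add: V VD left_mult_one_mat[of _ 1 1]
      right_mult_one_mat[of _ 1 1] del: One_nat_def)
  have HAH: "H * A' * H = A"
  proof -
   have "H * A' * H = (H * H) * A * (H * H)"
    using H(1) Suc.prems(1) by (simp add: A'_def assoc_mult_mat[of _ ?n ?n _ ?n _ ?n])
   also have "... = A" unfolding H(3) using Suc.prems by simp
   finally show ?thesis .
  qed
  show ?case
  proof (intro exI[of _ "H * W"] exI[of _ l'] conjI)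
   show "H * W \<in> rmat ?n ?n" using H W by simp
   have T: "(H * W)\<^sup>T = W\<^sup>T * H"
    using H W by (simp add: transpose_mult[of _ ?n ?n _ ?n])
   have WT': "W\<^sup>T \<in> rmat ?n ?n" using W by simp
   have "(H * W) * (H * W)\<^sup>T = H * (W * W\<^sup>T) * H"
    unfolding T using H(1) W WT'
    by (simp add: assoc_mult_mat[of _ ?n ?n _ ?n _ ?n] mult_carrier_mat[of _ ?n ?n _ ?n])
   thus "(H * W) * (H * W)\<^sup>T = 1\<^sub>m ?n"
    using WW H by simp
   have "(H * W) * diagm ?n l' * (H * W)\<^sup>T
     = H * (W * diagm ?n l' * W\<^sup>T) * H"
    unfolding T using H(1) W WT'
    by (simp add: assoc_mult_mat[of _ ?n ?n _ ?n _ ?n] mult_carrier_mat[of _ ?n ?n _ ?n])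
   thus "A = (H * W) * diagm ?n l' * (H * W)\<^sup>T"
    using WDW HAH by simp
  qed
 qed
 then obtain U l where U: "U \<in> rmat n n" "U * U\<^sup>T = 1\<^sub>m n"
  "A = U * diagm n l * U\<^sup>T" by blast
 moreover have "U\<^sup>T * U = 1\<^sub>m n"
  by (rule mat_mult_left_right_inverse[OF U(1) _ U(2)]) (use U in simp)
 ultimately show thesis using that by blast
qed

section \<open>Transposes and the bilinear form of a matrix\<close>

lemma scalar_prod_transpose_mult:
 assumes "(L :: real mat) \<in> rmat d n" "x \<in> rvec n" "w \<in> rvec d"
 shows "x \<bullet> (L\<^sup>T *\<^sub>v w) = (L *\<^sub>v x) \<bullet> w"
proof -
 have "L\<^sup>T *\<^sub>v w \<in> rvec n" "L *\<^sub>v x \<in> rvec d" using assms by auto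
 hence "x \<bullet> (L\<^sup>T *\<^sub>v w) = (L\<^sup>T *\<^sub>v w) \<bullet> x" "(L *\<^sub>v x) \<bullet> w = w \<bullet> (L *\<^sub>v x)"
  using assms comm_scalar_prod by blast+
 thus ?thesis using transpose_vec_mult_scalar[OF assms] by simp
qed

lemma mult_right_inv_vec:
 assumes "A \<in> rmat n k" "B \<in> rmat k n" "A * B = 1\<^sub>m n" "v \<in> rvec n"
 shows "A *\<^sub>v (B *\<^sub>v v) = (v :: real vec)"
proof -
 have "A *\<^sub>v (B *\<^sub>v v) = (A * B) *\<^sub>v v" using assms(1,2,4) by simp
 thus ?thesis using assms(3,4) by simp
qed

lemma dim_diagm [simp]: "dim_row (diagm n l) = n" "dim_col (diagm n l) = n"
 by (simp_all add: diagm_def)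

lemma smult_mat_mult_vec:
 assumes "A \<in> rmat n k" "v \<in> rvec k"
 shows "(c \<cdot>\<^sub>m A) *\<^sub>v v = c \<cdot>\<^sub>v (A *\<^sub>v (v :: real vec))"
 using assms by (intro eq_vecI) (auto simp: mult_vec_index[of _ n k] sum_distrib_left mult_ac simp del: index_mult_mat_vec)

definition bilf :: "real mat \<Rightarrow> real vec \<Rightarrow> real vec \<Rightarrow> real" where
 "bilf A x y = x \<bullet> (A *\<^sub>v y)"

abbreviation qf :: "real mat \<Rightarrow> real vec \<Rightarrow> real" where "qf A x \<equiv> bilf A x x"
abbreviation gker :: "real mat \<Rightarrow> real vec \<Rightarrow> real" where "gker A x \<equiv> exp (- pi * qf A x)"

lemma bilf_add_left:
 assumes "A \<in> rmat n n" "x \<in> rvec n" "y \<in> rvec n" "z \<in> rvec n"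
 shows "bilf A (x + y) z = bilf A x z + bilf A y z"
 using assms by (simp add: bilf_def add_scalar_prod_distrib[of _ n])

lemma bilf_add_right:
 assumes "A \<in> rmat n n" "x \<in> rvec n" "y \<in> rvec n" "z \<in> rvec n"
 shows "bilf A z (x + y) = bilf A z x + bilf A z y"
 using assms by (simp add: bilf_def mult_add_distrib_mat_vec[of _ n n] scalar_prod_add_distrib[of _ n])

lemma bilf_smult_left:
 assumes "A \<in> rmat n n" "x \<in> rvec n" "z \<in> rvec n"
 shows "bilf A (c \<cdot>\<^sub>v x) z = c * bilf A x z"
 using assms by (simp add: bilf_def)

lemma bilf_smult_right:
 assumes "A \<in> rmat n n" "x \<in> rvec n" "z \<in> rvec n"
 shows "bilf A z (c \<cdot>\<^sub>v x) = c * bilf A z x"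
 using assms by (simp add: bilf_def mult_mat_vec[of _ n n])

lemma bilf_commute:
 assumes "A \<in> rmat n n" "A\<^sup>T = A" "x \<in> rvec n" "y \<in> rvec n"
 shows "bilf A x y = bilf A y x"
 using scalar_prod_mult_mat_vec_commute[OF assms] by (simp add: bilf_def)

lemma bilf_smult_mat:
 assumes "A \<in> rmat n n" "x \<in> rvec n" "y \<in> rvec n"
 shows "bilf (c \<cdot>\<^sub>m A) x y = c * bilf A x y"
 using assms by (simp add: bilf_def smult_mat_mult_vec[of _ n n])

lemma bilf_add_mat:
 assumes "A \<in> rmat n n" "B \<in> rmat n n" "x \<in> rvec n" "y \<in> rvec n"
 shows "bilf (A + B) x y = bilf A x y + bilf B x y"
 using assms by (simp add: bilf_def add_mult_distrib_mat_vec[of _ n n] scalar_prod_add_distrib[of _ n])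

lemma bilf_one: "x \<in> rvec n \<Longrightarrow> bilf (1\<^sub>m n) x y = x \<bullet> y" if "y \<in> rvec n"
 using that by (simp add: bilf_def)

lemma bilf_zero_left: "A \<in> rmat n n \<Longrightarrow> y \<in> rvec n \<Longrightarrow> bilf A (0\<^sub>v n) y = 0"
 by (simp add: bilf_def)

lemma bilf_eq_sum:
 assumes "A \<in> rmat n n" "x \<in> rvec n" "y \<in> rvec n"
 shows "bilf A x y = (\<Sum>i<n. \<Sum>j<n. A $$ (i, j) * x $ i * y $ j)"
proof -
 have "bilf A x y = (\<Sum>i<n. x $ i * (\<Sum>j<n. A $$ (i, j) * y $ j))"
  unfolding bilf_def using assms
  by (subst scalar_prod_eq_sum[of _ n]) (auto intro!: sum.cong simp: mult_vec_index[of _ n n] simp del: index_mult_mat_vec)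
 thus ?thesis by (simp add: sum_distrib_left mult_ac)
qed

lemma bilf_unit:
 assumes "A \<in> rmat n n" "i < n" "j < n"
 shows "bilf A (unit_vec n i) (unit_vec n j) = A $$ (i, j)"
 using assms by (simp add: bilf_def)

lemma bilf_add_self:
 assumes "A \<in> rmat n n" "A\<^sup>T = A" "x \<in> rvec n" "y \<in> rvec n"
 shows "qf A (x + y) = qf A x + 2 * bilf A x y + qf A y"
 using assms bilf_commute[OF assms]
 by (simp add: bilf_add_left[of _ n] bilf_add_right[of _ n])

lemma transpose_congruence:
 assumes L: "(L :: real mat) \<in> rmat d n" and N: "N \<in> rmat n n" "N\<^sup>T = N"
 shows "(L * N * L\<^sup>T)\<^sup>T = L * N * L\<^sup>T"
proof -
 have LN: "L * N \<in> rmat d n" and LT: "L\<^sup>T \<in> rmat n d" using L N by auto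
 have "(L * N * L\<^sup>T)\<^sup>T = L * (N * L\<^sup>T)"
  unfolding transpose_mult[OF LN LT] transpose_mult[OF L N(1)] N(2) by simp
 also have "... = L * N * L\<^sup>T" using assoc_mult_mat[OF L N(1) LT] by (rule sym)
 finally show ?thesis .
qed

lemma bilf_congruence:
 assumes "L \<in> rmat d n" "A \<in> rmat d d" "x \<in> rvec n" "y \<in> rvec n"
 shows "bilf (L\<^sup>T * A * L) x y = bilf A (L *\<^sub>v x) (L *\<^sub>v y)"
proof -
 have "(L\<^sup>T * A * L) *\<^sub>v y = L\<^sup>T *\<^sub>v (A *\<^sub>v (L *\<^sub>v y))"
  using assms by (simp add: assoc_mult_mat_vec[of _ n d _ n] assoc_mult_mat_vec[of _ n d _ d])
 moreover have "x \<bullet> (L\<^sup>T *\<^sub>v (A *\<^sub>v (L *\<^sub>v y))) = (L *\<^sub>v x) \<bullet> (A *\<^sub>v (L *\<^sub>v y))"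
  using assms by (intro scalar_prod_transpose_mult) auto
 ultimately show ?thesis by (simp add: bilf_def)
qed

section \<open>Positive definite matrices\<close>

lemma pd_carrier: "pos_def_mat n A \<Longrightarrow> A \<in> rmat n n"
 and pd_sym: "pos_def_mat n A \<Longrightarrow> A\<^sup>T = A"
 and pd_pos: "pos_def_mat n A \<Longrightarrow> v \<in> rvec n \<Longrightarrow> v \<noteq> 0\<^sub>v n \<Longrightarrow> 0 < qf A v"
 by (auto simp: pos_def_mat_def bilf_def)

lemma pdI:
 assumes "A \<in> rmat n n" "A\<^sup>T = A"
  "\<And>v. v \<in> rvec n \<Longrightarrow> v \<noteq> 0\<^sub>v n \<Longrightarrow> 0 < qf A v"
 shows "pos_def_mat n A"
 using assms by (auto simp: pos_def_mat_def bilf_def)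

lemma pd_nonneg: "pos_def_mat n A \<Longrightarrow> v \<in> rvec n \<Longrightarrow> 0 \<le> qf A v"
 using pd_pos[of n A v] bilf_zero_left[of A n "0\<^sub>v n"] pd_carrier[of n A]
 by (cases "v = 0\<^sub>v n") auto

lemma pos_def_one: "pos_def_mat n (1\<^sub>m n)"
proof (rule pdI)
 fix v assume "v \<in> rvec n" "v \<noteq> 0\<^sub>v n"
 thus "0 < qf (1\<^sub>m n) v"
  using nsq_eq_0[of v n] nsq_nonneg[of v] by (simp add: bilf_one)
qed auto

lemma transpose_smult_mat: "(c \<cdot>\<^sub>m A)\<^sup>T = c \<cdot>\<^sub>m A\<^sup>T"
 by (rule eq_matI) auto

lemma pos_def_smult: "pos_def_mat n A \<Longrightarrow> 0 < c \<Longrightarrow> pos_def_mat n (c \<cdot>\<^sub>m A)"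
 using pd_carrier[of n A] pd_sym[of n A]
 by (intro pdI) (auto simp: transpose_smult_mat bilf_smult_mat[of _ n] pd_pos)

lemma diagm_mult_vec: "i < n \<Longrightarrow> v \<in> rvec n \<Longrightarrow> (diagm n l *\<^sub>v v) $ i = l i * v $ i"
 by (subst mult_vec_index[of _ n n]) (auto simp: diagm_def if_distrib[of "\<lambda>x. x * _"] cong: if_cong)

lemma det_diagm: "det (diagm n l) = (\<Prod>i<n. l i)"
proof -
 have "det (diagm n l) = prod_list (diag_mat (diagm n l))"
  by (rule det_upper_triangular[of _ n]) (auto simp: diagm_def)
 also have "diag_mat (diagm n l) = map l [0..<n]"
  by (auto simp: diag_mat_def diagm_def)
 also have "prod_list (map l [0..<n]) = (\<Prod>i<n. l i)"
  using prod.distinct_set_conv_list[of "[0..<n]" l] by (simp add: lessThan_atLeast0)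
 finally show ?thesis .
qed

lemma diagm_mult: "diagm n l * diagm n l' = diagm n (\<lambda>i. l i * l' i)"
proof (rule eq_matI)
 fix i j assume "i < dim_row (diagm n (\<lambda>i. l i * l' i))" "j < dim_col (diagm n (\<lambda>i. l i * l' i))"
 hence ij: "i < n" "j < n" by (auto simp: diagm_def)
 have "(diagm n l * diagm n l') $$ (i, j) = (\<Sum>t<n. diagm n l $$ (i, t) * diagm n l' $$ (t, j))"
  by (rule mult_mat_index[OF _ _ ij]) auto
 also have "... = (\<Sum>t<n. if i = t then (if t = j then l t * l' t else 0) else 0)"
  using ij by (intro sum.cong) (auto simp: diagm_def)
 also have "... = diagm n (\<lambda>i. l i * l' i) $$ (i, j)"
  using ij by (auto simp: diagm_def)
 finally show "(diagm n l * diagm n l') $$ (i, j) = diagm n (\<lambda>i. l i * l' i) $$ (i, j)" .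
qed (auto simp: diagm_def)

section \<open>Matrices given by an orthonormal eigenbasis and eigenvalues\<close>

definition orth_mat :: "nat \<Rightarrow> real mat \<Rightarrow> bool" where
 "orth_mat n U \<longleftrightarrow> U \<in> rmat n n \<and> U * U\<^sup>T = 1\<^sub>m n \<and> U\<^sup>T * U = 1\<^sub>m n"

text \<open>With \<open>U\<close> fixed this is a functional calculus: products, inverses,
  determinants and quadratic forms are read off from \<open>l\<close>.\<close>

definition spec_mat :: "nat \<Rightarrow> real mat \<Rightarrow> (nat \<Rightarrow> real) \<Rightarrow> real mat" where
 "spec_mat n U l = U * diagm n l * U\<^sup>T"

lemma orth_mat_carrier: "orth_mat n U \<Longrightarrow> U \<in> rmat n n"
 by (simp add: orth_mat_def)

lemma orth_mat_det_sq: "orth_mat n U \<Longrightarrow> det U * det U = 1"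
 using det_mult[of U n "U\<^sup>T"] by (auto simp: orth_mat_def det_transpose)

lemma spec_mat_carrier: "orth_mat n U \<Longrightarrow> spec_mat n U l \<in> rmat n n"
 by (auto simp: spec_mat_def orth_mat_def)

lemma spec_mat_sym: "orth_mat n U \<Longrightarrow> (spec_mat n U l)\<^sup>T = spec_mat n U l"
proof -
 assume U: "orth_mat n U"
 have "(diagm n l)\<^sup>T = diagm n l" by (rule eq_matI) (auto simp: diagm_def)
 thus ?thesis using orth_mat_carrier[OF U]
  by (simp add: spec_mat_def transpose_mult[of _ n n _ n] assoc_mult_mat[of _ n n _ n _ n] mult_carrier_mat[of _ n n _ n])
qed

lemma det_spec_mat:
 assumes "orth_mat n U" shows "det (spec_mat n U l) = (\<Prod>i<n. l i)"
proof -
 have "det (spec_mat n U l) = (det U * det U) * (\<Prod>i<n. l i)"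
  using orth_mat_carrier[OF assms]
  by (simp add: spec_mat_def det_mult[of _ n] det_transpose[of _ n] det_diagm mult_carrier_mat[of _ n n _ n])
 thus ?thesis using orth_mat_det_sq[OF assms] by simp
qed

lemma spec_mat_mult:
 assumes "orth_mat n U"
 shows "spec_mat n U l * spec_mat n U l' = spec_mat n U (\<lambda>i. l i * l' i)"
proof -
 note U = orth_mat_carrier[OF assms]
 have UT: "U\<^sup>T \<in> rmat n n" using U by simp
 have "spec_mat n U l * spec_mat n U l' = U * diagm n l * (U\<^sup>T * U) * diagm n l' * U\<^sup>T"
  using U UT by (simp add: spec_mat_def assoc_mult_mat[of _ n n _ n _ n] mult_carrier_mat[of _ n n _ n])
 also have "... = U * (diagm n l * diagm n l') * U\<^sup>T"
  using assms U UT by (simp add: orth_mat_def assoc_mult_mat[of _ n n _ n _ n] mult_carrier_mat[of _ n n _ n] left_mult_one_mat[of _ n n])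
 finally show ?thesis by (simp add: spec_mat_def diagm_mult)
qed

lemma spec_mat_one: "orth_mat n U \<Longrightarrow> (\<And>i. i < n \<Longrightarrow> l i = 1) \<Longrightarrow> spec_mat n U l = 1\<^sub>m n"
proof -
 assume U: "orth_mat n U" and l: "\<And>i. i < n \<Longrightarrow> l i = 1"
 have "diagm n l = 1\<^sub>m n" using l by (intro eq_matI) (auto simp: diagm_def)
 thus ?thesis using U by (simp add: spec_mat_def orth_mat_def right_mult_one_mat[of _ n n])
qed

lemma bilf_spec_mat:
 assumes "orth_mat n U" "x \<in> rvec n"
 shows "qf (spec_mat n U l) x = (\<Sum>i<n. l i * ((U\<^sup>T *\<^sub>v x) $ i)\<^sup>2)"
proof -
 note U = orth_mat_carrier[OF assms(1)]
 define y where "y = U\<^sup>T *\<^sub>v x"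
 have y: "y \<in> rvec n" using U assms by (simp add: y_def)
 have "qf (spec_mat n U l) x = qf (diagm n l) y"
  using bilf_congruence[of "U\<^sup>T" n n "diagm n l" x x] U assms by (simp add: spec_mat_def y_def)
 also have "... = (\<Sum>i<n. y $ i * (l i * y $ i))"
  unfolding bilf_def using y by (subst scalar_prod_eq_sum[of _ n]) (auto simp: diagm_mult_vec simp del: index_mult_mat_vec intro!: sum.cong mult_mat_vec_carrier[of _ n n])
 finally show ?thesis by (simp add: y_def power2_eq_square mult_ac)
qed

lemma orth_mat_norm:
 assumes "orth_mat n U" "x \<in> rvec n"
 shows "(\<Sum>i<n. ((U\<^sup>T *\<^sub>v x) $ i)\<^sup>2) = nsq x"
 using bilf_spec_mat[OF assms, of "\<lambda>_. 1"] spec_mat_one[OF assms(1), of "\<lambda>_. 1"] assms(2)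
 by (simp add: bilf_one)

lemma spec_mat_pos_def:
 assumes "orth_mat n U" "\<And>i. i < n \<Longrightarrow> 0 < l i"
 shows "pos_def_mat n (spec_mat n U l)"
proof (rule pdI[OF spec_mat_carrier[OF assms(1)] spec_mat_sym[OF assms(1)]])
 fix v assume v: "v \<in> rvec n" "v \<noteq> 0\<^sub>v n"
 have "(\<Sum>i<n. ((U\<^sup>T *\<^sub>v v) $ i)\<^sup>2) \<noteq> 0"
  using orth_mat_norm[OF assms(1) v(1)] nsq_eq_0[OF v(1)] v(2) by simp
 then obtain i where i: "i < n" "((U\<^sup>T *\<^sub>v v) $ i)\<^sup>2 \<noteq> 0"
  by (meson lessThan_iff sum.neutral)
 show "0 < qf (spec_mat n U l) v"
  unfolding bilf_spec_mat[OF assms(1) v(1)] using i assms(2)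
  by (intro sum_pos2[of _ i]) (auto intro!: mult_nonneg_nonneg less_imp_le[OF assms(2)])
qed

lemma spec_mat_eigenvector:
 assumes "orth_mat n U" "i < n"
 shows "U *\<^sub>v unit_vec n i \<in> rvec n" "nsq (U *\<^sub>v unit_vec n i) = 1"
  "spec_mat n U l *\<^sub>v (U *\<^sub>v unit_vec n i) = l i \<cdot>\<^sub>v (U *\<^sub>v unit_vec n i)"
proof -
 note U = orth_mat_carrier[OF assms(1)]
 show 1: "U *\<^sub>v unit_vec n i \<in> rvec n" using U by simp
 have UTU: "U\<^sup>T *\<^sub>v (U *\<^sub>v unit_vec n i) = unit_vec n i"
  using assms(1) by (intro mult_right_inv_vec[of _ n n]) (auto simp: orth_mat_def)
 show "nsq (U *\<^sub>v unit_vec n i) = 1"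
  using transpose_vec_mult_scalar[OF U, of "unit_vec n i" "U *\<^sub>v unit_vec n i"] 1 UTU assms(2) by simp
 have "diagm n l *\<^sub>v unit_vec n i = l i \<cdot>\<^sub>v unit_vec n i"
  using assms(2) by (intro eq_vecI) (auto simp: diagm_mult_vec simp del: index_mult_mat_vec)
 thus "spec_mat n U l *\<^sub>v (U *\<^sub>v unit_vec n i) = l i \<cdot>\<^sub>v (U *\<^sub>v unit_vec n i)"
  using U 1 UTU
  by (simp add: spec_mat_def assoc_mult_mat_vec[of _ n n _ n] mult_carrier_mat[of _ n n _ n] mult_mat_vec[of _ n n])
qed

lemma symmetric_spec_mat:
 assumes "(A :: real mat) \<in> rmat n n" "A\<^sup>T = A"
 obtains U l where "orth_mat n U" "A = spec_mat n U l"
 using spectral_theorem[OF assms] that unfolding orth_mat_def spec_mat_def by metis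

lemma pos_def_spec_mat:
 assumes "pos_def_mat n A"
 obtains U l where "orth_mat n U" "A = spec_mat n U l" "\<And>i. i < n \<Longrightarrow> 0 < l i"
proof -
 obtain U l where U: "orth_mat n U" "A = spec_mat n U l"
  using symmetric_spec_mat[OF pd_carrier[OF assms] pd_sym[OF assms]] by blast
 have "0 < l i" if i: "i < n" for i
 proof -
  let ?x = "U *\<^sub>v unit_vec n i"
  note e = spec_mat_eigenvector[OF U(1) i]
  have "?x \<noteq> 0\<^sub>v n" using e(2) by auto
  hence "0 < qf A ?x" using pd_pos[OF assms e(1)] by simp
  also have "qf A ?x = l i" using e by (simp add: bilf_def U(2))
  finally show ?thesis .
 qed
 with U that show thesis by blast
qed

lemma pd_det_pos: "pos_def_mat n A \<Longrightarrow> 0 < det A"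
 by (metis det_spec_mat lessThan_iff pos_def_spec_mat prod_pos)

section \<open>Inverses and their variational description\<close>

lemma inv_mat_props:
 assumes A: "A \<in> rmat n n" and "det A \<noteq> 0"
 shows "inv_mat A \<in> rmat n n" "A * inv_mat A = 1\<^sub>m n" "inv_mat A * A = 1\<^sub>m n"
proof -
 have "A \<in> Units (ring_mat TYPE(real) n undefined)"
  using det_non_zero_imp_unit[OF assms] .
 then obtain B where B: "mat_inverse A = Some B" using mat_inverse(1)[OF A, of undefined] by (cases "mat_inverse A") auto
 show "inv_mat A \<in> rmat n n" "A * inv_mat A = 1\<^sub>m n" "inv_mat A * A = 1\<^sub>m n"
  using mat_inverse(2)[OF A B] B by (auto simp: inv_mat_def)
qed

lemma inv_mat_eqI:
 assumes A: "A \<in> rmat n n" and B: "B \<in> rmat n n" "A * B = 1\<^sub>m n"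
 shows "inv_mat A = B"
proof -
 have "det A * det B = 1" using det_mult[OF A B(1)] B(2) by simp
 hence "det A \<noteq> 0" by auto
 note I = inv_mat_props[OF A this]
 have "inv_mat A = inv_mat A * (A * B)" using B I(1) by simp
 also have "... = (inv_mat A * A) * B" using I(1) A B by (simp add: assoc_mult_mat[of _ n n _ n _ n])
 also have "... = B" using I(3) B by simp
 finally show ?thesis .
qed

lemma pd_inv:
 assumes "pos_def_mat n A"
 shows "inv_mat A \<in> rmat n n" "A * inv_mat A = 1\<^sub>m n" "inv_mat A * A = 1\<^sub>m n"
  "pos_def_mat n (inv_mat A)"
proof -
 note A = pd_carrier[OF assms]
 show 1: "inv_mat A \<in> rmat n n" "A * inv_mat A = 1\<^sub>m n" "inv_mat A * A = 1\<^sub>m n"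
  using inv_mat_props[OF A] pd_det_pos[OF assms] by auto
 obtain U l where U: "orth_mat n U" "A = spec_mat n U l" "\<And>i. i < n \<Longrightarrow> 0 < l i"
  using pos_def_spec_mat[OF assms] by blast
 have "A * spec_mat n U (\<lambda>i. 1 / l i) = 1\<^sub>m n"
  unfolding U(2) spec_mat_mult[OF U(1)] by (rule spec_mat_one[OF U(1)]) (use U(3) in force)
 hence "inv_mat A = spec_mat n U (\<lambda>i. 1 / l i)"
  by (rule inv_mat_eqI[OF A spec_mat_carrier[OF U(1)]])
 thus "pos_def_mat n (inv_mat A)" using spec_mat_pos_def[OF U(1), of "\<lambda>i. 1 / l i"] U(3) by auto
qed

lemma inv_mat_spec_mat:
 assumes "orth_mat n U" "\<And>i. i < n \<Longrightarrow> l i \<noteq> 0"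
 shows "inv_mat (spec_mat n U l) = spec_mat n U (\<lambda>i. 1 / l i)"
 by (rule inv_mat_eqI[OF spec_mat_carrier[OF assms(1)] spec_mat_carrier[OF assms(1)]])
   (unfold spec_mat_mult[OF assms(1)], rule spec_mat_one[OF assms(1)], use assms(2) in force)

text \<open>The expression 2 (v . z) - <Mz, z> falls short of its maximum by the form of
  \<open>M\<close> at the difference of z and M^(-1) v, which is nonnegative. This Legendre formula
  yields bounds for inverses of block matrices from a single test vector, without inverting
  them.\<close>

lemma bilf_inv_variational:
 assumes M: "pos_def_mat n M" and v: "v \<in> rvec n" and z: "z \<in> rvec n"
 shows "2 * (v \<bullet> z) - qf M z \<le> qf (inv_mat M) v"
  "2 * (v \<bullet> (inv_mat M *\<^sub>v v)) - qf M (inv_mat M *\<^sub>v v) = qf (inv_mat M) v"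
proof -
 note Mc = pd_carrier[OF M] and Ms = pd_sym[OF M] and I = pd_inv[OF M]
 define w where "w = inv_mat M *\<^sub>v v"
 have w: "w \<in> rvec n" using I v by (simp add: w_def)
 have Mw: "M *\<^sub>v w = v" unfolding w_def
  by (rule mult_right_inv_vec[OF Mc I(1,2) v])
 have ww: "qf M w = qf (inv_mat M) v" unfolding bilf_def Mw
  using comm_scalar_prod[OF w v] by (simp add: w_def)
 have zw: "bilf M z w = v \<bullet> z" unfolding bilf_def Mw by (rule comm_scalar_prod[OF z v])
 have "0 \<le> qf M (z + (-1) \<cdot>\<^sub>v w)"
  by (rule pd_nonneg[OF M]) (use z w in auto)
 also have "... = qf M z - 2 * (v \<bullet> z) + qf (inv_mat M) v"
  using z w by (subst bilf_add_self[OF Mc Ms])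
   (auto simp: bilf_smult_left[OF Mc] bilf_smult_right[OF Mc] zw ww)
 finally show "2 * (v \<bullet> z) - qf M z \<le> qf (inv_mat M) v" by simp
 show "2 * (v \<bullet> (inv_mat M *\<^sub>v v)) - qf M (inv_mat M *\<^sub>v v) = qf (inv_mat M) v"
  unfolding w_def[symmetric] ww by (simp add: bilf_def w_def)
qed

text \<open>The maximiser in the variational formula for \<open>M'\<close> serves as test vector in
  the formula for \<open>M\<close>.\<close>

lemma bilf_inv_antimono:
 assumes "pos_def_mat n M" "pos_def_mat n M'" "v \<in> rvec n"
  "\<And>z. z \<in> rvec n \<Longrightarrow> qf M z \<le> qf M' z"
 shows "qf (inv_mat M') v \<le> qf (inv_mat M) v"
proof -
 have c: "inv_mat M' *\<^sub>v v \<in> rvec n" using pd_inv[OF assms(2)] assms(3) by simp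
 show ?thesis
  using bilf_inv_variational(2)[OF assms(2,3,3)] bilf_inv_variational(1)[OF assms(1,3) c] assms(4)[OF c]
  by linarith
qed

lemma inv_mat_inv_mat: "pos_def_mat n M \<Longrightarrow> inv_mat (inv_mat M) = M"
 by (rule inv_mat_eqI[OF pd_inv(1) pd_carrier pd_inv(3)])

section \<open>Operator norm and square root\<close>

lemma op_norm_spec_mat_le:
 assumes U: "orth_mat n U" and r: "0 \<le> r" "\<And>i. i < n \<Longrightarrow> \<bar>l i\<bar> \<le> r"
 shows "op_norm_mat (spec_mat n U l) \<le> r"
 unfolding op_norm_mat_def
proof (rule cSUP_least)
 have dim: "dim_col (spec_mat n U l) = n" using spec_mat_carrier[OF U] by auto
 show "{v :: real vec. v \<in> rvec (dim_col (spec_mat n U l)) \<and> nsq v \<le> 1} \<noteq> {}"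
  unfolding dim using zero_carrier_vec[of n] scalar_prod_left_zero[of "0\<^sub>v n :: real vec" n]
  by (intro ex_in_conv[THEN iffD1] exI[of _ "0\<^sub>v n"]) simp
 fix v assume "v \<in> {v \<in> rvec (dim_col (spec_mat n U l)). nsq v \<le> 1}"
 hence v: "v \<in> rvec n" "nsq v \<le> 1" using dim by auto
 let ?A = "spec_mat n U l"
 note A = spec_mat_carrier[OF U, of l]
 have "nsq (?A *\<^sub>v v) = qf (?A * ?A) v"
  unfolding bilf_def using A v spec_mat_sym[OF U, of l] scalar_prod_transpose_mult[OF A v(1), of "?A *\<^sub>v v"]
  by (simp add: assoc_mult_mat_vec[of _ n n _ n])
 also have "... = (\<Sum>i<n. (l i)\<^sup>2 * ((U\<^sup>T *\<^sub>v v) $ i)\<^sup>2)"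
  unfolding spec_mat_mult[OF U] by (subst bilf_spec_mat[OF U v(1)]) (simp add: power2_eq_square)
 also have "... \<le> (\<Sum>i<n. r\<^sup>2 * ((U\<^sup>T *\<^sub>v v) $ i)\<^sup>2)"
  using r by (intro sum_mono mult_right_mono) (auto simp: abs_le_square_iff[symmetric])
 also have "... = r\<^sup>2 * nsq v" using orth_mat_norm[OF U v(1)] by (simp add: sum_distrib_left[symmetric])
 also have "... \<le> r\<^sup>2" using v(2) by (simp add: mult_left_le)
 finally show "vnorm (?A *\<^sub>v v) \<le> r" using r(1) real_le_lsqrt by blast
qed

text \<open>Existence: take the roots of the eigenvalues. Uniqueness: for a unit eigenvector x of C
  - R with eigenvalue e, the number e (<Cx, x> + <Rx, x>) equals |Cx|^2 - |Rx|^2 = <Sx, x> - <Sx, x>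
  = 0, and the bracket is positive because R is positive definite. So all eigenvalues of the
  symmetric matrix C - R vanish.\<close>

lemma sqrt_mat_pos_def:
 assumes S: "pos_def_mat n S"
 shows "pos_def_mat n (sqrt_mat S)" "sqrt_mat S * sqrt_mat S = S"
proof -
 obtain U l where U: "orth_mat n U" "S = spec_mat n U l" "\<And>i. i < n \<Longrightarrow> 0 < l i"
  using pos_def_spec_mat[OF S] by blast
 define R where "R = spec_mat n U (\<lambda>i. sqrt (l i))"
 have R: "pos_def_mat n R" using spec_mat_pos_def[OF U(1), of "\<lambda>i. sqrt (l i)"] U(3) by (simp add: R_def)
 note Rc = pd_carrier[OF R]
 have "spec_mat n U (\<lambda>i. sqrt (l i) * sqrt (l i)) = spec_mat n U l"
  unfolding spec_mat_def by (rule arg_cong[of _ _ "\<lambda>D. U * D * _"]) (rule eq_matI, use U(3) in \<open>auto simp: diagm_def less_imp_le\<close>)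
 hence RR: "R * R = S" unfolding R_def spec_mat_mult[OF U(1)] U(2) .
 have dim: "dim_row S = n" using pd_carrier[OF S] by auto
 have "sqrt_mat S = R" unfolding sqrt_mat_def dim
 proof (rule the_equality)
  show "pos_semidef_mat n R \<and> R * R = S"
   using RR Rc pd_sym[OF R] pd_nonneg[OF R] by (auto simp: pos_semidef_mat_def bilf_def)
 next
  fix C assume C: "pos_semidef_mat n C \<and> C * C = S"
  hence Cc: "C \<in> rmat n n" "C\<^sup>T = C"
   "\<And>v. v \<in> rvec n \<Longrightarrow> 0 \<le> qf C v" by (auto simp: pos_semidef_mat_def bilf_def)
  have Es: "C - R \<in> rmat n n" "(C - R)\<^sup>T = C - R"
   using Cc Rc pd_sym[OF R] by (auto simp: transpose_minus[of _ n n])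
  obtain V e where V: "orth_mat n V" "C - R = spec_mat n V e" using symmetric_spec_mat[OF Es] by blast
  have "e i = 0" if i: "i < n" for i
  proof -
   define x where "x = V *\<^sub>v unit_vec n i"
   have x: "x \<in> rvec n" "nsq x = 1" "(C - R) *\<^sub>v x = e i \<cdot>\<^sub>v x"
    using spec_mat_eigenvector[OF V(1) i] by (auto simp: x_def V(2))
   have Cx: "C *\<^sub>v x \<in> rvec n" "R *\<^sub>v x \<in> rvec n" using Cc Rc x by auto
   have d: "C *\<^sub>v x - R *\<^sub>v x = e i \<cdot>\<^sub>v x" using x(3) Cc Rc x(1) by (simp add: minus_mult_distrib_mat_vec[of _ n n])
   have "nsq (C *\<^sub>v x) = x \<bullet> (S *\<^sub>v x)"
    using scalar_prod_transpose_mult[OF Cc(1) x(1) Cx(1)] assoc_mult_mat_vec[OF Cc(1) Cc(1) x(1)] Cc(2) C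
    by simp
   moreover have "nsq (R *\<^sub>v x) = x \<bullet> (S *\<^sub>v x)"
    using scalar_prod_transpose_mult[OF Rc x(1) Cx(2)] assoc_mult_mat_vec[OF Rc Rc x(1)] pd_sym[OF R] RR
    by simp
   moreover have "(C *\<^sub>v x - R *\<^sub>v x) \<bullet> (C *\<^sub>v x + R *\<^sub>v x)
     = nsq (C *\<^sub>v x) - nsq (R *\<^sub>v x)"
    using Cx comm_scalar_prod[OF Cx] by (simp add: minus_scalar_prod_distrib[of _ n] scalar_prod_add_distrib[of _ n])
   ultimately have "(e i \<cdot>\<^sub>v x) \<bullet> (C *\<^sub>v x + R *\<^sub>v x) = 0" unfolding d by simp
   hence "e i * (qf C x + qf R x) = 0"
    using x(1) Cx by (simp add: bilf_def scalar_prod_add_distrib[of _ n] distrib_left del: mult_eq_0_iff)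
   moreover have "qf R x > 0" by (rule pd_pos[OF R x(1)]) (use x(2) in auto)
   ultimately show "e i = 0" using Cc(3)[OF x(1)] by auto
  qed
  hence "diagm n e = 0\<^sub>m n n" by (intro eq_matI) (auto simp: diagm_def)
  hence "C - R = 0\<^sub>m n n" using V orth_mat_carrier[OF V(1)] by (simp add: spec_mat_def)
  hence z: "(C - R) $$ (i, j) = 0" if "i < n" "j < n" for i j using that by simp
  show "C = R" by (rule eq_matI) (use z Cc Rc in auto)
 qed
 thus "pos_def_mat n (sqrt_mat S)" "sqrt_mat S * sqrt_mat S = S" using R RR by auto
qed

section \<open>Congruence and the form of a tuple\<close>

text \<open>If v = L x lies in the kernel of the transpose, then v . v = (L x) . v = x . (L^T v) =
  0.\<close>

lemma surj_transpose_inj: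
 assumes L: "(L :: real mat) \<in> rmat d n" "\<forall>y\<in>rvec d. \<exists>x\<in>rvec n. L *\<^sub>v x = y"
  and v: "v \<in> rvec d" "L\<^sup>T *\<^sub>v v = 0\<^sub>v n"
 shows "v = 0\<^sub>v d"
proof -
 obtain x where x: "x \<in> rvec n" "L *\<^sub>v x = v" using L v by blast
 have "nsq v = 0" using transpose_vec_mult_scalar[OF L(1) x(1) v(1)] x v by simp
 thus ?thesis using nsq_eq_0[OF v(1)] by simp
qed

lemma pos_def_congruence:
 assumes L: "L \<in> rmat d n" "\<forall>y\<in>rvec d. \<exists>x\<in>rvec n. L *\<^sub>v x = y"
  and N: "pos_def_mat n N"
 shows "pos_def_mat d (L * N * L\<^sup>T)"
proof (rule pdI)
 note Nc = pd_carrier[OF N]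
 show "L * N * L\<^sup>T \<in> rmat d d" using L Nc by simp
 show "(L * N * L\<^sup>T)\<^sup>T = L * N * L\<^sup>T"
  by (rule transpose_congruence[OF L(1) Nc pd_sym[OF N]])
 fix v assume v: "v \<in> rvec d" "v \<noteq> 0\<^sub>v d"
 hence "L\<^sup>T *\<^sub>v v \<noteq> 0\<^sub>v n" using surj_transpose_inj[OF L v(1)] by blast
 hence "0 < qf N (L\<^sup>T *\<^sub>v v)"
  by (intro pd_pos[OF N]) (use L v in auto)
 thus "0 < qf (L * N * L\<^sup>T) v"
  using bilf_congruence[of "L\<^sup>T" n d N v v] L Nc v by simp
qed

lemma bilf_congruence':
 assumes "L \<in> rmat d n" "N \<in> rmat n n" "x \<in> rvec d" "y \<in> rvec d"
 shows "bilf (L * N * L\<^sup>T) x y = bilf N (L\<^sup>T *\<^sub>v x) (L\<^sup>T *\<^sub>v y)"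
 using bilf_congruence[of "L\<^sup>T" n d N x y] assms by simp

lemma BL_form_carrier: "BL_form n m L p A \<in> rmat n n"
 by (simp add: BL_form_def)

lemma BL_form_sym:
 assumes "\<And>j. j < m \<Longrightarrow> L j \<in> rmat (d j) n"
  and "\<And>j. j < m \<Longrightarrow> A j \<in> rmat (d j) (d j)" "\<And>j. j < m \<Longrightarrow> (A j)\<^sup>T = A j"
 shows "(BL_form n m L p A)\<^sup>T = BL_form n m L p A"
proof (rule eq_matI)
 fix i k assume "i < dim_row (BL_form n m L p A)" "k < dim_col (BL_form n m L p A)"
 hence ik: "i < n" "k < n" by (auto simp: BL_form_def)
 have "((L j)\<^sup>T * A j * L j) $$ (k, i) = ((L j)\<^sup>T * A j * L j) $$ (i, k)"
  if j: "j < m" for j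
 proof -
  let ?B = "(L j)\<^sup>T * A j * L j"
  have "?B\<^sup>T = ?B"
   using transpose_congruence[of "(L j)\<^sup>T" n "d j" "A j"] assms[OF j] by simp
  moreover have "?B \<in> rmat n n"
   using assms(1,2)[OF j] by (simp add: mult_carrier_mat[of _ n "d j"])
  ultimately show ?thesis using ik by (metis carrier_matD index_transpose_mat(1))
 qed
 thus "(BL_form n m L p A)\<^sup>T $$ (i, k) = BL_form n m L p A $$ (i, k)"
  using ik by (simp add: BL_form_def)
qed (auto simp: BL_form_def)

lemma bilf_BL_form:
 assumes "\<And>j. j < m \<Longrightarrow> L j \<in> rmat (d j) n" "\<And>j. j < m \<Longrightarrow> A j \<in> rmat (d j) (d j)"
  and "x \<in> rvec n" "y \<in> rvec n"
 shows "bilf (BL_form n m L p A) x y = (\<Sum>j<m. p j * bilf (A j) (L j *\<^sub>v x) (L j *\<^sub>v y))"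
proof -
 have "bilf (BL_form n m L p A) x y
   = (\<Sum>i<n. \<Sum>k<n. \<Sum>j<m. p j * (((L j)\<^sup>T * A j * L j) $$ (i, k) * x $ i * y $ k))"
  unfolding bilf_eq_sum[OF BL_form_carrier assms(3,4)]
  by (intro sum.cong refl) (simp add: BL_form_def sum_distrib_left sum_distrib_right mult_ac)
 also have "... = (\<Sum>j<m. p j * (\<Sum>i<n. \<Sum>k<n. ((L j)\<^sup>T * A j * L j) $$ (i, k) * x $ i * y $ k))"
  by (subst sum.swap, subst (2) sum.swap) (simp add: sum_distrib_left sum.swap[of _ "{..<n}" "{..<m}"])
 also have "... = (\<Sum>j<m. p j * bilf (A j) (L j *\<^sub>v x) (L j *\<^sub>v y))"
 proof (intro sum.cong refl arg_cong[of _ _ "\<lambda>x. _ * x"])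
  fix j assume "j \<in> {..<m}"
  hence j: "L j \<in> rmat (d j) n" "A j \<in> rmat (d j) (d j)" using assms by auto
  have "(L j)\<^sup>T * A j * L j \<in> rmat n n" using j by simp
  from bilf_eq_sum[OF this assms(3,4)] bilf_congruence[OF j assms(3,4)]
  show "(\<Sum>i<n. \<Sum>k<n. ((L j)\<^sup>T * A j * L j) $$ (i, k) * x $ i * y $ k)
   = bilf (A j) (L j *\<^sub>v x) (L j *\<^sub>v y)" by simp
 qed
 finally show ?thesis .
qed

section \<open>Cutting off posynomials\<close>

lemma pos_semidef_det_nonneg:
 assumes A: "A \<in> rmat n n" "A\<^sup>T = A"
  and nn: "\<And>v. v \<in> rvec n \<Longrightarrow> 0 \<le> qf A v"
 shows "0 \<le> det A"
proof -
 obtain U l where U: "orth_mat n U" "A = spec_mat n U l" using symmetric_spec_mat[OF A] by blast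
 have "0 \<le> l i" if i: "i < n" for i
  using nn[OF spec_mat_eigenvector(1)[OF U(1) i]] spec_mat_eigenvector(1,2)[OF U(1) i]
   spec_mat_eigenvector(3)[OF U(1) i, of l]
  by (simp add: bilf_def U(2))
 thus ?thesis unfolding U(2) det_spec_mat[OF U(1)] by (intro prod_nonneg) auto
qed

lemma abs_det_le:
 assumes A: "(A :: real mat) \<in> rmat n n" and K: "\<And>i j. i < n \<Longrightarrow> j < n \<Longrightarrow> \<bar>A $$ (i, j)\<bar> \<le> K"
 shows "\<bar>det A\<bar> \<le> fact n * K ^ n"
proof -
 have "\<bar>det A\<bar> \<le> (\<Sum>q | q permutes {0..<n}. \<bar>signof q * (\<Prod>i = 0..<n. A $$ (i, q i))\<bar>)"
  unfolding det_def'[OF A] by (rule sum_abs)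
 also have "... \<le> (\<Sum>q | q permutes {0..<n}. K ^ n)"
 proof (rule sum_mono)
  fix q assume "q \<in> {q. q permutes {0..<n}}"
  hence q: "q permutes {0..<n}" by simp
  have "\<bar>signof q * (\<Prod>i = 0..<n. A $$ (i, q i))\<bar> = (\<Prod>i = 0..<n. \<bar>A $$ (i, q i)\<bar>)"
   by (simp add: abs_mult abs_prod sign_def)
  also have "... \<le> (\<Prod>i = 0..<n. K)"
  proof (rule prod_mono)
   fix i assume i: "i \<in> {0..<n}"
   hence "q i < n" using permutes_in_image[OF q, of i] by simp
   thus "0 \<le> \<bar>A $$ (i, q i)\<bar> \<and> \<bar>A $$ (i, q i)\<bar> \<le> K" using K i by simp
  qed
  finally show "\<bar>signof q * (\<Prod>i = 0..<n. A $$ (i, q i))\<bar> \<le> K ^ n" by simp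
 qed
 also have "... = fact n * K ^ n" by (simp add: card_permutations[OF refl])
 finally show ?thesis .
qed

text \<open>The matrix U^T diag(l) U, where U has the rows \<open>u t\<close>; indexing by a set
  avoids a choice of order on \<open>T\<close>.\<close>

definition gram_mat :: "nat \<Rightarrow> 'a set \<Rightarrow> ('a \<Rightarrow> real) \<Rightarrow> ('a \<Rightarrow> nat \<Rightarrow> real) \<Rightarrow> real mat" where
 "gram_mat n T l u = mat n n (\<lambda>(a, b). \<Sum>t\<in>T. l t * u t a * u t b)"

lemma bilf_gram_mat:
 assumes "finite T" "v \<in> rvec n"
 shows "qf (gram_mat n T l u) v = (\<Sum>t\<in>T. l t * (\<Sum>a<n. u t a * v $ a)\<^sup>2)"
proof -
 have "qf (gram_mat n T l u) v = (\<Sum>a<n. \<Sum>b<n. \<Sum>t\<in>T. l t * ((u t a * v $ a) * (u t b * v $ b)))"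
  using assms(2) by (subst bilf_eq_sum[of _ n])
   (auto simp: gram_mat_def sum_distrib_left sum_distrib_right mult_ac intro!: sum.cong)
 also have "... = (\<Sum>t\<in>T. \<Sum>a<n. \<Sum>b<n. l t * ((u t a * v $ a) * (u t b * v $ b)))"
  by (subst sum.swap[of _ T "{..<n}"]) (intro sum.cong refl sum.swap)
 also have "... = (\<Sum>t\<in>T. l t * (\<Sum>a<n. u t a * v $ a)\<^sup>2)"
  unfolding power2_eq_square sum_product by (simp add: sum_distrib_left)
 finally show ?thesis .
qed

lemma det_gram_mat_nonneg:
 assumes "finite T" "\<And>t. t \<in> T \<Longrightarrow> 0 \<le> l t"
 shows "0 \<le> det (gram_mat n T l u)"
proof (rule pos_semidef_det_nonneg)
 show "gram_mat n T l u \<in> rmat n n" by (simp add: gram_mat_def)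
 show "(gram_mat n T l u)\<^sup>T = gram_mat n T l u"
  by (rule eq_matI) (auto simp: gram_mat_def mult_ac intro!: sum.cong)
 fix v assume "v \<in> rvec n"
 thus "0 \<le> qf (gram_mat n T l u) v"
  using assms by (simp add: bilf_gram_mat sum_nonneg)
qed

text \<open>The coefficients are nonnegative because \<open>c I\<close> is itself the Gram determinant of \<open>I\<close>
 (or \<open>0\<close>); this is the Cauchy--Binet formula without the explicit minors.\<close>
lemma det_gram_mat_expand:
 assumes T: "finite T"
 obtains c where "\<And>I. I \<subseteq> T \<Longrightarrow> 0 \<le> c I"
  "\<And>l. det (gram_mat n T l u) = (\<Sum>I\<in>Pow T. c I * (\<Prod>t\<in>I. l t))"
proof -
 let ?F = "{0..<n} \<rightarrow>\<^sub>E T"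
 let ?N = "\<lambda>f. mat n n (\<lambda>(i, k). u (f i) k)"
 \<comment> \<open>In the multilinear expansion \<open>f\<close> selects the summand t = f i in row
   i; \<open>w f\<close> is what remains of this choice once the weights are taken out.\<close>
 define w where "w f = (\<Prod>i = 0..<n. u (f i) i) * det (?N f)" for f
 define c where "c I = (\<Sum>f\<in>{f \<in> ?F. inj_on f {0..<n} \<and> f ` {0..<n} = I}. w f)" for I
 have fF: "finite ?F" using T by (intro finite_PiE) auto
 have exp: "det (gram_mat n T l u) = (\<Sum>I\<in>Pow T. c I * (\<Prod>t\<in>I. l t))" for l
 proof -
  have G: "gram_mat n T l u \<in> rmat n n" by (simp add: gram_mat_def)
  have "det (gram_mat n T l u) = (\<Sum>q | q permutes {0..<n}. signof q *
    (\<Prod>i = 0..<n. \<Sum>t\<in>T. l t * u t i * u t (q i)))"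
   unfolding det_def'[OF G]
  proof (intro sum.cong refl arg_cong[of _ _ "\<lambda>x. _ * x"] prod.cong)
   fix q i assume "q \<in> {q. q permutes {0..<n}}" "i \<in> {0..<n}"
   hence "i < n" "q i < n" using permutes_in_image[of q "{0..<n}" i] by auto
   thus "gram_mat n T l u $$ (i, q i) = (\<Sum>t\<in>T. l t * u t i * u t (q i))"
    by (simp add: gram_mat_def)
  qed
  also have "... = (\<Sum>q | q permutes {0..<n}. signof q *
    (\<Sum>f\<in>?F. \<Prod>i = 0..<n. l (f i) * u (f i) i * u (f i) (q i)))"
   using T by (subst prod_sum_PiE) auto
  also have "... = (\<Sum>f\<in>?F. \<Sum>q | q permutes {0..<n}. signof q *
    (\<Prod>i = 0..<n. l (f i) * u (f i) i * u (f i) (q i)))"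
   by (simp add: sum_distrib_left) (rule sum.swap)
  also have "... = (\<Sum>f\<in>?F. (\<Prod>i = 0..<n. l (f i)) * w f)"
  proof (rule sum.cong[OF refl])
   fix f
   have N: "?N f \<in> rmat n n" by simp
   have "det (?N f) = (\<Sum>q | q permutes {0..<n}. signof q * (\<Prod>i = 0..<n. u (f i) (q i)))"
    unfolding det_def'[OF N]
   proof (intro sum.cong refl arg_cong[of _ _ "\<lambda>x. _ * x"] prod.cong)
    fix q i assume "q \<in> {q. q permutes {0..<n}}" "i \<in> {0..<n}"
    hence "i < n" "q i < n" using permutes_in_image[of q "{0..<n}" i] by auto
    thus "?N f $$ (i, q i) = u (f i) (q i)" by simp
   qed
   thus "(\<Sum>q | q permutes {0..<n}. signof q *
     (\<Prod>i = 0..<n. l (f i) * u (f i) i * u (f i) (q i))) = (\<Prod>i = 0..<n. l (f i)) * w f"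
    by (simp add: w_def prod.distrib sum_distrib_left mult_ac)
  qed
  \<comment> \<open>If \<open>f\<close> repeats an index, two rows of \<open>?N f\<close>
    coincide.\<close>
  also have "... = (\<Sum>f\<in>{f \<in> ?F. inj_on f {0..<n}}. (\<Prod>i = 0..<n. l (f i)) * w f)"
  proof (rule sum.mono_neutral_right[OF fF])
   show "\<forall>f\<in>?F - {f \<in> ?F. inj_on f {0..<n}}. (\<Prod>i = 0..<n. l (f i)) * w f = 0"
   proof
    fix f assume "f \<in> ?F - {f \<in> ?F. inj_on f {0..<n}}"
    then obtain i j where ij: "i < n" "j < n" "i \<noteq> j" "f i = f j" by (auto simp: inj_on_def)
    have "det (?N f) = 0"
     by (rule det_identical_rows[OF _ ij(3,1,2)]) (use ij in \<open>auto intro!: eq_vecI\<close>)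
    thus "(\<Prod>i = 0..<n. l (f i)) * w f = 0" by (simp add: w_def)
   qed
  qed auto
  also have "... = (\<Sum>I\<in>Pow T. \<Sum>f\<in>{f \<in> {f \<in> ?F. inj_on f {0..<n}}. f ` {0..<n} = I}.
    (\<Prod>i = 0..<n. l (f i)) * w f)"
   by (rule sum.group[symmetric]) (use fF T in auto)
  also have "... = (\<Sum>I\<in>Pow T. c I * (\<Prod>t\<in>I. l t))"
  proof (rule sum.cong[OF refl])
   fix I
   have "(\<Sum>f\<in>{f \<in> {f \<in> ?F. inj_on f {0..<n}}. f ` {0..<n} = I}. (\<Prod>i = 0..<n. l (f i)) * w f)
    = (\<Sum>f\<in>{f \<in> ?F. inj_on f {0..<n} \<and> f ` {0..<n} = I}. (\<Prod>t\<in>I. l t) * w f)"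
    by (rule sum.cong) (auto simp: prod.reindex)
   thus "(\<Sum>f\<in>{f \<in> {f \<in> ?F. inj_on f {0..<n}}. f ` {0..<n} = I}. (\<Prod>i = 0..<n. l (f i)) * w f)
    = c I * (\<Prod>t\<in>I. l t)"
    by (simp add: c_def sum_distrib_left mult.commute)
  qed
  finally show ?thesis .
 qed
 have card: "c I = 0" if "card I \<noteq> n" for I
 proof -
  have "{f \<in> ?F. inj_on f {0..<n} \<and> f ` {0..<n} = I} = {}"
   using that by (auto simp: card_image)
  thus ?thesis by (simp only: c_def sum.empty)
 qed
 have "0 \<le> c I" if I: "I \<subseteq> T" for I
 proof (cases "card I = n")
  case True
  \<comment> \<open>At the indicator of \<open>I\<close> every other monomial with a nonzero
    coefficient vanishes: its index set J has as many elements as I, so it is not contained in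
    I.\<close>
  define l :: "'a \<Rightarrow> real" where "l t = (if t \<in> I then 1 else 0)" for t
  have "c J * (\<Prod>t\<in>J. l t) = (if J = I then c I else 0)" if J: "J \<subseteq> T" for J
  proof (cases "card J = n \<and> J \<noteq> I")
   case t: True
   have "finite I" by (rule finite_subset[OF I T])
   hence "\<not> J \<subseteq> I"
    using t True card_subset_eq[of I J] by auto
   then obtain t where "t \<in> J" "t \<notin> I" by auto
   hence "(\<Prod>t\<in>J. l t) = 0" using J T by (intro prod_zero) (auto simp: l_def finite_subset)
   thus ?thesis using t by simp
  next
   case False
   have "c J = 0" if "J \<noteq> I" using False that by (intro card) simp
   moreover have "(\<Prod>t\<in>I. l t) = 1" by (simp add: l_def)
   ultimately show ?thesis by (cases "J = I") simp_all
  qed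
  hence "det (gram_mat n T l u) = (\<Sum>J\<in>Pow T. if J = I then c I else 0)"
   unfolding exp by (intro sum.cong) auto
  also have "... = c I" using I T by simp
  finally show ?thesis using det_gram_mat_nonneg[OF T, of l n u] by (simp add: l_def)
 qed (use card in simp)
 with exp show thesis using that by blast
qed

text \<open>Fourier--Motzkin elimination: a solvable system \<open>\<beta> \<cdot> x \<le> b\<close> with \<open>b \<ge> - \<Lambda>\<close> has a solution
 of size \<open>O(\<Lambda>)\<close>, with a constant that depends only on the set of the vectors \<open>\<beta>\<close>.\<close>
lemma bounded_solution_of_inequalities:
 assumes "finite T" "finite (B :: ('a \<Rightarrow> real) set)"
 shows "\<exists>H\<ge>0. \<forall>\<Lambda>\<ge>0. \<forall>S. finite S \<longrightarrow> S \<subseteq> B \<times> {-\<Lambda>..} \<longrightarrow>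
  (\<exists>x. \<forall>(\<beta>, b)\<in>S. (\<Sum>t\<in>T. \<beta> t * x t) \<le> b) \<longrightarrow>
  (\<exists>x. (\<forall>(\<beta>, b)\<in>S. (\<Sum>t\<in>T. \<beta> t * x t) \<le> b) \<and> (\<forall>t\<in>T. \<bar>x t\<bar> \<le> H * \<Lambda>))"
 using assms
proof (induction T arbitrary: B rule: finite_induct)
 case empty
 thus ?case by (intro exI[of _ 0]) auto
next
 case (insert k T)
 note finB = \<open>finite B\<close>
 \<comment> \<open>The positive combination of an upper bound (beta k > 0) and a lower bound (gamma
   k < 0) for x k in which x k cancels.\<close>
 define comb :: "('a \<Rightarrow> real) \<Rightarrow> ('a \<Rightarrow> real) \<Rightarrow> 'a \<Rightarrow> real"
  where "comb \<beta> \<gamma> t = (- \<gamma> k) * \<beta> t + \<beta> k * \<gamma> t" for \<beta> \<gamma> t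
 \<comment> \<open>\<open>B'\<close> contains the combinations of all pairs, so the constant from
   the induction hypothesis depends on \<open>B\<close> alone and not on the system
   \<open>S\<close>.\<close>
 define B' where "B' = B \<union> (\<lambda>(\<beta>, \<gamma>). comb \<beta> \<gamma>) ` (B \<times> B)"
 have "finite B'" using finB by (simp add: B'_def)
 from insert.IH[OF this] obtain H' where H': "H' \<ge> 0" and IH: "\<And>\<Lambda> S. \<Lambda> \<ge> 0 \<Longrightarrow> finite S \<Longrightarrow> S \<subseteq> B' \<times> {-\<Lambda>..} \<Longrightarrow>
  (\<exists>x. \<forall>(\<beta>, b)\<in>S. (\<Sum>t\<in>T. \<beta> t * x t) \<le> b) \<Longrightarrow>
  (\<exists>x. (\<forall>(\<beta>, b)\<in>S. (\<Sum>t\<in>T. \<beta> t * x t) \<le> b) \<and> (\<forall>t\<in>T. \<bar>x t\<bar> \<le> H' * \<Lambda>))"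
  by (elim exE conjE) simp
 \<comment> \<open>The right-hand side of a combined inequality is at least -c Lambda.
   \<open>D\<close> bounds the contribution of the remaining variables in units of H' c Lambda, and
   \<open>E\<close> bounds every 1 / |beta k|; a summand with beta k = 0 has the value 0
   there.\<close>
 define c where "c = 1 + 2 * (\<Sum>\<beta>\<in>B. \<bar>\<beta> k\<bar>)"
 define D where "D = (\<Sum>\<beta>\<in>B. \<Sum>t\<in>T. \<bar>\<beta> t\<bar>)"
 define E where "E = (\<Sum>\<beta>\<in>B. 1 / \<bar>\<beta> k\<bar>)"
 have c: "c \<ge> 1" and D: "D \<ge> 0" and E: "E \<ge> 0"
  by (auto simp: c_def D_def E_def intro!: sum_nonneg)
 define H where "H = H' * c + (1 + D * (H' * c)) * E"
 have HH: "H \<ge> 0" using H' c D E by (simp add: H_def)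
 show ?case
 proof (intro exI[of _ H] conjI HH allI impI)
  fix \<Lambda> :: real and S
  assume L: "0 \<le> \<Lambda>" and finS: "finite S" and SB: "S \<subseteq> B \<times> {-\<Lambda>..}"
   and "\<exists>x. \<forall>(\<beta>, b)\<in>S. (\<Sum>t\<in>insert k T. \<beta> t * x t) \<le> b"
  then obtain x where x: "\<And>\<beta> b. (\<beta>, b) \<in> S \<Longrightarrow> \<beta> k * x k + (\<Sum>t\<in>T. \<beta> t * x t) \<le> b"
   using insert.hyps by fastforce
  define P where "P = {s \<in> S. fst s k > 0}"
  define N where "N = {s \<in> S. fst s k < 0}"
  \<comment> \<open>The system after elimination of x k: the inequalities without x k, and one
    combination for every pair of an upper and a lower bound.\<close>
  define S' where "S' = {s \<in> S. fst s k = 0} \<union>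
   (\<lambda>((\<beta>, b), (\<gamma>, d)). (comb \<beta> \<gamma>, (- \<gamma> k) * b + \<beta> k * d)) ` (P \<times> N)"
  have kle: "\<bar>\<beta> k\<bar> \<le> (\<Sum>\<beta>\<in>B. \<bar>\<beta> k\<bar>)" if "\<beta> \<in> B" for \<beta>
   using finB that by (intro member_le_sum) auto
  have "finite S'" using finS by (auto simp: S'_def P_def N_def)
  moreover have "S' \<subseteq> B' \<times> {-(c * \<Lambda>)..}"
  proof
   fix s assume "s \<in> S'"
   then consider "s \<in> S" | \<beta> b \<gamma> d where "s = (comb \<beta> \<gamma>, (- \<gamma> k) * b + \<beta> k * d)" "(\<beta>, b) \<in> P" "(\<gamma>, d) \<in> N"
    by (auto simp: S'_def)
   thus "s \<in> B' \<times> {-(c * \<Lambda>)..}"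
   proof cases
    case 1
    hence "s \<in> B \<times> {-\<Lambda>..}" using SB by auto
    moreover have "\<Lambda> \<le> c * \<Lambda>" using mult_right_mono[OF c L] by simp
    ultimately show ?thesis by (auto simp: B'_def)
   next
    case 2
    hence m: "\<beta> \<in> B" "\<gamma> \<in> B" "b \<ge> -\<Lambda>" "d \<ge> -\<Lambda>" "\<beta> k > 0" "\<gamma> k < 0"
     using SB by (auto simp: P_def N_def)
    have "(- \<gamma> k) * b \<ge> (- \<gamma> k) * (-\<Lambda>)" "\<beta> k * d \<ge> \<beta> k * (-\<Lambda>)"
     using mult_left_mono[OF m(3), of "- \<gamma> k"] mult_left_mono[OF m(4), of "\<beta> k"] m by auto
    moreover have "(- \<gamma> k + \<beta> k) * \<Lambda> \<le> c * \<Lambda>"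
     using kle[OF m(1)] kle[OF m(2)] m L by (intro mult_right_mono) (auto simp: c_def)
    ultimately have "(- \<gamma> k) * b + \<beta> k * d \<ge> -(c * \<Lambda>)" by (simp add: algebra_simps)
    thus ?thesis using m 2(1) by (auto simp: B'_def)
   qed
  qed
  moreover have "\<exists>x. \<forall>(\<beta>, b)\<in>S'. (\<Sum>t\<in>T. \<beta> t * x t) \<le> b"
  proof (intro exI[of _ x] ballI, clarify)
   fix \<beta>' b' assume "(\<beta>', b') \<in> S'"
   then consider "(\<beta>', b') \<in> S" "\<beta>' k = 0"
    | \<beta> b \<gamma> d where "\<beta>' = comb \<beta> \<gamma>" "b' = (- \<gamma> k) * b + \<beta> k * d" "(\<beta>, b) \<in> P" "(\<gamma>, d) \<in> N"
    by (auto simp: S'_def)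
   thus "(\<Sum>t\<in>T. \<beta>' t * x t) \<le> b'"
   proof cases
    case 1
    thus ?thesis using x[OF 1(1)] by simp
   next
    case 2
    hence m: "(\<beta>, b) \<in> S" "(\<gamma>, d) \<in> S" "\<beta> k > 0" "\<gamma> k < 0" by (auto simp: P_def N_def)
    have "(\<Sum>t\<in>T. \<beta>' t * x t) = (- \<gamma> k) * (\<beta> k * x k + (\<Sum>t\<in>T. \<beta> t * x t))
      + \<beta> k * (\<gamma> k * x k + (\<Sum>t\<in>T. \<gamma> t * x t))"
     unfolding 2(1) comb_def
     by (simp add: algebra_simps sum.distrib sum_subtractf sum_distrib_left sum_negf)
    also have "... \<le> (- \<gamma> k) * b + \<beta> k * d"
     using x[OF m(1)] x[OF m(2)] m by (intro add_mono mult_left_mono) auto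
    finally show ?thesis using 2 by simp
   qed
  qed
  ultimately have "\<exists>y. (\<forall>(\<beta>, b)\<in>S'. (\<Sum>t\<in>T. \<beta> t * y t) \<le> b) \<and> (\<forall>t\<in>T. \<bar>y t\<bar> \<le> H' * (c * \<Lambda>))"
   using L c by (intro IH) simp_all
  then obtain y where y: "\<And>\<beta> b. (\<beta>, b) \<in> S' \<Longrightarrow> (\<Sum>t\<in>T. \<beta> t * y t) \<le> b"
   "\<And>t. t \<in> T \<Longrightarrow> \<bar>y t\<bar> \<le> H' * (c * \<Lambda>)"
   by auto
  define \<sigma> where "\<sigma> \<beta> = (\<Sum>t\<in>T. \<beta> t * y t)" for \<beta>
  \<comment> \<open>\<open>K\<close> limits what a single inequality can impose on x k: every lower
    bound for x k is at most K, and every upper bound is at least -K.\<close>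
  define K where "K = (1 + D * (H' * c)) * E * \<Lambda>"
  have \<sigma>: "\<bar>\<sigma> \<beta>\<bar> \<le> D * (H' * c) * \<Lambda>" if "\<beta> \<in> B" for \<beta>
  proof -
   have "\<bar>\<sigma> \<beta>\<bar> \<le> (\<Sum>t\<in>T. \<bar>\<beta> t\<bar> * (H' * (c * \<Lambda>)))"
    unfolding \<sigma>_def by (rule order_trans[OF sum_abs]) (auto simp: abs_mult intro!: sum_mono mult_left_mono y(2))
   also have "... = (\<Sum>t\<in>T. \<bar>\<beta> t\<bar>) * (H' * (c * \<Lambda>))" by (simp add: sum_distrib_right)
   also have "... \<le> D * (H' * (c * \<Lambda>))"
    unfolding D_def using finB that H' c L
    by (intro mult_right_mono member_le_sum[of \<beta> B "\<lambda>\<beta>. \<Sum>t\<in>T. \<bar>\<beta> t\<bar>"]) (auto intro: sum_nonneg)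
   finally show ?thesis by (simp add: mult_ac)
  qed
  have K: "K \<ge> (\<Lambda> + \<bar>\<sigma> \<beta>\<bar>) / \<bar>\<beta> k\<bar>" if "\<beta> \<in> B" for \<beta>
  proof -
   have "(\<Lambda> + \<bar>\<sigma> \<beta>\<bar>) * (1 / \<bar>\<beta> k\<bar>) \<le> ((1 + D * (H' * c)) * \<Lambda>) * E"
    unfolding E_def using \<sigma>[OF that] L D H' c finB that
    by (intro mult_mono member_le_sum[of \<beta> B "\<lambda>\<beta>. 1 / \<bar>\<beta> k\<bar>"]) (auto simp: algebra_simps)
   thus ?thesis by (simp add: K_def mult_ac)
  qed
  \<comment> \<open>The lower bounds for x k. Adding -K keeps the set nonempty and its maximum at
    least -K.\<close>
  define Lo where "Lo = insert (-K) ((\<lambda>(\<gamma>, d). (d - \<sigma> \<gamma>) / \<gamma> k) ` N)"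
  define z where "z = Max Lo"
  have finLo: "finite Lo" "Lo \<noteq> {}" using finS by (auto simp: Lo_def N_def)
  have K0: "K \<ge> 0" using D H' c E L by (simp add: K_def)
  have loK: "l \<le> K" if "l \<in> Lo" for l
  proof -
   { fix \<gamma> d assume "(\<gamma>, d) \<in> N"
    hence m: "\<gamma> \<in> B" "d \<ge> -\<Lambda>" "\<gamma> k < 0" using SB by (auto simp: N_def)
    have "(d - \<sigma> \<gamma>) / \<gamma> k = (- d + \<sigma> \<gamma>) / \<bar>\<gamma> k\<bar>" using m by (simp add: field_simps)
    also have "... \<le> (\<Lambda> + \<bar>\<sigma> \<gamma>\<bar>) / \<bar>\<gamma> k\<bar>" using m by (intro divide_right_mono) auto
    also have "... \<le> K" by (rule K[OF m(1)])
    finally have "(d - \<sigma> \<gamma>) / \<gamma> k \<le> K" . }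
   thus ?thesis using that K0 by (auto simp: Lo_def)
  qed
  have z1: "z \<le> K" "-K \<le> z" using loK finLo Max_in[OF finLo] by (auto simp: z_def Lo_def)
  \<comment> \<open>Every lower bound lies below every upper bound: for a pair from \<open>N\<close>
    and \<open>P\<close> this is the combined inequality in \<open>S'\<close>, which y satisfies;
    for -K it is the choice of \<open>K\<close>. Hence the largest element of \<open>Lo\<close> is a
    valid value of x k.\<close>
  have up: "l \<le> (b - \<sigma> \<beta>) / \<beta> k" if l: "l \<in> Lo" and P: "(\<beta>, b) \<in> P" for l \<beta> b
  proof -
   have m: "\<beta> \<in> B" "b \<ge> -\<Lambda>" "\<beta> k > 0" using P SB by (auto simp: P_def)
   consider "l = -K" | \<gamma> d where "(\<gamma>, d) \<in> N" "l = (d - \<sigma> \<gamma>) / \<gamma> k" using l by (auto simp: Lo_def)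
   thus ?thesis
   proof cases
    case 1
    have "- K \<le> - ((\<Lambda> + \<bar>\<sigma> \<beta>\<bar>) / \<bar>\<beta> k\<bar>)" using K[OF m(1)] by simp
    also have "... = (- \<Lambda> - \<bar>\<sigma> \<beta>\<bar>) / \<beta> k" using m by (simp add: field_simps)
    also have "... \<le> (b - \<sigma> \<beta>) / \<beta> k" using m by (intro divide_right_mono) auto
    finally show ?thesis using 1 by simp
   next
    case 2
    have n: "\<gamma> k < 0" using 2 by (auto simp: N_def)
    have "(comb \<beta> \<gamma>, (- \<gamma> k) * b + \<beta> k * d) \<in> S'" using P 2(1) by (force simp: S'_def)
    from y(1)[OF this] have "(- \<gamma> k) * \<sigma> \<beta> + \<beta> k * \<sigma> \<gamma> \<le> (- \<gamma> k) * b + \<beta> k * d"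
     by (simp add: comb_def \<sigma>_def algebra_simps sum.distrib sum_subtractf sum_distrib_left sum_negf)
    moreover have "d = \<sigma> \<gamma> + l * \<gamma> k" using 2(2) n by (simp add: field_simps)
    ultimately have "\<gamma> k * (b - \<sigma> \<beta> - l * \<beta> k) \<le> 0" by (simp add: algebra_simps)
    hence "l * \<beta> k \<le> b - \<sigma> \<beta>" using n by (simp add: mult_le_0_iff)
    thus ?thesis using m(3) by (simp add: pos_le_divide_eq)
   qed
  qed
  show "\<exists>x. (\<forall>(\<beta>, b)\<in>S. (\<Sum>t\<in>insert k T. \<beta> t * x t) \<le> b) \<and> (\<forall>t\<in>insert k T. \<bar>x t\<bar> \<le> H * \<Lambda>)"
  proof (intro exI[of _ "y(k := z)"] conjI ballI, clarify)
   fix \<beta> b assume s: "(\<beta>, b) \<in> S"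
   have "(\<Sum>t\<in>insert k T. \<beta> t * (y(k := z)) t) = \<beta> k * z + \<sigma> \<beta>"
    using insert.hyps by (auto simp: \<sigma>_def intro!: sum.cong)
   moreover have "\<beta> k * z + \<sigma> \<beta> \<le> b"
   proof (cases "\<beta> k" "0::real" rule: linorder_cases)
    case less
    hence "(\<beta>, b) \<in> N" using s by (simp add: N_def)
    hence "(b - \<sigma> \<beta>) / \<beta> k \<in> Lo" by (force simp: Lo_def)
    hence "(b - \<sigma> \<beta>) / \<beta> k \<le> z" using finLo by (simp add: z_def)
    thus ?thesis using less by (simp add: field_simps)
   next
    case equal
    hence "(\<beta>, b) \<in> S'" using s by (simp add: S'_def)
    thus ?thesis using y(1) equal by (simp add: \<sigma>_def)
   next
    case greater
    hence "(\<beta>, b) \<in> P" using s by (simp add: P_def)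
    from up[OF _ this, of z] have "z \<le> (b - \<sigma> \<beta>) / \<beta> k" using Max_in[OF finLo] by (simp add: z_def)
    thus ?thesis using greater by (simp add: field_simps)
   qed
   ultimately show "(\<Sum>t\<in>insert k T. \<beta> t * (y(k := z)) t) \<le> b" by simp
  next
   fix t assume t: "t \<in> insert k T"
   have "H * \<Lambda> = H' * (c * \<Lambda>) + K" by (simp add: H_def K_def algebra_simps)
   moreover have "0 \<le> H' * (c * \<Lambda>)" using H' c L by simp
   moreover have "\<bar>z\<bar> \<le> K" using z1 by linarith
   ultimately show "\<bar>(y(k := z)) t\<bar> \<le> H * \<Lambda>"
    using t y(2)[of t] K0 by (cases "t = k") auto
  qed
 qed
qed

text \<open>Each exponent is relaxed to the larger of its value at x and -ln (C / delta); since the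
  coefficients sum to at most C, this adds at most C (delta / C) to the sum. The point x solves the
  resulting linear system, hence so does some y of controlled size. \<open>H\<close> is fixed before
  the coefficients, which makes the later bounds uniform.\<close>

lemma posynomial_cutoff:
 fixes \<beta> :: "'b \<Rightarrow> 'a \<Rightarrow> real"
 assumes T: "finite T" and V: "finite V"
 obtains H where "0 \<le> H" "\<And>c C \<delta> x. (\<And>v. v \<in> V \<Longrightarrow> 0 \<le> c v) \<Longrightarrow> sum c V \<le> C \<Longrightarrow> 1 \<le> C \<Longrightarrow> 0 < \<delta> \<Longrightarrow> \<delta> \<le> 1 \<Longrightarrow>
  \<exists>y. (\<forall>t\<in>T. \<bar>y t\<bar> \<le> H * ln (C / \<delta>)) \<and>
   (\<Sum>v\<in>V. c v * exp (\<Sum>t\<in>T. \<beta> v t * y t)) \<le> (\<Sum>v\<in>V. c v * exp (\<Sum>t\<in>T. \<beta> v t * x t)) + \<delta>"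
proof -
 obtain H where H: "H \<ge> 0" and H2: "\<And>\<Lambda> S. \<Lambda> \<ge> 0 \<Longrightarrow> finite S \<Longrightarrow> S \<subseteq> (\<beta> ` V) \<times> {-\<Lambda>..} \<Longrightarrow>
  (\<exists>x. \<forall>(\<beta>, b)\<in>S. (\<Sum>t\<in>T. \<beta> t * x t) \<le> b) \<Longrightarrow>
  (\<exists>x. (\<forall>(\<beta>, b)\<in>S. (\<Sum>t\<in>T. \<beta> t * x t) \<le> b) \<and> (\<forall>t\<in>T. \<bar>x t\<bar> \<le> H * \<Lambda>))"
  using bounded_solution_of_inequalities[OF T finite_imageI[OF V, of \<beta>]] by (elim exE conjE) simp
 show thesis
 proof (rule that[OF H])
  fix c and C \<delta> :: real and x
  assume c: "\<And>v. v \<in> V \<Longrightarrow> 0 \<le> c v" "sum c V \<le> C" "1 \<le> C" and d: "0 < \<delta>" "\<delta> \<le> 1"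
  define \<Lambda> where "\<Lambda> = ln (C / \<delta>)"
  have L: "\<Lambda> \<ge> 0" unfolding \<Lambda>_def using c(3) d by (intro ln_ge_zero) (simp add: field_simps)
  define b where "b v = max (\<Sum>t\<in>T. \<beta> v t * x t) (- \<Lambda>)" for v
  define S where "S = (\<lambda>v. (\<beta> v, b v)) ` V"
  have "\<exists>y. (\<forall>(\<beta>, b)\<in>S. (\<Sum>t\<in>T. \<beta> t * y t) \<le> b) \<and> (\<forall>t\<in>T. \<bar>y t\<bar> \<le> H * \<Lambda>)"
   by (rule H2[OF L]) (use V in \<open>auto simp: S_def b_def intro!: exI[of _ x]\<close>)
  then obtain y where y: "\<And>v. v \<in> V \<Longrightarrow> (\<Sum>t\<in>T. \<beta> v t * y t) \<le> b v" "\<And>t. t \<in> T \<Longrightarrow> \<bar>y t\<bar> \<le> H * \<Lambda>"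
   by (auto simp: S_def)
  have "(\<Sum>v\<in>V. c v * exp (\<Sum>t\<in>T. \<beta> v t * y t))
    \<le> (\<Sum>v\<in>V. c v * exp (\<Sum>t\<in>T. \<beta> v t * x t) + c v * (\<delta> / C))"
  proof (rule sum_mono)
   fix v assume v: "v \<in> V"
   have "exp (\<Sum>t\<in>T. \<beta> v t * y t) \<le> exp (b v)" using y(1)[OF v] by simp
   also have "... \<le> exp (\<Sum>t\<in>T. \<beta> v t * x t) + exp (- \<Lambda>)"
    by (simp add: b_def max_def add_increasing)
   also have "exp (- \<Lambda>) = \<delta> / C" using c(3) d by (simp add: \<Lambda>_def exp_minus)
   finally show "c v * exp (\<Sum>t\<in>T. \<beta> v t * y t) \<le> c v * exp (\<Sum>t\<in>T. \<beta> v t * x t) + c v * (\<delta> / C)"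
    unfolding distrib_left[symmetric] using c(1)[OF v] by (rule mult_left_mono)
  qed
  also have "... = (\<Sum>v\<in>V. c v * exp (\<Sum>t\<in>T. \<beta> v t * x t)) + sum c V * (\<delta> / C)"
   by (simp add: sum.distrib sum_distrib_right[symmetric] sum_divide_distrib[symmetric])
  also have "sum c V * (\<delta> / C) \<le> C * (\<delta> / C)" using c d by (intro mult_right_mono) auto
  also have "C * (\<delta> / C) = \<delta>" using c by simp
  finally show "\<exists>y. (\<forall>t\<in>T. \<bar>y t\<bar> \<le> H * ln (C / \<delta>)) \<and>
   (\<Sum>v\<in>V. c v * exp (\<Sum>t\<in>T. \<beta> v t * y t)) \<le> (\<Sum>v\<in>V. c v * exp (\<Sum>t\<in>T. \<beta> v t * x t)) + \<delta>"
   using y(2) by (intro exI[of _ y]) (auto simp: \<Lambda>_def)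
 qed
qed

section \<open>Cutting off the Gaussian functional\<close>

definition gform :: "nat \<Rightarrow> nat \<Rightarrow> (nat \<Rightarrow> real mat) \<Rightarrow> (nat \<Rightarrow> real) \<Rightarrow> (nat \<Rightarrow> real mat) \<Rightarrow> real" where
 "gform n m L p A = det (BL_form n m L p A) / (\<Prod>j<m. det (A j) powr p j)"

lemma det_BL_form_nonneg:
 assumes "\<And>j. j < m \<Longrightarrow> L j \<in> rmat (d j) n" "\<And>j. j < m \<Longrightarrow> pos_def_mat (d j) (A j)"
  "\<And>j. j < m \<Longrightarrow> 0 \<le> p j"
 shows "0 \<le> det (BL_form n m L p A)"
proof (rule pos_semidef_det_nonneg[OF BL_form_carrier])
 show "(BL_form n m L p A)\<^sup>T = BL_form n m L p A"
  by (rule BL_form_sym[of m L d])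
   (use assms in \<open>simp_all add: pd_carrier pd_sym[OF assms(2)]\<close>)
 fix v assume v: "v \<in> rvec n"
 have "qf (BL_form n m L p A) v = (\<Sum>j<m. p j * qf (A j) (L j *\<^sub>v v))"
  by (rule bilf_BL_form[of m L d]) (use assms pd_carrier v in auto)
 also have "... \<ge> 0"
  using assms v by (intro sum_nonneg mult_nonneg_nonneg pd_nonneg[of "d _"] mult_mat_vec_carrier[of _ "d _" n]) auto
 finally show "0 \<le> qf (BL_form n m L p A) v" .
qed

lemma prod_det_powr_pos:
 assumes "\<And>j. j < m \<Longrightarrow> pos_def_mat (d j) (A j)"
 shows "0 < (\<Prod>j<m. det (A j) powr p j)"
 using assms pd_det_pos by (intro prod_pos) force

text \<open>If the determinant vanishes, both sides are 0 by the convention for infinity.\<close>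

lemma inv_sq_BL_g:
 assumes "\<And>j. j < m \<Longrightarrow> L j \<in> rmat (d j) n" "\<And>j. j < m \<Longrightarrow> pos_def_mat (d j) (A j)"
  "\<And>j. j < m \<Longrightarrow> 0 \<le> p j"
 shows "inv_sq (BL_g n m L p A) = ennreal (gform n m L p A)"
proof (cases "det (BL_form n m L p A) = 0")
 case True
 thus ?thesis by (simp add: inv_sq_def BL_g_def gform_def)
next
 case False
 hence D: "0 < det (BL_form n m L p A)"
  using det_BL_form_nonneg[of m L d n A p] assms by auto
 define P where "P = (\<Prod>j<m. det (A j) powr (p j / 2))"
 have P: "P > 0" unfolding P_def by (rule prod_det_powr_pos) (use assms in auto)
 have "P\<^sup>2 = (\<Prod>j<m. det (A j) powr p j)"
  by (simp add: P_def power2_eq_square prod.distrib[symmetric] powr_add[symmetric])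
 hence "(inverse (P / sqrt (det (BL_form n m L p A))))\<^sup>2 = gform n m L p A"
  using D by (simp add: gform_def power_divide field_simps)
 thus ?thesis using D P
  by (simp add: inv_sq_def BL_g_def P_def[symmetric] inverse_ennreal ennreal_power del: inverse_divide)
qed

lemma spec_mat_cong: "(\<And>i. i < n \<Longrightarrow> l i = l' i) \<Longrightarrow> spec_mat n U l = spec_mat n U l'"
 unfolding spec_mat_def by (rule arg_cong[of _ _ "\<lambda>D. U * D * _"]) (rule eq_matI, auto simp: diagm_def)

text \<open>Diagonalising each A_j exhibits the form as a sum of rank-one matrices weighted by the
  eigenvalues. The vectors, sqrt(p_j) times the rows of U_j^T L_j, do not involve the eigenvalues,
  so \<open>det_gram_mat_expand\<close> applies.\<close>

lemma BL_form_spec_mat: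
 assumes L: "\<And>j. j < m \<Longrightarrow> L j \<in> rmat (d j) n" and U: "\<And>j. j < m \<Longrightarrow> orth_mat (d j) (U j)"
  and p: "\<And>j. j < m \<Longrightarrow> 0 \<le> p j"
 shows "BL_form n m L p (\<lambda>j. spec_mat (d j) (U j) (\<lambda>i. l (j, i)))
  = gram_mat n (Sigma {..<m} (\<lambda>j. {..<d j})) l (\<lambda>(j, i) a. sqrt (p j) * ((U j)\<^sup>T * L j) $$ (i, a))"
  (is "?A = ?B")
proof (rule eq_matI)
 fix a b assume "a < dim_row ?B" "b < dim_col ?B"
 hence ab: "a < n" "b < n" by (auto simp: gram_mat_def)
 have "p j * ((L j)\<^sup>T * spec_mat (d j) (U j) (\<lambda>i. l (j, i)) * L j) $$ (a, b)
  = (\<Sum>i<d j. l (j, i) * (sqrt (p j) * ((U j)\<^sup>T * L j) $$ (i, a)) * (sqrt (p j) * ((U j)\<^sup>T * L j) $$ (i, b)))"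
  if j: "j < m" for j
 proof -
  define W where "W = (U j)\<^sup>T * L j"
  note Lj = L[OF j] and Uj = orth_mat_carrier[OF U[OF j]]
  have W: "W \<in> rmat (d j) n" using Lj Uj by (simp add: W_def)
  have LT: "(L j)\<^sup>T \<in> rmat n (d j)" and UT: "(U j)\<^sup>T \<in> rmat (d j) (d j)"
   using Lj Uj by auto
  have WT: "W\<^sup>T = (L j)\<^sup>T * U j"
   unfolding W_def transpose_mult[OF UT Lj] by simp
  let ?D = "diagm (d j) (\<lambda>i. l (j, i))"
  have "(L j)\<^sup>T * spec_mat (d j) (U j) (\<lambda>i. l (j, i)) * L j = W\<^sup>T * (?D * W)"
   unfolding WT unfolding W_def spec_mat_def using Lj Uj LT UT
   by (simp add: assoc_mult_mat[of _ n "d j" _ "d j" _ "d j"] assoc_mult_mat[of _ n "d j" _ "d j" _ n]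
     assoc_mult_mat[of _ "d j" "d j" _ "d j" _ "d j"] assoc_mult_mat[of _ "d j" "d j" _ "d j" _ n]
     mult_carrier_mat[of _ n "d j"] mult_carrier_mat[of _ "d j" "d j"])
  also have "(W\<^sup>T * (?D * W)) $$ (a, b) = (\<Sum>i<d j. W $$ (i, a) * (?D * W) $$ (i, b))"
   using W ab by (subst mult_mat_index[of _ n "d j" _ n]) (auto simp: mult_carrier_mat[of _ "d j" "d j"] simp del: index_mult_mat(1))
  also have "... = (\<Sum>i<d j. W $$ (i, a) * (l (j, i) * W $$ (i, b)))"
  proof (intro sum.cong refl arg_cong[of _ _ "\<lambda>x. _ * x"])
   fix i assume "i \<in> {..<d j}"
   hence i: "i < d j" by simp
   have "(?D * W) $$ (i, b) = (\<Sum>t<d j. ?D $$ (i, t) * W $$ (t, b))"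
    by (rule mult_mat_index[OF diagm_carrier W i ab(2)])
   also have "... = (\<Sum>t<d j. if i = t then l (j, i) * W $$ (t, b) else 0)"
    using i by (intro sum.cong) (auto simp: diagm_def)
   finally have "(?D * W) $$ (i, b) = (\<Sum>t<d j. if i = t then l (j, i) * W $$ (t, b) else 0)" .
   thus "(?D * W) $$ (i, b) = l (j, i) * W $$ (i, b)" using i by simp
  qed
  finally have "p j * ((L j)\<^sup>T * spec_mat (d j) (U j) (\<lambda>i. l (j, i)) * L j) $$ (a, b)
   = (sqrt (p j) * sqrt (p j)) * (\<Sum>i<d j. W $$ (i, a) * (l (j, i) * W $$ (i, b)))"
   using p[OF j] by simp
  thus ?thesis unfolding W_def[symmetric] by (simp only: sum_distrib_left mult_ac)
 qed
 thus "?A $$ (a, b) = ?B $$ (a, b)"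
  using ab by (simp add: BL_form_def gram_mat_def sum.Sigma split_def)
qed (auto simp: BL_form_def gram_mat_def)

text \<open>The eigenbases are kept and only the logarithms of the eigenvalues move. In these
  variables \<open>gform\<close> is a posynomial whose exponents do not involve \<open>L\<close>;
  the normalisation serves to bound the sum of its coefficients.\<close>

lemma gform_cutoff_normalised:
 fixes p :: "nat \<Rightarrow> real"
 assumes "\<forall>j<m. 0 \<le> p j \<and> p j \<le> 1"
 obtains \<delta>0 :: real and N :: nat where "0 < \<delta>0"
  "\<And>\<delta> L B. 0 < \<delta> \<Longrightarrow> \<delta> < \<delta>0 \<Longrightarrow> (\<And>j. j < m \<Longrightarrow> L j \<in> rmat (d j) n) \<Longrightarrow>
   (\<And>j. j < m \<Longrightarrow> L j * (L j)\<^sup>T = 1\<^sub>m (d j)) \<Longrightarrow> (\<And>j. j < m \<Longrightarrow> pos_def_mat (d j) (B j)) \<Longrightarrow>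
   \<exists>B'. (\<forall>j<m. pos_def_mat (d j) (B' j) \<and> op_norm_mat (B' j) \<le> 1 / \<delta> ^ N \<and> op_norm_mat (inv_mat (B' j)) \<le> 1 / \<delta> ^ N) \<and>
    gform n m L p B' \<le> gform n m L p B + \<delta>"
proof -
 have p: "0 \<le> p j \<and> p j \<le> 1" if "j < m" for j using assms that by blast
 define T where "T = Sigma {..<m} (\<lambda>j. {..<d j})"
 have T: "finite T" by (simp add: T_def)
 \<comment> \<open>The exponent of the eigenvalue with index t in the monomial I, after division by
   the product of the det(A_j)^(p_j).\<close>
 define \<beta> where "\<beta> I t = of_bool (t \<in> I) - p (fst t)" for I and t :: "nat \<times> nat"
 obtain H where H: "0 \<le> H" and cut: "\<And>c C \<delta> x. (\<And>v. v \<in> Pow T \<Longrightarrow> 0 \<le> c v) \<Longrightarrow> sum c (Pow T) \<le> C \<Longrightarrow> 1 \<le> C \<Longrightarrow> 0 < \<delta> \<Longrightarrow> \<delta> \<le> 1 \<Longrightarrow>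
  \<exists>y. (\<forall>t\<in>T. \<bar>y t\<bar> \<le> H * ln (C / \<delta>)) \<and>
   (\<Sum>v\<in>Pow T. c v * exp (\<Sum>t\<in>T. \<beta> v t * y t)) \<le> (\<Sum>v\<in>Pow T. c v * exp (\<Sum>t\<in>T. \<beta> v t * x t)) + \<delta>"
  by (fact posynomial_cutoff[OF T finite_Pow_iff[THEN iffD2, OF T], of \<beta>])
 \<comment> \<open>Bounds the sum of the coefficients, which is the determinant of the form at A_j =
   1. There the rows of each L_j are unit vectors, so the entries of the form are at most the sum of
   the d_j.\<close>
 define C where "C = max 1 (fact n * real (\<Sum>j<m. d j) ^ n)"
 have C: "C \<ge> 1" by (simp add: C_def)
 \<comment> \<open>For delta < 1/C one has C / delta <= delta^(-2), so a bound H ln (C / delta) on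
   the logarithms gives eigenvalues within delta^(-2H). This explains the factor 2 and the threshold
   1/C.\<close>
 obtain N :: nat where N: "2 * H \<le> real N" using real_arch_simple by blast
 show thesis
 proof (rule that[of "1 / C" N])
  show "0 < 1 / C" using C by simp
  fix \<delta> :: real and L B :: "nat \<Rightarrow> real mat"
  assume d0: "0 < \<delta>" "\<delta> < 1 / C" and L: "\<And>j. j < m \<Longrightarrow> L j \<in> rmat (d j) n"
   and LL: "\<And>j. j < m \<Longrightarrow> L j * (L j)\<^sup>T = 1\<^sub>m (d j)"
   and B: "\<And>j. j < m \<Longrightarrow> pos_def_mat (d j) (B j)"
  have dC: "\<delta> * C < 1" using d0 C by (simp add: field_simps)
  have d1: "\<delta> \<le> 1" using dC C d0(1) by (smt (verit) mult_le_cancel_left1)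
  have "\<forall>j. \<exists>U l. j < m \<longrightarrow> orth_mat (d j) U \<and> B j = spec_mat (d j) U l \<and> (\<forall>i<d j. 0 < l i)"
   using pos_def_spec_mat[OF B] by metis
  then obtain U l where "\<forall>j. j < m \<longrightarrow> orth_mat (d j) (U j) \<and> B j = spec_mat (d j) (U j) (l j) \<and> (\<forall>i<d j. 0 < l j i)"
   by metis
  hence U: "\<And>j. j < m \<Longrightarrow> orth_mat (d j) (U j)"
   and Bl: "\<And>j. j < m \<Longrightarrow> B j = spec_mat (d j) (U j) (l j)"
   and l: "\<And>j i. j < m \<Longrightarrow> i < d j \<Longrightarrow> 0 < l j i" by auto
  define S where "S z j = spec_mat (d j) (U j) (\<lambda>i. exp (z (j, i)))" for z :: "nat \<times> nat \<Rightarrow> real" and j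
  define u where "u = (\<lambda>(j, i) a. sqrt (p j) * ((U j)\<^sup>T * L j) $$ (i, a))"
  obtain c where c: "\<And>I. I \<subseteq> T \<Longrightarrow> 0 \<le> c I"
   "\<And>l. det (gram_mat n T l u) = (\<Sum>I\<in>Pow T. c I * (\<Prod>t\<in>I. l t))"
   using det_gram_mat_expand[OF T, of n u] by blast
  have form: "det (BL_form n m L p (S z)) = (\<Sum>I\<in>Pow T. c I * exp (\<Sum>t\<in>I. z t))" for z
  proof -
   have "BL_form n m L p (S z) = gram_mat n T (\<lambda>t. exp (z t)) u"
    unfolding S_def T_def u_def by (rule BL_form_spec_mat) (use L U p in auto)
   thus ?thesis using T
    by (auto simp: c(2) exp_sum finite_subset intro!: sum.cong)
  qed
  have detS: "det (S z j) powr p j = exp (\<Sum>i<d j. p j * z (j, i))" if "j < m" for z j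
   using U[OF that] by (simp add: S_def det_spec_mat exp_sum[symmetric] sum_distrib_left[symmetric] powr_def)
  have prodS: "(\<Prod>j<m. det (S z j) powr p j) = exp (\<Sum>t\<in>T. p (fst t) * z t)" for z
  proof -
   have "(\<Prod>j<m. det (S z j) powr p j) = exp (\<Sum>j<m. \<Sum>i<d j. p j * z (j, i))"
    by (simp add: detS exp_sum)
   thus ?thesis by (simp add: T_def sum.Sigma split_def)
  qed
  have gS: "gform n m L p (S z) = (\<Sum>I\<in>Pow T. c I * exp (\<Sum>t\<in>T. \<beta> I t * z t))" for z
  proof -
   have "(\<Sum>t\<in>T. \<beta> I t * z t) = (\<Sum>t\<in>I. z t) - (\<Sum>t\<in>T. p (fst t) * z t)" if "I \<subseteq> T" for I
   proof -
    have "(\<Sum>t\<in>I. z t) = (\<Sum>t\<in>T. of_bool (t \<in> I) * z t)"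
     using that T by (intro sum.mono_neutral_cong_left) auto
    thus ?thesis by (simp add: \<beta>_def left_diff_distrib sum_subtractf)
   qed
   thus ?thesis
    by (auto simp: gform_def form prodS sum_divide_distrib exp_diff intro!: sum.cong)
  qed
  have "sum c (Pow T) \<le> C"
  proof -
   \<comment> \<open>With all logarithms 0 the matrices are identities, and the expansion reduces to
     the sum of its coefficients.\<close>
   have e: "BL_form n m L p (S (\<lambda>_. 0)) = BL_form n m L p (\<lambda>j. 1\<^sub>m (d j))"
    unfolding BL_form_def S_def using spec_mat_one[OF U] by (intro cong_mat) (auto intro!: sum.cong)
   have Lb: "\<bar>L j $$ (r, a)\<bar> \<le> 1" if "j < m" "r < d j" "a < n" for j r a
   proof -
    have "(L j * (L j)\<^sup>T) $$ (r, r) = (\<Sum>t<n. L j $$ (r, t) * L j $$ (r, t))"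
     using L[OF that(1)] that(2) by (subst mult_mat_index[of _ "d j" n _ "d j"]) auto
    hence "(\<Sum>t<n. (L j $$ (r, t))\<^sup>2) = 1" using LL[OF that(1)] that(2) by (simp add: power2_eq_square)
    moreover have "(L j $$ (r, a))\<^sup>2 \<le> (\<Sum>t<n. (L j $$ (r, t))\<^sup>2)"
     using that(3) by (intro member_le_sum) auto
    ultimately show ?thesis by (simp add: abs_square_le_1)
   qed
   have "\<bar>det (BL_form n m L p (\<lambda>j. 1\<^sub>m (d j)))\<bar> \<le> fact n * real (\<Sum>j<m. d j) ^ n"
   proof (rule abs_det_le[OF BL_form_carrier])
    fix a b assume ab: "a < n" "b < n"
    have "\<bar>BL_form n m L p (\<lambda>j. 1\<^sub>m (d j)) $$ (a, b)\<bar>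
     \<le> (\<Sum>j<m. \<bar>p j * ((L j)\<^sup>T * 1\<^sub>m (d j) * L j) $$ (a, b)\<bar>)"
     using ab by (simp add: BL_form_def sum_abs)
    also have "... \<le> (\<Sum>j<m. real (d j))"
    proof (rule sum_mono)
     fix j assume "j \<in> {..<m}"
     hence j: "j < m" by simp
     have "\<bar>((L j)\<^sup>T * 1\<^sub>m (d j) * L j) $$ (a, b)\<bar> = \<bar>\<Sum>t<d j. L j $$ (t, a) * L j $$ (t, b)\<bar>"
      using L[OF j] ab by (subst mult_mat_index[of _ n "d j" _ n]) (auto simp: right_mult_one_mat[of _ n])
     also have "... \<le> (\<Sum>t<d j. 1)"
      by (rule order_trans[OF sum_abs sum_mono])
        (use Lb[OF j _ ab(1)] Lb[OF j _ ab(2)] in \<open>auto simp: abs_mult intro!: mult_le_one\<close>)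
     finally have "\<bar>((L j)\<^sup>T * 1\<^sub>m (d j) * L j) $$ (a, b)\<bar> \<le> real (d j)" by simp
     hence "\<bar>p j\<bar> * \<bar>((L j)\<^sup>T * 1\<^sub>m (d j) * L j) $$ (a, b)\<bar> \<le> 1 * real (d j)"
      using p[OF j] by (intro mult_mono) auto
     thus "\<bar>p j * ((L j)\<^sup>T * 1\<^sub>m (d j) * L j) $$ (a, b)\<bar> \<le> real (d j)"
      by (simp add: abs_mult)
    qed
    finally show "\<bar>BL_form n m L p (\<lambda>j. 1\<^sub>m (d j)) $$ (a, b)\<bar> \<le> real (\<Sum>j<m. d j)" by simp
   qed
   thus ?thesis using form[of "\<lambda>_. 0"] unfolding e C_def by simp
  qed
  then obtain y where y: "\<forall>t\<in>T. \<bar>y t\<bar> \<le> H * ln (C / \<delta>)"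
   "(\<Sum>v\<in>Pow T. c v * exp (\<Sum>t\<in>T. \<beta> v t * y t))
    \<le> (\<Sum>v\<in>Pow T. c v * exp (\<Sum>t\<in>T. \<beta> v t * ln (l (fst t) (snd t)))) + \<delta>"
   using cut[of c C \<delta> "\<lambda>t. ln (l (fst t) (snd t))"] c(1) C d0(1) d1 by auto
  have "H * ln (C / \<delta>) \<le> real N * ln (1 / \<delta>)"
  proof -
   have "ln (C / \<delta>) \<le> ln ((1 / \<delta>) * (1 / \<delta>))"
    using dC d0(1) C by (subst ln_le_cancel_iff) (auto simp: field_simps)
   also have "... = 2 * ln (1 / \<delta>)" using d0(1) by (subst ln_mult) auto
   finally have "H * ln (C / \<delta>) \<le> (2 * H) * ln (1 / \<delta>)" using mult_left_mono[OF _ H] by fastforce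
   also have "... \<le> real N * ln (1 / \<delta>)" using N d0(1) d1 by (intro mult_right_mono) (auto simp: ln_ge_zero)
   finally show ?thesis .
  qed
  hence yb: "\<bar>y (j, i)\<bar> \<le> real N * ln (1 / \<delta>)" if "j < m" "i < d j" for j i
   using y(1) that by (force simp: T_def)
  have expN: "exp (real N * ln (1 / \<delta>)) = 1 / \<delta> ^ N"
   using d0(1) by (simp add: exp_of_nat_mult power_one_over)
  have SB: "gform n m L p (S (\<lambda>t. ln (l (fst t) (snd t)))) = gform n m L p B"
  proof -
   have SB: "S (\<lambda>t. ln (l (fst t) (snd t))) j = B j" if "j < m" for j
    unfolding S_def Bl[OF that] by (rule spec_mat_cong) (use l that in auto)
   have "BL_form n m L p (S (\<lambda>t. ln (l (fst t) (snd t)))) = BL_form n m L p B"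
    unfolding BL_form_def by (intro cong_mat) (auto simp: SB intro!: sum.cong)
   thus ?thesis by (simp add: gform_def SB)
  qed
  show "\<exists>B'. (\<forall>j<m. pos_def_mat (d j) (B' j) \<and> op_norm_mat (B' j) \<le> 1 / \<delta> ^ N \<and> op_norm_mat (inv_mat (B' j)) \<le> 1 / \<delta> ^ N) \<and>
    gform n m L p B' \<le> gform n m L p B + \<delta>"
  proof (intro exI[of _ "S y"] conjI allI impI)
   show "gform n m L p (S y) \<le> gform n m L p B + \<delta>"
    using y(2) unfolding gS[symmetric] SB .
   fix j assume j: "j < m"
   have b: "exp (y (j, i)) \<le> 1 / \<delta> ^ N" "1 / exp (y (j, i)) \<le> 1 / \<delta> ^ N" if "i < d j" for i
    using yb[OF j that] unfolding expN[symmetric] by (auto simp: exp_minus[symmetric] inverse_eq_divide[symmetric])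
   show "pos_def_mat (d j) (S y j)" unfolding S_def by (rule spec_mat_pos_def[OF U[OF j]]) simp
   show "op_norm_mat (S y j) \<le> 1 / \<delta> ^ N" unfolding S_def
    by (rule op_norm_spec_mat_le[OF U[OF j]]) (use d0(1) b in auto)
   have "inv_mat (S y j) = spec_mat (d j) (U j) (\<lambda>i. 1 / exp (y (j, i)))"
    unfolding S_def by (rule inv_mat_spec_mat[OF U[OF j]]) simp
   thus "op_norm_mat (inv_mat (S y j)) \<le> 1 / \<delta> ^ N"
    by (simp only:) (rule op_norm_spec_mat_le[OF U[OF j]], use d0(1) b in auto)
  qed
 qed
qed

lemma admissible_gram_pos_def:
 assumes "admissible n m d L" "j < m"
 shows "pos_def_mat (d j) (L j * (L j)\<^sup>T)"
proof -
 have L: "L j \<in> rmat (d j) n" "\<forall>y\<in>rvec (d j). \<exists>x\<in>rvec n. L j *\<^sub>v x = y"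
  using assms by (auto simp: admissible_def)
 show ?thesis using pos_def_congruence[OF L pos_def_one] L(1) by (simp add: right_mult_one_mat[of _ "d j" n])
qed

text \<open>The maps C_j^(-1) L_j are normalised. Passing to them and to C_j A_j C_j divides
  \<open>gform\<close> by the product of the det(L_j L_j^T)^(p_j), because det(C_j A_j C_j) =
  det(A_j) det(L_j L_j^T). Undoing this multiplies the error delta by that product, which is how it
  enters the statement.\<close>

lemma gform_cutoff:
 fixes p :: "nat \<Rightarrow> real"
 assumes p: "\<forall>j<m. 0 \<le> p j \<and> p j \<le> 1"
 obtains \<delta>0 :: real and N :: nat where "0 < \<delta>0"
  "\<And>\<delta> L A. 0 < \<delta> \<Longrightarrow> \<delta> < \<delta>0 \<Longrightarrow> admissible n m d L \<Longrightarrow> (\<And>j. j < m \<Longrightarrow> pos_def_mat (d j) (A j)) \<Longrightarrow>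
   \<exists>A'\<in>bounded_tuples m d L (1 / \<delta> ^ N).
    gform n m L p A' \<le> gform n m L p A + \<delta> * (\<Prod>j<m. det (L j * (L j)\<^sup>T) powr p j)"
proof -
 obtain \<delta>0 :: real and N :: nat where d0: "0 < \<delta>0"
  and cut: "\<And>\<delta> L B. 0 < \<delta> \<Longrightarrow> \<delta> < \<delta>0 \<Longrightarrow> (\<And>j. j < m \<Longrightarrow> L j \<in> rmat (d j) n) \<Longrightarrow>
   (\<And>j. j < m \<Longrightarrow> L j * (L j)\<^sup>T = 1\<^sub>m (d j)) \<Longrightarrow> (\<And>j. j < m \<Longrightarrow> pos_def_mat (d j) (B j)) \<Longrightarrow>
   \<exists>B'. (\<forall>j<m. pos_def_mat (d j) (B' j) \<and> op_norm_mat (B' j) \<le> 1 / \<delta> ^ N \<and> op_norm_mat (inv_mat (B' j)) \<le> 1 / \<delta> ^ N) \<and>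
    gform n m L p B' \<le> gform n m L p B + \<delta>"
  by (fact gform_cutoff_normalised[OF p, where d = d and n = n])
 show thesis
 proof (rule that[OF d0])
  fix \<delta> :: real and L A :: "nat \<Rightarrow> real mat"
  assume d: "0 < \<delta>" "\<delta> < \<delta>0" and adm: "admissible n m d L" and A: "\<And>j. j < m \<Longrightarrow> pos_def_mat (d j) (A j)"
  have L: "\<And>j. j < m \<Longrightarrow> L j \<in> rmat (d j) n" using adm by (auto simp: admissible_def)
  define S where "S j = L j * (L j)\<^sup>T" for j
  define C where "C j = sqrt_mat (S j)" for j
  define K where "K j = inv_mat (C j)" for j
  define M where "M j = K j * L j" for j
  note S = admissible_gram_pos_def[OF adm, folded S_def]
  have C: "pos_def_mat (d j) (C j)" "C j * C j = S j" if "j < m" for j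
   using sqrt_mat_pos_def[OF S[OF that]] by (auto simp: C_def)
  have Cc: "C j \<in> rmat (d j) (d j)" "(C j)\<^sup>T = C j" if "j < m" for j
   using C(1)[OF that] pd_carrier pd_sym by auto
  have K: "K j \<in> rmat (d j) (d j)" "(K j)\<^sup>T = K j" "C j * K j = 1\<^sub>m (d j)" "K j * C j = 1\<^sub>m (d j)"
   "pos_def_mat (d j) (K j)"
   if "j < m" for j using pd_inv[OF C(1)[OF that]] pd_sym by (auto simp: K_def)
  have M: "M j \<in> rmat (d j) n" if "j < m" for j using K(1)[OF that] L[OF that] by (simp add: M_def)
  have CM: "C j * M j = L j" if "j < m" for j
   using assoc_mult_mat[OF Cc(1) K(1) L, OF that that that] K(3)[OF that] L[OF that]
   by (simp add: M_def left_mult_one_mat[of _ "d j" n] del: assoc_mult_mat)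
  have MM: "M j * (M j)\<^sup>T = 1\<^sub>m (d j)" if j: "j < m" for j
  proof -
   have LT: "(L j)\<^sup>T \<in> rmat n (d j)" using L[OF j] by simp
   have "M j * (M j)\<^sup>T = K j * L j * ((L j)\<^sup>T * K j)"
    unfolding M_def transpose_mult[OF K(1)[OF j] L[OF j]] K(2)[OF j] ..
   also have "... = K j * (L j * ((L j)\<^sup>T * K j))"
    using assoc_mult_mat[OF K(1)[OF j] L[OF j], of "(L j)\<^sup>T * K j" "d j"] LT K(1)[OF j] by simp
   also have "L j * ((L j)\<^sup>T * K j) = C j * C j * K j"
    using assoc_mult_mat[OF L[OF j] LT K(1)[OF j]] C(2)[OF j] by (simp add: S_def)
   also have "... = C j"
    using assoc_mult_mat[OF Cc(1) Cc(1) K(1), OF j j j] K(3)[OF j] Cc(1)[OF j] by (simp add: right_mult_one_mat[of _ "d j" "d j"])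
   finally show ?thesis using K(4)[OF j] by simp
  qed
  have scale: "gform n m L p A = gform n m M p (\<lambda>j. C j * A j * C j) * (\<Prod>j<m. det (S j) powr p j)"
   if A: "\<And>j. j < m \<Longrightarrow> pos_def_mat (d j) (A j)" for A
  proof -
   have eq: "(L j)\<^sup>T * A j * L j = (M j)\<^sup>T * (C j * A j * C j) * M j" if j: "j < m" for j
   proof -
    note c = M[OF j] Cc(1)[OF j] pd_carrier[OF A[OF j]]
    have MT: "(M j)\<^sup>T \<in> rmat n (d j)" using c by simp
    have "(L j)\<^sup>T * A j * L j = (M j)\<^sup>T * C j * A j * (C j * M j)"
     unfolding CM[OF j, symmetric] transpose_mult[OF c(2,1)] Cc(2)[OF j] ..
    also have "... = (M j)\<^sup>T * (C j * A j * C j) * M j"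
     using c MT by (simp add: assoc_mult_mat[of _ n "d j" _ "d j" _ "d j"] assoc_mult_mat[of _ n "d j" _ "d j" _ n]
     assoc_mult_mat[of _ "d j" "d j" _ "d j" _ "d j"] assoc_mult_mat[of _ "d j" "d j" _ "d j" _ n]
     mult_carrier_mat[of _ n "d j"] mult_carrier_mat[of _ "d j" "d j"])
    finally show ?thesis .
   qed
   have e1: "BL_form n m L p A = BL_form n m M p (\<lambda>j. C j * A j * C j)"
    unfolding BL_form_def by (intro cong_mat) (auto simp: eq intro!: sum.cong)
   have e2: "(\<Prod>j<m. det (C j * A j * C j) powr p j) = (\<Prod>j<m. det (A j) powr p j) * (\<Prod>j<m. det (S j) powr p j)"
    unfolding prod.distrib[symmetric]
   proof (rule prod.cong[OF refl])
    fix j assume "j \<in> {..<m}"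
    hence j: "j < m" by simp
    note c = Cc(1)[OF j] pd_carrier[OF A[OF j]]
    have "det (C j * A j * C j) = det (A j) * det (S j)"
     unfolding C(2)[OF j, symmetric] using c by (simp add: det_mult[of _ "d j"] mult_carrier_mat[of _ "d j" "d j"])
    thus "det (C j * A j * C j) powr p j = det (A j) powr p j * det (S j) powr p j"
     using pd_det_pos[OF A[OF j]] pd_det_pos[OF S[OF j]] by (simp add: powr_mult)
   qed
   have aux: "x / y = x / (y * s) * s" if "0 < s" for x y s :: real
    using that by simp
   show ?thesis unfolding gform_def e1 e2
    by (rule aux) (rule prod_det_powr_pos[OF S])
  qed
  define B where "B j = C j * A j * C j" for j
  have B: "pos_def_mat (d j) (B j)" if j: "j < m" for j
  proof -
   have "\<forall>y\<in>rvec (d j). \<exists>x\<in>rvec (d j). C j *\<^sub>v x = y"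
    using mult_right_inv_vec[OF Cc(1) K(1,3), OF j j j] K(1)[OF j] by (metis mult_mat_vec_carrier)
   from pos_def_congruence[OF Cc(1)[OF j] this A[OF j]] show ?thesis by (simp add: B_def Cc(2)[OF j])
  qed
  obtain B' where B': "\<And>j. j < m \<Longrightarrow> pos_def_mat (d j) (B' j) \<and> op_norm_mat (B' j) \<le> 1 / \<delta> ^ N \<and> op_norm_mat (inv_mat (B' j)) \<le> 1 / \<delta> ^ N"
   and le: "gform n m M p B' \<le> gform n m M p B + \<delta>"
   using cut[OF d M MM B] by blast
  define A' where "A' j = K j * B' j * K j" for j
  have A': "pos_def_mat (d j) (A' j)" if j: "j < m" for j
  proof -
   have "\<forall>y\<in>rvec (d j). \<exists>x\<in>rvec (d j). K j *\<^sub>v x = y"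
    using mult_right_inv_vec[OF K(1) Cc(1) K(4), OF j j j] Cc(1)[OF j] by (metis mult_mat_vec_carrier)
   from pos_def_congruence[OF K(1)[OF j] this] B'[OF j] show ?thesis by (simp add: A'_def K(2)[OF j])
  qed
  have CA'C: "C j * A' j * C j = B' j" if j: "j < m" for j
  proof -
   have c: "B' j \<in> rmat (d j) (d j)" using B'[OF j] pd_carrier by blast
   have "C j * A' j * C j = (C j * K j) * B' j * (K j * C j)"
    unfolding A'_def using c K(1)[OF j] Cc(1)[OF j]
    by (simp add: assoc_mult_mat[of _ "d j" "d j" _ "d j" _ "d j"] mult_carrier_mat[of _ "d j" "d j"])
   thus ?thesis using c K(3,4)[OF j] by simp
  qed
  show "\<exists>A'\<in>bounded_tuples m d L (1 / \<delta> ^ N).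
    gform n m L p A' \<le> gform n m L p A + \<delta> * (\<Prod>j<m. det (L j * (L j)\<^sup>T) powr p j)"
  proof (rule bexI[of _ A'])
   show "A' \<in> bounded_tuples m d L (1 / \<delta> ^ N)"
    unfolding bounded_tuples_def S_def[symmetric] C_def[symmetric] Let_def
    using A' B' by (simp add: Cc(2) CA'C)
   have "gform n m M p (\<lambda>j. C j * A' j * C j) = gform n m M p B'"
   proof -
    have "BL_form n m M p (\<lambda>j. C j * A' j * C j) = BL_form n m M p B'"
     unfolding BL_form_def by (intro cong_mat) (auto simp: CA'C intro!: sum.cong)
    thus ?thesis by (simp add: gform_def CA'C)
   qed
   hence "gform n m L p A' \<le> (gform n m M p B + \<delta>) * (\<Prod>j<m. det (S j) powr p j)"
    using scale[OF A'] le prod_det_powr_pos[OF S, where m = m and p = p] by (simp add: mult_right_mono)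
   moreover have "gform n m L p A = gform n m M p B * (\<Prod>j<m. det (S j) powr p j)"
    unfolding B_def by (rule scale) (rule A)
   ultimately show "gform n m L p A' \<le> gform n m L p A + \<delta> * (\<Prod>j<m. det (L j * (L j)\<^sup>T) powr p j)"
    unfolding S_def[symmetric] by (simp add: distrib_right)
  qed
 qed
qed

section \<open>Lebesgue measure on column vectors\<close>

lemma inj_on_vec: "inj_on (vec k) (space (\<Pi>\<^sub>M i\<in>{..<k}. (lborel :: real measure)))"
proof (rule inj_onI)
 fix x y :: "nat \<Rightarrow> real"
 assume "x \<in> space (\<Pi>\<^sub>M i\<in>{..<k}. lborel)" "y \<in> space (\<Pi>\<^sub>M i\<in>{..<k}. lborel)" and e: "vec k x = vec k y"
 hence xy: "x \<in> extensional {..<k}" "y \<in> extensional {..<k}" by (auto simp: space_PiM PiE_def)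
 show "x = y"
 proof (rule extensionalityI[OF xy])
  fix i assume "i \<in> {..<k}"
  thus "x i = y i" using arg_cong[OF e, of "\<lambda>v. v $ i"] by simp
 qed
qed

lemma space_leb [simp]: "space (leb k) = rvec k"
proof -
 have "v \<in> vec k ` ({..<k} \<rightarrow>\<^sub>E UNIV)" if "v \<in> rvec k" for v :: "real vec"
  using that by (intro image_eqI[of _ _ "\<lambda>i\<in>{..<k}. v $ i"]) auto
 thus ?thesis by (auto simp: lborel_vec_def space_embed_measure space_PiM)
qed

lemma measurable_vec [measurable]: "vec k \<in> (\<Pi>\<^sub>M i\<in>{..<k}. lborel) \<rightarrow>\<^sub>M leb k"
 unfolding lborel_vec_def by (rule measurable_embed_measure2'[OF inj_on_vec])

lemma measurable_vec_index: "i < k \<Longrightarrow> (\<lambda>v. v $ i) \<in> bmeas k"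
 unfolding lborel_vec_def
proof (rule measurable_embed_measure1)
 assume "i < k"
 hence "(\<lambda>x. x i) \<in> borel_measurable (\<Pi>\<^sub>M i\<in>{..<k}. (lborel :: real measure))"
  using measurable_component_singleton[of i "{..<k}" "\<lambda>_. lborel :: real measure"] by simp
 thus "(\<lambda>x. vec k x $ i) \<in> borel_measurable (\<Pi>\<^sub>M i\<in>{..<k}. (lborel :: real measure))"
  using \<open>i < k\<close> by simp
qed

lemma measurable_lebI:
 assumes "\<And>x. x \<in> space N \<Longrightarrow> f x \<in> rvec k"
  and "\<And>i. i < k \<Longrightarrow> (\<lambda>x. f x $ i) \<in> borel_measurable N"
 shows "f \<in> N \<rightarrow>\<^sub>M leb k"
proof -
 have "(\<lambda>x. \<lambda>i\<in>{..<k}. f x $ i) \<in> N \<rightarrow>\<^sub>M (\<Pi>\<^sub>M i\<in>{..<k}. lborel)"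
  using assms(2) by (intro measurable_restrict) auto
 from measurable_compose[OF this measurable_vec]
 have "(\<lambda>x. vec k (\<lambda>i\<in>{..<k}. f x $ i)) \<in> N \<rightarrow>\<^sub>M leb k" .
 moreover have "vec k (\<lambda>i\<in>{..<k}. f x $ i) = f x" if "x \<in> space N" for x
  using assms(1)[OF that] by (intro eq_vecI) auto
 ultimately show ?thesis by (rule measurable_cong[THEN iffD1, rotated])
qed

lemma measurable_leb_index:
 "f \<in> N \<rightarrow>\<^sub>M leb k \<Longrightarrow> i < k \<Longrightarrow> (\<lambda>x. f x $ i) \<in> borel_measurable N"
 by (rule measurable_compose[OF _ measurable_vec_index])

lemma measurable_leb_carrier:
 "f \<in> N \<rightarrow>\<^sub>M leb k \<Longrightarrow> x \<in> space N \<Longrightarrow> f x \<in> rvec k"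
 using measurable_space[of f N "leb k" x] by simp

lemma measurable_vec_add [measurable (raw)]:
 assumes "f \<in> N \<rightarrow>\<^sub>M leb k" "g \<in> N \<rightarrow>\<^sub>M leb k"
 shows "(\<lambda>x. f x + g x) \<in> N \<rightarrow>\<^sub>M leb k"
proof (rule measurable_lebI)
 note c = measurable_leb_carrier[OF assms(1)] measurable_leb_carrier[OF assms(2)]
 show "f x + g x \<in> rvec k" if "x \<in> space N" for x using c[OF that] by simp
 fix i assume i: "i < k"
 have "(\<lambda>x. f x $ i + g x $ i) \<in> borel_measurable N"
  using assms[THEN measurable_leb_index[OF _ i]] by measurable
 thus "(\<lambda>x. (f x + g x) $ i) \<in> borel_measurable N"
  by (rule measurable_cong[THEN iffD1, rotated]) (use c[THEN carrier_vecD] i in auto)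
qed

lemma measurable_vec_smult [measurable (raw)]:
 assumes "f \<in> N \<rightarrow>\<^sub>M leb k" "c \<in> borel_measurable N"
 shows "(\<lambda>x. c x \<cdot>\<^sub>v f x) \<in> N \<rightarrow>\<^sub>M leb k"
proof (rule measurable_lebI)
 note c = measurable_leb_carrier[OF assms(1)]
 show "c x \<cdot>\<^sub>v f x \<in> rvec k" if "x \<in> space N" for x using c[OF that] by simp
 fix i assume i: "i < k"
 have "(\<lambda>x. c x * f x $ i) \<in> borel_measurable N"
  using assms(1)[THEN measurable_leb_index[OF _ i]] assms(2) by measurable
 thus "(\<lambda>x. (c x \<cdot>\<^sub>v f x) $ i) \<in> borel_measurable N"
  by (rule measurable_cong[THEN iffD1, rotated]) (use c[THEN carrier_vecD] i in auto)
qed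

lemma measurable_scalar_prod [measurable (raw)]:
 assumes "f \<in> N \<rightarrow>\<^sub>M leb k" "g \<in> N \<rightarrow>\<^sub>M leb k"
 shows "(\<lambda>x. f x \<bullet> g x) \<in> borel_measurable N"
proof -
 have "(\<lambda>x. \<Sum>i<k. f x $ i * g x $ i) \<in> borel_measurable N"
  using assms[THEN measurable_leb_index] by measurable
 thus ?thesis
  by (rule measurable_cong[THEN iffD1, rotated])
    (use scalar_prod_eq_sum measurable_leb_carrier[OF assms(2)] in metis)
qed

lemma meas_mult_mat_vec:
 assumes "A \<in> rmat d k" "f \<in> N \<rightarrow>\<^sub>M leb k"
 shows "(\<lambda>x. A *\<^sub>v f x) \<in> N \<rightarrow>\<^sub>M leb d"
proof (rule measurable_lebI)
 note c = measurable_leb_carrier[OF assms(2)]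
 show "A *\<^sub>v f x \<in> rvec d" if "x \<in> space N" for x using c[OF that] assms by simp
 fix i assume i: "i < d"
 have "(\<lambda>x. \<Sum>j<k. A $$ (i, j) * f x $ j) \<in> borel_measurable N"
  using assms(2)[THEN measurable_leb_index] by measurable
 thus "(\<lambda>x. (A *\<^sub>v f x) $ i) \<in> borel_measurable N"
  by (rule measurable_cong[THEN iffD1, rotated])
    (use mult_vec_index[OF assms(1) c i] in metis)
qed

lemma measurable_bilf:
 assumes "A \<in> rmat k k" "f \<in> N \<rightarrow>\<^sub>M leb k" "g \<in> N \<rightarrow>\<^sub>M leb k"
 shows "(\<lambda>x. bilf A (f x) (g x)) \<in> borel_measurable N"
 unfolding bilf_def using assms meas_mult_mat_vec[OF assms(1,3)] by measurable

lemma sigma_finite_leb: "sigma_finite_measure (leb k)"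
proof -
 interpret product_sigma_finite "\<lambda>i :: nat. lborel :: real measure" ..
 interpret P: sigma_finite_measure "\<Pi>\<^sub>M i\<in>{..<k}. (lborel :: real measure)"
  by (rule sigma_finite) simp
 obtain A :: "(nat \<Rightarrow> real) set set" where A: "countable A" "A \<subseteq> sets (\<Pi>\<^sub>M i\<in>{..<k}. lborel)"
  "\<Union>A = space (\<Pi>\<^sub>M i\<in>{..<k}. lborel)" "\<forall>a\<in>A. emeasure (\<Pi>\<^sub>M i\<in>{..<k}. lborel) a \<noteq> \<infinity>"
  using P.sigma_finite_countable by blast
 show ?thesis
 proof (rule sigma_finite_measure.intro)
  show "\<exists>B. countable B \<and> B \<subseteq> sets (leb k) \<and> \<Union> B = space (leb k) \<and> (\<forall>a\<in>B. emeasure (leb k) a \<noteq> \<infinity>)"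
  proof (intro exI[of _ "(`) (vec k) ` A"] conjI ballI)
   show "countable ((`) (vec k) ` A)" using A by simp
   show "(`) (vec k) ` A \<subseteq> sets (leb k)"
    using A unfolding lborel_vec_def by (auto intro: in_sets_embed_measure)
   show "\<Union> ((`) (vec k) ` A) = space (leb k)"
    using A(3) unfolding lborel_vec_def space_embed_measure by (metis image_Union)
   fix a assume "a \<in> (`) (vec k) ` A"
   thus "emeasure (leb k) a \<noteq> \<infinity>"
    using A unfolding lborel_vec_def by (auto simp: emeasure_embed_measure_image'[OF inj_on_vec])
  qed
 qed
qed

lemma pair_sigma_finite_leb: "pair_sigma_finite (leb a) (leb b)"
 by (intro pair_sigma_finite.intro sigma_finite_leb)

lemma nn_integral_leb:
 "f \<in> bmeas k \<Longrightarrow>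
  (\<integral>\<^sup>+v. f v \<partial>leb k) = (\<integral>\<^sup>+x. f (vec k x) \<partial>(\<Pi>\<^sub>M i\<in>{..<k}. lborel))"
 unfolding lborel_vec_def by (rule nn_integral_embed_measure'[OF inj_on_vec])

lemma nn_integral_leb_0: "(\<integral>\<^sup>+v. f v \<partial>leb 0) = f (0\<^sub>v 0)"
proof -
 interpret product_sigma_finite "\<lambda>i :: nat. lborel :: real measure" ..
 have "(\<integral>\<^sup>+v. f v \<partial>leb 0) = (\<integral>\<^sup>+v. f (0\<^sub>v 0) \<partial>leb 0)"
 proof (rule nn_integral_cong)
  fix x assume "x \<in> space (leb 0)"
  hence "x = 0\<^sub>v 0" by (intro eq_vecI) auto
  thus "f x = f (0\<^sub>v 0)" by simp
 qed
 also have "... = f (0\<^sub>v 0)"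
  using nn_integral_leb[of "\<lambda>_. f (0\<^sub>v 0)" 0] nn_integral_empty[of "\<lambda>_. f (0\<^sub>v 0)"]
  unfolding lessThan_0 by simp
 finally show ?thesis .
qed

text \<open>Adjoining a last coordinate splits a one-dimensional integral off
  \<open>leb (Suc k)\<close>; this drives the inductions on the dimension.\<close>

definition vsnoc :: "real vec \<Rightarrow> real \<Rightarrow> real vec" where
 "vsnoc v t = vec (Suc (dim_vec v)) (\<lambda>i. if i < dim_vec v then v $ i else t)"

lemma vsnoc_carrier [simp]: "v \<in> rvec k \<Longrightarrow> vsnoc v t \<in> rvec (Suc k)"
 by (auto simp: vsnoc_def)

lemma vsnoc_index: "v \<in> rvec k \<Longrightarrow> i < Suc k \<Longrightarrow> vsnoc v t $ i = (if i < k then v $ i else t)"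
 by (auto simp: vsnoc_def)

lemma measurable_vsnoc [measurable (raw)]:
 assumes "f \<in> N \<rightarrow>\<^sub>M leb k" "g \<in> borel_measurable N"
 shows "(\<lambda>x. vsnoc (f x) (g x)) \<in> N \<rightarrow>\<^sub>M leb (Suc k)"
proof (rule measurable_lebI)
 note c = measurable_leb_carrier[OF assms(1)]
 show "vsnoc (f x) (g x) \<in> rvec (Suc k)" if "x \<in> space N" for x using c[OF that] by simp
 fix i assume i: "i < Suc k"
 have "(\<lambda>x. if i < k then f x $ i else g x) \<in> borel_measurable N"
  using assms measurable_leb_index[OF assms(1)] by (cases "i < k") auto
 thus "(\<lambda>x. vsnoc (f x) (g x) $ i) \<in> borel_measurable N"
  by (rule measurable_cong[THEN iffD1, rotated]) (use i in \<open>simp add: vsnoc_index[OF c]\<close>)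
qed

lemma nn_integral_leb_Suc:
 assumes [measurable]: "f \<in> bmeas (Suc k)"
 shows "(\<integral>\<^sup>+v. f v \<partial>leb (Suc k)) = (\<integral>\<^sup>+v. \<integral>\<^sup>+t. f (vsnoc v t) \<partial>lborel \<partial>leb k)"
proof -
 interpret product_sigma_finite "\<lambda>i :: nat. lborel :: real measure" ..
 have ins: "{..<Suc k} = insert k {..<k}" by auto
 have m: "(\<lambda>x. f (vec (Suc k) x)) \<in> borel_measurable (\<Pi>\<^sub>M i\<in>insert k {..<k}. lborel)"
  using measurable_compose[OF measurable_vec assms] unfolding ins .
 have "(\<integral>\<^sup>+v. f v \<partial>leb (Suc k)) = (\<integral>\<^sup>+x. f (vec (Suc k) x) \<partial>(\<Pi>\<^sub>M i\<in>insert k {..<k}. lborel))"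
  unfolding nn_integral_leb[OF assms] ins ..
 also have "... = (\<integral>\<^sup>+x. \<integral>\<^sup>+t. f (vec (Suc k) (x(k := t))) \<partial>lborel \<partial>(\<Pi>\<^sub>M i\<in>{..<k}. lborel))"
  by (rule product_nn_integral_insert[OF _ _ m]) auto
 also have "... = (\<integral>\<^sup>+x. \<integral>\<^sup>+t. f (vsnoc (vec k x) t) \<partial>lborel \<partial>(\<Pi>\<^sub>M i\<in>{..<k}. lborel))"
  by (intro nn_integral_cong arg_cong[of _ _ f]) (auto simp: vsnoc_def)
 also have "... = (\<integral>\<^sup>+v. \<integral>\<^sup>+t. f (vsnoc v t) \<partial>lborel \<partial>leb k)"
  by (rule nn_integral_leb[symmetric]) measurable
 finally show ?thesis .
qed

lemma nn_integral_lborel_translate: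
 fixes a :: real
 assumes "f \<in> borel_measurable borel"
 shows "(\<integral>\<^sup>+t. f (t + a) \<partial>lborel) = (\<integral>\<^sup>+t. f t \<partial>lborel)"
 using nn_integral_real_affine[OF assms, of 1 a] by (simp add: add.commute)

lemma nn_integral_leb_translate:
 assumes "f \<in> bmeas k" "a \<in> rvec k"
 shows "(\<integral>\<^sup>+v. f (v + a) \<partial>leb k) = (\<integral>\<^sup>+v. f v \<partial>leb k)"
 using assms
proof (induction k arbitrary: f a)
 case 0
 hence "0\<^sub>v 0 + a = 0\<^sub>v 0" by (intro eq_vecI) auto
 thus ?case by (simp only: nn_integral_leb_0)
next
 case (Suc k)
 note [measurable] = Suc.prems(1)
 define b where "b = vec k (\<lambda>i. a $ i)"
 have b[simp]: "b \<in> rvec k" by (simp add: b_def)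
 have [measurable]: "(\<lambda>v. v + a) \<in> leb (Suc k) \<rightarrow>\<^sub>M leb (Suc k)"
  using Suc.prems(2) by (intro measurable_vec_add) auto
 have sn: "vsnoc v t + a = vsnoc (v + b) (t + a $ k)" if "v \<in> rvec k" for v t
  using that Suc.prems(2) by (intro eq_vecI) (auto simp: vsnoc_index[of _ k] vsnoc_def b_def less_Suc_eq)
 have "(\<integral>\<^sup>+v. f (v + a) \<partial>leb (Suc k)) = (\<integral>\<^sup>+v. \<integral>\<^sup>+t. f (vsnoc v t + a) \<partial>lborel \<partial>leb k)"
  by (rule nn_integral_leb_Suc) measurable
 also have "... = (\<integral>\<^sup>+v. \<integral>\<^sup>+t. f (vsnoc (v + b) (t + a $ k)) \<partial>lborel \<partial>leb k)"
  by (intro nn_integral_cong) (simp add: sn)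
 also have "... = (\<integral>\<^sup>+v. \<integral>\<^sup>+t. f (vsnoc (v + b) t) \<partial>lborel \<partial>leb k)"
 proof (rule nn_integral_cong)
  fix v assume "v \<in> space (leb k)"
  hence "v + b \<in> space (leb k)" by simp
  hence "(\<lambda>t. f (vsnoc (v + b) t)) \<in> borel_measurable borel" by measurable
  thus "(\<integral>\<^sup>+t. f (vsnoc (v + b) (t + a $ k)) \<partial>lborel) = (\<integral>\<^sup>+t. f (vsnoc (v + b) t) \<partial>lborel)"
   by (rule nn_integral_lborel_translate)
 qed
 also have "... = (\<integral>\<^sup>+v. \<integral>\<^sup>+t. f (vsnoc v t) \<partial>lborel \<partial>leb k)"
  by (rule Suc.IH[of "\<lambda>v. \<integral>\<^sup>+t. f (vsnoc v t) \<partial>lborel", OF _ b]) measurable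
 also have "... = (\<integral>\<^sup>+v. f v \<partial>leb (Suc k))"
  by (rule nn_integral_leb_Suc[symmetric]) measurable
 finally show ?case .
qed

text \<open>The map \<open>(z, y) \<mapsto> (z - N (L z + y), L z)\<close> preserves Lebesgue measure, because it is
 the composition of the shears \<open>y \<mapsto> y + L z\<close>, \<open>z \<mapsto> z - N y\<close> and \<open>y \<mapsto> y + L z\<close>.\<close>
lemma nn_integral_exchange:
 assumes L: "L \<in> rmat d k" and N: "N \<in> rmat k d" and LN: "L * N = 1\<^sub>m d"
  and h[measurable]: "(\<lambda>(z, y). h z y) \<in> borel_measurable (leb k \<Otimes>\<^sub>M leb d)"
 shows "(\<integral>\<^sup>+z. \<integral>\<^sup>+y. h z y \<partial>leb d \<partial>leb k)
  = (\<integral>\<^sup>+z. \<integral>\<^sup>+y. h (z + (-1) \<cdot>\<^sub>v (N *\<^sub>v (y + L *\<^sub>v z))) (L *\<^sub>v z) \<partial>leb d \<partial>leb k)"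
proof -
 interpret pair_sigma_finite "leb k" "leb d" by (rule pair_sigma_finite_leb)
 have Lm[measurable]: "(\<lambda>v. L *\<^sub>v v) \<in> leb k \<rightarrow>\<^sub>M leb d"
  and Nm[measurable]: "(\<lambda>v. N *\<^sub>v v) \<in> leb d \<rightarrow>\<^sub>M leb k"
  using meas_mult_mat_vec[OF L measurable_ident] meas_mult_mat_vec[OF N measurable_ident] by auto
 define S where "S z y = z + (-1) \<cdot>\<^sub>v (N *\<^sub>v y)" for z y
 have S[measurable]: "(\<lambda>(z, y). S z y) \<in> leb k \<Otimes>\<^sub>M leb d \<rightarrow>\<^sub>M leb k"
  unfolding S_def by measurable
 have Sc: "S z y \<in> rvec k" if "z \<in> rvec k" "y \<in> rvec d" for z y
  using that N by (simp add: S_def)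
 \<comment> \<open>Since L N = 1, the last shear sends the second component to L z, which no longer
   contains y.\<close>
 have shear: "y + L *\<^sub>v S z y = L *\<^sub>v z" if "z \<in> rvec k" "y \<in> rvec d" for z y
 proof -
  have NL: "L *\<^sub>v (N *\<^sub>v y) = y" by (rule mult_right_inv_vec[OF L N LN that(2)])
  have "L *\<^sub>v S z y = L *\<^sub>v z + (-1) \<cdot>\<^sub>v y"
   using that L N NL by (simp add: S_def mult_add_distrib_mat_vec[of _ d k] mult_mat_vec[of _ d k])
  thus ?thesis using that L by (intro eq_vecI) auto
 qed
 have m1[measurable]: "(\<lambda>(z, y). h (S z y) (y + L *\<^sub>v S z y)) \<in> borel_measurable (leb k \<Otimes>\<^sub>M leb d)"
  using S by measurable
 have m2[measurable]: "(\<lambda>(z, y). h z (y + L *\<^sub>v z)) \<in> borel_measurable (leb k \<Otimes>\<^sub>M leb d)"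
  by measurable
 have "(\<integral>\<^sup>+z. \<integral>\<^sup>+y. h (S z (y + L *\<^sub>v z)) (L *\<^sub>v z) \<partial>leb d \<partial>leb k)
  = (\<integral>\<^sup>+z. \<integral>\<^sup>+y. h (S z (y + L *\<^sub>v z)) ((y + L *\<^sub>v z) + L *\<^sub>v S z (y + L *\<^sub>v z)) \<partial>leb d \<partial>leb k)"
  using L by (intro nn_integral_cong) (simp add: shear)
 also have "... = (\<integral>\<^sup>+z. \<integral>\<^sup>+y. h (S z y) (y + L *\<^sub>v S z y) \<partial>leb d \<partial>leb k)"
 proof (rule nn_integral_cong)
  fix z assume "z \<in> space (leb k)"
  hence z: "z \<in> rvec k" by simp
  show "(\<integral>\<^sup>+y. h (S z (y + L *\<^sub>v z)) ((y + L *\<^sub>v z) + L *\<^sub>v S z (y + L *\<^sub>v z)) \<partial>leb d)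
   = (\<integral>\<^sup>+y. h (S z y) (y + L *\<^sub>v S z y) \<partial>leb d)"
  proof (rule nn_integral_leb_translate[where f = "\<lambda>y. h (S z y) (y + L *\<^sub>v S z y)"])
   show "(\<lambda>y. h (S z y) (y + L *\<^sub>v S z y)) \<in> bmeas d"
    using measurable_compose[OF measurable_Pair1'[of z "leb k" "leb d"] m1] z by simp
  qed (use L z in auto)
 qed
 also have "... = (\<integral>\<^sup>+y. \<integral>\<^sup>+z. h (S z y) (y + L *\<^sub>v S z y) \<partial>leb k \<partial>leb d)"
  by (rule Fubini'[symmetric]) (rule m1)
 also have "... = (\<integral>\<^sup>+y. \<integral>\<^sup>+z. h z (y + L *\<^sub>v z) \<partial>leb k \<partial>leb d)"
 proof (rule nn_integral_cong)
  fix y assume "y \<in> space (leb d)"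
  hence y: "y \<in> rvec d" by simp
  show "(\<integral>\<^sup>+z. h (S z y) (y + L *\<^sub>v S z y) \<partial>leb k) = (\<integral>\<^sup>+z. h z (y + L *\<^sub>v z) \<partial>leb k)"
   unfolding S_def
  proof (rule nn_integral_leb_translate[where f = "\<lambda>z. h z (y + L *\<^sub>v z)"])
   show "(\<lambda>z. h z (y + L *\<^sub>v z)) \<in> bmeas k"
    using measurable_compose[OF measurable_Pair2'[of y "leb d" "leb k"] m2] y by simp
  qed (use N y in auto)
 qed
 also have "... = (\<integral>\<^sup>+z. \<integral>\<^sup>+y. h z (y + L *\<^sub>v z) \<partial>leb d \<partial>leb k)"
  by (rule Fubini') (rule m2)
 also have "... = (\<integral>\<^sup>+z. \<integral>\<^sup>+y. h z y \<partial>leb d \<partial>leb k)"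
 proof (rule nn_integral_cong)
  fix z assume "z \<in> space (leb k)"
  hence z: "z \<in> rvec k" by simp
  show "(\<integral>\<^sup>+y. h z (y + L *\<^sub>v z) \<partial>leb d) = (\<integral>\<^sup>+y. h z y \<partial>leb d)"
  proof (rule nn_integral_leb_translate)
   show "h z \<in> bmeas d"
    using measurable_compose[OF measurable_Pair1'[of z "leb k" "leb d"] h] z by simp
  qed (use L z in auto)
 qed
 finally show ?thesis unfolding S_def by simp
qed

section \<open>Gaussian measures\<close>

text \<open>Up to the factor 1 / sqrt a, the integrand is the normal density of variance 1 / (2 pi
  a). With pi in the exponent, Gaussian integrals become pure powers of determinants.\<close>

lemma nn_integral_gauss_real:
 assumes "0 < a"
 shows "(\<integral>\<^sup>+t. ennreal (exp (- pi * (a * t\<^sup>2))) \<partial>lborel) = ennreal (1 / sqrt a)"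
proof -
 define \<sigma> where "\<sigma> = sqrt (1 / (2 * pi * a))"
 have s: "\<sigma> > 0" using assms by (simp add: \<sigma>_def)
 have s2: "\<sigma>\<^sup>2 = 1 / (2 * pi * a)" using assms by (simp add: \<sigma>_def)
 have e: "exp (- pi * (a * t\<^sup>2)) = (1 / sqrt a) * normal_density 0 \<sigma> t" for t
  using assms by (simp add: normal_density_def s2 real_sqrt_divide field_simps)
 have "(\<integral>\<^sup>+t. ennreal (normal_density 0 \<sigma> t) \<partial>lborel) = 1"
  using s by (subst nn_integral_eq_integral) (auto simp: integrable_normal_density integral_normal_density)
 thus ?thesis
  unfolding e using assms by (subst ennreal_mult', simp, subst nn_integral_cmult) auto
qed

lemma nn_integral_gauss_diag:
 assumes "\<And>i. i < k \<Longrightarrow> 0 < l i"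
 shows "(\<integral>\<^sup>+v. ennreal (exp (- pi * (\<Sum>i<k. l i * (v $ i)\<^sup>2))) \<partial>leb k) = ennreal (1 / sqrt (\<Prod>i<k. l i))"
 using assms
proof (induction k)
 case 0
 thus ?case by (subst nn_integral_leb_0) simp
next
 case (Suc k)
 note [measurable] = measurable_vec_index
 have "(\<integral>\<^sup>+v. ennreal (exp (- pi * (\<Sum>i<Suc k. l i * (v $ i)\<^sup>2))) \<partial>leb (Suc k))
  = (\<integral>\<^sup>+v. \<integral>\<^sup>+t. ennreal (exp (- pi * (\<Sum>i<Suc k. l i * (vsnoc v t $ i)\<^sup>2))) \<partial>lborel \<partial>leb k)"
  by (rule nn_integral_leb_Suc) measurable
 also have "... = (\<integral>\<^sup>+v. \<integral>\<^sup>+t. ennreal (exp (- pi * (\<Sum>i<k. l i * (v $ i)\<^sup>2))) * ennreal (exp (- pi * (l k * t\<^sup>2))) \<partial>lborel \<partial>leb k)"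
 proof (intro nn_integral_cong)
  fix v t assume "v \<in> space (leb k)"
  hence "(\<Sum>i<Suc k. l i * (vsnoc v t $ i)\<^sup>2) = (\<Sum>i<k. l i * (v $ i)\<^sup>2) + l k * t\<^sup>2"
   by (simp add: vsnoc_index[of _ k])
  thus "ennreal (exp (- pi * (\<Sum>i<Suc k. l i * (vsnoc v t $ i)\<^sup>2)))
   = ennreal (exp (- pi * (\<Sum>i<k. l i * (v $ i)\<^sup>2))) * ennreal (exp (- pi * (l k * t\<^sup>2)))"
   by (simp only: distrib_left exp_add ennreal_mult' exp_ge_zero)
 qed
 also have "... = (\<integral>\<^sup>+v. ennreal (exp (- pi * (\<Sum>i<k. l i * (v $ i)\<^sup>2))) * ennreal (1 / sqrt (l k)) \<partial>leb k)"
  by (intro nn_integral_cong) (subst nn_integral_cmult, simp, subst nn_integral_gauss_real, simp_all add: Suc.prems)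
 also have "... = ennreal (1 / sqrt (\<Prod>i<k. l i)) * ennreal (1 / sqrt (l k))"
 proof -
  have "(\<integral>\<^sup>+v. ennreal (exp (- pi * (\<Sum>i<k. l i * (v $ i)\<^sup>2))) \<partial>leb k) = ennreal (1 / sqrt (\<Prod>i<k. l i))"
   using Suc.prems by (intro Suc.IH) simp
  moreover have "(\<lambda>v. ennreal (exp (- pi * (\<Sum>i<k. l i * (v $ i)\<^sup>2)))) \<in> bmeas k"
   by measurable
  ultimately show ?thesis by (simp only: nn_integral_multc)
 qed
 also have "... = ennreal (1 / sqrt (\<Prod>i<Suc k. l i))"
 proof -
  have "0 \<le> (\<Prod>i<k. l i)" using Suc.prems by (intro prod_nonneg ballI less_imp_le) simp
  thus ?thesis by (subst ennreal_mult'[symmetric]) (auto simp: real_sqrt_mult)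
 qed
 finally show ?case .
qed

text \<open>A Gaussian of integral one is inserted in a second variable, and
  \<open>nn_integral_exchange\<close> is applied with L = U and N = U^T. The Gaussian is invariant
  under rotations and under a change of sign, so it factors out again.\<close>

lemma nn_integral_orth_mat:
 assumes U: "orth_mat k U" and F[measurable]: "F \<in> bmeas k"
 shows "(\<integral>\<^sup>+v. F (U *\<^sub>v v) \<partial>leb k) = (\<integral>\<^sup>+v. F v \<partial>leb k)"
proof -
 note Uc = orth_mat_carrier[OF U]
 have UT: "U\<^sup>T \<in> rmat k k" using Uc by simp
 have mU[measurable]: "(\<lambda>v. U *\<^sub>v v) \<in> leb k \<rightarrow>\<^sub>M leb k"
  and [measurable]: "(\<lambda>v. U\<^sup>T *\<^sub>v v) \<in> leb k \<rightarrow>\<^sub>M leb k"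
  using meas_mult_mat_vec[OF Uc measurable_ident] meas_mult_mat_vec[OF UT measurable_ident] by auto
 define g where "g v = ennreal (exp (- pi * nsq v))" for v :: "real vec"
 have [measurable]: "g \<in> bmeas k" unfolding g_def by measurable
 have g1: "(\<integral>\<^sup>+v. g v \<partial>leb k) = 1"
 proof -
  have "(\<integral>\<^sup>+v. g v \<partial>leb k) = (\<integral>\<^sup>+v. ennreal (exp (- pi * (\<Sum>i<k. 1 * (v $ i)\<^sup>2))) \<partial>leb k)"
   by (intro nn_integral_cong) (simp add: g_def scalar_prod_eq_sum[of _ k] power2_eq_square)
  also have "... = 1" by (subst nn_integral_gauss_diag) auto
  finally show ?thesis .
 qed
 \<comment> \<open>Because U^T U z = z, the first argument collapses to minus U^T y, and
   \<open>g\<close> is even.\<close>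
 have gi: "g (z + (-1) \<cdot>\<^sub>v (U\<^sup>T *\<^sub>v (y + U *\<^sub>v z))) = g (U\<^sup>T *\<^sub>v y)"
  if "z \<in> rvec k" "y \<in> rvec k" for z y
 proof -
  have "U\<^sup>T *\<^sub>v (U *\<^sub>v z) = z"
   by (rule mult_right_inv_vec[OF UT Uc]) (use U that in \<open>auto simp: orth_mat_def\<close>)
  hence "z + (-1) \<cdot>\<^sub>v (U\<^sup>T *\<^sub>v (y + U *\<^sub>v z)) = (-1) \<cdot>\<^sub>v (U\<^sup>T *\<^sub>v y)"
   using that Uc UT by (subst mult_add_distrib_mat_vec[OF UT]) (auto intro!: eq_vecI)
  moreover have "U\<^sup>T *\<^sub>v y \<in> rvec k" using UT that by simp
  ultimately show ?thesis by (simp add: g_def)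
 qed
 have gU: "g (U\<^sup>T *\<^sub>v y) = g y" if "y \<in> rvec k" for y
  using orth_mat_norm[OF U that] mult_mat_vec_carrier[OF UT that]
  by (simp add: g_def scalar_prod_eq_sum[of "U\<^sup>T *\<^sub>v y" k] power2_eq_square)
 have "(\<integral>\<^sup>+v. F v \<partial>leb k) = (\<integral>\<^sup>+z. \<integral>\<^sup>+y. g z * F y \<partial>leb k \<partial>leb k)"
  by (simp add: nn_integral_cmult nn_integral_multc g1)
 also have "... = (\<integral>\<^sup>+z. \<integral>\<^sup>+y. g (z + (-1) \<cdot>\<^sub>v (U\<^sup>T *\<^sub>v (y + U *\<^sub>v z))) * F (U *\<^sub>v z) \<partial>leb k \<partial>leb k)"
  by (rule nn_integral_exchange[OF Uc UT, where h = "\<lambda>z y. g z * F y"])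
    (use U in \<open>auto simp: orth_mat_def\<close>)
 also have "... = (\<integral>\<^sup>+z. \<integral>\<^sup>+y. g y * F (U *\<^sub>v z) \<partial>leb k \<partial>leb k)"
  by (intro nn_integral_cong) (simp only: gi gU space_leb)
 also have "... = (\<integral>\<^sup>+z. F (U *\<^sub>v z) \<partial>leb k)"
  by (simp add: nn_integral_multc g1)
 finally show ?thesis by simp
qed

lemma nn_integral_gauss:
 assumes "pos_def_mat k M"
 shows "(\<integral>\<^sup>+v. ennreal (gker M v) \<partial>leb k) = ennreal (1 / sqrt (det M))"
proof -
 obtain U l where U: "orth_mat k U" "M = spec_mat k U l" "\<And>i. i < k \<Longrightarrow> 0 < l i"
  using pos_def_spec_mat[OF assms] by blast
 have UT: "orth_mat k (U\<^sup>T)" using U(1) by (simp add: orth_mat_def)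
 define F where "F v = ennreal (exp (- pi * (\<Sum>i<k. l i * (v $ i)\<^sup>2)))" for v :: "real vec"
 note [measurable] = measurable_vec_index
 have [measurable]: "F \<in> bmeas k" unfolding F_def by measurable
 have "(\<integral>\<^sup>+v. ennreal (gker M v) \<partial>leb k) = (\<integral>\<^sup>+v. F (U\<^sup>T *\<^sub>v v) \<partial>leb k)"
  by (intro nn_integral_cong) (simp only: F_def U(2) bilf_spec_mat[OF U(1)] space_leb)
 also have "... = (\<integral>\<^sup>+v. F v \<partial>leb k)" by (rule nn_integral_orth_mat[OF UT]) measurable
 also have "... = ennreal (1 / sqrt (det M))"
  unfolding F_def U(2) det_spec_mat[OF U(1)] by (rule nn_integral_gauss_diag[OF U(3)])
 finally show ?thesis .
qed

text \<open>For positive definite \<open>M\<close>, the centred Gaussian probability measure whose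
  covariance is M^(-1) divided by 2 pi.\<close>

definition gauss :: "nat \<Rightarrow> real mat \<Rightarrow> real vec measure" where
 "gauss k M = density (leb k) (\<lambda>v. ennreal (sqrt (det M) * gker M v))"

lemma sets_gauss [measurable_cong, simp]: "sets (gauss k M) = sets (leb k)"
 by (simp add: gauss_def)

lemma space_gauss [simp]: "space (gauss k M) = rvec k"
 by (simp add: gauss_def)

lemma meas_qf [measurable]:
 "A \<in> rmat k k \<Longrightarrow> (\<lambda>v. qf A v) \<in> bmeas k"
 by (rule measurable_bilf) auto

lemma nn_integral_gauss_density:
 assumes M: "pos_def_mat k M" and [measurable]: "f \<in> bmeas k"
 shows "(\<integral>\<^sup>+v. f v \<partial>gauss k M) = ennreal (sqrt (det M)) * (\<integral>\<^sup>+v. ennreal (gker M v) * f v \<partial>leb k)"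
proof -
 have [measurable]: "M \<in> rmat k k" by (rule pd_carrier[OF M])
 note [measurable] = meas_qf[OF pd_carrier[OF M]]
 have "(\<integral>\<^sup>+v. f v \<partial>gauss k M) = (\<integral>\<^sup>+v. ennreal (sqrt (det M)) * (ennreal (gker M v) * f v) \<partial>leb k)"
  unfolding gauss_def using pd_det_pos[OF M]
  by (subst nn_integral_density) (auto simp: ennreal_mult' mult.assoc)
 also have "... = ennreal (sqrt (det M)) * (\<integral>\<^sup>+v. ennreal (gker M v) * f v \<partial>leb k)"
  by (rule nn_integral_cmult) measurable
 finally show ?thesis .
qed

lemma prob_space_gauss:
 assumes M: "pos_def_mat k M" shows "prob_space (gauss k M)"
proof
 have "emeasure (gauss k M) (space (gauss k M)) = (\<integral>\<^sup>+v. 1 \<partial>gauss k M)" by simp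
 also have "... = ennreal (sqrt (det M)) * ennreal (1 / sqrt (det M))"
  using nn_integral_gauss_density[OF M, of "\<lambda>_. 1"] nn_integral_gauss[OF M] by simp
 also have "... = 1" using pd_det_pos[OF M] by (subst ennreal_mult'[symmetric]) auto
 finally show "emeasure (gauss k M) (space (gauss k M)) = 1" .
qed

text \<open>The condition \<open>AL\<close> says that A^(-1) is L M^(-1) L^T, the covariance of L z
  up to the factor 2 pi. The exchange of variables preserves the sum of the forms of M in z and of A
  in y, so it turns a product integral in which f is evaluated at y into one in which f is evaluated
  at L z. Cancelling the free Gaussian factors leaves the claim.\<close>

lemma nn_integral_gauss_linear:
 assumes M: "pos_def_mat k M" and A: "pos_def_mat d A" and L: "L \<in> rmat d k"
  and AL: "A * (L * inv_mat M * L\<^sup>T) = 1\<^sub>m d"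
  and [measurable]: "f \<in> bmeas d"
 shows "(\<integral>\<^sup>+z. f (L *\<^sub>v z) \<partial>gauss k M) = (\<integral>\<^sup>+y. f y \<partial>gauss d A)"
proof -
 note Mc = pd_carrier[OF M] and Ac = pd_carrier[OF A] and I = pd_inv[OF M]
 note Ms = pd_sym[OF M] and As = pd_sym[OF A]
 have LT: "L\<^sup>T \<in> rmat k d" using L by simp
 have Lm[measurable]: "(\<lambda>v. L *\<^sub>v v) \<in> leb k \<rightarrow>\<^sub>M leb d"
  using meas_mult_mat_vec[OF L measurable_ident] by auto
 note [measurable] = meas_qf[OF Mc] meas_qf[OF Ac]
 \<comment> \<open>The right inverse of L adapted to M: it satisfies M N = L^T A, so the mixed terms
   of M below are expressed through A.\<close>
 define N where "N = inv_mat M * L\<^sup>T * A"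
 have N: "N \<in> rmat k d" using I LT Ac by (simp add: N_def)
 have C: "L * inv_mat M * L\<^sup>T \<in> rmat d d" using L I LT by simp
 have "L * N = L * inv_mat M * L\<^sup>T * A"
  using L I LT Ac by (simp add: N_def assoc_mult_mat[of _ d k _ k _ d] assoc_mult_mat[of _ k k _ d _ d] assoc_mult_mat[of _ d k _ d _ d] mult_carrier_mat[of _ d k _ k] mult_carrier_mat[of _ k k _ d] mult_carrier_mat[of _ k d _ d])
 also have "... = 1\<^sub>m d" by (rule mat_mult_left_right_inverse[OF Ac C AL])
 finally have LN: "L * N = 1\<^sub>m d" .
 \<comment> \<open>With w = y + L z, the M-form of the shifted vector is <Mz, z> - 2 <A L z, w> + <A
   w, w>; after w is expanded, the terms containing L z cancel against <A L z, L z>.\<close>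
 have ex: "qf M (z + (-1) \<cdot>\<^sub>v (N *\<^sub>v (y + L *\<^sub>v z))) + qf A (L *\<^sub>v z)
  = qf M z + qf A y" if z: "z \<in> rvec k" and y: "y \<in> rvec d" for z y
 proof -
  define w where "w = y + L *\<^sub>v z"
  have Lz: "L *\<^sub>v z \<in> rvec d" and w: "w \<in> rvec d" using L z y by (auto simp: w_def)
  have Nw: "N *\<^sub>v w \<in> rvec k" using N w by simp
  have MN: "M *\<^sub>v (N *\<^sub>v w) = L\<^sup>T *\<^sub>v (A *\<^sub>v w)"
  proof -
   have "N *\<^sub>v w = inv_mat M *\<^sub>v (L\<^sup>T *\<^sub>v (A *\<^sub>v w))"
    using I LT Ac w by (simp add: N_def assoc_mult_mat_vec[of _ k d _ d] assoc_mult_mat_vec[of _ k k _ d] mult_carrier_mat[of _ k k _ d])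
   thus ?thesis using mult_right_inv_vec[OF Mc I(1,2), of "L\<^sup>T *\<^sub>v (A *\<^sub>v w)"] LT Ac w by simp
  qed
  have b1: "bilf M x (N *\<^sub>v w) = bilf A (L *\<^sub>v x) w" if "x \<in> rvec k" for x
   unfolding bilf_def MN using scalar_prod_transpose_mult[OF L that, of "A *\<^sub>v w"] Ac w by simp
  have LNw: "L *\<^sub>v (N *\<^sub>v w) = w" by (rule mult_right_inv_vec[OF L N LN w])
  have "qf M (z + (-1) \<cdot>\<^sub>v (N *\<^sub>v w)) = qf M z - 2 * bilf A (L *\<^sub>v z) w + qf A w"
  proof -
   have "qf M ((-1) \<cdot>\<^sub>v (N *\<^sub>v w)) = qf M (N *\<^sub>v w)"
    using Nw by (simp only: bilf_smult_left[OF Mc] bilf_smult_right[OF Mc] smult_carrier_vec mult_minus_left mult_minus_right minus_minus mult_1)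
   thus ?thesis
    using z Nw by (simp add: bilf_add_self[OF Mc Ms] bilf_smult_right[OF Mc] b1 LNw)
  qed
  moreover have "bilf A (L *\<^sub>v z) w = bilf A (L *\<^sub>v z) y + qf A (L *\<^sub>v z)"
   unfolding w_def by (rule bilf_add_right[OF Ac y Lz Lz])
  moreover have "qf A w = qf A y + 2 * bilf A (L *\<^sub>v z) y + qf A (L *\<^sub>v z)"
   unfolding w_def bilf_add_self[OF Ac As y Lz] using bilf_commute[OF Ac As y Lz] by simp
  ultimately show ?thesis unfolding w_def[symmetric] by simp
 qed
 define h where "h z y = ennreal (gker M z) * (ennreal (gker A y) * f y)" for z y
 have hm: "(\<lambda>(z, y). h z y) \<in> borel_measurable (leb k \<Otimes>\<^sub>M leb d)"
  unfolding h_def by measurable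
 have hex: "h (z + (-1) \<cdot>\<^sub>v (N *\<^sub>v (y + L *\<^sub>v z))) (L *\<^sub>v z)
  = ennreal (gker A y) * (ennreal (gker M z) * f (L *\<^sub>v z))"
  if "z \<in> rvec k" "y \<in> rvec d" for z y
 proof -
  have "gker M (z + (-1) \<cdot>\<^sub>v (N *\<^sub>v (y + L *\<^sub>v z))) * gker A (L *\<^sub>v z)
   = gker A y * gker M z"
   unfolding exp_add[symmetric] distrib_left[symmetric] ex[OF that] by (simp add: add.commute)
  thus ?thesis unfolding h_def mult.assoc[symmetric] by (simp only: ennreal_mult'[symmetric] exp_ge_zero)
 qed
 have "ennreal (1 / sqrt (det M)) * (\<integral>\<^sup>+y. ennreal (gker A y) * f y \<partial>leb d)
  = (\<integral>\<^sup>+z. \<integral>\<^sup>+y. h z y \<partial>leb d \<partial>leb k)"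
  unfolding h_def nn_integral_gauss[OF M, symmetric] by (simp add: nn_integral_cmult nn_integral_multc)
 also have "... = (\<integral>\<^sup>+z. \<integral>\<^sup>+y. h (z + (-1) \<cdot>\<^sub>v (N *\<^sub>v (y + L *\<^sub>v z))) (L *\<^sub>v z) \<partial>leb d \<partial>leb k)"
  by (rule nn_integral_exchange[OF L N LN hm])
 also have "... = (\<integral>\<^sup>+z. \<integral>\<^sup>+y. ennreal (gker A y) * (ennreal (gker M z) * f (L *\<^sub>v z)) \<partial>leb d \<partial>leb k)"
  by (intro nn_integral_cong) (simp only: hex space_leb)
 also have "... = ennreal (1 / sqrt (det A)) * (\<integral>\<^sup>+z. ennreal (gker M z) * f (L *\<^sub>v z) \<partial>leb k)"
  unfolding nn_integral_gauss[OF A, symmetric] by (simp add: nn_integral_cmult nn_integral_multc)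
 finally have eq: "ennreal (1 / sqrt (det M)) * (\<integral>\<^sup>+y. ennreal (gker A y) * f y \<partial>leb d)
  = ennreal (1 / sqrt (det A)) * (\<integral>\<^sup>+z. ennreal (gker M z) * f (L *\<^sub>v z) \<partial>leb k)" .
 have c1: "ennreal (sqrt (det A)) * ennreal (1 / sqrt (det A)) = 1" "ennreal (sqrt (det M)) * ennreal (1 / sqrt (det M)) = 1"
  using pd_det_pos[OF M] pd_det_pos[OF A] by (simp_all add: ennreal_mult'[symmetric])
 have "(\<integral>\<^sup>+z. f (L *\<^sub>v z) \<partial>gauss k M)
  = (ennreal (sqrt (det A)) * ennreal (1 / sqrt (det A))) * (ennreal (sqrt (det M)) * (\<integral>\<^sup>+z. ennreal (gker M z) * f (L *\<^sub>v z) \<partial>leb k))"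
  unfolding c1 by (subst nn_integral_gauss_density[OF M]) auto
 also have "... = (ennreal (sqrt (det A)) * ennreal (sqrt (det M))) * (ennreal (1 / sqrt (det A)) * (\<integral>\<^sup>+z. ennreal (gker M z) * f (L *\<^sub>v z) \<partial>leb k))"
  by (simp only: mult_ac)
 also have "... = (ennreal (sqrt (det M)) * ennreal (1 / sqrt (det M))) * (ennreal (sqrt (det A)) * (\<integral>\<^sup>+y. ennreal (gker A y) * f y \<partial>leb d))"
  unfolding eq[symmetric] by (simp only: mult_ac)
 also have "... = (\<integral>\<^sup>+y. f y \<partial>gauss d A)"
  unfolding c1 by (subst nn_integral_gauss_density[OF A]) auto
 finally show ?thesis .
qed

lemma distr_gauss_linear:
 assumes M: "pos_def_mat k M" and A: "pos_def_mat d A" and L: "L \<in> rmat d k"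
  and AL: "A * (L * inv_mat M * L\<^sup>T) = 1\<^sub>m d"
 shows "distr (gauss k M) (leb d) (\<lambda>z. L *\<^sub>v z) = gauss d A"
proof (rule measure_eqI)
 have Lm[measurable]: "(\<lambda>v. L *\<^sub>v v) \<in> leb k \<rightarrow>\<^sub>M leb d"
  using meas_mult_mat_vec[OF L measurable_ident] by auto
 fix E assume "E \<in> sets (distr (gauss k M) (leb d) (\<lambda>z. L *\<^sub>v z))"
 hence E[measurable]: "E \<in> sets (leb d)" by simp
 have "emeasure (distr (gauss k M) (leb d) (\<lambda>z. L *\<^sub>v z)) E = (\<integral>\<^sup>+z. indicator E (L *\<^sub>v z) \<partial>gauss k M)"
  by (subst nn_integral_distr[symmetric, where M' = "leb d"]) auto
 also have "... = (\<integral>\<^sup>+y. indicator E y \<partial>gauss d A)"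
  by (rule nn_integral_gauss_linear[OF assms]) measurable
 also have "... = emeasure (gauss d A) E" by simp
 finally show "emeasure (distr (gauss k M) (leb d) (\<lambda>z. L *\<^sub>v z)) E = emeasure (gauss d A) E" .
qed simp

lemma smult_smult_mat: "a \<cdot>\<^sub>m (b \<cdot>\<^sub>m A) = (a * b :: real) \<cdot>\<^sub>m A"
 by (rule eq_matI) auto

lemma distr_gauss_scale:
 assumes M: "pos_def_mat k M" and s: "0 < s"
 shows "distr (gauss k M) (leb k) (\<lambda>z. sqrt s \<cdot>\<^sub>v z) = gauss k ((1 / s) \<cdot>\<^sub>m M)"
proof -
 let ?L = "sqrt s \<cdot>\<^sub>m 1\<^sub>m k"
 note c = pd_carrier[OF M] pd_inv[OF M]
 have "((1 / s) \<cdot>\<^sub>m M) * (?L * inv_mat M * ?L\<^sup>T) = 1\<^sub>m k"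
 proof -
  have T: "?L\<^sup>T = ?L" by (simp add: transpose_smult_mat)
  have "?L * inv_mat M * ?L = s \<cdot>\<^sub>m inv_mat M"
   using c s by (simp add: mult_smult_assoc_mat[of _ k k _ k] mult_smult_distrib[of _ k k _ k] smult_smult_mat
     left_mult_one_mat[of _ k k] right_mult_one_mat[of _ k k])
  hence "((1 / s) \<cdot>\<^sub>m M) * (?L * inv_mat M * ?L\<^sup>T) = ((1 / s) * s) \<cdot>\<^sub>m (M * inv_mat M)"
   unfolding T using c(1,2) by (simp add: mult_smult_assoc_mat[of _ k k _ k] mult_smult_distrib[of _ k k _ k] smult_smult_mat)
  also have "... = 1\<^sub>m k" using s c by (intro eq_matI) auto
  finally show ?thesis .
 qed
 hence "distr (gauss k M) (leb k) (\<lambda>z. ?L *\<^sub>v z) = gauss k ((1 / s) \<cdot>\<^sub>m M)"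
  using s by (intro distr_gauss_linear[OF M pos_def_smult[OF M]]) auto
 moreover have "distr (gauss k M) (leb k) (\<lambda>z. ?L *\<^sub>v z) = distr (gauss k M) (leb k) (\<lambda>z. sqrt s \<cdot>\<^sub>v z)"
  by (rule distr_cong) (auto simp: smult_mat_mult_vec[of _ k k])
 ultimately show ?thesis by simp
qed

text \<open>Completing the square separates a Gaussian in the sum u of the two variables from a
  Gaussian in a translate of the first one. The remaining constant is determined by the case F = 1,
  where all measures are probability measures.\<close>

lemma nn_integral_gauss_convolution:
 assumes M: "pos_def_mat k M" and s: "0 < s" and t: "0 < t" and F[measurable]: "F \<in> bmeas k"
 shows "(\<integral>\<^sup>+x. \<integral>\<^sup>+y. F (x + y) \<partial>gauss k ((1 / t) \<cdot>\<^sub>m M) \<partial>gauss k ((1 / s) \<cdot>\<^sub>m M)) = (\<integral>\<^sup>+u. F u \<partial>gauss k ((1 / (s + t)) \<cdot>\<^sub>m M))"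
proof -
 interpret pair_sigma_finite "leb k" "leb k" by (rule pair_sigma_finite_leb)
 note Mc = pd_carrier[OF M] and Ms = pd_sym[OF M]
 note [measurable] = meas_qf[OF Mc]
 have pd: "pos_def_mat k ((1 / r) \<cdot>\<^sub>m M)" if "0 < r" for r using pos_def_smult[OF M] that by simp
 define D where "D r = sqrt (det ((1 / r) \<cdot>\<^sub>m M))" for r
 have D: "D r > 0" if "0 < r" for r using pd_det_pos[OF pd[OF that]] by (simp add: D_def)
 define e where "e r x = ennreal (exp (- pi * (1 / r * qf M x)))" for r x
 have [measurable]: "e r \<in> bmeas k" for r unfolding e_def by measurable
 have g: "(\<integral>\<^sup>+v. f v \<partial>gauss k ((1 / r) \<cdot>\<^sub>m M)) = ennreal (D r) * (\<integral>\<^sup>+v. e r v * f v \<partial>leb k)"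
  if "0 < r" "f \<in> bmeas k" for r f
  unfolding nn_integral_gauss_density[OF pd[OF that(1)] that(2)] D_def e_def
  by (intro arg_cong2[of _ _ _ _ "(*)"] refl nn_integral_cong) (simp only: bilf_smult_mat[OF Mc] space_leb)
 have sq: "1 / s * qf M x + 1 / t * qf M (u + (-1) \<cdot>\<^sub>v x)
  = 1 / (s + t) * qf M u + 1 / (s * t / (s + t)) * qf M (x + (- (s / (s + t))) \<cdot>\<^sub>v u)"
  if "x \<in> rvec k" "u \<in> rvec k" for x u
  using that s t bilf_commute[OF Mc Ms that]
  by (simp add: bilf_add_self[OF Mc Ms] bilf_smult_left[OF Mc] bilf_smult_right[OF Mc] divide_simps)
    (simp add: algebra_simps power2_eq_square add_divide_distrib diff_divide_distrib divide_simps)?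
 have esq: "e s x * e t (u + (-1) \<cdot>\<^sub>v x) = e (s + t) u * e (s * t / (s + t)) (x + (- (s / (s + t))) \<cdot>\<^sub>v u)"
  if "x \<in> rvec k" "u \<in> rvec k" for x u
  unfolding e_def using sq[OF that]
  by (simp only: ennreal_mult'[symmetric] exp_ge_zero exp_add[symmetric] distrib_left[symmetric])
 \<comment> \<open>The integral over the translated first variable, the same for every u by
   translation invariance.\<close>
 define Z where "Z = (\<integral>\<^sup>+x. e (s * t / (s + t)) x \<partial>leb k)"
 have main: "(\<integral>\<^sup>+x. \<integral>\<^sup>+y. F (x + y) \<partial>gauss k ((1 / t) \<cdot>\<^sub>m M) \<partial>gauss k ((1 / s) \<cdot>\<^sub>m M))
  = ennreal (D s * D t) * Z * (\<integral>\<^sup>+u. e (s + t) u * F u \<partial>leb k)"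
  if F[measurable]: "F \<in> bmeas k" for F
 proof -
  have "(\<integral>\<^sup>+x. \<integral>\<^sup>+y. F (x + y) \<partial>gauss k ((1 / t) \<cdot>\<^sub>m M) \<partial>gauss k ((1 / s) \<cdot>\<^sub>m M))
   = (\<integral>\<^sup>+x. ennreal (D t) * (\<integral>\<^sup>+y. e t y * F (x + y) \<partial>leb k) \<partial>gauss k ((1 / s) \<cdot>\<^sub>m M))"
  proof (rule nn_integral_cong)
   fix x assume "x \<in> space (gauss k ((1 / s) \<cdot>\<^sub>m M))"
   hence x: "x \<in> space (leb k)" by simp
   have "(\<lambda>y. F (x + y)) \<in> bmeas k" using x by measurable
   from g[OF t this] show "(\<integral>\<^sup>+y. F (x + y) \<partial>gauss k ((1 / t) \<cdot>\<^sub>m M)) = ennreal (D t) * (\<integral>\<^sup>+y. e t y * F (x + y) \<partial>leb k)" .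
  qed
  also have "... = ennreal (D s) * (\<integral>\<^sup>+x. e s x * (ennreal (D t) * (\<integral>\<^sup>+y. e t y * F (x + y) \<partial>leb k)) \<partial>leb k)"
   by (rule g[OF s]) measurable
  also have "... = ennreal (D s) * (\<integral>\<^sup>+x. ennreal (D t) * (\<integral>\<^sup>+y. e s x * (e t y * F (x + y)) \<partial>leb k) \<partial>leb k)"
  proof (rule arg_cong2[of _ _ _ _ "(*)", OF refl], rule nn_integral_cong)
   fix x assume "x \<in> space (leb k)"
   hence "(\<lambda>y. e t y * F (x + y)) \<in> bmeas k" by measurable
   from nn_integral_cmult[OF this, of "e s x"]
   show "e s x * (ennreal (D t) * (\<integral>\<^sup>+y. e t y * F (x + y) \<partial>leb k)) = ennreal (D t) * (\<integral>\<^sup>+y. e s x * (e t y * F (x + y)) \<partial>leb k)"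
    by (simp add: mult_ac)
  qed
  also have "... = ennreal (D s) * (ennreal (D t) * (\<integral>\<^sup>+x. \<integral>\<^sup>+y. e s x * (e t y * F (x + y)) \<partial>leb k \<partial>leb k))"
  proof -
   have "(\<lambda>x. \<integral>\<^sup>+y. e s x * (e t y * F (x + y)) \<partial>leb k) \<in> bmeas k"
    by measurable
   thus ?thesis by (simp only: nn_integral_cmult)
  qed
  also have "... = ennreal (D s * D t) * (\<integral>\<^sup>+x. \<integral>\<^sup>+y. e s x * (e t y * F (x + y)) \<partial>leb k \<partial>leb k)"
   using D[OF s] by (simp add: ennreal_mult' mult.assoc)
  also have "(\<integral>\<^sup>+x. \<integral>\<^sup>+y. e s x * (e t y * F (x + y)) \<partial>leb k \<partial>leb k)
   = (\<integral>\<^sup>+x. \<integral>\<^sup>+u. e s x * (e t (u + (-1) \<cdot>\<^sub>v x) * F u) \<partial>leb k \<partial>leb k)"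
  proof (rule nn_integral_cong)
   fix x assume x: "x \<in> space (leb k)"
   have m: "(\<lambda>u. e s x * (e t (u + (-1) \<cdot>\<^sub>v x) * F u)) \<in> bmeas k"
    using x by measurable
   have "(\<integral>\<^sup>+u. e s x * (e t (u + (-1) \<cdot>\<^sub>v x) * F u) \<partial>leb k) = (\<integral>\<^sup>+y. e s x * (e t ((y + x) + (-1) \<cdot>\<^sub>v x) * F (y + x)) \<partial>leb k)"
    using nn_integral_leb_translate[OF m, of x] x by simp
   also have "... = (\<integral>\<^sup>+y. e s x * (e t y * F (x + y)) \<partial>leb k)"
   proof (rule nn_integral_cong)
    fix y assume y: "y \<in> space (leb k)"
    have "(y + x) + (-1) \<cdot>\<^sub>v x = y" "y + x = x + y" using x y by (auto intro!: eq_vecI)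
    thus "e s x * (e t ((y + x) + (-1) \<cdot>\<^sub>v x) * F (y + x)) = e s x * (e t y * F (x + y))" by simp
   qed
   finally show "(\<integral>\<^sup>+y. e s x * (e t y * F (x + y)) \<partial>leb k) = (\<integral>\<^sup>+u. e s x * (e t (u + (-1) \<cdot>\<^sub>v x) * F u) \<partial>leb k)" by simp
  qed
  also have "... = (\<integral>\<^sup>+x. \<integral>\<^sup>+u. e (s * t / (s + t)) (x + (- (s / (s + t))) \<cdot>\<^sub>v u) * (e (s + t) u * F u) \<partial>leb k \<partial>leb k)"
   by (intro nn_integral_cong) (simp only: mult.assoc[symmetric] esq space_leb, simp only: mult_ac)
  also have "... = (\<integral>\<^sup>+u. \<integral>\<^sup>+x. e (s * t / (s + t)) (x + (- (s / (s + t))) \<cdot>\<^sub>v u) * (e (s + t) u * F u) \<partial>leb k \<partial>leb k)"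
   by (rule Fubini'[symmetric]) measurable
  also have "... = (\<integral>\<^sup>+u. Z * (e (s + t) u * F u) \<partial>leb k)"
  proof (rule nn_integral_cong)
   fix u assume u: "u \<in> space (leb k)"
   have "(\<integral>\<^sup>+x. e (s * t / (s + t)) (x + (- (s / (s + t))) \<cdot>\<^sub>v u) * (e (s + t) u * F u) \<partial>leb k)
    = (\<integral>\<^sup>+x. e (s * t / (s + t)) (x + (- (s / (s + t))) \<cdot>\<^sub>v u) \<partial>leb k) * (e (s + t) u * F u)"
    using u by (intro nn_integral_multc) measurable
   also have "(\<integral>\<^sup>+x. e (s * t / (s + t)) (x + (- (s / (s + t))) \<cdot>\<^sub>v u) \<partial>leb k) = Z"
    unfolding Z_def using u by (intro nn_integral_leb_translate) auto
   finally show "(\<integral>\<^sup>+x. e (s * t / (s + t)) (x + (- (s / (s + t))) \<cdot>\<^sub>v u) * (e (s + t) u * F u) \<partial>leb k) = Z * (e (s + t) u * F u)" .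
  qed
  also have "... = Z * (\<integral>\<^sup>+u. e (s + t) u * F u \<partial>leb k)" by (rule nn_integral_cmult) measurable
  finally show ?thesis by (simp add: mult.assoc)
 qed
 have st: "0 < s + t" using s t by simp
 interpret Ps: prob_space "gauss k ((1 / s) \<cdot>\<^sub>m M)" by (rule prob_space_gauss[OF pd[OF s]])
 interpret Pt: prob_space "gauss k ((1 / t) \<cdot>\<^sub>m M)" by (rule prob_space_gauss[OF pd[OF t]])
 interpret Pst: prob_space "gauss k ((1 / (s + t)) \<cdot>\<^sub>m M)" by (rule prob_space_gauss[OF pd[OF st]])
 define E where "E = (\<integral>\<^sup>+u. e (s + t) u \<partial>leb k)"
 have "1 = ennreal (D s * D t) * Z * E"
  using main[of "\<lambda>_. 1"] Ps.emeasure_space_1 Pt.emeasure_space_1 by (simp add: E_def)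
 moreover have "ennreal (D (s + t)) * E = 1"
  using g[OF st, of "\<lambda>_. 1"] Pst.emeasure_space_1 by (simp add: E_def)
 ultimately have "ennreal (D s * D t) * Z = ennreal (D (s + t))"
  by (metis mult.assoc mult.commute mult.right_neutral)
 thus ?thesis using main[OF F] g[OF st F] by simp
qed

text \<open>Subtracting c times the identity, with c below every eigenvalue, leaves \<open>M\<close>
  positive definite; the subtracted part pays for the growing exponential.\<close>

lemma exp_square_integrable_gauss:
 assumes M: "pos_def_mat k M"
 obtains \<eta> where "0 < \<eta>" "integrable (gauss k M) (\<lambda>v. exp (\<eta> * nsq v))"
proof -
 obtain U l where U: "orth_mat k U" "M = spec_mat k U l" "\<And>i. i < k \<Longrightarrow> 0 < l i"
  using pos_def_spec_mat[OF M] by blast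
 obtain c where c: "0 < c" "\<And>i. i < k \<Longrightarrow> c < l i"
 proof -
  \<comment> \<open>Inserting 1 keeps the set nonempty when k = 0; halving makes c strictly smaller
    than every eigenvalue.\<close>
  define c where "c = Min (insert 1 (l ` {..<k})) / 2"
  have pos: "0 < Min (insert 1 (l ` {..<k}))" using U(3) by (subst Min_gr_iff) auto
  have "c < l i" if "i < k" for i
  proof -
   have "Min (insert 1 (l ` {..<k})) \<le> l i" using that by (intro Min_le) auto
   thus ?thesis using pos unfolding c_def by linarith
  qed
  moreover have "0 < c" using pos by (simp add: c_def)
  ultimately show thesis by (intro that)
 qed
 define M' where "M' = spec_mat k U (\<lambda>i. l i - c)"
 have M': "pos_def_mat k M'" unfolding M'_def by (rule spec_mat_pos_def[OF U(1)]) (use c in auto)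
 have b: "qf M v = qf M' v + c * nsq v" if "v \<in> rvec k" for v
  unfolding M'_def U(2) bilf_spec_mat[OF U(1) that] orth_mat_norm[OF U(1) that, symmetric]
  by (simp add: sum_distrib_left sum.distrib[symmetric] algebra_simps)
 show thesis
 proof (rule that[of "pi * c"])
  show "0 < pi * c" using c by simp
  show "integrable (gauss k M) (\<lambda>v. exp (pi * c * nsq v))"
  proof (rule integrableI_nonneg)
   have "(\<integral>\<^sup>+v. ennreal (exp (pi * c * nsq v)) \<partial>gauss k M)
    = ennreal (sqrt (det M)) * (\<integral>\<^sup>+v. ennreal (gker M v) * ennreal (exp (pi * c * nsq v)) \<partial>leb k)"
    by (rule nn_integral_gauss_density[OF M]) measurable
   also have "(\<integral>\<^sup>+v. ennreal (gker M v) * ennreal (exp (pi * c * nsq v)) \<partial>leb k)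
    = (\<integral>\<^sup>+v. ennreal (gker M' v) \<partial>leb k)"
    by (intro nn_integral_cong)
      (simp add: b ennreal_mult'[symmetric] exp_add[symmetric] algebra_simps)
   also have "... = ennreal (1 / sqrt (det M'))" by (rule nn_integral_gauss[OF M'])
   finally show "(\<integral>\<^sup>+v. ennreal (exp (pi * c * nsq v)) \<partial>gauss k M) < \<infinity>"
    by (simp add: ennreal_mult_less_top)
  qed auto
 qed
qed

section \<open>Gaussian averages\<close>

lemma scalar_prod_Cauchy_Schwarz:
 assumes "(x :: real vec) \<in> rvec k" "y \<in> rvec k"
 shows "\<bar>x \<bullet> y\<bar> \<le> vnorm x * vnorm y"
proof -
 have "(x \<bullet> y)\<^sup>2 \<le> nsq x * nsq y"
  using Cauchy_Schwarz_ineq_sum[of "\<lambda>i. x $ i" "\<lambda>i. y $ i" "{..<k}"] assms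
  by (simp add: scalar_prod_eq_sum[of _ k] power2_eq_square)
 hence "sqrt ((x \<bullet> y)\<^sup>2) \<le> sqrt (nsq x * nsq y)" by (rule real_sqrt_le_mono)
 thus ?thesis by (simp add: real_sqrt_mult)
qed

lemma abs_index_le_norm:
 assumes "(v :: real vec) \<in> rvec k" "i < k"
 shows "\<bar>v $ i\<bar> \<le> vnorm v"
proof -
 have "(v $ i)\<^sup>2 \<le> (\<Sum>i<k. (v $ i)\<^sup>2)" using assms by (intro member_le_sum) auto
 thus ?thesis using assms by (intro real_le_rsqrt) (simp add: scalar_prod_eq_sum[of _ k] power2_eq_square)
qed

lemma mult_mat_vec_bounded:
 assumes "(L :: real mat) \<in> rmat d k"
 obtains \<Lambda> where "1 \<le> \<Lambda>" "\<And>v. v \<in> rvec k \<Longrightarrow> vnorm (L *\<^sub>v v) \<le> \<Lambda> * vnorm v"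
proof -
 define \<Lambda> where "\<Lambda> = 1 + (\<Sum>i<d. \<Sum>j<k. \<bar>L $$ (i, j)\<bar>)"
 have "vnorm (L *\<^sub>v v) \<le> \<Lambda> * vnorm v" if v: "v \<in> rvec k" for v
 proof -
  have Lv: "L *\<^sub>v v \<in> rvec d" using assms v by simp
  have "vnorm (L *\<^sub>v v) \<le> (\<Sum>i<d. \<bar>(L *\<^sub>v v) $ i\<bar>)"
   using L2_set_le_sum_abs[of "\<lambda>i. (L *\<^sub>v v) $ i" "{..<d}"] scalar_prod_eq_sum[OF Lv, of "L *\<^sub>v v"]
   by (simp add: L2_set_def power2_eq_square)
  also have "... \<le> (\<Sum>i<d. \<Sum>j<k. \<bar>L $$ (i, j)\<bar> * vnorm v)"
  proof (rule sum_mono)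
   fix i assume "i \<in> {..<d}"
   hence "(L *\<^sub>v v) $ i = (\<Sum>j<k. L $$ (i, j) * v $ j)" by (intro mult_vec_index[OF assms v]) simp
   also have "\<bar>...\<bar> \<le> (\<Sum>j<k. \<bar>L $$ (i, j)\<bar> * vnorm v)"
    by (rule order_trans[OF sum_abs]) (auto simp: abs_mult intro!: sum_mono mult_left_mono abs_index_le_norm[OF v])
   finally show "\<bar>(L *\<^sub>v v) $ i\<bar> \<le> (\<Sum>j<k. \<bar>L $$ (i, j)\<bar> * vnorm v)" .
  qed
  also have "... = (\<Sum>i<d. \<Sum>j<k. \<bar>L $$ (i, j)\<bar>) * vnorm v" by (simp add: sum_distrib_right)
  also have "... \<le> \<Lambda> * vnorm v" unfolding \<Lambda>_def by (intro mult_right_mono) (auto simp: nsq_nonneg)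
  finally show ?thesis .
 qed
 moreover have "1 \<le> \<Lambda>" unfolding \<Lambda>_def by (auto intro!: sum_nonneg)
 ultimately show thesis using that by blast
qed

lemma bilf_bounded:
 assumes A: "(A :: real mat) \<in> rmat k k"
 obtains \<alpha> where "1 \<le> \<alpha>" "\<And>x y. x \<in> rvec k \<Longrightarrow> y \<in> rvec k \<Longrightarrow> \<bar>bilf A x y\<bar> \<le> \<alpha> * vnorm x * vnorm y"
proof -
 obtain \<alpha> where a: "1 \<le> \<alpha>" "\<And>v. v \<in> rvec k \<Longrightarrow> vnorm (A *\<^sub>v v) \<le> \<alpha> * vnorm v"
  by (fact mult_mat_vec_bounded[OF A])
 show thesis
 proof (rule that[OF a(1)])
  fix x y :: "real vec" assume xy: "x \<in> rvec k" "y \<in> rvec k"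
  have "\<bar>bilf A x y\<bar> \<le> vnorm x * vnorm (A *\<^sub>v y)"
   unfolding bilf_def by (rule scalar_prod_Cauchy_Schwarz) (use A xy in auto)
  also have "... \<le> vnorm x * (\<alpha> * vnorm y)"
   using a(2)[OF xy(2)] by (intro mult_left_mono) (auto simp: nsq_nonneg)
  finally show "\<bar>bilf A x y\<bar> \<le> \<alpha> * vnorm x * vnorm y" by (simp add: mult_ac)
 qed
qed

text \<open>Young's inequality for t = sqrt q. Through it \<open>exp_square_integrable_gauss\<close>
  dominates every function of exponential growth.\<close>

lemma exp_linear_le_exp_square:
 fixes \<beta> \<gamma> q :: real
 assumes "0 < \<eta>" and that: "0 \<le> q"
 shows "exp (\<beta> * sqrt q + \<gamma>) \<le> exp (\<beta>\<^sup>2 / (4 * \<eta>) + \<gamma>) * exp (\<eta> * q)"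
proof -
 have "0 \<le> (2 * \<eta> * sqrt q - \<beta>)\<^sup>2" by simp
 also have "... = 4 * \<eta>\<^sup>2 * q + \<beta>\<^sup>2 - 4 * \<eta> * (\<beta> * sqrt q)"
  using that by (simp add: power2_diff power_mult_distrib)
 finally have "(4 * \<eta>) * (\<beta> * sqrt q) \<le> (4 * \<eta>) * (\<eta> * q + \<beta>\<^sup>2 / (4 * \<eta>))"
  using assms by (simp add: distrib_left power2_eq_square mult_ac)
 hence "\<beta> * sqrt q \<le> \<eta> * q + \<beta>\<^sup>2 / (4 * \<eta>)" using assms by (simp only: mult_le_cancel_left_pos)
 thus ?thesis unfolding exp_add[symmetric] by simp
qed

lemma integrable_gauss_exp_norm:
 assumes M: "pos_def_mat k M" and f: "f \<in> bmeas k"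
  and le: "\<And>v. v \<in> rvec k \<Longrightarrow> \<bar>f v\<bar> \<le> C * exp (\<beta> * vnorm v)"
 shows "integrable (gauss k M) (f :: _ \<Rightarrow> real)"
proof -
 obtain \<eta> where e: "0 < \<eta>" "integrable (gauss k M) (\<lambda>v. exp (\<eta> * nsq v))"
  by (fact exp_square_integrable_gauss[OF M])
 show ?thesis
 proof (rule Bochner_Integration.integrable_bound)
  show "integrable (gauss k M) (\<lambda>v. \<bar>C\<bar> * (exp (\<beta>\<^sup>2 / (4 * \<eta>) + 0) * exp (\<eta> * nsq v)))"
   using e(2) by (intro integrable_mult_right)
  show "f \<in> borel_measurable (gauss k M)" using f by (simp cong: measurable_cong_sets)
  show "AE v in gauss k M. norm (f v) \<le> norm (\<bar>C\<bar> * (exp (\<beta>\<^sup>2 / (4 * \<eta>) + 0) * exp (\<eta> * nsq v)))"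
  proof (rule AE_I2)
   fix v assume "v \<in> space (gauss k M)"
   hence v: "v \<in> rvec k" by simp
   have "\<bar>f v\<bar> \<le> \<bar>C\<bar> * exp (\<beta> * vnorm v)"
    by (rule order_trans[OF le[OF v] mult_right_mono]) simp_all
   hence "\<bar>f v\<bar> \<le> \<bar>C\<bar> * exp (\<beta> * vnorm v + 0)" by simp
   also have "... \<le> \<bar>C\<bar> * (exp (\<beta>\<^sup>2 / (4 * \<eta>) + 0) * exp (\<eta> * nsq v))"
    by (intro mult_left_mono exp_linear_le_exp_square e nsq_nonneg) auto
   finally show "norm (f v) \<le> norm (\<bar>C\<bar> * (exp (\<beta>\<^sup>2 / (4 * \<eta>) + 0) * exp (\<eta> * nsq v)))" by (simp add: abs_mult)
  qed
 qed
qed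

lemma power_le_exp: "0 \<le> x \<Longrightarrow> x ^ n \<le> fact n * exp (x :: real)"
proof -
 assume x: "0 \<le> x"
 have "(\<lambda>n. x ^ n /\<^sub>R fact n) sums exp x" by (rule exp_converges)
 hence "x ^ n /\<^sub>R fact n \<le> exp x"
  using sum_le_suminf[of "\<lambda>n. x ^ n /\<^sub>R fact n" "{n}"] x by (simp add: sums_iff)
 thus ?thesis by (simp add: field_simps)
qed

lemma integrable_gauss_norm_power:
 assumes M: "pos_def_mat k M"
 shows "integrable (gauss k M) (\<lambda>v. vnorm v ^ n)"
proof (rule integrable_gauss_exp_norm[OF M])
 fix v :: "real vec"
 show "\<bar>vnorm v ^ n\<bar> \<le> fact n * exp (1 * vnorm v)"
  using power_le_exp[of "vnorm v" n] nsq_nonneg[of v] by (simp add: power_abs[symmetric])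
qed measurable

text \<open>With (1/s) A as matrix this is a heat semigroup at time s, its kernel having covariance
  proportional to s A^(-1).\<close>

definition gavg :: "nat \<Rightarrow> real mat \<Rightarrow> (real vec \<Rightarrow> real) \<Rightarrow> real vec \<Rightarrow> real" where
 "gavg k A h y = (\<integral>u. h (y + u) \<partial>gauss k A)"

definition bdd_fun :: "nat \<Rightarrow> real \<Rightarrow> real \<Rightarrow> (real vec \<Rightarrow> real) \<Rightarrow> bool" where
 "bdd_fun k a b h \<longleftrightarrow> h \<in> bmeas k \<and> (\<forall>v\<in>rvec k. a \<le> h v \<and> h v \<le> b)"

lemma measurable_gauss_shift:
 assumes "h \<in> bmeas k" "y \<in> rvec k"
 shows "(\<lambda>u. h (y + u)) \<in> bmeas k"
proof -
 have "y \<in> space (leb k)" using assms by simp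
 note [measurable] = this assms(1)
 show ?thesis by measurable
qed

lemma integrable_gauss_bdd_fun:
 assumes A: "pos_def_mat k A" and h: "bdd_fun k a b h" and y: "y \<in> rvec k"
 shows "integrable (gauss k A) (\<lambda>u. h (y + u))"
proof -
 interpret prob_space "gauss k A" by (rule prob_space_gauss[OF A])
 show ?thesis
 proof (rule integrable_const_bound[of _ "\<bar>a\<bar> + \<bar>b\<bar>"])
  show "AE u in gauss k A. norm (h (y + u)) \<le> \<bar>a\<bar> + \<bar>b\<bar>"
  proof (rule AE_I2)
   fix u assume "u \<in> space (gauss k A)"
   hence "a \<le> h (y + u) \<and> h (y + u) \<le> b" using h y by (simp add: bdd_fun_def)
   thus "norm (h (y + u)) \<le> \<bar>a\<bar> + \<bar>b\<bar>" unfolding real_norm_def by linarith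
  qed
  have "(\<lambda>u. h (y + u)) \<in> bmeas k"
   using h by (intro measurable_gauss_shift[OF _ y]) (simp add: bdd_fun_def)
  thus "(\<lambda>u. h (y + u)) \<in> borel_measurable (gauss k A)"
   by (simp cong: measurable_cong_sets)
 qed
qed

lemma gavg_bounds:
 assumes A: "pos_def_mat k A" and h: "bdd_fun k a b h" and y: "y \<in> rvec k"
 shows "a \<le> gavg k A h y" "gavg k A h y \<le> b"
proof -
 interpret prob_space "gauss k A" by (rule prob_space_gauss[OF A])
 note i = integrable_gauss_bdd_fun[OF assms]
 have b: "\<And>u. u \<in> space (gauss k A) \<Longrightarrow> a \<le> h (y + u) \<and> h (y + u) \<le> b" using h y by (auto simp: bdd_fun_def)
 show "a \<le> gavg k A h y" unfolding gavg_def using b by (intro integral_ge_const[OF i] AE_I2) auto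
 show "gavg k A h y \<le> b" unfolding gavg_def using b by (intro integral_le_const[OF i] AE_I2) auto
qed

lemma bdd_fun_gavg:
 assumes A: "pos_def_mat k A" and h: "bdd_fun k a b h"
 shows "bdd_fun k a b (gavg k A h)"
proof -
 interpret prob_space "gauss k A" by (rule prob_space_gauss[OF A])
 have [measurable]: "h \<in> bmeas k" using h by (simp add: bdd_fun_def)
 have "gavg k A h \<in> bmeas k"
  unfolding gavg_def by (rule borel_measurable_lebesgue_integral) measurable
 thus ?thesis using gavg_bounds[OF assms] by (simp add: bdd_fun_def)
qed

lemma ennreal_gavg:
 assumes A: "pos_def_mat k A" and h: "bdd_fun k a b h" "0 \<le> a" and y: "y \<in> rvec k"
 shows "ennreal (gavg k A h y) = (\<integral>\<^sup>+u. ennreal (h (y + u)) \<partial>gauss k A)"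
 unfolding gavg_def
 by (rule nn_integral_eq_integral[symmetric, OF integrable_gauss_bdd_fun[OF A h(1) y]])
   (use h y in \<open>auto simp: bdd_fun_def intro!: AE_I2 intro: order_trans\<close>)

text \<open>The semigroup law in the time s. Nonnegativity of \<open>h\<close> allows it to be read
  off from the unsigned convolution formula.\<close>

lemma gavg_gavg:
 assumes A: "pos_def_mat k A" and st: "0 < s" "0 < t" and h: "bdd_fun k a b h" "0 \<le> a" and y: "y \<in> rvec k"
 shows "gavg k ((1 / s) \<cdot>\<^sub>m A) (gavg k ((1 / t) \<cdot>\<^sub>m A) h) y = gavg k ((1 / (s + t)) \<cdot>\<^sub>m A) h y"
proof -
 have pd: "pos_def_mat k ((1 / r) \<cdot>\<^sub>m A)" if "0 < r" for r using pos_def_smult[OF A] that by simp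
 have hm: "h \<in> bmeas k" using h by (simp add: bdd_fun_def)
 note b = bdd_fun_gavg[OF pd[OF st(2)] h(1)]
 have "ennreal (gavg k ((1 / s) \<cdot>\<^sub>m A) (gavg k ((1 / t) \<cdot>\<^sub>m A) h) y)
  = (\<integral>\<^sup>+x. ennreal (gavg k ((1 / t) \<cdot>\<^sub>m A) h (y + x)) \<partial>gauss k ((1 / s) \<cdot>\<^sub>m A))"
  by (rule ennreal_gavg[OF pd[OF st(1)] b h(2) y])
 also have "... = (\<integral>\<^sup>+x. \<integral>\<^sup>+u. ennreal (h (y + (x + u))) \<partial>gauss k ((1 / t) \<cdot>\<^sub>m A) \<partial>gauss k ((1 / s) \<cdot>\<^sub>m A))"
 proof (rule nn_integral_cong)
  fix x assume "x \<in> space (gauss k ((1 / s) \<cdot>\<^sub>m A))"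
  hence x: "x \<in> rvec k" by simp
  have "ennreal (gavg k ((1 / t) \<cdot>\<^sub>m A) h (y + x)) = (\<integral>\<^sup>+u. ennreal (h ((y + x) + u)) \<partial>gauss k ((1 / t) \<cdot>\<^sub>m A))"
   using x y by (intro ennreal_gavg[OF pd[OF st(2)] h]) simp
  also have "... = (\<integral>\<^sup>+u. ennreal (h (y + (x + u))) \<partial>gauss k ((1 / t) \<cdot>\<^sub>m A))"
   using x y by (intro nn_integral_cong) (simp add: assoc_add_vec[of _ k])
  finally show "ennreal (gavg k ((1 / t) \<cdot>\<^sub>m A) h (y + x)) = (\<integral>\<^sup>+u. ennreal (h (y + (x + u))) \<partial>gauss k ((1 / t) \<cdot>\<^sub>m A))" .
 qed
 also have "... = (\<integral>\<^sup>+u. ennreal (h (y + u)) \<partial>gauss k ((1 / (s + t)) \<cdot>\<^sub>m A))"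
  using measurable_gauss_shift[OF hm y] by (intro nn_integral_gauss_convolution[OF A st]) simp
 also have "... = ennreal (gavg k ((1 / (s + t)) \<cdot>\<^sub>m A) h y)"
  using st by (intro ennreal_gavg[symmetric, OF pd h y]) simp
 finally show ?thesis
  using gavg_bounds(1)[OF pd b y] gavg_bounds(1)[OF pd h(1) y] st h(2)
  by (subst (asm) ennreal_inj) (auto intro: order_trans)
qed

lemma distr_lborel_vec_translate:
 assumes "a \<in> rvec k"
 shows "distr (leb k) (leb k) (\<lambda>v. v + a) = leb k"
proof (rule measure_eqI)
 have "a \<in> space (leb k)" using assms by simp
 note [measurable] = this
 have m[measurable]: "(\<lambda>v. v + a) \<in> leb k \<rightarrow>\<^sub>M leb k" by measurable
 fix E assume "E \<in> sets (distr (leb k) (leb k) (\<lambda>v. v + a))"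
 hence E[measurable]: "E \<in> sets (leb k)" by simp
 have "emeasure (distr (leb k) (leb k) (\<lambda>v. v + a)) E = (\<integral>\<^sup>+v. indicator E (v + a) \<partial>leb k)"
  by (subst nn_integral_distr[symmetric, where M' = "leb k"]) auto
 also have "... = (\<integral>\<^sup>+v. indicator E v \<partial>leb k)"
  by (rule nn_integral_leb_translate) (use assms in auto)
 finally show "emeasure (distr (leb k) (leb k) (\<lambda>v. v + a)) E = emeasure (leb k) E" by simp
qed simp

text \<open>The Cameron--Martin formula: by translation invariance of Lebesgue measure the shift
  moves from \<open>h\<close> to the density, so that \<open>h\<close> itself may be merely
  measurable.\<close>

lemma integral_gauss_shift:
 fixes h :: "real vec \<Rightarrow> real"
 assumes A: "pos_def_mat k A" and v: "v \<in> rvec k" and h: "h \<in> bmeas k"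
 shows "(\<integral>u. h (v + u) \<partial>gauss k A)
  = (\<integral>u. exp (2 * pi * bilf A v u - pi * qf A v) * h u \<partial>gauss k A)"
proof -
 note Ac = pd_carrier[OF A] and As = pd_sym[OF A]
 have "v \<in> space (leb k)" using v by simp
 note [measurable] = this h meas_qf[OF Ac]
 have [measurable]: "(\<lambda>u. bilf A v u) \<in> bmeas k" by (rule measurable_bilf[OF Ac]) measurable
 define \<rho> where "\<rho> u = sqrt (det A) * gker A u" for u
 have \<rho>: "\<rho> \<in> bmeas k" "\<And>u. 0 \<le> \<rho> u"
  using pd_det_pos[OF A] unfolding \<rho>_def by auto
 note [measurable] = \<rho>(1)
 have i: "(\<integral>u. f u \<partial>gauss k A) = (\<integral>u. \<rho> u * f u \<partial>leb k)"
  if "f \<in> bmeas k" for f :: "real vec \<Rightarrow> real"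
  unfolding gauss_def \<rho>_def[symmetric] using that \<rho> by (subst integral_density) auto
 define F where "F u = \<rho> (u + (-1) \<cdot>\<^sub>v v) * h u" for u
 have [measurable]: "F \<in> bmeas k" unfolding F_def by measurable
 have m: "(\<lambda>u. u + v) \<in> leb k \<rightarrow>\<^sub>M leb k" by measurable
 have "(\<integral>u. h (v + u) \<partial>gauss k A) = (\<integral>u. \<rho> u * h (v + u) \<partial>leb k)" by (rule i) measurable
 also have "... = (\<integral>u. F (u + v) \<partial>leb k)"
 proof (rule integral_cong_refl)
  fix u assume "u \<in> space (leb k)"
  hence "(u + v) + (-1) \<cdot>\<^sub>v v = u" "v + u = u + v" using v by (auto intro!: eq_vecI)
  thus "\<rho> u * h (v + u) = F (u + v)" by (simp add: F_def)
 qed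
 also have "... = (\<integral>u. F u \<partial>distr (leb k) (leb k) (\<lambda>u. u + v))"
  by (rule integral_distr[symmetric, OF m]) measurable
 also have "... = (\<integral>u. F u \<partial>leb k)" unfolding distr_lborel_vec_translate[OF v] ..
 also have "... = (\<integral>u. \<rho> u * (exp (2 * pi * bilf A v u - pi * qf A v) * h u) \<partial>leb k)"
 proof (rule integral_cong_refl)
  fix u assume "u \<in> space (leb k)"
  hence u: "u \<in> rvec k" by simp
  have "qf A (u + (-1) \<cdot>\<^sub>v v) = qf A u - 2 * bilf A v u + qf A v"
   using u v bilf_commute[OF Ac As u v]
   by (simp add: bilf_add_self[OF Ac As] bilf_smult_left[OF Ac] bilf_smult_right[OF Ac])
  hence "\<rho> (u + (-1) \<cdot>\<^sub>v v) = \<rho> u * exp (2 * pi * bilf A v u - pi * qf A v)"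
   unfolding \<rho>_def by (simp only: mult.assoc exp_add[symmetric]) (simp add: algebra_simps)
  thus "F u = \<rho> u * (exp (2 * pi * bilf A v u - pi * qf A v) * h u)" by (simp add: F_def)
 qed
 also have "... = (\<integral>u. exp (2 * pi * bilf A v u - pi * qf A v) * h u \<partial>gauss k A)"
  by (rule i[symmetric]) measurable
 finally show ?thesis .
qed

lemma exp_sub_linear_le: "\<bar>exp x - 1 - x\<bar> \<le> x\<^sup>2 * exp \<bar>x :: real\<bar>"
proof -
 obtain t where t: "\<bar>t\<bar> \<le> \<bar>x\<bar>" "exp x = (\<Sum>m<2. x ^ m / fact m) + exp t / fact 2 * x ^ 2"
  using Maclaurin_exp_le[of x 2] by blast
 have "\<bar>exp x - 1 - x\<bar> = exp t / 2 * x\<^sup>2" using t(2) by (simp add: numeral_2_eq_2 abs_mult)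
 also have "... \<le> exp \<bar>x\<bar> * x\<^sup>2"
 proof (rule mult_right_mono)
  have "exp t \<le> exp \<bar>x\<bar>" using t(1) by simp
  thus "exp t / 2 \<le> exp \<bar>x\<bar>" using exp_gt_zero[of t] by linarith
 qed simp
 finally show ?thesis by (simp add: mult.commute)
qed

text \<open>Gaussian averages of bounded functions have first-order Taylor expansions whose constants
 depend only on the bound. The shift is moved onto the Gaussian weight.\<close>
lemma gavg_taylor:
 assumes A: "pos_def_mat k A" and b: "0 \<le> b"
 obtains C where "0 \<le> C" "\<And>h y. bdd_fun k 0 b h \<Longrightarrow> y \<in> rvec k \<Longrightarrow>
  \<exists>c\<in>rvec k. \<forall>v\<in>rvec k. \<bar>c \<bullet> v\<bar> \<le> C * vnorm v \<and>
   \<bar>gavg k A h (y + v) - gavg k A h y - c \<bullet> v\<bar> \<le> C * nsq v"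
proof -
 note Ac = pd_carrier[OF A] and As = pd_sym[OF A]
 interpret prob_space "gauss k A" by (rule prob_space_gauss[OF A])
 obtain \<alpha> where a: "1 \<le> \<alpha>" "\<And>x y. x \<in> rvec k \<Longrightarrow> y \<in> rvec k \<Longrightarrow> \<bar>bilf A x y\<bar> \<le> \<alpha> * vnorm x * vnorm y"
  by (fact bilf_bounded[OF Ac])
 \<comment> \<open>For |v| = t <= 1 the exponent of the shifted weight is at most t Q(u) in absolute
   value, and the weight minus its linear part in v is at most t^2 W(u), with \<open>W\<close>
   defined next.\<close>
 define Q where "Q u = pi * \<alpha> * (2 * vnorm u + 1)" for u :: "real vec"
 have Q0: "0 \<le> Q u" for u using a by (simp add: Q_def nsq_nonneg)
 define W where "W u = (Q u)\<^sup>2 * exp (Q u) + pi * \<alpha>" for u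
 have Wm[measurable]: "W \<in> bmeas k" unfolding W_def Q_def by measurable
 have iW: "integrable (gauss k A) W"
 proof (rule integrable_gauss_exp_norm[OF A Wm])
  fix v :: "real vec"
  have "(Q v)\<^sup>2 \<le> 2 * exp (Q v)" using power_le_exp[OF Q0, of v 2] by simp
  hence "(Q v)\<^sup>2 * exp (Q v) \<le> 2 * exp (Q v) * exp (Q v)" by (intro mult_right_mono) auto
  also have "... = 2 * exp (2 * pi * \<alpha>) * exp (4 * pi * \<alpha> * vnorm v)"
   by (simp add: Q_def mult_exp_exp algebra_simps)
  finally have "(Q v)\<^sup>2 * exp (Q v) \<le> 2 * exp (2 * pi * \<alpha>) * exp (4 * pi * \<alpha> * vnorm v)" .
  moreover have "pi * \<alpha> * 1 \<le> pi * \<alpha> * exp (4 * pi * \<alpha> * vnorm v)"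
   using a by (intro mult_left_mono) (auto simp: nsq_nonneg)
  moreover have "0 \<le> W v" using a by (simp add: W_def)
  ultimately show "\<bar>W v\<bar> \<le> (2 * exp (2 * pi * \<alpha>) + pi * \<alpha>) * exp (4 * pi * \<alpha> * vnorm v)"
   unfolding distrib_right abs_of_nonneg[OF \<open>0 \<le> W v\<close>] unfolding W_def by linarith
 qed
 define E where "E = (\<integral>u. W u \<partial>gauss k A)"
 define R where "R = (\<integral>u. vnorm u ^ 1 \<partial>gauss k A)"
 have E: "0 \<le> E" unfolding E_def using a by (intro integral_nonneg_AE AE_I2) (auto simp: W_def)
 have R: "0 \<le> R" unfolding R_def by (intro integral_nonneg_AE AE_I2) (auto simp: nsq_nonneg)
 \<comment> \<open>The first summand controls the Taylor remainder for |v| <= 1, the second the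
   trivial bound for |v| > 1, and the third the gradient.\<close>
 define C where "C = b * E + b + 2 * pi * \<alpha> * b * R"
 have C: "0 \<le> C" using E R b a by (simp add: C_def)
 show thesis
 proof (rule that[OF C])
  fix h and y :: "real vec" assume h: "bdd_fun k 0 b h" and y: "y \<in> rvec k"
  define g where "g u = h (y + u)" for u
  have gm[measurable]: "g \<in> bmeas k"
   unfolding g_def using h by (intro measurable_gauss_shift[OF _ y]) (simp add: bdd_fun_def)
  have gb: "0 \<le> g u" "g u \<le> b" if "u \<in> rvec k" for u
   using h y that by (auto simp: g_def bdd_fun_def)
  note indm = measurable_leb_index[OF meas_mult_mat_vec[OF Ac measurable_ident]]
  have ii: "integrable (gauss k A) (\<lambda>u. g u * (2 * pi * (A *\<^sub>v u) $ i))" if i: "i < k" for i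
  proof (rule integrable_gauss_exp_norm[OF A])
   have "(\<lambda>u. (A *\<^sub>v u) $ i) \<in> bmeas k" using indm[OF i] by simp
   thus "(\<lambda>u. g u * (2 * pi * (A *\<^sub>v u) $ i)) \<in> bmeas k" by measurable
   fix u assume u: "u \<in> rvec k"
   have "(A *\<^sub>v u) $ i = bilf A (unit_vec k i) u" using u Ac i by (simp add: bilf_def del: index_mult_mat_vec)
   also have "\<bar>...\<bar> \<le> \<alpha> * sqrt (unit_vec k i \<bullet> unit_vec k i) * vnorm u" using u by (intro a) auto
   also have "... \<le> \<alpha> * exp (1 * vnorm u)"
    using power_le_exp[of "vnorm u" 1] a i by (simp add: nsq_nonneg)
   finally have "\<bar>g u\<bar> * \<bar>2 * pi * (A *\<^sub>v u) $ i\<bar> \<le> b * (2 * pi * (\<alpha> * exp (1 * vnorm u)))"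
    using gb[OF u] b by (intro mult_mono) (auto simp: abs_mult)
   thus "\<bar>g u * (2 * pi * (A *\<^sub>v u) $ i)\<bar> \<le> (b * (2 * pi * \<alpha>)) * exp (1 * vnorm u)"
    by (simp add: abs_mult mult_ac)
  qed
  \<comment> \<open>The gradient at y: the derivative of the Gaussian weight with respect to the
    shift, integrated against \<open>g\<close>.\<close>
  define c where "c = vec k (\<lambda>i. \<integral>u. g u * (2 * pi * (A *\<^sub>v u) $ i) \<partial>gauss k A)"
  have c: "c \<in> rvec k" by (simp add: c_def)
  have gsum: "(\<Sum>i<k. g u * (2 * pi * (A *\<^sub>v u) $ i) * v $ i) = g u * (2 * pi * bilf A v u)"
   if "v \<in> rvec k" "u \<in> rvec k" for u v
  proof -
   have "bilf A v u = (\<Sum>i<k. v $ i * (A *\<^sub>v u) $ i)" unfolding bilf_def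
    using that Ac by (intro scalar_prod_eq_sum) simp
   thus ?thesis by (simp only: sum_distrib_left mult_ac)
  qed
  have iz: "integrable (gauss k A) (\<lambda>u. g u * (2 * pi * bilf A v u))" if v: "v \<in> rvec k" for v
  proof -
   have "integrable (gauss k A) (\<lambda>u. \<Sum>i<k. g u * (2 * pi * (A *\<^sub>v u) $ i) * v $ i)"
    by (intro Bochner_Integration.integrable_sum integrable_mult_left ii) simp
   thus ?thesis by (rule Bochner_Integration.integrable_cong[THEN iffD1, OF refl, rotated]) (simp only: gsum[OF v] space_gauss)
  qed
  have cv: "c \<bullet> v = (\<integral>u. g u * (2 * pi * bilf A v u) \<partial>gauss k A)" if v: "v \<in> rvec k" for v
  proof -
   have "c \<bullet> v = (\<Sum>i<k. \<integral>u. g u * (2 * pi * (A *\<^sub>v u) $ i) * v $ i \<partial>gauss k A)"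
    using v by (simp add: scalar_prod_eq_sum[of _ k] c_def del: index_mult_mat_vec)
   also have "... = (\<integral>u. (\<Sum>i<k. g u * (2 * pi * (A *\<^sub>v u) $ i) * v $ i) \<partial>gauss k A)"
    by (intro Bochner_Integration.integral_sum[symmetric] integrable_mult_left ii) simp
   also have "... = (\<integral>u. g u * (2 * pi * bilf A v u) \<partial>gauss k A)"
    by (rule integral_cong_refl) (simp only: gsum[OF v] space_gauss)
   finally show ?thesis .
  qed
  show "\<exists>c\<in>rvec k. \<forall>v\<in>rvec k. \<bar>c \<bullet> v\<bar> \<le> C * vnorm v \<and>
   \<bar>gavg k A h (y + v) - gavg k A h y - c \<bullet> v\<bar> \<le> C * nsq v"
  proof (intro bexI[OF _ c] ballI conjI)
   fix v assume v: "v \<in> rvec k"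
   define t where "t = vnorm v"
   have t: "0 \<le> t" "t\<^sup>2 = nsq v" by (auto simp: t_def nsq_nonneg)
   have "\<bar>c \<bullet> v\<bar> \<le> (\<integral>u. \<bar>g u * (2 * pi * bilf A v u)\<bar> \<partial>gauss k A)"
    unfolding cv[OF v] by (rule integral_abs_bound)
   also have "... \<le> (\<integral>u. (2 * pi * \<alpha> * b * t) * vnorm u ^ 1 \<partial>gauss k A)"
   proof (rule integral_mono)
    show "integrable (gauss k A) (\<lambda>u. \<bar>g u * (2 * pi * bilf A v u)\<bar>)" using iz[OF v] by simp
    show "integrable (gauss k A) (\<lambda>u. (2 * pi * \<alpha> * b * t) * vnorm u ^ 1)"
     by (intro integrable_mult_right integrable_gauss_norm_power[OF A])
    fix u assume "u \<in> space (gauss k A)"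
    hence u: "u \<in> rvec k" by simp
    have "\<bar>g u\<bar> * \<bar>2 * pi * bilf A v u\<bar> \<le> b * (2 * pi * (\<alpha> * t * vnorm u))"
     using gb[OF u] b a(2)[OF v u] by (intro mult_mono) (auto simp: abs_mult t_def)
    thus "\<bar>g u * (2 * pi * bilf A v u)\<bar> \<le> (2 * pi * \<alpha> * b * t) * vnorm u ^ 1"
     by (simp add: abs_mult mult_ac)
   qed
   also have "... = (2 * pi * \<alpha> * b * R) * t" by (simp add: R_def)
   finally have c1: "\<bar>c \<bullet> v\<bar> \<le> (2 * pi * \<alpha> * b * R) * t" .
   also have "... \<le> C * t" unfolding C_def using E b t by (intro mult_right_mono) auto
   finally show "\<bar>c \<bullet> v\<bar> \<le> C * vnorm v" by (simp add: t_def)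
   have H0: "gavg k A h y = (\<integral>u. g u \<partial>gauss k A)" by (simp add: gavg_def g_def)
   have ig: "integrable (gauss k A) g" unfolding g_def by (rule integrable_gauss_bdd_fun[OF A h y])
   show "\<bar>gavg k A h (y + v) - gavg k A h y - c \<bullet> v\<bar> \<le> C * nsq v"
   proof (cases "t \<le> 1")
    case True
    define X where "X u = 2 * pi * bilf A v u - pi * qf A v" for u
    have bm: "(\<lambda>u. bilf A v u) \<in> bmeas k"
    proof (rule measurable_bilf[OF Ac])
     show "(\<lambda>u. v) \<in> leb k \<rightarrow>\<^sub>M leb k" using v by (intro measurable_const) simp
    qed simp
    note [measurable] = bm
    have Xm[measurable]: "X \<in> bmeas k" unfolding X_def by measurable
    have est: "\<bar>exp (X u) - 1 - 2 * pi * bilf A v u\<bar> \<le> t\<^sup>2 * W u" if u: "u \<in> rvec k" for u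
    proof -
     have b1: "\<bar>bilf A v u\<bar> \<le> \<alpha> * t * vnorm u" using a(2)[OF v u] by (simp add: t_def)
     have b2: "\<bar>bilf A v v\<bar> \<le> \<alpha> * t * t" using a(2)[OF v v] by (simp add: t_def)
     also have "... \<le> \<alpha> * t * 1" using a True t by (intro mult_left_mono) auto
     finally have "\<bar>bilf A v v\<bar> \<le> \<alpha> * t" by simp
     hence "\<bar>X u\<bar> \<le> 2 * pi * (\<alpha> * t * vnorm u) + pi * (\<alpha> * t)"
      unfolding X_def using b1 by (intro order_trans[OF abs_triangle_ineq4] add_mono) (auto simp: abs_mult)
     also have "... = t * Q u" by (simp add: Q_def algebra_simps)
     finally have XQ: "\<bar>X u\<bar> \<le> t * Q u" .
     have XQ': "\<bar>X u\<bar> \<le> Q u" using XQ mult_right_mono[OF True Q0[of u]] by simp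
     have "\<bar>exp (X u) - 1 - X u\<bar> \<le> (X u)\<^sup>2 * exp \<bar>X u\<bar>" by (rule exp_sub_linear_le)
     also have "... \<le> (t * Q u)\<^sup>2 * exp (Q u)"
      using XQ XQ' t Q0[of u] by (intro mult_mono) (auto intro!: abs_le_square_iff[THEN iffD1])
     finally have "\<bar>exp (X u) - 1 - X u\<bar> \<le> (t * Q u)\<^sup>2 * exp (Q u)" .
     moreover have "\<bar>X u - 2 * pi * bilf A v u\<bar> \<le> pi * \<alpha> * t\<^sup>2"
      using b2 mult_left_mono[OF b2, of pi] by (simp add: X_def abs_mult power2_eq_square mult_ac)
     ultimately have "\<bar>exp (X u) - 1 - 2 * pi * bilf A v u\<bar> \<le> (t * Q u)\<^sup>2 * exp (Q u) + pi * \<alpha> * t\<^sup>2" by linarith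
     thus ?thesis by (simp add: W_def power_mult_distrib algebra_simps)
    qed
    have iD: "integrable (gauss k A) (\<lambda>u. g u * (exp (X u) - 1 - 2 * pi * bilf A v u))"
    proof (rule Bochner_Integration.integrable_bound)
     show "integrable (gauss k A) (\<lambda>u. b * (t\<^sup>2 * W u))" by (intro integrable_mult_right iW)
     show "(\<lambda>u. g u * (exp (X u) - 1 - 2 * pi * bilf A v u)) \<in> borel_measurable (gauss k A)"
      by measurable
     show "AE u in gauss k A. norm (g u * (exp (X u) - 1 - 2 * pi * bilf A v u)) \<le> norm (b * (t\<^sup>2 * W u))"
     proof (rule AE_I2)
      fix u assume "u \<in> space (gauss k A)"
      hence u: "u \<in> rvec k" by simp
      have "\<bar>g u\<bar> * \<bar>exp (X u) - 1 - 2 * pi * bilf A v u\<bar> \<le> b * (t\<^sup>2 * W u)"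
       using est[OF u] gb[OF u] b by (intro mult_mono) auto
      thus "norm (g u * (exp (X u) - 1 - 2 * pi * bilf A v u)) \<le> norm (b * (t\<^sup>2 * W u))"
       using abs_ge_self[of "b * (t\<^sup>2 * W u)"] unfolding real_norm_def abs_mult[of "g u"] by linarith
     qed
    qed
    have "gavg k A h (y + v) = (\<integral>u. g (v + u) \<partial>gauss k A)"
     unfolding gavg_def g_def using v y
     by (intro integral_cong_refl) (simp add: assoc_add_vec[of _ k])
    also have "... = (\<integral>u. exp (X u) * g u \<partial>gauss k A)"
     unfolding X_def by (rule integral_gauss_shift[OF A v gm])
    also have "... = (\<integral>u. (g u * (exp (X u) - 1 - 2 * pi * bilf A v u) + g u) + g u * (2 * pi * bilf A v u) \<partial>gauss k A)"
     by (rule integral_cong_refl) (simp add: algebra_simps)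
    also have "... = (\<integral>u. g u * (exp (X u) - 1 - 2 * pi * bilf A v u) \<partial>gauss k A) + gavg k A h y + c \<bullet> v"
     unfolding cv[OF v] H0 using iD ig iz[OF v] by simp
    finally have "\<bar>gavg k A h (y + v) - gavg k A h y - c \<bullet> v\<bar> = \<bar>\<integral>u. g u * (exp (X u) - 1 - 2 * pi * bilf A v u) \<partial>gauss k A\<bar>"
     by simp
    also have "... \<le> (\<integral>u. \<bar>g u * (exp (X u) - 1 - 2 * pi * bilf A v u)\<bar> \<partial>gauss k A)" by (rule integral_abs_bound)
    also have "... \<le> (\<integral>u. b * (t\<^sup>2 * W u) \<partial>gauss k A)"
    proof (rule integral_mono)
     show "integrable (gauss k A) (\<lambda>u. b * (t\<^sup>2 * W u))" by (intro integrable_mult_right iW)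
     fix u assume "u \<in> space (gauss k A)"
     hence u: "u \<in> rvec k" by simp
     have "\<bar>g u\<bar> * \<bar>exp (X u) - 1 - 2 * pi * bilf A v u\<bar> \<le> b * (t\<^sup>2 * W u)"
      using est[OF u] gb[OF u] b by (intro mult_mono) auto
     thus "\<bar>g u * (exp (X u) - 1 - 2 * pi * bilf A v u)\<bar> \<le> b * (t\<^sup>2 * W u)" by (simp add: abs_mult)
    qed (use iD in simp)
    also have "... = b * E * t\<^sup>2" by (simp add: E_def)
    also have "... \<le> C * t\<^sup>2" unfolding C_def using b R a by (intro mult_right_mono) auto
    finally show ?thesis by (simp add: t)
   next
    \<comment> \<open>For |v| > 1 both averages lie in [0, b], and b as well as the linear term is
      absorbed by a multiple of |v|^2.\<close>
    case False
    have yv: "y + v \<in> rvec k" using y v by simp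
    have "\<bar>gavg k A h (y + v) - gavg k A h y\<bar> \<le> b"
     using gavg_bounds[OF A h y] gavg_bounds[OF A h yv] by linarith
    moreover have "1 * 1 \<le> t * t" "1 * t \<le> t * t" using False by (intro mult_mono; simp)+
    hence "b * 1 \<le> b * t\<^sup>2" "(2 * pi * \<alpha> * b * R) * t \<le> (2 * pi * \<alpha> * b * R) * t\<^sup>2"
     using b R a by (intro mult_left_mono; simp add: power2_eq_square)+
    ultimately have "\<bar>gavg k A h (y + v) - gavg k A h y - c \<bullet> v\<bar> \<le> b * t\<^sup>2 + (2 * pi * \<alpha> * b * R) * t\<^sup>2"
     using c1 by linarith
    also have "... \<le> C * t\<^sup>2" using E b by (simp add: C_def algebra_simps)
    finally show ?thesis by (simp add: t)
   qed
  qed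
 qed
qed

section \<open>The Brascamp--Lieb inequality for Gaussian vectors\<close>

text \<open>Without the absolute value, right side minus left side has derivative x^3 / (1 + x),
  hence its minimum at 0.\<close>

lemma ln_one_plus_le_cubic:
 assumes "-1 < (x :: real)"
 shows "ln (1 + x) \<le> x - x\<^sup>2 / 2 + \<bar>x\<bar> ^ 3 / 3"
proof -
 define f where "f x = x - x\<^sup>2 / 2 + x ^ 3 / 3 - ln (1 + x)" for x :: real
 have d: "(f has_real_derivative x ^ 3 / (1 + x)) (at x)" if "-1 < x" for x
  unfolding f_def using that
  by (auto intro!: derivative_eq_intros simp: field_simps power2_eq_square power3_eq_cube)
 have "f 0 \<le> f x"
 proof (cases "0 \<le> x")
  case True
  show ?thesis
  proof (rule DERIV_nonneg_imp_nondecreasing[OF True])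
   fix y assume y: "0 \<le> y" "y \<le> x"
   hence "0 \<le> y ^ 3 / (1 + y)" by simp
   thus "\<exists>D. DERIV f y :> D \<and> 0 \<le> D" using d[of y] y by force
  qed
 next
  case False
  show ?thesis
  proof (rule DERIV_nonpos_imp_nonincreasing[where f = f and a = x and b = 0])
   show "x \<le> 0" using False by simp
   fix y assume y: "x \<le> y" "y \<le> 0"
   have "y ^ 3 / (1 + y) \<le> 0" using y assms by (intro divide_nonpos_pos) (auto simp: power3_eq_cube mult_le_0_iff zero_le_mult_iff)
   thus "\<exists>D. DERIV f y :> D \<and> D \<le> 0" using d[of y] y assms by force
  qed
 qed
 hence "ln (1 + x) \<le> x - x\<^sup>2 / 2 + x ^ 3 / 3" by (simp add: f_def)
 also have "x ^ 3 \<le> \<bar>x\<bar> ^ 3" by (metis abs_ge_self power_abs)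
 finally show ?thesis by simp
qed

lemma exp_le_quadratic: "exp x \<le> 1 + x + x\<^sup>2 / 2 + \<bar>x\<bar> ^ 3 * exp \<bar>x :: real\<bar>"
proof -
 obtain t where t: "\<bar>t\<bar> \<le> \<bar>x\<bar>" "exp x = (\<Sum>m<3. x ^ m / fact m) + exp t / fact 3 * x ^ 3"
  using Maclaurin_exp_le[of x 3] by blast
 have "exp t / fact 3 * x ^ 3 \<le> \<bar>exp t / fact 3 * x ^ 3\<bar>" by (rule abs_ge_self)
 also have "... = exp t / 6 * \<bar>x\<bar> ^ 3" by (simp add: abs_mult power_abs fact_numeral)
 also have "... \<le> exp \<bar>x\<bar> * \<bar>x\<bar> ^ 3"
 proof (rule mult_right_mono)
  have "exp t \<le> exp \<bar>x\<bar>" using t(1) by simp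
  thus "exp t / 6 \<le> exp \<bar>x\<bar>" using exp_gt_zero[of t] by linarith
 qed simp
 finally show ?thesis using t(2) by (simp add: numeral_3_eq_3 power2_eq_square mult.commute)
qed

text \<open>Second order expansion of the exponential of the sum of the p_j ln (1 + rho_j). Its two
  quadratic terms, the negative one with the squares and the positive one with the squared sum, are
  those that the covariance inequality compares. The a priori bound \<open>B\<close> keeps the
  exponential in the remainder bounded, so that the error is cubic in x even for large x.\<close>

lemma prod_powr_upper:
 fixes p :: "nat \<Rightarrow> real"
 assumes "\<forall>j<m. 0 \<le> p j" and B: "0 \<le> B"
 obtains C where "0 \<le> C" "\<And>\<rho> x. (\<And>j. j < m \<Longrightarrow> -1 < \<rho> j) \<Longrightarrow> (\<And>j. j < m \<Longrightarrow> \<bar>\<rho> j\<bar> \<le> B) \<Longrightarrow> (\<And>j. j < m \<Longrightarrow> \<bar>\<rho> j\<bar> \<le> x) \<Longrightarrow> 0 \<le> x \<Longrightarrow>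
  (\<Prod>j<m. (1 + \<rho> j) powr p j) \<le> 1 + (\<Sum>j<m. p j * \<rho> j) - (\<Sum>j<m. p j * (\<rho> j)\<^sup>2) / 2 + (\<Sum>j<m. p j * \<rho> j)\<^sup>2 / 2 + C * x ^ 3"
proof -
 have p: "0 \<le> p j" if "j < m" for j using assms(1) that by blast
 define P where "P = (\<Sum>j<m. p j)"
 have P: "0 \<le> P" unfolding P_def by (intro sum_nonneg) (use p in auto)
 \<comment> \<open>\<open>c1\<close> and \<open>c2\<close> control the nonlinear part E of the
   exponent, by c1 x^2, c2 x and c2 B; \<open>c3\<close> and \<open>c4\<close> control the whole
   exponent X, by c3 x and c4.\<close>
 define c1 where "c1 = P / 2 + P * B / 3"
 define c2 where "c2 = P * B / 2 + P * B\<^sup>2 / 3"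
 define c3 where "c3 = P + c2"
 define c4 where "c4 = P * B + c2 * B"
 have c: "0 \<le> c1" "0 \<le> c2" "0 \<le> c3" using P B by (auto simp: c1_def c2_def c3_def)
 define C where "C = P / 3 + P * c1 + c1 * c2 / 2 + c3 ^ 3 * exp c4"
 have C: "0 \<le> C" using P c by (simp add: C_def)
 show thesis
 proof (rule that[OF C])
  fix \<rho> :: "nat \<Rightarrow> real" and x
  assume r1: "\<And>j. j < m \<Longrightarrow> -1 < \<rho> j" and rB: "\<And>j. j < m \<Longrightarrow> \<bar>\<rho> j\<bar> \<le> B" and rx: "\<And>j. j < m \<Longrightarrow> \<bar>\<rho> j\<bar> \<le> x" and x: "0 \<le> x"
  define S where "S = (\<Sum>j<m. p j * \<rho> j)"
  define T where "T = (\<Sum>j<m. p j * (\<rho> j)\<^sup>2)"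
  define K where "K = (\<Sum>j<m. p j * \<bar>\<rho> j\<bar> ^ 3)"
  have wsum: "(\<Sum>j<m. p j * f j) \<le> P * y" if "\<And>j. j < m \<Longrightarrow> f j \<le> y" for f y
   unfolding P_def sum_distrib_right using that p by (intro sum_mono mult_left_mono) auto
  have S: "\<bar>S\<bar> \<le> P * z" if "\<And>j. j < m \<Longrightarrow> \<bar>\<rho> j\<bar> \<le> z" for z
  proof -
   have "\<bar>S\<bar> \<le> (\<Sum>j<m. p j * \<bar>\<rho> j\<bar>)" unfolding S_def
    by (rule order_trans[OF sum_abs]) (use p in \<open>auto simp: abs_mult intro!: sum_mono\<close>)
   also have "... \<le> P * z" by (rule wsum) (rule that)
   finally show ?thesis .
  qed
  have sq: "(\<rho> j)\<^sup>2 \<le> z * z'" if "j < m" "\<bar>\<rho> j\<bar> \<le> z" "\<bar>\<rho> j\<bar> \<le> z'" for j z z'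
   using mult_mono[OF that(2,3)] that(2) by (simp add: power2_eq_square)
  have cu: "\<bar>\<rho> j\<bar> ^ 3 \<le> z * z' * z''" if "j < m" "\<bar>\<rho> j\<bar> \<le> z" "\<bar>\<rho> j\<bar> \<le> z'" "\<bar>\<rho> j\<bar> \<le> z''" for j z z' z''
  proof -
   have "\<bar>\<rho> j\<bar> * \<bar>\<rho> j\<bar> * \<bar>\<rho> j\<bar> \<le> z * z' * z''"
    using that by (intro mult_mono) auto
   thus ?thesis by (simp add: power3_eq_cube)
  qed
  have T: "0 \<le> T" "T \<le> P * (x * x)" "T \<le> P * (B * x)" "T \<le> P * (B * B)"
   unfolding T_def using p rB rx by (auto intro!: sum_nonneg wsum sq)
  have K: "0 \<le> K" "K \<le> P * (x * x * x)" "K \<le> P * (B * x * x)" "K \<le> P * (B * B * x)" "K \<le> P * (B * B * B)"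
   unfolding K_def using p rB rx by (auto intro!: sum_nonneg wsum cu)
  define E where "E = K / 3 - T / 2"
  have "\<bar>E\<bar> \<le> K / 3 + T / 2" using T(1) K(1) by (simp add: E_def abs_if)
  hence E: "\<bar>E\<bar> \<le> c1 * (x * x)" "\<bar>E\<bar> \<le> c2 * x" "\<bar>E\<bar> \<le> c2 * B"
   using T K by (auto simp: c1_def c2_def algebra_simps power2_eq_square)
  define X where "X = S + E"
  have X1: "\<bar>X\<bar> \<le> c3 * x" using S[OF rx] E(2) unfolding X_def c3_def distrib_right by linarith
  have X2: "\<bar>X\<bar> \<le> c4" using S[OF rB] E(3) unfolding X_def c4_def by linarith
  have "(\<Prod>j<m. (1 + \<rho> j) powr p j) = exp (\<Sum>j<m. p j * ln (1 + \<rho> j))"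
  proof -
   have "1 + \<rho> j \<noteq> 0" if "j < m" for j using r1[OF that] by linarith
   thus ?thesis by (subst exp_sum) (auto simp: powr_def intro!: prod.cong)
  qed
  also have "... \<le> exp X"
  proof -
   have "(\<Sum>j<m. p j * ln (1 + \<rho> j)) \<le> (\<Sum>j<m. p j * (\<rho> j - (\<rho> j)\<^sup>2 / 2 + \<bar>\<rho> j\<bar> ^ 3 / 3))"
    using p r1 by (intro sum_mono mult_left_mono ln_one_plus_le_cubic) auto
   also have "... = X"
    by (simp add: X_def E_def S_def T_def K_def distrib_left right_diff_distrib sum.distrib sum_subtractf sum_divide_distrib)
   finally show ?thesis by simp
  qed
  also have "exp X \<le> 1 + X + X\<^sup>2 / 2 + \<bar>X\<bar> ^ 3 * exp \<bar>X\<bar>" by (rule exp_le_quadratic)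
  also have "\<bar>X\<bar> ^ 3 * exp \<bar>X\<bar> \<le> (c3 * x) ^ 3 * exp c4"
   using X1 X2 c x by (intro mult_mono power_mono) auto
  also have "X\<^sup>2 \<le> S\<^sup>2 + 2 * (P * x * (c1 * (x * x))) + c1 * (x * x) * (c2 * x)"
  proof -
   have "S * E \<le> \<bar>S\<bar> * \<bar>E\<bar>" by (metis abs_ge_self abs_mult)
   also have "... \<le> P * x * (c1 * (x * x))" using S[OF rx] E(1) P x by (intro mult_mono) auto
   finally have "S * E \<le> P * x * (c1 * (x * x))" .
   moreover have "E * E \<le> \<bar>E\<bar> * \<bar>E\<bar>" by simp
   moreover have "\<bar>E\<bar> * \<bar>E\<bar> \<le> c1 * (x * x) * (c2 * x)" using E c x by (intro mult_mono) auto
   ultimately show ?thesis by (simp add: X_def power2_eq_square algebra_simps)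
  qed
  finally have "(\<Prod>j<m. (1 + \<rho> j) powr p j)
   \<le> 1 + X + (S\<^sup>2 + 2 * (P * x * (c1 * (x * x))) + c1 * (x * x) * (c2 * x)) / 2 + (c3 * x) ^ 3 * exp c4" by simp
  also have "... \<le> 1 + S - T / 2 + S\<^sup>2 / 2 + C * x ^ 3"
   using K(2) by (simp add: X_def E_def C_def power3_eq_cube field_simps)
  finally show "(\<Prod>j<m. (1 + \<rho> j) powr p j) \<le> 1 + (\<Sum>j<m. p j * \<rho> j) - (\<Sum>j<m. p j * (\<rho> j)\<^sup>2) / 2 + (\<Sum>j<m. p j * \<rho> j)\<^sup>2 / 2 + C * x ^ 3"
   by (simp add: S_def T_def)
 qed
qed

text \<open>In this direction a first order bound suffices: it is applied to mean increments, whose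
  squares are of fourth order in the step size. It follows from ln (1 + e) >= e / (1 + e) and exp y
  >= 1 + y.\<close>

lemma prod_powr_lower:
 fixes p :: "nat \<Rightarrow> real"
 assumes p: "\<And>j. j < m \<Longrightarrow> 0 \<le> p j" and r: "0 < r" "\<And>j. j < m \<Longrightarrow> r \<le> 1 + \<epsilon> j"
 shows "1 + (\<Sum>j<m. p j * \<epsilon> j) - (\<Sum>j<m. p j * (\<epsilon> j)\<^sup>2) / r \<le> (\<Prod>j<m. (1 + \<epsilon> j) powr p j)"
proof -
 have ln: "e - e\<^sup>2 / r \<le> ln (1 + e)" if "r \<le> 1 + e" for e
 proof -
  have pos: "0 < 1 + e" using that r by linarith
  have "e\<^sup>2 / (1 + e) \<le> e\<^sup>2 / r" using that r by (intro divide_left_mono) auto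
  moreover have "1 - 1 / (1 + e) = e - e\<^sup>2 / (1 + e)" using pos by (simp add: field_simps power2_eq_square)
  moreover have "1 - 1 / (1 + e) \<le> ln (1 + e)"
   using ln_le_minus_one[of "1 / (1 + e)"] pos by (simp add: ln_div)
  ultimately show ?thesis by linarith
 qed
 have "1 + (\<Sum>j<m. p j * \<epsilon> j) - (\<Sum>j<m. p j * (\<epsilon> j)\<^sup>2) / r = 1 + (\<Sum>j<m. p j * (\<epsilon> j - (\<epsilon> j)\<^sup>2 / r))"
  by (simp add: right_diff_distrib sum_subtractf sum_divide_distrib)
 also have "... \<le> 1 + (\<Sum>j<m. p j * ln (1 + \<epsilon> j))"
  using p r by (intro add_left_mono sum_mono mult_left_mono ln) auto
 also have "... \<le> exp (\<Sum>j<m. p j * ln (1 + \<epsilon> j))" by (rule exp_ge_add_one_self)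
 also have "... = (\<Prod>j<m. (1 + \<epsilon> j) powr p j)"
 proof -
  have "1 + \<epsilon> j \<noteq> 0" if "j < m" for j using r(1) r(2)[OF that] by linarith
  thus ?thesis by (subst exp_sum) (auto simp: powr_def intro!: prod.cong)
 qed
 finally show ?thesis .
qed

section \<open>Moments and the covariance inequality\<close>

lemma inv_mat_of_linear:
 assumes A: "pos_def_mat d A" and M: "pos_def_mat k M" and L: "L \<in> rmat d k"
  and AL: "A * (L * inv_mat M * L\<^sup>T) = 1\<^sub>m d" and c: "c \<in> rvec d"
 shows "qf (inv_mat A) c = qf (inv_mat M) (L\<^sup>T *\<^sub>v c)"
proof -
 have "inv_mat A = L * inv_mat M * L\<^sup>T"
  by (rule inv_mat_eqI[OF pd_carrier[OF A] _ AL]) (use L pd_inv(1)[OF M] in simp)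
 thus ?thesis using bilf_congruence'[OF L pd_inv(1)[OF M] c c] by simp
qed

text \<open>G and -G have the same distribution.\<close>

lemma gauss_first_moment:
 assumes M: "pos_def_mat k M" and a: "a \<in> rvec k"
 shows "(\<integral>G. a \<bullet> G \<partial>gauss k M) = 0"
proof -
 let ?L = "(-1) \<cdot>\<^sub>m 1\<^sub>m k :: real mat"
 note c = pd_carrier[OF M] pd_inv[OF M]
 have am: "(\<lambda>G. a \<bullet> G) \<in> bmeas k"
  using a by (intro measurable_scalar_prod[of _ _ k] measurable_const) auto
 have Lv: "?L *\<^sub>v G = (-1) \<cdot>\<^sub>v G" if "G \<in> rvec k" for G
  using that by (subst smult_mat_mult_vec[of _ k k]) auto
 have "?L * inv_mat M * ?L\<^sup>T = inv_mat M"
  using c by (simp add: transpose_smult_mat mult_smult_assoc_mat[of _ k k _ k] mult_smult_distrib[of _ k k _ k] smult_smult_mat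
    left_mult_one_mat[of _ k k] right_mult_one_mat[of _ k k]) (auto intro!: eq_matI)
 hence "distr (gauss k M) (leb k) (\<lambda>z. ?L *\<^sub>v z) = gauss k M"
  using c by (intro distr_gauss_linear[OF M M]) auto
 hence "(\<integral>G. a \<bullet> G \<partial>gauss k M) = (\<integral>G. a \<bullet> G \<partial>distr (gauss k M) (leb k) (\<lambda>z. ?L *\<^sub>v z))" by simp
 also have "... = (\<integral>G. a \<bullet> (?L *\<^sub>v G) \<partial>gauss k M)"
 proof (rule integral_distr[OF _ am])
  show "(\<lambda>z. ?L *\<^sub>v z) \<in> gauss k M \<rightarrow>\<^sub>M leb k"
   by (rule meas_mult_mat_vec[of _ k k]) (auto cong: measurable_cong_sets)
 qed
 also have "... = (\<integral>G. - (a \<bullet> G) \<partial>gauss k M)"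
  using a by (intro integral_cong_refl) (simp add: Lv)
 finally show ?thesis by simp
qed

text \<open>The second moment of the one-dimensional Gaussian with density exp(-pi t^2); it is a
  common factor of both sides of the covariance inequality.\<close>

definition gvar :: real where "gvar = (\<integral>v. (v $ 0)\<^sup>2 \<partial>gauss 1 (1\<^sub>m 1))"

lemma gvar_nonneg: "0 \<le> gvar"
 unfolding gvar_def by (intro integral_nonneg_AE AE_I2) auto

text \<open>Reduction to dimension one: q is such that the row vector L = a / sqrt q has L M^(-1)
  L^T = 1, so L G has the standard density that defines \<open>gvar\<close>.\<close>

lemma gauss_second_moment:
 assumes M: "pos_def_mat k M" and a: "a \<in> rvec k"
 shows "(\<integral>G. (a \<bullet> G)\<^sup>2 \<partial>gauss k M) = gvar * qf (inv_mat M) a"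
proof (cases "a = 0\<^sub>v k")
 case True
 have "(\<integral>G. (a \<bullet> G)\<^sup>2 \<partial>gauss k M) = (\<integral>G. 0 \<partial>gauss k M)"
  by (rule integral_cong_refl) (simp add: True)
 thus ?thesis using True bilf_zero_left[OF pd_inv(1)[OF M]] by simp
next
 case False
 note I = pd_inv[OF M]
 define q where "q = qf (inv_mat M) a"
 have q: "0 < q" unfolding q_def using pd_pos[OF I(4) a False] .
 define L where "L = mat 1 k (\<lambda>(i, j). a $ j / sqrt q)"
 have L: "L \<in> rmat 1 k" by (simp add: L_def)
 have LG: "(L *\<^sub>v G) $ 0 = (a \<bullet> G) / sqrt q" if G: "G \<in> rvec k" for G
  using a G by (subst mult_vec_index[OF L G]) (auto simp: L_def scalar_prod_eq_sum[OF G] sum_divide_distrib)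
 have LT: "L\<^sup>T *\<^sub>v unit_vec 1 0 = (1 / sqrt q) \<cdot>\<^sub>v a"
 proof (rule eq_vecI)
  fix i assume "i < dim_vec ((1 / sqrt q) \<cdot>\<^sub>v a)"
  hence i: "i < k" using a by simp
  show "(L\<^sup>T *\<^sub>v unit_vec 1 0) $ i = ((1 / sqrt q) \<cdot>\<^sub>v a) $ i"
   using a i by (subst mult_vec_index[of _ k 1]) (auto simp: L_def)
 qed (use a L in auto)
 have C: "L * inv_mat M * L\<^sup>T \<in> rmat 1 1" using L I by simp
 have "L * inv_mat M * L\<^sup>T = 1\<^sub>m 1"
 proof (rule eq_matI)
  fix i j assume "i < dim_row (1\<^sub>m 1 :: real mat)" "j < dim_col (1\<^sub>m 1 :: real mat)"
  hence ij: "i = 0" "j = 0" by auto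
  have "(L * inv_mat M * L\<^sup>T) $$ (0, 0) = qf (L * inv_mat M * L\<^sup>T) (unit_vec 1 0)"
   by (rule bilf_unit[OF C, symmetric]) auto
  also have "... = qf (inv_mat M) ((1 / sqrt q) \<cdot>\<^sub>v a)"
   using bilf_congruence'[OF L I(1), of "unit_vec 1 0" "unit_vec 1 0"] unfolding LT by simp
  also have "... = 1" using q a
   by (simp add: bilf_smult_left[OF I(1)] bilf_smult_right[OF I(1)] q_def[symmetric])
  finally show "(L * inv_mat M * L\<^sup>T) $$ (i, j) = 1\<^sub>m 1 $$ (i, j)" using ij by simp
 qed (use C in auto)
 hence D: "distr (gauss k M) (leb 1) (\<lambda>z. L *\<^sub>v z) = gauss 1 (1\<^sub>m 1)"
  by (intro distr_gauss_linear[OF M pos_def_one L]) (simp add: left_mult_one_mat[of _ 1 1])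
 have vm: "(\<lambda>v. (v $ 0)\<^sup>2) \<in> bmeas 1"
  using measurable_vec_index[of 0 1] by measurable
 have "gvar = (\<integral>G. ((L *\<^sub>v G) $ 0)\<^sup>2 \<partial>gauss k M)"
  unfolding gvar_def D[symmetric]
 proof (rule integral_distr[OF _ vm])
  show "(\<lambda>z. L *\<^sub>v z) \<in> gauss k M \<rightarrow>\<^sub>M leb 1"
   by (rule meas_mult_mat_vec[OF L]) (auto cong: measurable_cong_sets)
 qed
 also have "... = (\<integral>G. (a \<bullet> G)\<^sup>2 / q \<partial>gauss k M)"
  by (intro integral_cong_refl) (use q in \<open>simp only: LG space_gauss power_divide real_sqrt_pow2 less_imp_le\<close>)
 also have "... = (\<integral>G. (a \<bullet> G)\<^sup>2 \<partial>gauss k M) / q" by simp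
 finally show ?thesis using q by (simp add: q_def[symmetric] field_simps)
qed

text \<open>For a Gaussian vector G with matrix \<open>M\<close>, condition \<open>AL\<close> makes
  L_j G Gaussian with matrix A_j. Condition \<open>form\<close> is what the covariance inequality is
  derived from; in the application \<open>M\<close> exceeds the sum by the kernel Q.\<close>

locale gaussian_data =
 fixes K m :: nat and d :: "nat \<Rightarrow> nat" and p :: "nat \<Rightarrow> real" and L A :: "nat \<Rightarrow> real mat" and M :: "real mat"
 assumes M: "pos_def_mat K M" and A: "\<And>j. j < m \<Longrightarrow> pos_def_mat (d j) (A j)"
  and L: "\<And>j. j < m \<Longrightarrow> L j \<in> rmat (d j) K"
  and AL: "\<And>j. j < m \<Longrightarrow> A j * (L j * inv_mat M * (L j)\<^sup>T) = 1\<^sub>m (d j)"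
  and p: "\<And>j. j < m \<Longrightarrow> 0 \<le> p j"
  and form: "\<And>z. z \<in> rvec K \<Longrightarrow> (\<Sum>j<m. p j * qf (A j) (L j *\<^sub>v z)) \<le> qf M z"
begin

text \<open>The infinitesimal form of the Brascamp--Lieb inequality, dual to \<open>form\<close>.
  Let a be the weighted sum of the L_j^T c_j and w = M^(-1) a, the maximiser in the variational
  formula for M. Young's inequality for each A_j bounds 2 (c_j . L_j w) by the dual form at c_j plus
  the form at L_j w, and \<open>form\<close> bounds the weighted sum of the latter by <Mw, w> = a .
  w.\<close>

lemma covariance_le:
 assumes c: "\<And>j. j < m \<Longrightarrow> c j \<in> rvec (d j)"
 shows "(\<integral>G. (\<Sum>j<m. p j * (c j \<bullet> (L j *\<^sub>v G)))\<^sup>2 \<partial>gauss K M) \<le> (\<Sum>j<m. p j * (\<integral>G. (c j \<bullet> (L j *\<^sub>v G))\<^sup>2 \<partial>gauss K M))"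
proof -
 note I = pd_inv[OF M]
 define a where "a = vec K (\<lambda>i. \<Sum>j<m. p j * ((L j)\<^sup>T *\<^sub>v c j) $ i)"
 have a: "a \<in> rvec K" by (simp add: a_def)
 have LT: "(L j)\<^sup>T *\<^sub>v c j \<in> rvec K" if "j < m" for j using L[OF that] c[OF that] by simp
 have cL: "c j \<bullet> (L j *\<^sub>v G) = ((L j)\<^sup>T *\<^sub>v c j) \<bullet> G" if "j < m" "G \<in> rvec K" for j G
  using transpose_vec_mult_scalar[OF L[OF that(1)] that(2) c[OF that(1)]] by simp
 have aG: "(\<Sum>j<m. p j * (c j \<bullet> (L j *\<^sub>v G))) = a \<bullet> G" if G: "G \<in> rvec K" for G
 proof -
  have "(\<Sum>j<m. p j * (c j \<bullet> (L j *\<^sub>v G))) = (\<Sum>j<m. \<Sum>i<K. p j * ((L j)\<^sup>T *\<^sub>v c j) $ i * G $ i)"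
   using cL[OF _ G] by (intro sum.cong refl) (simp add: scalar_prod_eq_sum[OF G] sum_distrib_left mult.assoc)
  also have "... = a \<bullet> G"
   unfolding scalar_prod_eq_sum[OF G] by (subst sum.swap) (auto simp: a_def sum_distrib_right intro!: sum.cong)
  finally show ?thesis .
 qed
 define w where "w = inv_mat M *\<^sub>v a"
 have w: "w \<in> rvec K" using I a by (simp add: w_def)
 have Mw: "M *\<^sub>v w = a" unfolding w_def by (rule mult_right_inv_vec[OF pd_carrier[OF M] I(1,2) a])
 have aw: "a \<bullet> w = qf (inv_mat M) a" by (simp add: bilf_def w_def)
 have MM: "qf M w = a \<bullet> w" unfolding bilf_def Mw by (rule comm_scalar_prod[OF w a])
 have "2 * (a \<bullet> w) = (\<Sum>j<m. p j * (2 * (c j \<bullet> (L j *\<^sub>v w))))"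
  unfolding aG[OF w, symmetric] by (simp add: sum_distrib_left mult_ac)
 also have "... \<le> (\<Sum>j<m. p j * (qf (inv_mat (A j)) (c j) + qf (A j) (L j *\<^sub>v w)))"
 proof (intro sum_mono mult_left_mono)
  fix j assume "j \<in> {..<m}"
  hence j: "j < m" by simp
  have "L j *\<^sub>v w \<in> rvec (d j)" using L[OF j] w by simp
  from bilf_inv_variational(1)[OF A[OF j] c[OF j] this]
  show "2 * (c j \<bullet> (L j *\<^sub>v w)) \<le> qf (inv_mat (A j)) (c j) + qf (A j) (L j *\<^sub>v w)" by simp
 qed (use p in auto)
 also have "... = (\<Sum>j<m. p j * qf (inv_mat (A j)) (c j)) + (\<Sum>j<m. p j * qf (A j) (L j *\<^sub>v w))"
  by (simp add: distrib_left sum.distrib)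
 also have "... \<le> (\<Sum>j<m. p j * qf (inv_mat (A j)) (c j)) + a \<bullet> w"
  using form[OF w] MM by simp
 finally have main: "qf (inv_mat M) a \<le> (\<Sum>j<m. p j * qf (inv_mat (A j)) (c j))" using aw by simp
 have "(\<integral>G. (\<Sum>j<m. p j * (c j \<bullet> (L j *\<^sub>v G)))\<^sup>2 \<partial>gauss K M) = (\<integral>G. (a \<bullet> G)\<^sup>2 \<partial>gauss K M)"
  by (intro integral_cong_refl) (simp add: aG)
 also have "... = gvar * qf (inv_mat M) a" by (rule gauss_second_moment[OF M a])
 also have "... \<le> gvar * (\<Sum>j<m. p j * qf (inv_mat (A j)) (c j))"
  by (rule mult_left_mono[OF main gvar_nonneg])
 also have "... = (\<Sum>j<m. p j * (gvar * qf (inv_mat (A j)) (c j)))"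
  by (simp add: sum_distrib_left mult_ac)
 also have "... = (\<Sum>j<m. p j * (\<integral>G. (c j \<bullet> (L j *\<^sub>v G))\<^sup>2 \<partial>gauss K M))"
 proof (intro sum.cong refl arg_cong[of _ _ "\<lambda>x. _ * x"])
  fix j assume "j \<in> {..<m}"
  hence j: "j < m" by simp
  have "gvar * qf (inv_mat (A j)) (c j) = (\<integral>G. (((L j)\<^sup>T *\<^sub>v c j) \<bullet> G)\<^sup>2 \<partial>gauss K M)"
   unfolding inv_mat_of_linear[OF A[OF j] M L[OF j] AL[OF j] c[OF j]] by (rule gauss_second_moment[OF M LT[OF j], symmetric])
  also have "... = (\<integral>G. (c j \<bullet> (L j *\<^sub>v G))\<^sup>2 \<partial>gauss K M)"
   by (intro integral_cong_refl) (simp add: cL[OF j])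
  finally show "gvar * qf (inv_mat (A j)) (c j) = (\<integral>G. (c j \<bullet> (L j *\<^sub>v G))\<^sup>2 \<partial>gauss K M)" .
 qed
 finally show ?thesis .
qed

end

section \<open>One time step\<close>

lemma integrable_gauss_norm_power_bound:
 assumes M: "pos_def_mat k M" and f: "f \<in> bmeas k"
  and le: "\<And>G. G \<in> rvec k \<Longrightarrow> \<bar>f G\<bar> \<le> C * vnorm G ^ n"
 shows "integrable (gauss k M) (f :: _ \<Rightarrow> real)"
proof (rule Bochner_Integration.integrable_bound)
 show "integrable (gauss k M) (\<lambda>G. C * vnorm G ^ n)"
  by (intro integrable_mult_right integrable_gauss_norm_power[OF M])
 show "f \<in> borel_measurable (gauss k M)" using f by (simp cong: measurable_cong_sets)
 show "AE G in gauss k M. norm (f G) \<le> norm (C * vnorm G ^ n)"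
  using le by (intro AE_I2) (auto intro: order_trans[OF _ abs_ge_self])
qed

context gaussian_data
begin

lemma measurable_L: "j < m \<Longrightarrow> (\<lambda>G. L j *\<^sub>v G) \<in> gauss K M \<rightarrow>\<^sub>M leb (d j)"
 by (rule meas_mult_mat_vec[OF L]) (auto cong: measurable_cong_sets)

lemma measurable_prod_powr:
 assumes "\<And>j. j < m \<Longrightarrow> g j \<in> bmeas (d j)"
  and "\<And>j. j < m \<Longrightarrow> F j \<in> N \<rightarrow>\<^sub>M leb (d j)"
 shows "(\<lambda>G. \<Prod>j<m. g j (F j G) powr p j) \<in> borel_measurable N"
proof (rule borel_measurable_prod)
 fix j assume "j \<in> {..<m}"
 hence "(\<lambda>G. g j (F j G)) \<in> borel_measurable N"
  using measurable_compose[OF assms(2) assms(1)] by simp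
 thus "(\<lambda>G. g j (F j G) powr p j) \<in> borel_measurable N" by measurable
qed

lemma prod_powr_bounds:
 assumes "0 < a" "\<And>j. j < m \<Longrightarrow> a \<le> x j" "\<And>j. j < m \<Longrightarrow> x j \<le> b"
 shows "(\<Prod>j<m. a powr p j) \<le> (\<Prod>j<m. x j powr p j)" "(\<Prod>j<m. x j powr p j) \<le> (\<Prod>j<m. b powr p j)"
proof -
 show "(\<Prod>j<m. a powr p j) \<le> (\<Prod>j<m. x j powr p j)"
  using assms p by (intro prod_mono) (auto intro!: powr_mono2)
 have "0 \<le> x j" if "j < m" for j using assms(1) assms(2)[OF that] by linarith
 thus "(\<Prod>j<m. x j powr p j) \<le> (\<Prod>j<m. b powr p j)"
  using assms p by (intro prod_mono) (auto intro!: powr_mono2)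
qed

text \<open>A step of time h^2. Relative to the values at the base points y_j, the increments are
  rho_j = h l_j + O(h^2) with l_j linear in G. The first order terms of the expansion integrate to
  the mean increments, the second order terms are nonpositive in the mean by
  \<open>covariance_le\<close>, and the rest is O(h^3), uniformly over functions with the same
  bounds a, b and the same Taylor constant C.\<close>

lemma one_step:
 assumes ab: "0 < a" "a \<le> b" and C: "0 \<le> C"
 obtains D where "0 \<le> D" "\<And>h g y c. 0 < h \<Longrightarrow> h \<le> 1 \<Longrightarrow>
  (\<And>j. j < m \<Longrightarrow> y j \<in> rvec (d j)) \<Longrightarrow> (\<And>j. j < m \<Longrightarrow> bdd_fun (d j) a b (g j)) \<Longrightarrow> (\<And>j. j < m \<Longrightarrow> c j \<in> rvec (d j)) \<Longrightarrow>
  (\<And>j v. j < m \<Longrightarrow> v \<in> rvec (d j) \<Longrightarrow> \<bar>c j \<bullet> v\<bar> \<le> C * vnorm v) \<Longrightarrow>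
  (\<And>j v. j < m \<Longrightarrow> v \<in> rvec (d j) \<Longrightarrow> \<bar>g j (y j + v) - g j (y j) - c j \<bullet> v\<bar> \<le> C * nsq v) \<Longrightarrow>
  (\<integral>G. (\<Prod>j<m. g j (y j + h \<cdot>\<^sub>v (L j *\<^sub>v G)) powr p j) \<partial>gauss K M)
   \<le> (\<Prod>j<m. (\<integral>G. g j (y j + h \<cdot>\<^sub>v (L j *\<^sub>v G)) \<partial>gauss K M) powr p j) + D * h ^ 3"
proof -
 interpret prob_space "gauss K M" by (rule prob_space_gauss[OF M])
 have total: "prob (rvec K) = 1" using prob_space by simp
 have "\<forall>j. \<exists>\<Lambda>\<ge>1. j < m \<longrightarrow> (\<forall>v\<in>rvec K. vnorm (L j *\<^sub>v v) \<le> \<Lambda> * vnorm v)"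
 proof
  fix j
  show "\<exists>\<Lambda>\<ge>1. j < m \<longrightarrow> (\<forall>v\<in>rvec K. vnorm (L j *\<^sub>v v) \<le> \<Lambda> * vnorm v)"
  proof (cases "j < m")
   case True
   obtain \<Lambda> where "1 \<le> \<Lambda>" "\<And>v. v \<in> rvec K \<Longrightarrow> vnorm (L j *\<^sub>v v) \<le> \<Lambda> * vnorm v"
    by (fact mult_mat_vec_bounded[OF L[OF True]])
   thus ?thesis by blast
  qed (auto intro: exI[of _ 1])
 qed
 then obtain \<Lambda>' where \<Lambda>': "\<And>j. 1 \<le> \<Lambda>' j"
  "\<And>j v. j < m \<Longrightarrow> v \<in> rvec K \<Longrightarrow> vnorm (L j *\<^sub>v v) \<le> \<Lambda>' j * vnorm v"
  by metis
 define \<Lambda> where "\<Lambda> = 1 + (\<Sum>j<m. \<Lambda>' j)"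
 have \<Lambda>'0: "0 \<le> \<Lambda>' j" for j using \<Lambda>'(1)[of j] by linarith
 have \<Lambda>1: "1 \<le> \<Lambda>" unfolding \<Lambda>_def using \<Lambda>'0 by (simp add: sum_nonneg)
 have Lr: "vnorm (L j *\<^sub>v v) \<le> \<Lambda> * vnorm v" if "j < m" "v \<in> rvec K" for j v
 proof -
  have "\<Lambda>' j \<le> (\<Sum>j<m. \<Lambda>' j)" using that(1) \<Lambda>'0 by (intro member_le_sum) auto
  hence "\<Lambda>' j * vnorm v \<le> \<Lambda> * vnorm v"
   by (intro mult_right_mono) (auto simp: \<Lambda>_def nsq_nonneg)
  with \<Lambda>'(2)[OF that] show ?thesis by linarith
 qed
 define r where "r G = vnorm G" for G :: "real vec"
 have r0: "0 \<le> r G" for G by (simp add: r_def nsq_nonneg)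
 have ir: "integrable (gauss K M) (\<lambda>G. r G ^ n)" for n
  unfolding r_def by (rule integrable_gauss_norm_power[OF M])
 have [measurable]: "r \<in> bmeas K" unfolding r_def by measurable
 \<comment> \<open>With r = |G|, \<open>C1\<close> bounds l_j by C1 r and rho_j - h l_j by C1 h^2
   r^2. The 1/a comes from the division by the base values, and the square of Lambda from the
   quadratic Taylor remainder.\<close>
 define C1 where "C1 = C / a * \<Lambda>\<^sup>2"
 have C1: "0 \<le> C1" using C ab by (simp add: C1_def)
 define P where "P = (\<Sum>j<m. p j)"
 have P: "0 \<le> P" unfolding P_def by (intro sum_nonneg) (use p in auto)
 have ba: "0 \<le> b / a" "1 \<le> b / a" using ab by simp_all
 have p_all: "\<forall>j<m. 0 \<le> p j" using p by blast
 obtain C0 where C0: "0 \<le> C0" and upper: "\<And>\<rho> x. (\<And>j. j < m \<Longrightarrow> -1 < \<rho> j) \<Longrightarrow> (\<And>j. j < m \<Longrightarrow> \<bar>\<rho> j\<bar> \<le> b / a) \<Longrightarrow> (\<And>j. j < m \<Longrightarrow> \<bar>\<rho> j\<bar> \<le> x) \<Longrightarrow> 0 \<le> x \<Longrightarrow>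
  (\<Prod>j<m. (1 + \<rho> j) powr p j) \<le> 1 + (\<Sum>j<m. p j * \<rho> j) - (\<Sum>j<m. p j * (\<rho> j)\<^sup>2) / 2 + (\<Sum>j<m. p j * \<rho> j)\<^sup>2 / 2 + C0 * x ^ 3"
  by (fact prod_powr_upper[OF p_all ba(1)])
 \<comment> \<open>The coefficient of h^3 in the pointwise bound \<open>pw\<close>: cross terms
   between linear parts and remainders, and the cubic error of \<open>prod_powr_upper\<close> at x =
   C1 h (r + r^2). Powers h^4 have been estimated by h^3.\<close>
 define V where "V G = (P + P\<^sup>2) * C1\<^sup>2 * r G ^ 3 + P\<^sup>2 * C1\<^sup>2 / 2 * r G ^ 4
  + C0 * C1 ^ 3 * (r G ^ 3 + 3 * r G ^ 4 + 3 * r G ^ 5 + r G ^ 6)" for G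
 have iV: "integrable (gauss K M) V" unfolding V_def
  by (intro Bochner_Integration.integrable_add integrable_mult_right ir)
 define R2 where "R2 = (\<integral>G. r G ^ 2 \<partial>gauss K M)"
 have R2: "0 \<le> R2" unfolding R2_def by (intro integral_nonneg_AE AE_I2) auto
 define EV where "EV = (\<integral>G. V G \<partial>gauss K M)"
 have EV: "0 \<le> EV" unfolding EV_def using P C0 C1 r0 by (intro integral_nonneg_AE AE_I2) (auto simp: V_def)
 define C7 where "C7 = EV + P * (C1 * R2)\<^sup>2 * (b / a)"
 have C7: "0 \<le> C7" unfolding C7_def using EV P ba(1) by (intro add_nonneg_nonneg mult_nonneg_nonneg zero_le_power2)
 define Wb where "Wb = (\<Prod>j<m. b powr p j)"
 have Wb: "0 \<le> Wb" unfolding Wb_def by (intro prod_nonneg) auto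
 show thesis
 proof (rule that[of "Wb * C7"])
  show "0 \<le> Wb * C7" using Wb C7 by simp
  fix h :: real and g :: "nat \<Rightarrow> real vec \<Rightarrow> real" and y c
  assume h: "0 < h" "h \<le> 1" and y: "\<And>j. j < m \<Longrightarrow> y j \<in> rvec (d j)" and g: "\<And>j. j < m \<Longrightarrow> bdd_fun (d j) a b (g j)"
   and c: "\<And>j. j < m \<Longrightarrow> c j \<in> rvec (d j)"
   and cb: "\<And>j v. j < m \<Longrightarrow> v \<in> rvec (d j) \<Longrightarrow> \<bar>c j \<bullet> v\<bar> \<le> C * vnorm v"
   and gt: "\<And>j v. j < m \<Longrightarrow> v \<in> rvec (d j) \<Longrightarrow> \<bar>g j (y j + v) - g j (y j) - c j \<bullet> v\<bar> \<le> C * nsq v"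
  define q where "q j = g j (y j)" for j
  define f where "f j G = g j (y j + h \<cdot>\<^sub>v (L j *\<^sub>v G))" for j G
  define \<rho> where "\<rho> j G = f j G / q j - 1" for j G
  define c' where "c' j = (1 / q j) \<cdot>\<^sub>v c j" for j
  define l where "l j G = c' j \<bullet> (L j *\<^sub>v G)" for j G
  have q: "a \<le> q j" "q j \<le> b" "0 < q j" if "j < m" for j
   using g[OF that] y[OF that] ab by (auto simp: q_def bdd_fun_def intro: less_le_trans)
  have LG: "L j *\<^sub>v G \<in> rvec (d j)" if "j < m" "G \<in> rvec K" for j G
   using L[OF that(1)] that by simp
  have fb: "a \<le> f j G" "f j G \<le> b" if "j < m" "G \<in> rvec K" for j G
   using g[OF that(1)] y[OF that(1)] LG[OF that] by (auto simp: f_def bdd_fun_def)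
  have c': "c' j \<in> rvec (d j)" if "j < m" for j using c[OF that] by (simp add: c'_def)
  have fm: "f j \<in> bmeas K" if j: "j < m" for j
  proof -
   have [measurable]: "(\<lambda>G. L j *\<^sub>v G) \<in> leb K \<rightarrow>\<^sub>M leb (d j)"
    by (rule meas_mult_mat_vec[OF L[OF j]]) auto
   have [measurable]: "g j \<in> bmeas (d j)" using g[OF j] by (simp add: bdd_fun_def)
   have "y j \<in> space (leb (d j))" using y[OF j] by simp
   note [measurable] = this
   show ?thesis unfolding f_def by measurable
  qed
  have \<rho>m: "\<rho> j \<in> bmeas K" if "j < m" for j
   unfolding \<rho>_def using fm[OF that] by measurable
  have lm: "l j \<in> bmeas K" if j: "j < m" for j
   unfolding l_def
  proof (rule measurable_scalar_prod)
   show "(\<lambda>G. c' j) \<in> leb K \<rightarrow>\<^sub>M leb (d j)" using c'[OF j] by (intro measurable_const) simp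
   show "(\<lambda>G. L j *\<^sub>v G) \<in> leb K \<rightarrow>\<^sub>M leb (d j)"
    by (rule meas_mult_mat_vec[OF L[OF j]]) auto
  qed
  have \<rho>B: "\<bar>\<rho> j G\<bar> \<le> b / a" "-1 < \<rho> j G" "a / b \<le> 1 + \<rho> j G" if "j < m" "G \<in> rvec K" for j G
  proof -
   note fb = fb[OF that] and q = q[OF that(1)]
   have "f j G / q j \<le> b / a" using fb q ab by (intro frac_le) auto
   moreover have lo: "a / b \<le> f j G / q j" using fb q ab by (intro frac_le) auto
   moreover have "0 < a / b" using ab by simp
   ultimately show "\<bar>\<rho> j G\<bar> \<le> b / a" "-1 < \<rho> j G" "a / b \<le> 1 + \<rho> j G"
    using ba by (auto simp: \<rho>_def)
  qed
  have lb: "\<bar>l j G\<bar> \<le> C1 * r G" if j: "j < m" and G: "G \<in> rvec K" for j G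
  proof -
   have "\<bar>c j \<bullet> (L j *\<^sub>v G)\<bar> \<le> C * (\<Lambda> * r G)"
    using cb[OF j LG[OF that]] mult_left_mono[OF Lr[OF that] C] unfolding r_def by linarith
   also have "... \<le> C * (\<Lambda>\<^sup>2 * r G)"
    using \<Lambda>1 C r0 by (intro mult_left_mono mult_right_mono) (auto simp: power2_eq_square)
   finally have "\<bar>c j \<bullet> (L j *\<^sub>v G)\<bar> / q j \<le> C * (\<Lambda>\<^sup>2 * r G) / a"
    using q[OF j] ab C r0 by (intro frac_le) auto
   moreover have "l j G = (c j \<bullet> (L j *\<^sub>v G)) / q j"
    using c[OF j] LG[OF that] by (simp add: l_def c'_def)
   ultimately show ?thesis using q[OF j] by (simp add: C1_def abs_divide mult_ac)
  qed
  have eb: "\<bar>\<rho> j G - h * l j G\<bar> \<le> C1 * h\<^sup>2 * (r G)\<^sup>2" if j: "j < m" and G: "G \<in> rvec K" for j G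
  proof -
   define v where "v = L j *\<^sub>v G"
   have v: "v \<in> rvec (d j)" unfolding v_def by (rule LG[OF that])
   have "nsq v = (vnorm v)\<^sup>2" by (simp add: nsq_nonneg)
   also have "... \<le> (\<Lambda> * r G)\<^sup>2" using Lr[OF that] unfolding v_def[symmetric] r_def
    by (intro power_mono) (auto simp: nsq_nonneg)
   finally have vv: "nsq v \<le> \<Lambda>\<^sup>2 * (r G)\<^sup>2" by (simp add: power_mult_distrib)
   have "\<bar>f j G - q j - h * (c j \<bullet> v)\<bar> \<le> C * (h\<^sup>2 * nsq v)"
    using gt[OF j, of "h \<cdot>\<^sub>v v"] v c[OF j] unfolding f_def q_def v_def[symmetric]
    by (simp add: power2_eq_square mult.assoc)
   also have "... \<le> C * (h\<^sup>2 * (\<Lambda>\<^sup>2 * (r G)\<^sup>2))" using vv C by (intro mult_left_mono) auto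
   finally have "\<bar>f j G - q j - h * (c j \<bullet> v)\<bar> / q j \<le> C * (h\<^sup>2 * (\<Lambda>\<^sup>2 * (r G)\<^sup>2)) / a"
    using q[OF j] ab C by (intro frac_le) auto
   moreover have "\<rho> j G - h * l j G = (f j G - q j - h * (c j \<bullet> v)) / q j"
    using c[OF j] v q[OF j] by (simp add: \<rho>_def l_def c'_def v_def[symmetric] diff_divide_distrib)
   ultimately show ?thesis using q[OF j] by (simp add: C1_def abs_divide mult_ac)
  qed
  define S where "S G = (\<Sum>j<m. p j * l j G)" for G
  have pw: "(\<Prod>j<m. (1 + \<rho> j G) powr p j) \<le> 1 + (\<Sum>j<m. p j * \<rho> j G) + h\<^sup>2 / 2 * ((S G)\<^sup>2 - (\<Sum>j<m. p j * (l j G)\<^sup>2)) + h ^ 3 * V G"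
   if G: "G \<in> rvec K" for G
  proof -
   have aux: "X \<le> 1 + s + E + hV"
    if "X \<le> 1 + s - T / 2 + Q / 2 + R" "B - 2 * u \<le> T" "Q \<le> A + 2 * w + v" "hV = u + (2 * w + v) / 2 + R" "E = A / 2 - B / 2"
    for X s T Q R A B E u w v hV :: real
    using that by argo
   define z where "z = r G"
   have z: "0 \<le> z" by (simp add: z_def r0)
   note lb = lb[OF _ G, folded z_def] and eb = eb[OF _ G, folded z_def]
   have h2: "h\<^sup>2 \<le> h" using h by (simp add: power2_eq_square mult_left_le)
   have h4: "h ^ 4 \<le> h ^ 3" using h by (intro power_decreasing) auto
   have \<rho>x: "\<bar>\<rho> j G\<bar> \<le> C1 * (h * (z + z\<^sup>2))" if j: "j < m" for j
   proof -
    have "\<bar>\<rho> j G\<bar> \<le> \<bar>h * l j G\<bar> + \<bar>\<rho> j G - h * l j G\<bar>" by linarith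
    also have "... \<le> h * (C1 * z) + C1 * h\<^sup>2 * z\<^sup>2"
     using eb[OF j] lb[OF j] h by (intro add_mono) (auto simp: abs_mult)
    also have "C1 * h\<^sup>2 * z\<^sup>2 \<le> C1 * h * z\<^sup>2" using h2 C1 by (intro mult_right_mono mult_left_mono) auto
    finally show ?thesis by (simp add: algebra_simps)
   qed
   have "(\<Prod>j<m. (1 + \<rho> j G) powr p j) \<le> 1 + (\<Sum>j<m. p j * \<rho> j G) - (\<Sum>j<m. p j * (\<rho> j G)\<^sup>2) / 2 + (\<Sum>j<m. p j * \<rho> j G)\<^sup>2 / 2
    + C0 * (C1 * (h * (z + z\<^sup>2))) ^ 3"
    using \<rho>B[OF _ G] \<rho>x C1 h z by (intro upper) auto
   moreover have "h\<^sup>2 * (\<Sum>j<m. p j * (l j G)\<^sup>2) - 2 * P * C1\<^sup>2 * h ^ 3 * z ^ 3 \<le> (\<Sum>j<m. p j * (\<rho> j G)\<^sup>2)"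
   proof -
    have "h\<^sup>2 * (\<Sum>j<m. p j * (l j G)\<^sup>2) - 2 * P * C1\<^sup>2 * h ^ 3 * z ^ 3
     = (\<Sum>j<m. p j * (h\<^sup>2 * (l j G)\<^sup>2 - 2 * C1\<^sup>2 * h ^ 3 * z ^ 3))"
     by (simp add: P_def right_diff_distrib sum_subtractf sum_distrib_left sum_distrib_right mult_ac)
    also have "... \<le> (\<Sum>j<m. p j * (\<rho> j G)\<^sup>2)"
    proof (intro sum_mono mult_left_mono)
     fix j assume "j \<in> {..<m}"
     hence j: "j < m" by simp
     define e where "e = \<rho> j G - h * l j G"
     have "\<bar>l j G * e\<bar> \<le> (C1 * z) * (C1 * h\<^sup>2 * z\<^sup>2)"
      unfolding abs_mult e_def using lb[OF j] eb[OF j] C1 z by (intro mult_mono) auto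
     hence "- (C1\<^sup>2 * h\<^sup>2 * z ^ 3) \<le> l j G * e" by (simp add: power2_eq_square power3_eq_cube mult_ac abs_le_iff)
     hence "(2 * h) * (- (C1\<^sup>2 * h\<^sup>2 * z ^ 3)) \<le> (2 * h) * (l j G * e)" using h by (intro mult_left_mono) auto
     moreover have "(\<rho> j G)\<^sup>2 = h\<^sup>2 * (l j G)\<^sup>2 + (2 * h) * (l j G * e) + e\<^sup>2"
      by (simp add: e_def power2_eq_square algebra_simps)
     moreover have "0 \<le> e\<^sup>2" by simp
     moreover have "(2 * h) * (- (C1\<^sup>2 * h\<^sup>2 * z ^ 3)) = - (2 * C1\<^sup>2 * h ^ 3 * z ^ 3)"
      by (simp add: power2_eq_square power3_eq_cube mult_ac)
     ultimately show "h\<^sup>2 * (l j G)\<^sup>2 - 2 * C1\<^sup>2 * h ^ 3 * z ^ 3 \<le> (\<rho> j G)\<^sup>2" by linarith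
    qed (use p in auto)
    finally show ?thesis .
   qed
   moreover have "(\<Sum>j<m. p j * \<rho> j G)\<^sup>2 \<le> h\<^sup>2 * (S G)\<^sup>2 + 2 * P\<^sup>2 * C1\<^sup>2 * h ^ 3 * z ^ 3 + P\<^sup>2 * C1\<^sup>2 * h ^ 3 * z ^ 4"
   proof -
    define E where "E = (\<Sum>j<m. p j * (\<rho> j G - h * l j G))"
    have Sb: "\<bar>S G\<bar> \<le> P * (C1 * z)" unfolding S_def P_def sum_distrib_right
     by (rule order_trans[OF sum_abs]) (use p lb in \<open>auto simp: abs_mult intro!: sum_mono mult_left_mono\<close>)
    have Eb: "\<bar>E\<bar> \<le> P * (C1 * h\<^sup>2 * z\<^sup>2)" unfolding E_def P_def sum_distrib_right
     by (rule order_trans[OF sum_abs]) (use p eb in \<open>auto simp: abs_mult intro!: sum_mono mult_left_mono\<close>)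
    have "(\<Sum>j<m. p j * \<rho> j G) = h * S G + E"
     by (simp add: E_def S_def right_diff_distrib sum_subtractf sum_distrib_left mult_ac)
    hence eq: "(\<Sum>j<m. p j * \<rho> j G)\<^sup>2 = h\<^sup>2 * (S G)\<^sup>2 + (2 * h) * (S G * E) + E\<^sup>2"
     by (simp add: power2_eq_square algebra_simps)
    have "S G * E \<le> \<bar>S G\<bar> * \<bar>E\<bar>" unfolding abs_mult[symmetric] by (rule abs_ge_self)
    also have "... \<le> (P * (C1 * z)) * (P * (C1 * h\<^sup>2 * z\<^sup>2))" using Sb Eb P C1 z by (intro mult_mono) auto
    finally have "(2 * h) * (S G * E) \<le> (2 * h) * ((P * (C1 * z)) * (P * (C1 * h\<^sup>2 * z\<^sup>2)))"
     using h by (intro mult_left_mono) auto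
    also have "... = 2 * P\<^sup>2 * C1\<^sup>2 * h ^ 3 * z ^ 3" by (simp add: power2_eq_square power3_eq_cube mult_ac)
    finally have 1: "(2 * h) * (S G * E) \<le> 2 * P\<^sup>2 * C1\<^sup>2 * h ^ 3 * z ^ 3" .
    have "E\<^sup>2 \<le> (P * (C1 * h\<^sup>2 * z\<^sup>2))\<^sup>2" using Eb P C1 by (intro abs_le_square_iff[THEN iffD1]) auto
    also have "... = P\<^sup>2 * C1\<^sup>2 * (h ^ 4 * z ^ 4)" by (simp add: power_mult_distrib power_mult[symmetric] mult_ac)
    also have "... \<le> P\<^sup>2 * C1\<^sup>2 * (h ^ 3 * z ^ 4)" using h4 by (intro mult_left_mono mult_right_mono) auto
    finally show ?thesis using 1 eq by (simp add: mult.assoc)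
   qed
   moreover have "h ^ 3 * V G = P * C1\<^sup>2 * h ^ 3 * z ^ 3 + (2 * P\<^sup>2 * C1\<^sup>2 * h ^ 3 * z ^ 3 + P\<^sup>2 * C1\<^sup>2 * h ^ 3 * z ^ 4) / 2 + C0 * (C1 * (h * (z + z\<^sup>2))) ^ 3"
    unfolding V_def z_def[symmetric] by (simp add: algebra_simps power2_eq_square eval_nat_numeral)
   moreover have "h\<^sup>2 / 2 * ((S G)\<^sup>2 - (\<Sum>j<m. p j * (l j G)\<^sup>2)) = h\<^sup>2 * (S G)\<^sup>2 / 2 - h\<^sup>2 * (\<Sum>j<m. p j * (l j G)\<^sup>2) / 2"
    by (simp add: right_diff_distrib)
   ultimately show ?thesis unfolding mult.assoc by (rule aux)
  qed
  have i\<rho>: "integrable (gauss K M) (\<rho> j)" if "j < m" for j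
   using \<rho>B[OF that] \<rho>m[OF that] by (intro integrable_const_bound[of _ "b / a"] AE_I2) (auto cong: measurable_cong_sets)
  have il: "integrable (gauss K M) (\<lambda>G. (l j G)\<^sup>2)" if j: "j < m" for j
  proof (rule integrable_gauss_norm_power_bound[OF M, where C = "C1\<^sup>2" and n = 2])
   show "(\<lambda>G. (l j G)\<^sup>2) \<in> bmeas K" using lm[OF j] by measurable
   fix G assume G: "G \<in> rvec K"
   have "\<bar>l j G\<bar>\<^sup>2 \<le> (C1 * r G)\<^sup>2" by (rule power_mono[OF lb[OF j G]]) simp
   thus "\<bar>(l j G)\<^sup>2\<bar> \<le> C1\<^sup>2 * vnorm G ^ 2" by (simp add: power_mult_distrib r_def)
  qed
  have iS: "integrable (gauss K M) (\<lambda>G. (S G)\<^sup>2)"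
  proof (rule integrable_gauss_norm_power_bound[OF M, where C = "(P * C1)\<^sup>2" and n = 2])
   show "(\<lambda>G. (S G)\<^sup>2) \<in> bmeas K" unfolding S_def using lm by measurable
   fix G assume G: "G \<in> rvec K"
   have "\<bar>S G\<bar> \<le> P * (C1 * r G)" unfolding S_def P_def sum_distrib_right
    by (rule order_trans[OF sum_abs]) (use p lb[OF _ G] in \<open>auto simp: abs_mult intro!: sum_mono mult_left_mono\<close>)
   hence "\<bar>S G\<bar>\<^sup>2 \<le> (P * C1 * r G)\<^sup>2" by (intro power_mono) (auto simp: mult.assoc)
   thus "\<bar>(S G)\<^sup>2\<bar> \<le> (P * C1)\<^sup>2 * vnorm G ^ 2" by (simp add: power_mult_distrib r_def)
  qed
  \<comment> \<open>The mean relative increments; they are O(h^2) because l_j has mean zero.\<close>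
  define \<epsilon> where "\<epsilon> j = (\<integral>G. \<rho> j G \<partial>gauss K M)" for j
  have cov: "(\<integral>G. (S G)\<^sup>2 \<partial>gauss K M) \<le> (\<Sum>j<m. p j * (\<integral>G. (l j G)\<^sup>2 \<partial>gauss K M))"
   unfolding S_def l_def by (rule covariance_le) (rule c')
  have iprod: "integrable (gauss K M) (\<lambda>G. \<Prod>j<m. (1 + \<rho> j G) powr p j)"
  proof (rule integrable_const_bound[of _ "\<Prod>j<m. (1 + b / a) powr p j"])
   show "(\<lambda>G. \<Prod>j<m. (1 + \<rho> j G) powr p j) \<in> borel_measurable (gauss K M)"
   proof (rule borel_measurable_prod)
    fix j assume "j \<in> {..<m}"
    hence [measurable]: "\<rho> j \<in> bmeas K" using \<rho>m by simp
    show "(\<lambda>G. (1 + \<rho> j G) powr p j) \<in> borel_measurable (gauss K M)" by measurable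
   qed
   show "AE G in gauss K M. norm (\<Prod>j<m. (1 + \<rho> j G) powr p j) \<le> (\<Prod>j<m. (1 + b / a) powr p j)"
   proof (rule AE_I2)
    fix G assume "G \<in> space (gauss K M)"
    hence G: "G \<in> rvec K" by simp
    have "(\<Prod>j<m. (1 + \<rho> j G) powr p j) \<le> (\<Prod>j<m. (1 + b / a) powr p j)"
     using ab \<rho>B[OF _ G] by (intro prod_powr_bounds(2)[of "a / b"]) (auto simp: abs_le_iff)
    moreover have "0 \<le> (\<Prod>j<m. (1 + \<rho> j G) powr p j)" by (intro prod_nonneg) auto
    ultimately show "norm (\<Prod>j<m. (1 + \<rho> j G) powr p j) \<le> (\<Prod>j<m. (1 + b / a) powr p j)" by simp
   qed
  qed
  have "(\<integral>G. (\<Prod>j<m. (1 + \<rho> j G) powr p j) \<partial>gauss K M)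
   \<le> (\<integral>G. 1 + (\<Sum>j<m. p j * \<rho> j G) + h\<^sup>2 / 2 * ((S G)\<^sup>2 - (\<Sum>j<m. p j * (l j G)\<^sup>2)) + h ^ 3 * V G \<partial>gauss K M)"
  proof (rule integral_mono[OF iprod])
   show "integrable (gauss K M) (\<lambda>G. 1 + (\<Sum>j<m. p j * \<rho> j G) + h\<^sup>2 / 2 * ((S G)\<^sup>2 - (\<Sum>j<m. p j * (l j G)\<^sup>2)) + h ^ 3 * V G)"
    using i\<rho> il iS iV by (intro Bochner_Integration.integrable_add Bochner_Integration.integrable_diff
     Bochner_Integration.integrable_sum integrable_mult_right) auto
  qed (use pw in simp)
  also have "... = 1 + (\<Sum>j<m. p j * \<epsilon> j) + h\<^sup>2 / 2 * ((\<integral>G. (S G)\<^sup>2 \<partial>gauss K M) - (\<Sum>j<m. p j * (\<integral>G. (l j G)\<^sup>2 \<partial>gauss K M))) + h ^ 3 * EV"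
  proof -
   have 1: "integrable (gauss K M) (\<lambda>G. \<Sum>j<m. p j * \<rho> j G)" "integrable (gauss K M) (\<lambda>G. \<Sum>j<m. p j * (l j G)\<^sup>2)"
    using i\<rho> il by (intro Bochner_Integration.integrable_sum integrable_mult_right; simp)+
   have 2: "(\<integral>G. (\<Sum>j<m. p j * \<rho> j G) \<partial>gauss K M) = (\<Sum>j<m. p j * \<epsilon> j)"
    "(\<integral>G. (\<Sum>j<m. p j * (l j G)\<^sup>2) \<partial>gauss K M) = (\<Sum>j<m. p j * (\<integral>G. (l j G)\<^sup>2 \<partial>gauss K M))"
    using i\<rho> il by (subst Bochner_Integration.integral_sum; simp add: \<epsilon>_def)+
   show ?thesis using 1 iS iV by (simp add: 2 EV_def total)
  qed
  also have "... \<le> 1 + (\<Sum>j<m. p j * \<epsilon> j) + h ^ 3 * EV"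
   using cov by (simp add: mult_nonneg_nonpos)
  finally have up: "(\<integral>G. (\<Prod>j<m. (1 + \<rho> j G) powr p j) \<partial>gauss K M) \<le> 1 + (\<Sum>j<m. p j * \<epsilon> j) + h ^ 3 * EV" .
  have \<epsilon>b: "\<bar>\<epsilon> j\<bar> \<le> h\<^sup>2 * (C1 * R2)" if j: "j < m" for j
  proof -
   have l1: "l j G = ((L j)\<^sup>T *\<^sub>v c' j) \<bullet> G" if "G \<in> rvec K" for G :: "real vec"
    unfolding l_def using transpose_vec_mult_scalar[OF L[OF j] that c'[OF j]] by simp
   have LT: "(L j)\<^sup>T *\<^sub>v c' j \<in> rvec K" using L[OF j] c'[OF j] by simp
   have l0: "(\<integral>G. l j G \<partial>gauss K M) = 0"
    using gauss_first_moment[OF M LT] by (subst integral_cong_refl) (auto simp: l1)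
   have il1: "integrable (gauss K M) (l j)"
    using lb[OF j] by (intro integrable_gauss_norm_power_bound[OF M lm[OF j], where C = C1 and n = 1]) (simp add: r_def)
   have "\<epsilon> j = (\<integral>G. \<rho> j G - h * l j G \<partial>gauss K M)"
    using i\<rho>[OF j] il1 l0 by (simp add: \<epsilon>_def)
   also have "\<bar>...\<bar> \<le> (\<integral>G. \<bar>\<rho> j G - h * l j G\<bar> \<partial>gauss K M)" by (rule integral_abs_bound)
   also have "... \<le> (\<integral>G. C1 * h\<^sup>2 * (r G)\<^sup>2 \<partial>gauss K M)"
   proof (rule integral_mono)
    show "integrable (gauss K M) (\<lambda>G. \<bar>\<rho> j G - h * l j G\<bar>)"
     using i\<rho>[OF j] il1 by (intro integrable_abs Bochner_Integration.integrable_diff integrable_mult_right)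
    show "integrable (gauss K M) (\<lambda>G. C1 * h\<^sup>2 * (r G)\<^sup>2)" by (intro integrable_mult_right ir)
   qed (use eb[OF j] in simp)
   also have "... = h\<^sup>2 * (C1 * R2)" by (simp add: R2_def mult_ac)
   finally show ?thesis .
  qed
  have f\<epsilon>: "(\<integral>G. f j G \<partial>gauss K M) = q j * (1 + \<epsilon> j)" if j: "j < m" for j
  proof -
   have "(\<integral>G. f j G \<partial>gauss K M) = (\<integral>G. q j * (1 + \<rho> j G) \<partial>gauss K M)"
    using q[OF j] by (intro integral_cong_refl) (simp add: \<rho>_def)
   also have "... = q j * (1 + \<epsilon> j)" using i\<rho>[OF j] by (simp add: \<epsilon>_def total)
   finally show ?thesis .
  qed
  have \<epsilon>1: "a / b \<le> 1 + \<epsilon> j" if j: "j < m" for j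
  proof -
   have "a / b \<le> (\<integral>G. 1 + \<rho> j G \<partial>gauss K M)"
    using i\<rho>[OF j] \<rho>B(3)[OF j] by (intro integral_ge_const AE_I2) auto
   thus ?thesis using i\<rho>[OF j] by (simp add: \<epsilon>_def total)
  qed
  \<comment> \<open>Returns from the sum to the product of the mean factors. Since the mean
    increments are O(h^2), their squares fit into the error h^3.\<close>
  have "1 + (\<Sum>j<m. p j * \<epsilon> j) \<le> (\<Prod>j<m. (1 + \<epsilon> j) powr p j) + (\<Sum>j<m. p j * (\<epsilon> j)\<^sup>2) / (a / b)"
  proof -
   have "1 + (\<Sum>j<m. p j * \<epsilon> j) - (\<Sum>j<m. p j * (\<epsilon> j)\<^sup>2) / (a / b) \<le> (\<Prod>j<m. (1 + \<epsilon> j) powr p j)"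
    by (rule prod_powr_lower) (use p \<epsilon>1 ab in auto)
   thus ?thesis by linarith
  qed
  also have "(\<Sum>j<m. p j * (\<epsilon> j)\<^sup>2) / (a / b) \<le> (P * (h ^ 3 * (C1 * R2)\<^sup>2)) / (a / b)"
  proof (rule divide_right_mono)
   show "(\<Sum>j<m. p j * (\<epsilon> j)\<^sup>2) \<le> P * (h ^ 3 * (C1 * R2)\<^sup>2)"
    unfolding P_def sum_distrib_right
   proof (intro sum_mono mult_left_mono)
    fix j assume "j \<in> {..<m}"
    hence j: "j < m" by simp
    have "\<bar>\<epsilon> j\<bar>\<^sup>2 \<le> (h\<^sup>2 * (C1 * R2))\<^sup>2" by (rule power_mono[OF \<epsilon>b[OF j]]) simp
    also have "... = h ^ 4 * (C1 * R2)\<^sup>2" by (simp add: power_mult_distrib power_mult[symmetric])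
    also have "... \<le> h ^ 3 * (C1 * R2)\<^sup>2" using h by (intro mult_right_mono power_decreasing) auto
    finally show "(\<epsilon> j)\<^sup>2 \<le> h ^ 3 * (C1 * R2)\<^sup>2" by simp
   qed (use p in auto)
  qed (use ab in simp)
  also have "(P * (h ^ 3 * (C1 * R2)\<^sup>2)) / (a / b) = h ^ 3 * (P * (C1 * R2)\<^sup>2 * (b / a))" by simp
  finally have main: "(\<integral>G. (\<Prod>j<m. (1 + \<rho> j G) powr p j) \<partial>gauss K M) \<le> (\<Prod>j<m. (1 + \<epsilon> j) powr p j) + h ^ 3 * C7"
   using up by (simp add: C7_def algebra_simps)
  \<comment> \<open>The base values, factored out of both sides; their product is at most
    \<open>Wb\<close>, whatever the base points are.\<close>
  define W where "W = (\<Prod>j<m. q j powr p j)"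
  have W: "0 \<le> W" "W \<le> Wb" unfolding W_def Wb_def
   using prod_powr_bounds(2)[of a q b] q ab by (auto intro!: prod_nonneg)
  have fW: "(\<Prod>j<m. f j G powr p j) = W * (\<Prod>j<m. (1 + \<rho> j G) powr p j)" if G: "G \<in> rvec K" for G
   unfolding W_def prod.distrib[symmetric]
  proof (rule prod.cong[OF refl])
   fix j assume "j \<in> {..<m}"
   hence j: "j < m" by simp
   have "f j G = q j * (1 + \<rho> j G)" using q[OF j] by (simp add: \<rho>_def)
   thus "f j G powr p j = q j powr p j * (1 + \<rho> j G) powr p j"
    using q[OF j] \<rho>B(2)[OF j G] by (simp add: powr_mult)
  qed
  have "(\<integral>G. (\<Prod>j<m. f j G powr p j) \<partial>gauss K M) = W * (\<integral>G. (\<Prod>j<m. (1 + \<rho> j G) powr p j) \<partial>gauss K M)"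
   by (subst Bochner_Integration.integral_cong[OF refl fW]) simp_all
  also have "... \<le> W * ((\<Prod>j<m. (1 + \<epsilon> j) powr p j) + h ^ 3 * C7)" by (rule mult_left_mono[OF main W(1)])
  also have "... = (\<Prod>j<m. (\<integral>G. f j G \<partial>gauss K M) powr p j) + W * (h ^ 3 * C7)"
  proof -
   have "W * (\<Prod>j<m. (1 + \<epsilon> j) powr p j) = (\<Prod>j<m. (\<integral>G. f j G \<partial>gauss K M) powr p j)"
    unfolding W_def prod.distrib[symmetric]
   proof (rule prod.cong[OF refl])
    fix j assume "j \<in> {..<m}"
    hence j: "j < m" by simp
    have "0 < a / b" using ab by simp
    hence "0 < 1 + \<epsilon> j" using \<epsilon>1[OF j] by linarith
    thus "q j powr p j * (1 + \<epsilon> j) powr p j = (\<integral>G. f j G \<partial>gauss K M) powr p j"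
     unfolding f\<epsilon>[OF j] using q[OF j] by (simp add: powr_mult)
   qed
   thus ?thesis by (simp add: distrib_left)
  qed
  also have "W * (h ^ 3 * C7) \<le> Wb * C7 * h ^ 3"
   using mult_right_mono[OF W(2), of "h ^ 3 * C7"] h C7 by (simp add: mult_ac)
  finally show "(\<integral>G. (\<Prod>j<m. g j (y j + h \<cdot>\<^sub>v (L j *\<^sub>v G)) powr p j) \<partial>gauss K M)
   \<le> (\<Prod>j<m. (\<integral>G. g j (y j + h \<cdot>\<^sub>v (L j *\<^sub>v G)) \<partial>gauss K M) powr p j) + Wb * C7 * h ^ 3"
   unfolding f_def by simp
 qed
qed

end

section \<open>Iteration of the step and passage to continuous functions\<close>

lemma integral_gauss_scale:
 fixes f :: "real vec \<Rightarrow> real"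
 assumes M: "pos_def_mat k M" and s: "0 < s" and f: "f \<in> bmeas k"
 shows "(\<integral>u. f u \<partial>gauss k ((1 / s) \<cdot>\<^sub>m M)) = (\<integral>u. f (sqrt s \<cdot>\<^sub>v u) \<partial>gauss k M)"
proof -
 have m: "(\<lambda>z. sqrt s \<cdot>\<^sub>v z) \<in> gauss k M \<rightarrow>\<^sub>M leb k" by measurable
 show ?thesis unfolding distr_gauss_scale[OF M s, symmetric] by (rule integral_distr[OF m f])
qed

text \<open>Time s of the semigroup is a spatial step sqrt s, which is how \<open>one_step\<close>
  is used, with h = sqrt s.\<close>

lemma gavg_scale:
 assumes M: "pos_def_mat k M" and s: "0 < s" and f: "f \<in> bmeas k" and x: "x \<in> rvec k"
 shows "gavg k ((1 / s) \<cdot>\<^sub>m M) f x = (\<integral>u. f (x + sqrt s \<cdot>\<^sub>v u) \<partial>gauss k M)"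
 unfolding gavg_def by (rule integral_gauss_scale[OF M s measurable_gauss_shift[OF f x]])

text \<open>The type \<^typ>\<open>real vec\<close> carries no topology, so continuity is stated with coordinatewise limits.\<close>
definition seqcont :: "nat \<Rightarrow> (real vec \<Rightarrow> real) \<Rightarrow> bool" where
 "seqcont k f \<longleftrightarrow> (\<forall>X x. (\<forall>n. X n \<in> rvec k) \<longrightarrow> x \<in> rvec k \<longrightarrow>
  (\<forall>i<k. (\<lambda>n. X n $ i) \<longlonglongrightarrow> x $ i) \<longrightarrow> (\<lambda>n. f (X n)) \<longlonglongrightarrow> f x)"

text \<open>The time is 1/(i + 1), so the spatial shift tends to 0 at every point u; boundedness of
  \<open>h\<close> dominates.\<close>

lemma gavg_tendsto:
 assumes A: "pos_def_mat k A" and h: "bdd_fun k a b h" "seqcont k h" and y: "y \<in> rvec k"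
 shows "(\<lambda>i. gavg k ((1 / (1 / real (Suc i))) \<cdot>\<^sub>m A) h y) \<longlonglongrightarrow> h y"
proof -
 interpret prob_space "gauss k A" by (rule prob_space_gauss[OF A])
 have hm: "h \<in> bmeas k" using h by (simp add: bdd_fun_def)
 have ys: "y \<in> space (leb k)" using y by simp
 note [measurable] = hm ys
 have "(\<lambda>i. \<integral>u. h (y + sqrt (1 / real (Suc i)) \<cdot>\<^sub>v u) \<partial>gauss k A) \<longlonglongrightarrow> (\<integral>u. h y \<partial>gauss k A)"
 proof (rule integral_dominated_convergence[where w = "\<lambda>_. \<bar>a\<bar> + \<bar>b\<bar>"])
  show "AE u in gauss k A. (\<lambda>i. h (y + sqrt (1 / real (Suc i)) \<cdot>\<^sub>v u)) \<longlonglongrightarrow> h y"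
  proof (rule AE_I2)
   fix u assume "u \<in> space (gauss k A)"
   hence u: "u \<in> rvec k" by simp
   have lim: "(\<lambda>n. y $ i + sqrt (1 / real (Suc n)) * u $ i) \<longlonglongrightarrow> y $ i" for i
   proof -
    have "(\<lambda>n. sqrt (1 / real (Suc n))) \<longlonglongrightarrow> sqrt 0"
     by (intro tendsto_real_sqrt LIMSEQ_Suc lim_1_over_n)
    hence "(\<lambda>n. y $ i + sqrt (1 / real (Suc n)) * u $ i) \<longlonglongrightarrow> y $ i + sqrt 0 * u $ i"
     by (intro tendsto_add tendsto_const tendsto_mult_right tendsto_mult)
    thus ?thesis by simp
   qed
   show "(\<lambda>i. h (y + sqrt (1 / real (Suc i)) \<cdot>\<^sub>v u)) \<longlonglongrightarrow> h y"
   proof (rule h(2)[unfolded seqcont_def, rule_format])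
    fix i assume i: "i < k"
    hence "(y + sqrt (1 / real (Suc n)) \<cdot>\<^sub>v u) $ i = y $ i + sqrt (1 / real (Suc n)) * u $ i" for n
     using y u by simp
    thus "(\<lambda>n. (y + sqrt (1 / real (Suc n)) \<cdot>\<^sub>v u) $ i) \<longlonglongrightarrow> y $ i" using lim[of i] by simp
   qed (use y u in auto)
  qed
  show "AE u in gauss k A. norm (h (y + sqrt (1 / real (Suc i)) \<cdot>\<^sub>v u)) \<le> \<bar>a\<bar> + \<bar>b\<bar>" for i
  proof (rule AE_I2)
   fix u assume "u \<in> space (gauss k A)"
   hence "a \<le> h (y + sqrt (1 / real (Suc i)) \<cdot>\<^sub>v u) \<and> h (y + sqrt (1 / real (Suc i)) \<cdot>\<^sub>v u) \<le> b"
    using h y by (simp add: bdd_fun_def)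
   thus "norm (h (y + sqrt (1 / real (Suc i)) \<cdot>\<^sub>v u)) \<le> \<bar>a\<bar> + \<bar>b\<bar>" unfolding real_norm_def by linarith
  qed
 qed auto
 thus ?thesis using prob_space by (subst gavg_scale[OF A _ hm y]) auto
qed

context gaussian_data
begin

lemma gauss_linear_integral:
 fixes f :: "real vec \<Rightarrow> real"
 assumes j: "j < m" and f: "f \<in> bmeas (d j)"
 shows "(\<integral>u. f u \<partial>gauss (d j) (A j)) = (\<integral>G. f (L j *\<^sub>v G) \<partial>gauss K M)"
 unfolding distr_gauss_linear[OF M A[OF j] L[OF j] AL[OF j], symmetric]
 by (rule integral_distr[OF measurable_L[OF j] f])

lemma bdd_fun_prod:
 assumes ab: "0 < a" and g: "\<And>j. j < m \<Longrightarrow> bdd_fun (d j) a b (g j)"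
 shows "bdd_fun K (\<Prod>j<m. a powr p j) (\<Prod>j<m. b powr p j) (\<lambda>z. \<Prod>j<m. g j (L j *\<^sub>v z) powr p j)"
 unfolding bdd_fun_def
proof (intro conjI ballI)
 show "(\<lambda>z. \<Prod>j<m. g j (L j *\<^sub>v z) powr p j) \<in> bmeas K"
  using g by (intro measurable_prod_powr meas_mult_mat_vec[OF L]) (auto simp: bdd_fun_def)
 fix z assume z: "z \<in> rvec K"
 have "a \<le> g j (L j *\<^sub>v z) \<and> g j (L j *\<^sub>v z) \<le> b" if "j < m" for j
  using g[OF that] L[OF that] z by (auto simp: bdd_fun_def)
 thus "(\<Prod>j<m. a powr p j) \<le> (\<Prod>j<m. g j (L j *\<^sub>v z) powr p j)"
  "(\<Prod>j<m. g j (L j *\<^sub>v z) powr p j) \<le> (\<Prod>j<m. b powr p j)"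
  by (auto intro!: prod_powr_bounds[OF ab])
qed

text \<open>Discretised heat flow: every step of length \<open>s\<close> loses \<open>O(s\<^sup>3\<^sup>/\<^sup>2)\<close>, so the total loss over
 \<open>1 / s\<close> steps vanishes as \<open>s \<rightarrow> 0\<close>. The initial smoothing for time \<open>s0\<close> makes the
 constants uniform.\<close>
lemma heat_flow:
 assumes ab: "0 < a" "a \<le> b" and h: "\<And>j. j < m \<Longrightarrow> bdd_fun (d j) a b (h j)" and s0: "0 < s0"
 shows "(\<integral>G. (\<Prod>j<m. gavg (d j) ((1 / s0) \<cdot>\<^sub>m A j) (h j) (L j *\<^sub>v G) powr p j) \<partial>gauss K M)
  \<le> (\<Prod>j<m. gavg (d j) (A j) (gavg (d j) ((1 / s0) \<cdot>\<^sub>m A j) (h j)) (0\<^sub>v (d j)) powr p j)"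
proof -
 interpret prob_space "gauss K M" by (rule prob_space_gauss[OF M])
 have a0: "0 \<le> a" and b0: "0 \<le> b" using ab by auto
 have pdA: "pos_def_mat (d j) ((1 / r) \<cdot>\<^sub>m A j)" if "0 < r" "j < m" for r j
  using pos_def_smult[OF A[OF that(2)]] that(1) by simp
 have pdM: "pos_def_mat K ((1 / r) \<cdot>\<^sub>m M)" if "0 < r" for r using pos_def_smult[OF M] that by simp
 define g where "g j = gavg (d j) ((1 / s0) \<cdot>\<^sub>m A j) (h j)" for j
 have g: "bdd_fun (d j) a b (g j)" if "j < m" for j
  unfolding g_def by (rule bdd_fun_gavg[OF pdA[OF s0 that] h[OF that]])
 have bz: "bdd_fun k 0 b f" if "bdd_fun k a b f" for k f
  using that a0 by (force simp: bdd_fun_def)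
 have "\<forall>j. \<exists>C\<ge>0. j < m \<longrightarrow> (\<forall>f y. bdd_fun (d j) 0 b f \<longrightarrow> y \<in> rvec (d j) \<longrightarrow>
  (\<exists>c\<in>rvec (d j). \<forall>v\<in>rvec (d j). \<bar>c \<bullet> v\<bar> \<le> C * vnorm v \<and>
   \<bar>gavg (d j) ((1 / s0) \<cdot>\<^sub>m A j) f (y + v) - gavg (d j) ((1 / s0) \<cdot>\<^sub>m A j) f y - c \<bullet> v\<bar> \<le> C * nsq v))"
  (is "\<forall>j. \<exists>C\<ge>0. j < m \<longrightarrow> ?T j C")
 proof
  fix j
  show "\<exists>C\<ge>0. j < m \<longrightarrow> ?T j C"
  proof (cases "j < m")
   case True
   obtain C where "0 \<le> C" "\<And>f y. bdd_fun (d j) 0 b f \<Longrightarrow> y \<in> rvec (d j) \<Longrightarrow>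
    \<exists>c\<in>rvec (d j). \<forall>v\<in>rvec (d j). \<bar>c \<bullet> v\<bar> \<le> C * vnorm v \<and>
    \<bar>gavg (d j) ((1 / s0) \<cdot>\<^sub>m A j) f (y + v) - gavg (d j) ((1 / s0) \<cdot>\<^sub>m A j) f y - c \<bullet> v\<bar> \<le> C * nsq v"
    by (fact gavg_taylor[OF pdA[OF s0 True] b0])
   thus ?thesis by blast
  qed (auto intro: exI[of _ 0])
 qed
 then obtain C' where C': "\<And>j. 0 \<le> C' j" "\<And>j. j < m \<Longrightarrow> ?T j (C' j)" by metis
 define C where "C = (\<Sum>j<m. C' j)"
 have C0: "0 \<le> C" unfolding C_def using C' by (intro sum_nonneg) auto
 have CC: "C' j \<le> C" if "j < m" for j unfolding C_def using that C' by (intro member_le_sum) auto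
 \<comment> \<open>One constant for all indices j and all functions that are averages over time s0
   of functions with values in [a, b].\<close>
 have taylor: "\<exists>c\<in>rvec (d j). \<forall>v\<in>rvec (d j). \<bar>c \<bullet> v\<bar> \<le> C * vnorm v \<and>
   \<bar>gavg (d j) ((1 / s0) \<cdot>\<^sub>m A j) f (y + v) - gavg (d j) ((1 / s0) \<cdot>\<^sub>m A j) f y - c \<bullet> v\<bar> \<le> C * nsq v"
  if j: "j < m" and f: "bdd_fun (d j) a b f" and y: "y \<in> rvec (d j)" for j f y
 proof -
  obtain c where c: "c \<in> rvec (d j)" "\<And>v. v \<in> rvec (d j) \<Longrightarrow> \<bar>c \<bullet> v\<bar> \<le> C' j * vnorm v"
   "\<And>v. v \<in> rvec (d j) \<Longrightarrow> \<bar>gavg (d j) ((1 / s0) \<cdot>\<^sub>m A j) f (y + v) - gavg (d j) ((1 / s0) \<cdot>\<^sub>m A j) f y - c \<bullet> v\<bar> \<le> C' j * nsq v"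
   using C'(2)[OF j] bz[OF f] y by blast
  show ?thesis
  proof (intro bexI[OF _ c(1)] ballI conjI)
   fix v assume v: "v \<in> rvec (d j)"
   show "\<bar>c \<bullet> v\<bar> \<le> C * vnorm v"
    by (rule order_trans[OF c(2)[OF v] mult_right_mono[OF CC[OF j]]]) (simp add: nsq_nonneg)
   show "\<bar>gavg (d j) ((1 / s0) \<cdot>\<^sub>m A j) f (y + v) - gavg (d j) ((1 / s0) \<cdot>\<^sub>m A j) f y - c \<bullet> v\<bar> \<le> C * nsq v"
    by (rule order_trans[OF c(3)[OF v] mult_right_mono[OF CC[OF j]]]) (simp add: nsq_nonneg)
  qed
 qed
 obtain D where D: "0 \<le> D" and step0: "\<And>h g y c. 0 < h \<Longrightarrow> h \<le> 1 \<Longrightarrow>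
  (\<And>j. j < m \<Longrightarrow> y j \<in> rvec (d j)) \<Longrightarrow> (\<And>j. j < m \<Longrightarrow> bdd_fun (d j) a b (g j)) \<Longrightarrow> (\<And>j. j < m \<Longrightarrow> c j \<in> rvec (d j)) \<Longrightarrow>
  (\<And>j v. j < m \<Longrightarrow> v \<in> rvec (d j) \<Longrightarrow> \<bar>c j \<bullet> v\<bar> \<le> C * vnorm v) \<Longrightarrow>
  (\<And>j v. j < m \<Longrightarrow> v \<in> rvec (d j) \<Longrightarrow> \<bar>g j (y j + v) - g j (y j) - c j \<bullet> v\<bar> \<le> C * nsq v) \<Longrightarrow>
  (\<integral>G. (\<Prod>j<m. g j (y j + h \<cdot>\<^sub>v (L j *\<^sub>v G)) powr p j) \<partial>gauss K M)
   \<le> (\<Prod>j<m. (\<integral>G. g j (y j + h \<cdot>\<^sub>v (L j *\<^sub>v G)) \<partial>gauss K M) powr p j) + D * h ^ 3"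
  by (fact one_step[OF ab C0])
 \<comment> \<open>\<open>gf\<close> records that g' is itself such an average of some bounded f;
   this keeps the Taylor constant, and with it \<open>D\<close>, the same in all steps.\<close>
 have step: "gavg K ((1 / s) \<cdot>\<^sub>m M) (\<lambda>z. \<Prod>j<m. g' j (L j *\<^sub>v z) powr p j) x
   \<le> (\<Prod>j<m. gavg (d j) ((1 / s) \<cdot>\<^sub>m A j) (g' j) (L j *\<^sub>v x) powr p j) + D * sqrt s ^ 3"
  if s: "0 < s" "s \<le> 1" and x: "x \<in> rvec K" and g': "\<And>j. j < m \<Longrightarrow> bdd_fun (d j) a b (g' j)"
   and f: "\<And>j. j < m \<Longrightarrow> bdd_fun (d j) a b (f j)"
   and gf: "\<And>j v. j < m \<Longrightarrow> v \<in> rvec (d j) \<Longrightarrow> g' j v = gavg (d j) ((1 / s0) \<cdot>\<^sub>m A j) (f j) v"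
  for s x g' f
 proof -
  have Lx: "L j *\<^sub>v x \<in> rvec (d j)" if "j < m" for j using L[OF that] x by simp
  have "\<forall>j. \<exists>c. j < m \<longrightarrow> c \<in> rvec (d j) \<and> (\<forall>v\<in>rvec (d j). \<bar>c \<bullet> v\<bar> \<le> C * vnorm v \<and>
   \<bar>g' j (L j *\<^sub>v x + v) - g' j (L j *\<^sub>v x) - c \<bullet> v\<bar> \<le> C * nsq v)"
  proof
   fix j
   show "\<exists>c. j < m \<longrightarrow> c \<in> rvec (d j) \<and> (\<forall>v\<in>rvec (d j). \<bar>c \<bullet> v\<bar> \<le> C * vnorm v \<and>
    \<bar>g' j (L j *\<^sub>v x + v) - g' j (L j *\<^sub>v x) - c \<bullet> v\<bar> \<le> C * nsq v)"
   proof (cases "j < m")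
    case True
    have "g' j (L j *\<^sub>v x + v) = gavg (d j) ((1 / s0) \<cdot>\<^sub>m A j) (f j) (L j *\<^sub>v x + v)" if "v \<in> rvec (d j)" for v
     using gf[OF True] Lx[OF True] that by simp
    thus ?thesis using taylor[OF True f[OF True] Lx[OF True]] gf[OF True Lx[OF True]] by auto
   qed simp
  qed
  then obtain c where c: "\<And>j. j < m \<Longrightarrow> c j \<in> rvec (d j)"
   "\<And>j v. j < m \<Longrightarrow> v \<in> rvec (d j) \<Longrightarrow> \<bar>c j \<bullet> v\<bar> \<le> C * vnorm v"
   "\<And>j v. j < m \<Longrightarrow> v \<in> rvec (d j) \<Longrightarrow> \<bar>g' j (L j *\<^sub>v x + v) - g' j (L j *\<^sub>v x) - c j \<bullet> v\<bar> \<le> C * nsq v"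
   by metis
  have gm: "g' j \<in> bmeas (d j)" if "j < m" for j using g'[OF that] by (simp add: bdd_fun_def)
  have Lxs: "L j *\<^sub>v (x + sqrt s \<cdot>\<^sub>v G) = L j *\<^sub>v x + sqrt s \<cdot>\<^sub>v (L j *\<^sub>v G)" if "j < m" "G \<in> rvec K" for j G
   using L[OF that(1)] x that(2) by (simp add: mult_add_distrib_mat_vec[of _ "d j" K] mult_mat_vec[of _ "d j" K])
  have Pm: "(\<lambda>z. \<Prod>j<m. g' j (L j *\<^sub>v z) powr p j) \<in> bmeas K"
   using bdd_fun_prod[OF ab(1) g'] by (simp add: bdd_fun_def)
  have "gavg K ((1 / s) \<cdot>\<^sub>m M) (\<lambda>z. \<Prod>j<m. g' j (L j *\<^sub>v z) powr p j) x
   = (\<integral>G. (\<Prod>j<m. g' j (L j *\<^sub>v x + sqrt s \<cdot>\<^sub>v (L j *\<^sub>v G)) powr p j) \<partial>gauss K M)"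
   unfolding gavg_scale[OF M s(1) Pm x]
   by (intro integral_cong_refl prod.cong) (auto simp: Lxs)
  also have "... \<le> (\<Prod>j<m. (\<integral>G. g' j (L j *\<^sub>v x + sqrt s \<cdot>\<^sub>v (L j *\<^sub>v G)) \<partial>gauss K M) powr p j) + D * sqrt s ^ 3"
   by (rule step0[of "sqrt s" "\<lambda>j. L j *\<^sub>v x" g' c]) (use s Lx g' c in auto)
  also have "(\<Prod>j<m. (\<integral>G. g' j (L j *\<^sub>v x + sqrt s \<cdot>\<^sub>v (L j *\<^sub>v G)) \<partial>gauss K M) powr p j)
   = (\<Prod>j<m. gavg (d j) ((1 / s) \<cdot>\<^sub>m A j) (g' j) (L j *\<^sub>v x) powr p j)"
  proof (rule prod.cong[OF refl])
   fix j assume "j \<in> {..<m}"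
   hence j: "j < m" by simp
   have "L j *\<^sub>v x \<in> space (leb (d j))" using Lx[OF j] by simp
   note [measurable] = this gm[OF j]
   have "gavg (d j) ((1 / s) \<cdot>\<^sub>m A j) (g' j) (L j *\<^sub>v x) = (\<integral>u. g' j (L j *\<^sub>v x + sqrt s \<cdot>\<^sub>v u) \<partial>gauss (d j) (A j))"
    by (rule gavg_scale[OF A[OF j] s(1) gm[OF j] Lx[OF j]])
   also have "... = (\<integral>G. g' j (L j *\<^sub>v x + sqrt s \<cdot>\<^sub>v (L j *\<^sub>v G)) \<partial>gauss K M)"
    by (rule gauss_linear_integral[OF j]) measurable
   finally show "(\<integral>G. g' j (L j *\<^sub>v x + sqrt s \<cdot>\<^sub>v (L j *\<^sub>v G)) \<partial>gauss K M) powr p j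
    = gavg (d j) ((1 / s) \<cdot>\<^sub>m A j) (g' j) (L j *\<^sub>v x) powr p j" by simp
  qed
  finally show ?thesis .
 qed
 define \<Phi> where "\<Phi> z = (\<Prod>j<m. g j (L j *\<^sub>v z) powr p j)" for z
 have \<Phi>: "bdd_fun K (\<Prod>j<m. a powr p j) (\<Prod>j<m. b powr p j) \<Phi>"
  unfolding \<Phi>_def by (rule bdd_fun_prod[OF ab(1) g])
 have pa0: "0 \<le> (\<Prod>j<m. a powr p j)" by (intro prod_nonneg) auto
 \<comment> \<open>Induction on the number of steps: the semigroup law splits off an outer step of
   length s, against which the induction hypothesis for the earlier time is integrated.\<close>
 have iter: "gavg K ((1 / (real (Suc k) * s)) \<cdot>\<^sub>m M) \<Phi> x
   \<le> (\<Prod>j<m. gavg (d j) ((1 / (real (Suc k) * s)) \<cdot>\<^sub>m A j) (g j) (L j *\<^sub>v x) powr p j) + real (Suc k) * (D * sqrt s ^ 3)"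
  if s: "0 < s" "s \<le> 1" and "x \<in> rvec K" for k s x
  using that(3)
 proof (induction k arbitrary: x)
  case 0
  show ?case using step[OF s 0 g h, folded \<Phi>_def] by (simp add: g_def)
 next
  case (Suc k)
  define t where "t = real (Suc k) * s"
  have t: "0 < t" using s by (simp add: t_def)
  have st: "real (Suc (Suc k)) * s = s + t" by (simp add: t_def algebra_simps)
  define g' where "g' j = gavg (d j) ((1 / t) \<cdot>\<^sub>m A j) (g j)" for j
  have g': "bdd_fun (d j) a b (g' j)" if "j < m" for j
   unfolding g'_def by (rule bdd_fun_gavg[OF pdA[OF t that] g[OF that]])
  have f: "bdd_fun (d j) a b (gavg (d j) ((1 / t) \<cdot>\<^sub>m A j) (h j))" if "j < m" for j
   by (rule bdd_fun_gavg[OF pdA[OF t that] h[OF that]])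
  \<comment> \<open>Averages over the times t and s0 commute by the semigroup law, so the function
    evolved for time t is again an average over time s0.\<close>
  have gf: "g' j v = gavg (d j) ((1 / s0) \<cdot>\<^sub>m A j) (gavg (d j) ((1 / t) \<cdot>\<^sub>m A j) (h j)) v"
   if "j < m" "v \<in> rvec (d j)" for j v
   unfolding g'_def g_def gavg_gavg[OF A[OF that(1)] t s0 h[OF that(1)] a0 that(2)]
    gavg_gavg[OF A[OF that(1)] s0 t h[OF that(1)] a0 that(2)] by (simp add: add.commute)
  define \<Psi> where "\<Psi> z = (\<Prod>j<m. g' j (L j *\<^sub>v z) powr p j)" for z
  have \<Psi>: "bdd_fun K (\<Prod>j<m. a powr p j) (\<Prod>j<m. b powr p j) \<Psi>"
   unfolding \<Psi>_def by (rule bdd_fun_prod[OF ab(1) g'])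
  define e where "e = real (Suc k) * (D * sqrt s ^ 3)"
  interpret Ms: prob_space "gauss K ((1 / s) \<cdot>\<^sub>m M)" by (rule prob_space_gauss[OF pdM[OF s(1)]])
  have "gavg K ((1 / (s + t)) \<cdot>\<^sub>m M) \<Phi> x = gavg K ((1 / s) \<cdot>\<^sub>m M) (gavg K ((1 / t) \<cdot>\<^sub>m M) \<Phi>) x"
   by (rule gavg_gavg[symmetric, OF M s(1) t \<Phi> pa0 Suc.prems])
  also have "... \<le> (\<integral>u. \<Psi> (x + u) + e \<partial>gauss K ((1 / s) \<cdot>\<^sub>m M))"
   unfolding gavg_def[of K "(1 / s) \<cdot>\<^sub>m M"]
  proof (rule integral_mono)
   show "integrable (gauss K ((1 / s) \<cdot>\<^sub>m M)) (\<lambda>u. gavg K ((1 / t) \<cdot>\<^sub>m M) \<Phi> (x + u))"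
    by (rule integrable_gauss_bdd_fun[OF pdM[OF s(1)] bdd_fun_gavg[OF pdM[OF t] \<Phi>] Suc.prems])
   show "integrable (gauss K ((1 / s) \<cdot>\<^sub>m M)) (\<lambda>u. \<Psi> (x + u) + e)"
    using integrable_gauss_bdd_fun[OF pdM[OF s(1)] \<Psi> Suc.prems] by simp
   fix u assume "u \<in> space (gauss K ((1 / s) \<cdot>\<^sub>m M))"
   hence "x + u \<in> rvec K" using Suc.prems by simp
   from Suc.IH[OF this] show "gavg K ((1 / t) \<cdot>\<^sub>m M) \<Phi> (x + u) \<le> \<Psi> (x + u) + e"
    by (simp add: t_def \<Psi>_def g'_def e_def)
  qed
  also have "... = gavg K ((1 / s) \<cdot>\<^sub>m M) \<Psi> x + e"
   using integrable_gauss_bdd_fun[OF pdM[OF s(1)] \<Psi> Suc.prems] Ms.prob_space by (simp add: gavg_def)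
  also have "gavg K ((1 / s) \<cdot>\<^sub>m M) \<Psi> x \<le> (\<Prod>j<m. gavg (d j) ((1 / s) \<cdot>\<^sub>m A j) (g' j) (L j *\<^sub>v x) powr p j) + D * sqrt s ^ 3"
   unfolding \<Psi>_def by (rule step[OF s Suc.prems g' f gf])
  also have "(\<Prod>j<m. gavg (d j) ((1 / s) \<cdot>\<^sub>m A j) (g' j) (L j *\<^sub>v x) powr p j)
   = (\<Prod>j<m. gavg (d j) ((1 / (s + t)) \<cdot>\<^sub>m A j) (g j) (L j *\<^sub>v x) powr p j)"
  proof (rule prod.cong[OF refl])
   fix j assume "j \<in> {..<m}"
   hence j: "j < m" by simp
   have "L j *\<^sub>v x \<in> rvec (d j)" using L[OF j] Suc.prems by simp
   from gavg_gavg[OF A[OF j] s(1) t g[OF j] a0 this]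
   show "gavg (d j) ((1 / s) \<cdot>\<^sub>m A j) (g' j) (L j *\<^sub>v x) powr p j = gavg (d j) ((1 / (s + t)) \<cdot>\<^sub>m A j) (g j) (L j *\<^sub>v x) powr p j"
    by (simp add: g'_def)
  qed
  finally show ?case unfolding st by (simp add: e_def algebra_simps)
 qed
 have one: "(1 / (1 :: real)) \<cdot>\<^sub>m B = B" for B :: "real mat" by (rule eq_matI) auto
 have x0: "0\<^sub>v K \<in> rvec K" by simp
 have L0: "L j *\<^sub>v 0\<^sub>v K = 0\<^sub>v (d j)" if "j < m" for j using L[OF that] by (intro eq_vecI) auto
 have bound: "gavg K M \<Phi> (0\<^sub>v K) \<le> (\<Prod>j<m. gavg (d j) (A j) (g j) (0\<^sub>v (d j)) powr p j) + D * sqrt (1 / real (Suc k))" for k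
 proof -
  let ?s = "1 / real (Suc k)"
  have s: "0 < ?s" "?s \<le> 1" by auto
  have 1: "real (Suc k) * ?s = 1" by simp
  have "real (Suc k) * (D * sqrt ?s ^ 3) = D * (real (Suc k) * (sqrt ?s * sqrt ?s) * sqrt ?s)"
   by (simp only: power3_eq_cube mult_ac)
  also have "... = D * sqrt ?s" using 1 by (simp only: real_sqrt_mult_self abs_of_pos[OF s(1)] mult_1)
  finally have e: "real (Suc k) * (D * sqrt ?s ^ 3) = D * sqrt ?s" .
  from iter[OF s x0, of k] show ?thesis unfolding 1 one e by (simp add: L0)
 qed
 have "(\<lambda>k. sqrt (1 / real (Suc k))) \<longlonglongrightarrow> sqrt 0"
  by (intro tendsto_real_sqrt LIMSEQ_Suc lim_1_over_n)
 hence "(\<lambda>k. (\<Prod>j<m. gavg (d j) (A j) (g j) (0\<^sub>v (d j)) powr p j) + D * sqrt (1 / real (Suc k)))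
  \<longlonglongrightarrow> (\<Prod>j<m. gavg (d j) (A j) (g j) (0\<^sub>v (d j)) powr p j) + D * sqrt 0"
  by (intro tendsto_add tendsto_mult tendsto_const)
 hence "gavg K M \<Phi> (0\<^sub>v K) \<le> (\<Prod>j<m. gavg (d j) (A j) (g j) (0\<^sub>v (d j)) powr p j) + D * sqrt 0"
  by (rule LIMSEQ_le_const) (use bound in auto)
 moreover have "gavg K M \<Phi> (0\<^sub>v K) = (\<integral>G. \<Phi> G \<partial>gauss K M)"
  unfolding gavg_def by (intro integral_cong_refl) simp
 ultimately show ?thesis by (simp add: \<Phi>_def g_def)
qed

text \<open>A Hoelder inequality for the dependent Gaussian vectors L_j G. Continuity of the h_j
  removes the initial smoothing as its time 1/(i + 1) tends to 0, and the lower bound a > 0 keeps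
  the powers continuous in the limit.\<close>

theorem gaussian_Brascamp_Lieb:
 assumes ab: "0 < a" "a \<le> b" and h: "\<And>j. j < m \<Longrightarrow> bdd_fun (d j) a b (h j)"
  and cont: "\<And>j. j < m \<Longrightarrow> seqcont (d j) (h j)"
 shows "(\<integral>G. (\<Prod>j<m. h j (L j *\<^sub>v G) powr p j) \<partial>gauss K M) \<le> (\<Prod>j<m. (\<integral>y. h j y \<partial>gauss (d j) (A j)) powr p j)"
proof -
 interpret prob_space "gauss K M" by (rule prob_space_gauss[OF M])
 define g where "g i j = gavg (d j) ((1 / (1 / real (Suc i))) \<cdot>\<^sub>m A j) (h j)" for i j
 have g: "bdd_fun (d j) a b (g i j)" if "j < m" for i j
  unfolding g_def by (rule bdd_fun_gavg[OF pos_def_smult[OF A[OF that]] h[OF that]]) simp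
 have lim: "(\<lambda>i. g i j y) \<longlonglongrightarrow> h j y" if "j < m" "y \<in> rvec (d j)" for j y
  unfolding g_def by (rule gavg_tendsto[OF A[OF that(1)] h[OF that(1)] cont[OF that(1)] that(2)])
 have hpos: "0 < h j y" if "j < m" "y \<in> rvec (d j)" for j y
  using h[OF that(1)] that(2) ab(1) by (force simp: bdd_fun_def)
 have flow: "(\<integral>G. (\<Prod>j<m. g i j (L j *\<^sub>v G) powr p j) \<partial>gauss K M) \<le> (\<Prod>j<m. gavg (d j) (A j) (g i j) (0\<^sub>v (d j)) powr p j)" for i
  unfolding g_def by (rule heat_flow[OF ab h]) auto
 have l1: "(\<lambda>i. \<integral>G. (\<Prod>j<m. g i j (L j *\<^sub>v G) powr p j) \<partial>gauss K M) \<longlonglongrightarrow> (\<integral>G. (\<Prod>j<m. h j (L j *\<^sub>v G) powr p j) \<partial>gauss K M)"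
 proof (rule integral_dominated_convergence[where w = "\<lambda>_. \<Prod>j<m. b powr p j"])
  show "(\<lambda>G. \<Prod>j<m. h j (L j *\<^sub>v G) powr p j) \<in> borel_measurable (gauss K M)"
   using bdd_fun_prod[OF ab(1) h] by (simp add: bdd_fun_def cong: measurable_cong_sets)
  show "(\<lambda>G. \<Prod>j<m. g i j (L j *\<^sub>v G) powr p j) \<in> borel_measurable (gauss K M)" for i
   using bdd_fun_prod[OF ab(1) g] by (simp add: bdd_fun_def cong: measurable_cong_sets)
  show "AE G in gauss K M. (\<lambda>i. \<Prod>j<m. g i j (L j *\<^sub>v G) powr p j) \<longlonglongrightarrow> (\<Prod>j<m. h j (L j *\<^sub>v G) powr p j)"
  proof (rule AE_I2)
   fix G assume "G \<in> space (gauss K M)"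
   hence G: "G \<in> rvec K" by simp
   show "(\<lambda>i. \<Prod>j<m. g i j (L j *\<^sub>v G) powr p j) \<longlonglongrightarrow> (\<Prod>j<m. h j (L j *\<^sub>v G) powr p j)"
   proof (rule tendsto_prod)
    fix j assume "j \<in> {..<m}"
    hence j: "j < m" by simp
    have "L j *\<^sub>v G \<in> rvec (d j)" using L[OF j] G by simp
    thus "(\<lambda>i. g i j (L j *\<^sub>v G) powr p j) \<longlonglongrightarrow> h j (L j *\<^sub>v G) powr p j"
     using hpos[OF j, of "L j *\<^sub>v G"] by (intro tendsto_powr lim[OF j] tendsto_const) auto
   qed
  qed
  show "AE G in gauss K M. norm (\<Prod>j<m. g i j (L j *\<^sub>v G) powr p j) \<le> (\<Prod>j<m. b powr p j)" for i
  proof (rule AE_I2)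
   fix G assume "G \<in> space (gauss K M)"
   moreover have "bdd_fun K (\<Prod>j<m. a powr p j) (\<Prod>j<m. b powr p j) (\<lambda>z. \<Prod>j<m. g i j (L j *\<^sub>v z) powr p j)"
    by (rule bdd_fun_prod[OF ab(1) g])
   ultimately have "(\<Prod>j<m. g i j (L j *\<^sub>v G) powr p j) \<le> (\<Prod>j<m. b powr p j)"
    by (simp add: bdd_fun_def)
   moreover have "0 \<le> (\<Prod>j<m. g i j (L j *\<^sub>v G) powr p j)" by (intro prod_nonneg) auto
   ultimately show "norm (\<Prod>j<m. g i j (L j *\<^sub>v G) powr p j) \<le> (\<Prod>j<m. b powr p j)" by simp
  qed
 qed auto
 have hint: "(\<integral>y. h j y \<partial>gauss (d j) (A j)) = gavg (d j) (A j) (h j) (0\<^sub>v (d j))" for j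
  unfolding gavg_def by (intro integral_cong_refl) simp
 have l2: "(\<lambda>i. \<Prod>j<m. gavg (d j) (A j) (g i j) (0\<^sub>v (d j)) powr p j) \<longlonglongrightarrow> (\<Prod>j<m. (\<integral>y. h j y \<partial>gauss (d j) (A j)) powr p j)"
 proof (rule tendsto_prod)
  fix j assume "j \<in> {..<m}"
  hence j: "j < m" by simp
  interpret Aj: prob_space "gauss (d j) (A j)" by (rule prob_space_gauss[OF A[OF j]])
  have "(\<lambda>i. \<integral>y. g i j (0\<^sub>v (d j) + y) \<partial>gauss (d j) (A j)) \<longlonglongrightarrow> (\<integral>y. h j (0\<^sub>v (d j) + y) \<partial>gauss (d j) (A j))"
  proof (rule integral_dominated_convergence[where w = "\<lambda>_. b"])
   have z: "0\<^sub>v (d j) \<in> rvec (d j)" by simp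
   show "(\<lambda>y. h j (0\<^sub>v (d j) + y)) \<in> borel_measurable (gauss (d j) (A j))"
    using integrable_gauss_bdd_fun[OF A[OF j] h[OF j] z] by (rule borel_measurable_integrable)
   show "(\<lambda>y. g i j (0\<^sub>v (d j) + y)) \<in> borel_measurable (gauss (d j) (A j))" for i
    using integrable_gauss_bdd_fun[OF A[OF j] g[OF j] z] by (rule borel_measurable_integrable)
   show "AE y in gauss (d j) (A j). (\<lambda>i. g i j (0\<^sub>v (d j) + y)) \<longlonglongrightarrow> h j (0\<^sub>v (d j) + y)"
    using lim[OF j] by (intro AE_I2) simp
   show "AE y in gauss (d j) (A j). norm (g i j (0\<^sub>v (d j) + y)) \<le> b" for i
   proof (rule AE_I2)
    fix y assume "y \<in> space (gauss (d j) (A j))"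
    hence "a \<le> g i j (0\<^sub>v (d j) + y) \<and> g i j (0\<^sub>v (d j) + y) \<le> b" using g[OF j, of i] by (simp add: bdd_fun_def)
    thus "norm (g i j (0\<^sub>v (d j) + y)) \<le> b" using ab by simp
   qed
  qed auto
  moreover have "0 < gavg (d j) (A j) (h j) (0\<^sub>v (d j))"
   using gavg_bounds(1)[OF A[OF j] h[OF j], of "0\<^sub>v (d j)"] ab by simp
  ultimately show "(\<lambda>i. gavg (d j) (A j) (g i j) (0\<^sub>v (d j)) powr p j) \<longlonglongrightarrow> (\<integral>y. h j y \<partial>gauss (d j) (A j)) powr p j"
   unfolding hint unfolding gavg_def by (intro tendsto_powr tendsto_const) auto
 qed
 show ?thesis by (rule LIMSEQ_le[OF l1 l2]) (use flow in auto)
qed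

end

section \<open>Gaussian kernels\<close>

text \<open>Nonnegative continuous functions of compact support, the support being confined by a
  bound on the coordinates.\<close>

definition nice_fun :: "nat \<Rightarrow> (real vec \<Rightarrow> real) \<Rightarrow> bool" where
 "nice_fun k f \<longleftrightarrow> f \<in> bmeas k \<and> seqcont k f \<and>
  (\<exists>b r. \<forall>v\<in>rvec k. 0 \<le> f v \<and> f v \<le> b \<and> (f v \<noteq> 0 \<longrightarrow> (\<forall>i<k. \<bar>v $ i\<bar> \<le> r)))"

lemma nice_fun_nonneg: "nice_fun k f \<Longrightarrow> v \<in> rvec k \<Longrightarrow> 0 \<le> f v"
 unfolding nice_fun_def by blast

lemma seqcont_bilf:
 assumes "A \<in> rmat k k" shows "seqcont k (\<lambda>v. qf A v)"
 unfolding seqcont_def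
proof (intro allI impI)
 fix X :: "nat \<Rightarrow> real vec" and x :: "real vec"
 assume X: "\<forall>n. X n \<in> rvec k" and x: "x \<in> rvec k" and lim: "\<forall>i<k. (\<lambda>n. X n $ i) \<longlonglongrightarrow> x $ i"
 have "(\<lambda>n. \<Sum>i<k. \<Sum>j<k. A $$ (i, j) * X n $ i * X n $ j) \<longlonglongrightarrow> (\<Sum>i<k. \<Sum>j<k. A $$ (i, j) * x $ i * x $ j)"
  using lim by (intro tendsto_sum tendsto_mult tendsto_const) auto
 thus "(\<lambda>n. qf A (X n)) \<longlonglongrightarrow> qf A x"
  using X x by (simp add: bilf_eq_sum[OF assms])
qed

text \<open>On the support the coordinates are bounded, hence so is the growing exponential.\<close>

lemma nice_fun_gauss_bounded:
 assumes f: "nice_fun k f" and A: "A \<in> rmat k k"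
 obtains B where "0 \<le> B" "\<And>v. v \<in> rvec k \<Longrightarrow> f v * exp (pi * qf A v) \<le> B"
proof -
 obtain b r where br: "\<And>v. v \<in> rvec k \<Longrightarrow> 0 \<le> f v \<and> f v \<le> b \<and> (f v \<noteq> 0 \<longrightarrow> (\<forall>i<k. \<bar>v $ i\<bar> \<le> r))"
  using f unfolding nice_fun_def by blast
 have b0: "0 \<le> b" using br[of "0\<^sub>v k"] by force
 define S where "S = (\<Sum>i<k. \<Sum>j<k. \<bar>A $$ (i, j)\<bar> * (\<bar>r\<bar> * \<bar>r\<bar>))"
 have "f v * exp (pi * qf A v) \<le> b * exp (pi * S)" if v: "v \<in> rvec k" for v
 proof (cases "f v = 0")
  case False
  hence vr: "\<bar>v $ i\<bar> \<le> \<bar>r\<bar>" if "i < k" for i using br[OF v] that by force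
  have "qf A v \<le> S" unfolding bilf_eq_sum[OF A v v] S_def
  proof (intro sum_mono)
   fix i j assume "i \<in> {..<k}" "j \<in> {..<k}"
   hence "\<bar>v $ i\<bar> * \<bar>v $ j\<bar> \<le> \<bar>r\<bar> * \<bar>r\<bar>" using vr by (intro mult_mono) auto
   hence "\<bar>A $$ (i, j)\<bar> * (\<bar>v $ i\<bar> * \<bar>v $ j\<bar>) \<le> \<bar>A $$ (i, j)\<bar> * (\<bar>r\<bar> * \<bar>r\<bar>)" by (intro mult_left_mono) auto
   thus "A $$ (i, j) * v $ i * v $ j \<le> \<bar>A $$ (i, j)\<bar> * (\<bar>r\<bar> * \<bar>r\<bar>)"
    using abs_ge_self[of "A $$ (i, j) * v $ i * v $ j"] by (simp add: abs_mult mult.assoc)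
  qed
  thus ?thesis using br[OF v] b0 by (intro mult_mono) auto
 qed (use b0 in simp)
 thus thesis using that[of "b * exp (pi * S)"] b0 by simp
qed

lemma nice_fun_integrable:
 assumes f: "nice_fun k f"
 shows "integrable (leb k) f"
proof (rule integrableI_nonneg)
 show "f \<in> bmeas k" using f by (simp add: nice_fun_def)
 show "AE v in leb k. 0 \<le> f v" using nice_fun_nonneg[OF f] by (intro AE_I2) simp
 note c = pd_carrier[OF pos_def_one[of k]]
 obtain B where B: "0 \<le> B" "\<And>v. v \<in> rvec k \<Longrightarrow> f v * exp (pi * qf (1\<^sub>m k) v) \<le> B"
  by (fact nice_fun_gauss_bounded[OF f c])
 have "(\<integral>\<^sup>+v. ennreal (f v) \<partial>leb k) \<le> (\<integral>\<^sup>+v. ennreal B * ennreal (gker (1\<^sub>m k) v) \<partial>leb k)"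
 proof (rule nn_integral_mono)
  fix v assume "v \<in> space (leb k)"
  hence "f v * exp (pi * qf (1\<^sub>m k) v) * gker (1\<^sub>m k) v \<le> B * gker (1\<^sub>m k) v"
   using B(2)[of v] by (intro mult_right_mono) auto
  hence "f v \<le> B * gker (1\<^sub>m k) v" by (simp add: mult.assoc exp_add[symmetric])
  thus "ennreal (f v) \<le> ennreal B * ennreal (gker (1\<^sub>m k) v)"
   using B(1) by (simp add: ennreal_mult'[symmetric] ennreal_leI)
 qed
 also have "... = ennreal B * ennreal (1 / sqrt (det (1\<^sub>m k)))"
 proof -
  note [measurable] = meas_qf[OF c]
  have "(\<lambda>v. ennreal (gker (1\<^sub>m k) v)) \<in> bmeas k" by measurable
  thus ?thesis by (simp only: nn_integral_cmult nn_integral_gauss[OF pos_def_one])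
 qed
 also have "... < \<infinity>" by (simp add: ennreal_mult_less_top)
 finally show "(\<integral>\<^sup>+v. ennreal (f v) \<partial>leb k) < \<infinity>" .
qed

lemma rpow_mono: "0 \<le> x \<Longrightarrow> x \<le> y \<Longrightarrow> 0 \<le> a \<Longrightarrow> rpow x a \<le> rpow y a"
 by (auto simp: rpow_def intro: powr_mono2)

lemma rpow_nonneg: "0 \<le> rpow x a"
 by (simp add: rpow_def)

lemma rpow_mult: "0 \<le> x \<Longrightarrow> 0 \<le> y \<Longrightarrow> rpow (x * y) a = rpow x a * rpow y a"
 by (simp add: rpow_def powr_mult)

lemma rpow_pos_eq: "0 < x \<Longrightarrow> rpow x a = x powr a"
 by (simp add: rpow_def)

lemma tendsto_rpow:
 assumes "(f \<longlongrightarrow> x) F" "eventually (\<lambda>n. 0 \<le> f n) F" "0 \<le> a"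
 shows "((\<lambda>n. rpow (f n) a) \<longlongrightarrow> rpow x a) F"
proof (cases "a = 0")
 case False
 hence "((\<lambda>n. f n powr a) \<longlongrightarrow> x powr a) F"
  using assms by (intro tendsto_powr') auto
 thus ?thesis using False by (simp add: rpow_def)
qed (simp add: rpow_def)

text \<open>Writing f_j as h_j times the Gaussian of A_j moves these Gaussians into the kernel,
  where they combine with Q to M. What is left is the inequality for the Gaussian vector with matrix
  M, and the constant collects the normalising factors of the Gaussians of the A_j and of M.\<close>

theorem kernel_Brascamp_Lieb:
 fixes p :: "nat \<Rightarrow> real"
 assumes Q: "pos_def_mat K Q" and A: "\<And>j. j < m \<Longrightarrow> pos_def_mat (d j) (A j)"
  and L: "\<And>j. j < m \<Longrightarrow> L j \<in> rmat (d j) K" and p: "\<And>j. j < m \<Longrightarrow> 0 \<le> p j"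
  and MQ: "M = Q + BL_form K m L p A" and Mpd: "pos_def_mat K M"
  and AL: "\<And>j. j < m \<Longrightarrow> A j * (L j * inv_mat M * (L j)\<^sup>T) = 1\<^sub>m (d j)"
  and f: "\<And>j. j < m \<Longrightarrow> nice_fun (d j) (f j)"
 shows "(\<integral>\<^sup>+z. ennreal (gker Q z * (\<Prod>j<m. rpow (f j (L j *\<^sub>v z)) (p j))) \<partial>leb K)
  \<le> ennreal (sqrt ((\<Prod>j<m. det (A j) powr p j) / det M) * (\<Prod>j<m. rpow (\<integral>y. f j y \<partial>leb (d j)) (p j)))"
proof -
 note Ac = pd_carrier[OF A] and Qc = pd_carrier[OF Q] and Mc = pd_carrier[OF Mpd]
 have Mz: "qf M z = qf Q z + (\<Sum>j<m. p j * qf (A j) (L j *\<^sub>v z))" if z: "z \<in> rvec K" for z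
  unfolding MQ bilf_add_mat[OF Qc BL_form_carrier z z]
  by (subst bilf_BL_form[of m L d]) (use L Ac z in auto)
 interpret gaussian_data K m d p L A M
 proof
  fix z assume z: "z \<in> rvec K"
  show "(\<Sum>j<m. p j * qf (A j) (L j *\<^sub>v z)) \<le> qf M z"
   using Mz[OF z] pd_nonneg[OF Q z] by simp
 qed (use MQ Mpd A L AL p in auto)
 define e where "e j y = exp (pi * qf (A j) y)" for j y
 have "\<forall>j. \<exists>B\<ge>0. j < m \<longrightarrow> (\<forall>v\<in>rvec (d j). f j v * e j v \<le> B)"
 proof
  fix j
  show "\<exists>B\<ge>0. j < m \<longrightarrow> (\<forall>v\<in>rvec (d j). f j v * e j v \<le> B)"
  proof (cases "j < m")
   case True
   obtain B where "0 \<le> B" "\<And>v. v \<in> rvec (d j) \<Longrightarrow> f j v * exp (pi * qf (A j) v) \<le> B"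
    by (fact nice_fun_gauss_bounded[OF f[OF True] Ac[OF True]])
   thus ?thesis by (auto simp: e_def)
  qed (auto intro: exI[of _ 0])
 qed
 then obtain B where B: "\<And>j. 0 \<le> B j" "\<And>j v. j < m \<Longrightarrow> v \<in> rvec (d j) \<Longrightarrow> f j v * e j v \<le> B j"
  by metis
 define b where "b = 1 + (\<Sum>j<m. B j)"
 have b: "1 \<le> b" unfolding b_def using B(1) by (simp add: sum_nonneg)
 have Bb: "B j \<le> b - 1" if "j < m" for j unfolding b_def using that B(1) by (auto intro!: member_le_sum)
 have fm: "f j \<in> bmeas (d j)" if "j < m" for j using f[OF that] by (simp add: nice_fun_def)
 have em: "e j \<in> bmeas (d j)" if "j < m" for j
  unfolding e_def using meas_qf[OF Ac[OF that]] by measurable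
 have f0: "0 \<le> f j v" if "j < m" "v \<in> rvec (d j)" for j v using nice_fun_nonneg[OF f[OF that(1)] that(2)] .
 define J where "J j = (\<integral>y. f j y \<partial>leb (d j))" for j
 have J: "0 \<le> J j" if "j < m" for j unfolding J_def using f0[OF that] by (intro integral_nonneg_AE AE_I2) simp
 define I where "I = (\<integral>\<^sup>+z. ennreal (gker Q z * (\<Prod>j<m. rpow (f j (L j *\<^sub>v z)) (p j))) \<partial>leb K)"
 have Lm: "(\<lambda>z. L j *\<^sub>v z) \<in> leb K \<rightarrow>\<^sub>M leb (d j)" if "j < m" for j
  by (rule meas_mult_mat_vec[OF L[OF that]]) auto
 have LG: "L j *\<^sub>v z \<in> rvec (d j)" if "j < m" "z \<in> rvec K" for j z
  using L[OF that(1)] that(2) by simp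
 have main: "ennreal (sqrt (det M)) * I \<le> ennreal (\<Prod>j<m. rpow (sqrt (det (A j)) * J j + \<alpha>) (p j))"
  if \<alpha>: "0 < \<alpha>" "\<alpha> \<le> 1" for \<alpha>
 proof -
  \<comment> \<open>Adding alpha makes the function bounded below by a positive number, as
    \<open>gaussian_Brascamp_Lieb\<close> requires; alpha tends to 0 at the end.\<close>
  define h where "h j v = f j v * e j v + \<alpha>" for j v
  have h: "bdd_fun (d j) \<alpha> b (h j)" if j: "j < m" for j
   unfolding bdd_fun_def
  proof (intro conjI ballI)
   note [measurable] = fm[OF j] em[OF j]
   show "h j \<in> bmeas (d j)" unfolding h_def by measurable
   fix v assume v: "v \<in> rvec (d j)"
   have "0 \<le> f j v * e j v" using f0[OF j v] by (simp add: e_def)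
   thus "\<alpha> \<le> h j v" by (simp add: h_def)
   show "h j v \<le> b" using B(2)[OF j v] Bb[OF j] \<alpha> by (simp add: h_def)
  qed
  have hc: "seqcont (d j) (h j)" if j: "j < m" for j
   unfolding seqcont_def
  proof (intro allI impI)
   fix X :: "nat \<Rightarrow> real vec" and x assume "\<forall>n. X n \<in> rvec (d j)" "x \<in> rvec (d j)" "\<forall>i<d j. (\<lambda>n. X n $ i) \<longlonglongrightarrow> x $ i"
   hence "(\<lambda>n. f j (X n)) \<longlonglongrightarrow> f j x" "(\<lambda>n. qf (A j) (X n)) \<longlonglongrightarrow> qf (A j) x"
    using f[OF j] seqcont_bilf[OF Ac[OF j]] by (auto simp: nice_fun_def seqcont_def)
   thus "(\<lambda>n. h j (X n)) \<longlonglongrightarrow> h j x"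
    unfolding h_def e_def by (intro tendsto_intros)
  qed
  have G: "(\<integral>G. (\<Prod>j<m. h j (L j *\<^sub>v G) powr p j) \<partial>gauss K M) \<le> (\<Prod>j<m. (\<integral>y. h j y \<partial>gauss (d j) (A j)) powr p j)"
   by (rule gaussian_Brascamp_Lieb[OF \<alpha>(1) _ h hc]) (use \<alpha> b in auto)
  have hint: "(\<integral>y. h j y \<partial>gauss (d j) (A j)) = sqrt (det (A j)) * J j + \<alpha>" if j: "j < m" for j
  proof -
   interpret Aj: prob_space "gauss (d j) (A j)" by (rule prob_space_gauss[OF A[OF j]])
   note [measurable] = fm[OF j] em[OF j] meas_qf[OF Ac[OF j]]
   have fe: "integrable (gauss (d j) (A j)) (\<lambda>y. f j y * e j y)"
   proof (rule Aj.integrable_const_bound[of _ "B j"])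
    show "AE y in gauss (d j) (A j). norm (f j y * e j y) \<le> B j"
     using B(2)[OF j] f0[OF j] by (intro AE_I2) (simp add: e_def)
   qed measurable
   have "(\<integral>y. f j y * e j y \<partial>gauss (d j) (A j))
    = (\<integral>y. (sqrt (det (A j)) * gker (A j) y) * (f j y * e j y) \<partial>leb (d j))"
    unfolding gauss_def using pd_det_pos[OF A[OF j]] by (subst integral_density) (auto intro!: AE_I2)
   also have "... = (\<integral>y. sqrt (det (A j)) * f j y \<partial>leb (d j))"
    by (intro integral_cong_refl) (simp add: e_def exp_minus field_simps)
   also have "... = sqrt (det (A j)) * J j" by (simp add: J_def)
   finally have "(\<integral>y. f j y * e j y \<partial>gauss (d j) (A j)) = sqrt (det (A j)) * J j" .
   moreover have "measure (gauss (d j) (A j)) (rvec (d j)) = 1" using Aj.prob_space by simp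
   ultimately show ?thesis unfolding h_def using fe by simp
  qed
  have hpos: "0 < h j v" if "j < m" "v \<in> rvec (d j)" for j v
   using h[OF that(1)] that(2) \<alpha> by (force simp: bdd_fun_def)
  have Pm: "(\<lambda>G. \<Prod>j<m. h j (L j *\<^sub>v G) powr p j) \<in> bmeas K"
   using bdd_fun_prod[OF \<alpha>(1) h] by (simp add: bdd_fun_def)
  note [measurable] = Pm meas_qf[OF Mc]
  \<comment> \<open>Here f_j <= h_j / e_j, and the powers of the factors 1 / e_j combine with the
    kernel of Q to the kernel of M.\<close>
  have pw: "gker Q z * (\<Prod>j<m. rpow (f j (L j *\<^sub>v z)) (p j))
   \<le> gker M z * (\<Prod>j<m. h j (L j *\<^sub>v z) powr p j)" if z: "z \<in> rvec K" for z
  proof -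
   have "(\<Prod>j<m. rpow (f j (L j *\<^sub>v z)) (p j)) \<le> (\<Prod>j<m. exp (- pi * (p j * qf (A j) (L j *\<^sub>v z))) * h j (L j *\<^sub>v z) powr p j)"
   proof (rule prod_mono, intro conjI rpow_nonneg)
    fix j assume "j \<in> {..<m}"
    hence j: "j < m" by simp
    define v where "v = L j *\<^sub>v z"
    have v: "v \<in> rvec (d j)" unfolding v_def by (rule LG[OF j z])
    have e0: "0 < e j v" by (simp add: e_def)
    have "f j v * e j v \<le> h j v" using \<alpha> by (simp add: h_def)
    hence "f j v \<le> h j v / e j v" using e0 by (simp add: field_simps)
    hence "rpow (f j v) (p j) \<le> rpow (h j v / e j v) (p j)" by (rule rpow_mono[OF f0[OF j v] _ p[OF j]])
    also have "... = (h j v / e j v) powr p j" using hpos[OF j v] e0 by (intro rpow_pos_eq) simp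
    also have "... = h j v powr p j / e j v powr p j" using hpos[OF j v] e0 by (simp add: powr_divide)
    also have "e j v powr p j = exp (pi * (p j * qf (A j) v))" by (simp add: e_def powr_def mult_ac)
    finally show "rpow (f j (L j *\<^sub>v z)) (p j) \<le> exp (- pi * (p j * qf (A j) (L j *\<^sub>v z))) * h j (L j *\<^sub>v z) powr p j"
     unfolding v_def[symmetric] by (simp add: exp_minus field_simps)
   qed
   also have "... = exp (- pi * (\<Sum>j<m. p j * qf (A j) (L j *\<^sub>v z))) * (\<Prod>j<m. h j (L j *\<^sub>v z) powr p j)"
    by (simp add: prod.distrib exp_sum[symmetric] sum_distrib_left)
   finally have "gker Q z * (\<Prod>j<m. rpow (f j (L j *\<^sub>v z)) (p j))
    \<le> gker Q z * (exp (- pi * (\<Sum>j<m. p j * qf (A j) (L j *\<^sub>v z))) * (\<Prod>j<m. h j (L j *\<^sub>v z) powr p j))"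
    by (intro mult_left_mono) auto
   also have "... = gker M z * (\<Prod>j<m. h j (L j *\<^sub>v z) powr p j)"
    unfolding Mz[OF z] by (simp only: distrib_left exp_add mult.assoc)
   finally show ?thesis .
  qed
  have "ennreal (sqrt (det M)) * I \<le> ennreal (sqrt (det M)) * (\<integral>\<^sup>+z. ennreal (gker M z) * ennreal (\<Prod>j<m. h j (L j *\<^sub>v z) powr p j) \<partial>leb K)"
   unfolding I_def
  proof (intro mult_left_mono nn_integral_mono)
   fix z assume "z \<in> space (leb K)"
   thus "ennreal (gker Q z * (\<Prod>j<m. rpow (f j (L j *\<^sub>v z)) (p j)))
    \<le> ennreal (gker M z) * ennreal (\<Prod>j<m. h j (L j *\<^sub>v z) powr p j)"
    using pw[of z] by (simp add: ennreal_mult'[symmetric] ennreal_leI)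
  qed simp
  also have "... = (\<integral>\<^sup>+G. ennreal (\<Prod>j<m. h j (L j *\<^sub>v G) powr p j) \<partial>gauss K M)"
   by (rule nn_integral_gauss_density[OF Mpd, symmetric]) measurable
  also have "... = ennreal (\<integral>G. (\<Prod>j<m. h j (L j *\<^sub>v G) powr p j) \<partial>gauss K M)"
  proof (rule nn_integral_eq_integral)
   have z: "0\<^sub>v K \<in> rvec K" by simp
   have "integrable (gauss K M) (\<lambda>u. \<Prod>j<m. h j (L j *\<^sub>v (0\<^sub>v K + u)) powr p j)"
    by (rule integrable_gauss_bdd_fun[OF Mpd bdd_fun_prod[OF \<alpha>(1) h] z])
   thus "integrable (gauss K M) (\<lambda>u. \<Prod>j<m. h j (L j *\<^sub>v u) powr p j)"
    by (rule Bochner_Integration.integrable_cong[THEN iffD1, OF refl, rotated]) simp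
  qed (auto intro!: AE_I2 prod_nonneg)
  also have "... \<le> ennreal (\<Prod>j<m. (\<integral>y. h j y \<partial>gauss (d j) (A j)) powr p j)" using G by (rule ennreal_leI)
  also have "(\<Prod>j<m. (\<integral>y. h j y \<partial>gauss (d j) (A j)) powr p j) = (\<Prod>j<m. rpow (sqrt (det (A j)) * J j + \<alpha>) (p j))"
  proof (rule prod.cong[OF refl])
   fix j assume "j \<in> {..<m}"
   hence j: "j < m" by simp
   have "0 < sqrt (det (A j)) * J j + \<alpha>" using J[OF j] pd_det_pos[OF A[OF j]] \<alpha>(1) by (intro add_nonneg_pos) auto
   thus "(\<integral>y. h j y \<partial>gauss (d j) (A j)) powr p j = rpow (sqrt (det (A j)) * J j + \<alpha>) (p j)"
    using hint[OF j] by (simp add: rpow_pos_eq)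
  qed
  finally show ?thesis .
 qed
 have "(\<lambda>n. \<Prod>j<m. rpow (sqrt (det (A j)) * J j + 1 / real (Suc n)) (p j)) \<longlonglongrightarrow> (\<Prod>j<m. rpow (sqrt (det (A j)) * J j + 0) (p j))"
 proof (rule tendsto_prod)
  fix j assume "j \<in> {..<m}"
  hence j: "j < m" by simp
  show "(\<lambda>n. rpow (sqrt (det (A j)) * J j + 1 / real (Suc n)) (p j)) \<longlonglongrightarrow> rpow (sqrt (det (A j)) * J j + 0) (p j)"
   using J[OF j] pd_det_pos[OF A[OF j]] p[OF j]
   by (intro tendsto_rpow tendsto_add tendsto_const LIMSEQ_Suc lim_1_over_n always_eventually) auto
 qed
 hence "(\<lambda>n. ennreal (\<Prod>j<m. rpow (sqrt (det (A j)) * J j + 1 / real (Suc n)) (p j))) \<longlonglongrightarrow> ennreal (\<Prod>j<m. rpow (sqrt (det (A j)) * J j + 0) (p j))"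
  by (rule tendsto_ennrealI)
 hence "ennreal (sqrt (det M)) * I \<le> ennreal (\<Prod>j<m. rpow (sqrt (det (A j)) * J j + 0) (p j))"
  by (rule LIMSEQ_le_const) (use main in auto)
 also have "(\<Prod>j<m. rpow (sqrt (det (A j)) * J j + 0) (p j)) = sqrt (\<Prod>j<m. det (A j) powr p j) * (\<Prod>j<m. rpow (J j) (p j))"
 proof -
  have "rpow (sqrt (det (A j)) * J j + 0) (p j) = sqrt (det (A j) powr p j) * rpow (J j) (p j)" if j: "j < m" for j
  proof -
   have dp: "0 < det (A j)" by (rule pd_det_pos[OF A[OF j]])
   have "rpow (sqrt (det (A j))) (p j) = sqrt (det (A j) powr p j)"
    using dp by (simp add: rpow_pos_eq powr_half_sqrt[symmetric] powr_powr mult.commute)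
   thus ?thesis using J[OF j] dp by (simp add: rpow_mult)
  qed
  moreover have "sqrt (\<Prod>j<m. det (A j) powr p j) = (\<Prod>j<m. sqrt (det (A j) powr p j))"
   by (induction m) (simp_all add: real_sqrt_mult)
  ultimately show ?thesis by (simp add: prod.distrib)
 qed
 finally have le: "ennreal (sqrt (det M)) * I \<le> ennreal (sqrt (\<Prod>j<m. det (A j) powr p j) * (\<Prod>j<m. rpow (J j) (p j)))" .
 have dM: "0 < det M" by (rule pd_det_pos[OF Mpd])
 have "I = ennreal (1 / sqrt (det M)) * (ennreal (sqrt (det M)) * I)"
  using dM by (simp add: mult.assoc[symmetric] ennreal_mult'[symmetric])
 also have "... \<le> ennreal (1 / sqrt (det M)) * ennreal (sqrt (\<Prod>j<m. det (A j) powr p j) * (\<Prod>j<m. rpow (J j) (p j)))"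
  by (rule mult_left_mono[OF le]) simp
 also have "... = ennreal (sqrt ((\<Prod>j<m. det (A j) powr p j) / det M) * (\<Prod>j<m. rpow (J j) (p j)))"
  using dM by (simp add: ennreal_mult'[symmetric] real_sqrt_divide)
 finally show ?thesis unfolding I_def J_def .
qed

section \<open>Limits of matrices and the fixed point\<close>

definition mconv :: "nat \<Rightarrow> nat \<Rightarrow> (nat \<Rightarrow> real mat) \<Rightarrow> real mat \<Rightarrow> bool" where
 "mconv a b X Y \<longleftrightarrow> (\<forall>t. X t \<in> rmat a b) \<and> Y \<in> rmat a b \<and>
  (\<forall>i<a. \<forall>j<b. (\<lambda>t. X t $$ (i, j)) \<longlonglongrightarrow> Y $$ (i, j))"

lemma mconv_const: "Y \<in> rmat a b \<Longrightarrow> mconv a b (\<lambda>_. Y) Y"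
 by (simp add: mconv_def)

lemma mconv_mult:
 assumes "mconv a b X Y" "mconv b c Z W"
 shows "mconv a c (\<lambda>t. X t * Z t) (Y * W)"
 unfolding mconv_def
proof (intro conjI allI impI)
 have c: "X t \<in> rmat a b" "Z t \<in> rmat b c" "Y \<in> rmat a b" "W \<in> rmat b c" for t
  using assms by (auto simp: mconv_def)
 show "X t * Z t \<in> rmat a c" for t by (rule mult_carrier_mat[OF c(1,2)])
 show "Y * W \<in> rmat a c" by (rule mult_carrier_mat[OF c(3,4)])
 fix i j assume ij: "i < a" "j < c"
 have "(\<lambda>t. \<Sum>s<b. X t $$ (i, s) * Z t $$ (s, j)) \<longlonglongrightarrow> (\<Sum>s<b. Y $$ (i, s) * W $$ (s, j))"
  using assms ij by (intro tendsto_sum tendsto_mult) (auto simp: mconv_def)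
 thus "(\<lambda>t. (X t * Z t) $$ (i, j)) \<longlonglongrightarrow> (Y * W) $$ (i, j)"
  using mult_mat_index[OF c(1,2) ij] mult_mat_index[OF c(3,4) ij] by simp
qed

lemma mconv_add:
 assumes "mconv a b X Y" "mconv a b Z W"
 shows "mconv a b (\<lambda>t. X t + Z t) (Y + W)"
proof -
 have c: "X t \<in> rmat a b" "Z t \<in> rmat a b" "Y \<in> rmat a b" "W \<in> rmat a b" for t
  using assms by (auto simp: mconv_def)
 have "(X t + Z t) $$ (i, j) = X t $$ (i, j) + Z t $$ (i, j)" if "i < a" "j < b" for t i j
  using c(2)[of t] that by simp
 thus ?thesis using assms c by (auto simp: mconv_def intro!: tendsto_add)
qed

lemma mconv_unique: "mconv a b X Y \<Longrightarrow> mconv a b X Y' \<Longrightarrow> Y = Y'"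
proof (rule eq_matI)
 assume X: "mconv a b X Y" "mconv a b X Y'"
 thus "dim_row Y = dim_row Y'" "dim_col Y = dim_col Y'" by (auto simp: mconv_def)
 fix i j assume "i < dim_row Y'" "j < dim_col Y'"
 hence "i < a" "j < b" using X by (auto simp: mconv_def)
 hence "(\<lambda>t. X t $$ (i, j)) \<longlonglongrightarrow> Y $$ (i, j)" "(\<lambda>t. X t $$ (i, j)) \<longlonglongrightarrow> Y' $$ (i, j)"
  using X by (simp_all add: mconv_def)
 thus "Y $$ (i, j) = Y' $$ (i, j)" by (rule LIMSEQ_unique)
qed

lemma mconv_BL_form:
 assumes L: "\<And>j. j < m \<Longrightarrow> L j \<in> rmat (d j) n" and A: "\<And>j. j < m \<Longrightarrow> mconv (d j) (d j) (\<lambda>t. A t j) (A' j)"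
 shows "mconv n n (\<lambda>t. BL_form n m L p (A t)) (BL_form n m L p A')"
 unfolding mconv_def
proof (intro conjI allI impI BL_form_carrier)
 fix i k assume ik: "i < n" "k < n"
 have "(\<lambda>t. \<Sum>j<m. p j * ((L j)\<^sup>T * A t j * L j) $$ (i, k)) \<longlonglongrightarrow> (\<Sum>j<m. p j * ((L j)\<^sup>T * A' j * L j) $$ (i, k))"
 proof (intro tendsto_sum tendsto_mult tendsto_const)
  fix j assume "j \<in> {..<m}"
  hence j: "j < m" by simp
  have "mconv n n (\<lambda>t. (L j)\<^sup>T * A t j * L j) ((L j)\<^sup>T * A' j * L j)"
   using L[OF j] by (intro mconv_mult[of n "d j"] mconv_const A[OF j]) auto
  thus "(\<lambda>t. ((L j)\<^sup>T * A t j * L j) $$ (i, k)) \<longlonglongrightarrow> ((L j)\<^sup>T * A' j * L j) $$ (i, k)"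
   using ik by (simp add: mconv_def)
 qed
 thus "(\<lambda>t. BL_form n m L p (A t) $$ (i, k)) \<longlonglongrightarrow> BL_form n m L p A' $$ (i, k)"
  using ik by (simp add: BL_form_def)
qed

lemma mconv_bilf:
 assumes "mconv n n X Y" "x \<in> rvec n" "y \<in> rvec n"
 shows "(\<lambda>t. bilf (X t) x y) \<longlonglongrightarrow> bilf Y x y"
proof -
 have c: "X t \<in> rmat n n" "Y \<in> rmat n n" for t using assms by (auto simp: mconv_def)
 have "(\<lambda>t. \<Sum>i<n. \<Sum>j<n. X t $$ (i, j) * x $ i * y $ j) \<longlonglongrightarrow> (\<Sum>i<n. \<Sum>j<n. Y $$ (i, j) * x $ i * y $ j)"
  using assms(1) by (intro tendsto_sum tendsto_mult tendsto_const) (auto simp: mconv_def)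
 thus ?thesis using assms(2,3) by (simp add: bilf_eq_sum[OF c(1)] bilf_eq_sum[OF c(2)])
qed

text \<open>Polarisation recovers the entries from the values of the quadratic form, so a monotone
  and bounded sequence of symmetric matrices converges entrywise.\<close>

lemma mconv_of_quadratic:
 assumes X: "\<And>t. X t \<in> rmat n n" "\<And>t. (X t)\<^sup>T = X t"
  and cv: "\<And>x. x \<in> rvec n \<Longrightarrow> convergent (\<lambda>t. qf (X t) x)"
 obtains Y where "mconv n n X Y" "Y\<^sup>T = Y"
proof -
 have c: "convergent (\<lambda>t. X t $$ (i, j))" if ij: "i < n" "j < n" for i j
 proof -
  have "(\<lambda>t. X t $$ (i, j)) = (\<lambda>t. (qf (X t) (unit_vec n i + unit_vec n j)
   - qf (X t) (unit_vec n i) - qf (X t) (unit_vec n j)) * (1 / 2))"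
  proof
   fix t
   show "X t $$ (i, j) = (qf (X t) (unit_vec n i + unit_vec n j)
   - qf (X t) (unit_vec n i) - qf (X t) (unit_vec n j)) * (1 / 2)"
    using bilf_unit[OF X(1) ij, of t] by (subst bilf_add_self[OF X]) auto
  qed
  moreover have "convergent (\<lambda>t. (qf (X t) (unit_vec n i + unit_vec n j)
   - qf (X t) (unit_vec n i) - qf (X t) (unit_vec n j)) * (1 / 2))"
   by (intro convergent_mult convergent_diff cv convergent_const) auto
  ultimately show ?thesis by simp
 qed
 define Y where "Y = mat n n (\<lambda>(i, j). lim (\<lambda>t. X t $$ (i, j)))"
 have "mconv n n X Y" using c X by (auto simp: mconv_def Y_def convergent_LIMSEQ_iff)
 moreover have "Y\<^sup>T = Y"
 proof (rule eq_matI)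
  fix i j assume "i < dim_row Y" "j < dim_col Y"
  hence ij: "i < n" "j < n" by (auto simp: Y_def)
  have "X t $$ (j, i) = X t $$ (i, j)" for t
   using arg_cong[OF X(2)[of t], of "\<lambda>M. M $$ (i, j)"] ij X(1)[of t] by simp
  thus "Y\<^sup>T $$ (i, j) = Y $$ (i, j)" using ij by (simp add: Y_def)
 qed (auto simp: Y_def)
 ultimately show thesis by (rule that)
qed

lemma pos_def_add_BL_form:
 fixes p :: "nat \<Rightarrow> real"
 assumes Q: "pos_def_mat K Q" and L: "\<And>j. j < m \<Longrightarrow> L j \<in> rmat (d j) K" and p: "\<And>j. j < m \<Longrightarrow> 0 \<le> p j"
  and A: "\<And>j. j < m \<Longrightarrow> pos_def_mat (d j) (A j)"
 shows "pos_def_mat K (Q + BL_form K m L p A)"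
  and "z \<in> rvec K \<Longrightarrow> qf (Q + BL_form K m L p A) z = qf Q z + (\<Sum>j<m. p j * qf (A j) (L j *\<^sub>v z))"
  and "z \<in> rvec K \<Longrightarrow> qf Q z \<le> qf (Q + BL_form K m L p A) z"
proof -
 note Qc = pd_carrier[OF Q]
 have z: "qf (Q + BL_form K m L p A) z = qf Q z + (\<Sum>j<m. p j * qf (A j) (L j *\<^sub>v z))"
  if "z \<in> rvec K" for z
  unfolding bilf_add_mat[OF Qc BL_form_carrier that that]
  by (subst bilf_BL_form[of m L d]) (use L A that pd_carrier in auto)
 have ge: "qf Q z \<le> qf (Q + BL_form K m L p A) z" if "z \<in> rvec K" for z
 proof -
  have "0 \<le> (\<Sum>j<m. p j * qf (A j) (L j *\<^sub>v z))"
  proof (intro sum_nonneg mult_nonneg_nonneg)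
   fix j assume "j \<in> {..<m}"
   hence j: "j < m" by simp
   show "0 \<le> p j" by (rule p[OF j])
   show "0 \<le> qf (A j) (L j *\<^sub>v z)" by (rule pd_nonneg[OF A[OF j]]) (use L[OF j] that in simp)
  qed
  thus ?thesis using z[OF that] by simp
 qed
 show "pos_def_mat K (Q + BL_form K m L p A)"
 proof (rule pdI)
  show "Q + BL_form K m L p A \<in> rmat K K" using Qc BL_form_carrier by simp
  have "(BL_form K m L p A)\<^sup>T = BL_form K m L p A"
   by (rule BL_form_sym[of m L d]) (use L A pd_carrier pd_sym[OF A] in auto)
  thus "(Q + BL_form K m L p A)\<^sup>T = Q + BL_form K m L p A"
   using Qc BL_form_carrier[of K m L p A] pd_sym[OF Q] by (simp add: transpose_add[of _ K K])
  fix v assume "v \<in> rvec K" "v \<noteq> 0\<^sub>v K"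
  thus "0 < qf (Q + BL_form K m L p A) v" using ge[of v] pd_pos[OF Q, of v] by linarith
 qed
 show "z \<in> rvec K \<Longrightarrow> qf (Q + BL_form K m L p A) z = qf Q z + (\<Sum>j<m. p j * qf (A j) (L j *\<^sub>v z))"
  by (rule z)
 show "z \<in> rvec K \<Longrightarrow> qf Q z \<le> qf (Q + BL_form K m L p A) z" by (rule ge)
qed

text \<open>The fixed point is the limit of the increasing iterates of the order preserving map
 \<open>A \<mapsto> (L\<^sub>j (Q + \<Sum> p\<^sub>j L\<^sub>j\<^sup>T A\<^sub>j L\<^sub>j)\<^sup>-\<^sup>1 L\<^sub>j\<^sup>T)\<^sup>-\<^sup>1\<close>, which the supersolution \<open>R\<close> keeps bounded.\<close>
lemma gaussian_fixed_point:
 fixes p :: "nat \<Rightarrow> real"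
 assumes Q: "pos_def_mat K Q" and L: "\<And>j. j < m \<Longrightarrow> L j \<in> rmat (d j) K"
  and surj: "\<And>j. j < m \<Longrightarrow> \<forall>y\<in>rvec (d j). \<exists>x\<in>rvec K. L j *\<^sub>v x = y"
  and p: "\<And>j. j < m \<Longrightarrow> 0 \<le> p j" and R: "0 < R"
  and super: "\<And>j v. j < m \<Longrightarrow> v \<in> rvec (d j) \<Longrightarrow>
   1 / R * nsq v \<le> qf (L j * inv_mat (Q + BL_form K m L p (\<lambda>j. R \<cdot>\<^sub>m 1\<^sub>m (d j))) * (L j)\<^sup>T) v"
 obtains A where "\<And>j. j < m \<Longrightarrow> pos_def_mat (d j) (A j)" "pos_def_mat K (Q + BL_form K m L p A)"
  "\<And>j. j < m \<Longrightarrow> A j * (L j * inv_mat (Q + BL_form K m L p A) * (L j)\<^sup>T) = 1\<^sub>m (d j)"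
  "\<And>j v. j < m \<Longrightarrow> v \<in> rvec (d j) \<Longrightarrow> qf (inv_mat (A j)) v \<le> qf (L j * inv_mat Q * (L j)\<^sup>T) v"
proof -
 define Mf where "Mf A = Q + BL_form K m L p A" for A
 define S where "S N j = L j * N * (L j)\<^sup>T" for N j
 define good where "good A \<longleftrightarrow> (\<forall>j<m. pos_def_mat (d j) (A j))" for A
 define le where "le A B \<longleftrightarrow> (\<forall>j<m. \<forall>v\<in>rvec (d j). qf (A j) v \<le> qf (B j) v)" for A B :: "nat \<Rightarrow> real mat"
 note Qc = pd_carrier[OF Q]
 have Mfz: "qf (Mf A) z = qf Q z + (\<Sum>j<m. p j * qf (A j) (L j *\<^sub>v z))"
  if "good A" "z \<in> rvec K" for A z
  unfolding Mf_def by (rule pos_def_add_BL_form(2)[of K Q m L d]) (use Q L p that in \<open>auto simp: good_def\<close>)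
 have LG: "L j *\<^sub>v z \<in> rvec (d j)" if "j < m" "z \<in> rvec K" for j z
  using L[OF that(1)] that(2) by simp
 have Mfge: "qf Q z \<le> qf (Mf A) z" if "good A" "z \<in> rvec K" for A z
  unfolding Mf_def by (rule pos_def_add_BL_form(3)[of K Q m L d]) (use Q L p that in \<open>auto simp: good_def\<close>)
 have Mfpd: "pos_def_mat K (Mf A)" if "good A" for A
  unfolding Mf_def by (rule pos_def_add_BL_form(1)[of K Q m L d]) (use Q L p that in \<open>auto simp: good_def\<close>)
 have Spd: "pos_def_mat (d j) (S N j)" if "pos_def_mat K N" "j < m" for N j
  unfolding S_def by (rule pos_def_congruence[OF L[OF that(2)] surj[OF that(2)] that(1)])
 have Sb: "qf (S N j) v = qf N ((L j)\<^sup>T *\<^sub>v v)"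
  if "pos_def_mat K N" "j < m" "v \<in> rvec (d j)" for N j v
  unfolding S_def by (rule bilf_congruence'[OF L[OF that(2)] pd_carrier[OF that(1)] that(3,3)])
 define F where "F N j = inv_mat (S (inv_mat N) j)" for N j
 have Fgood: "good (F N)" if "pos_def_mat K N" for N
  unfolding good_def F_def using pd_inv(4)[OF Spd[OF pd_inv(4)[OF that]]] by blast
 \<comment> \<open>Each of the two inversions reverses the order, so their composition with a
   congruence preserves it.\<close>
 have Fmono: "le (F N) (F N')" if N: "pos_def_mat K N" "pos_def_mat K N'"
  and NN: "\<And>z. z \<in> rvec K \<Longrightarrow> qf N z \<le> qf N' z" for N N'
  unfolding le_def F_def
 proof (intro allI impI ballI)
  fix j and v :: "real vec" assume j: "j < m" and v: "v \<in> rvec (d j)"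
  show "qf (inv_mat (S (inv_mat N) j)) v \<le> qf (inv_mat (S (inv_mat N') j)) v"
  proof (rule bilf_inv_antimono[OF _ _ v])
   fix z assume z: "z \<in> rvec (d j)"
   have "(L j)\<^sup>T *\<^sub>v z \<in> rvec K" using L[OF j] z by simp
   from bilf_inv_antimono[OF N this NN]
   show "qf (S (inv_mat N') j) z \<le> qf (S (inv_mat N) j) z"
    by (simp add: Sb[OF pd_inv(4) j z] N)
  qed (use Spd pd_inv(4) N j in auto)
 qed
 have Mfmono: "qf (Mf A) z \<le> qf (Mf B) z" if "good A" "good B" "le A B" "z \<in> rvec K" for A B z
  unfolding Mfz[OF that(1,4)] Mfz[OF that(2,4)]
  using p that LG by (intro add_left_mono sum_mono mult_left_mono) (auto simp: le_def)
 \<comment> \<open>The start is the value of the map at the zero tuple, where the form reduces to Q;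
   it lies below every later value, so the sequence increases.\<close>
 define A where "A = rec_nat (F Q) (\<lambda>_ A. F (Mf A))"
 have A0: "A 0 = F Q" and AS: "A (Suc t) = F (Mf (A t))" for t by (simp_all add: A_def)
 have good: "good (A t)" for t by (induction t) (simp_all add: A0 AS Fgood Q Mfpd)
 have inc: "le (A t) (A (Suc t))" for t
 proof (induction t)
  case 0
  show ?case unfolding A0 AS by (rule Fmono[OF Q Mfpd[OF good] Mfge[OF good], of 0, unfolded A0])
 next
  case (Suc t)
  show ?case unfolding AS[of "Suc t"] unfolding AS[of t]
   by (rule Fmono[OF Mfpd Mfpd Mfmono]) (use good Suc in \<open>auto simp: AS[symmetric]\<close>)
 qed
 define RR where "RR = (\<lambda>j. R \<cdot>\<^sub>m 1\<^sub>m (d j))"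
 have RRgood: "good RR" unfolding good_def RR_def using pos_def_smult[OF pos_def_one R] by blast
 \<comment> \<open>Inverting the hypothesis \<open>super\<close>: the map sends the tuple R times
   the identity below itself.\<close>
 have Fle: "le (F (Mf RR)) RR"
  unfolding le_def F_def
 proof (intro allI impI ballI)
  fix j and v :: "real vec" assume j: "j < m" and v: "v \<in> rvec (d j)"
  have R1: "pos_def_mat (d j) ((1 / R) \<cdot>\<^sub>m 1\<^sub>m (d j))" by (rule pos_def_smult[OF pos_def_one]) (use R in simp)
  have "qf (inv_mat (S (inv_mat (Mf RR)) j)) v \<le> qf (inv_mat ((1 / R) \<cdot>\<^sub>m 1\<^sub>m (d j))) v"
  proof (rule bilf_inv_antimono[OF R1 Spd[OF pd_inv(4)[OF Mfpd[OF RRgood]] j] v])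
   fix z assume z: "z \<in> rvec (d j)"
   show "qf ((1 / R) \<cdot>\<^sub>m 1\<^sub>m (d j)) z \<le> qf (S (inv_mat (Mf RR)) j) z"
    using super[OF j z] z by (simp add: S_def Mf_def RR_def bilf_smult_mat[of _ "d j"] bilf_one)
  qed
  also have "inv_mat ((1 / R) \<cdot>\<^sub>m 1\<^sub>m (d j)) = RR j"
  proof (rule inv_mat_eqI)
   show "(1 / R) \<cdot>\<^sub>m 1\<^sub>m (d j) * RR j = 1\<^sub>m (d j)"
    using R by (simp add: RR_def mult_smult_assoc_mat[of _ "d j" "d j" _ "d j"] mult_smult_distrib[of _ "d j" "d j" _ "d j"] smult_smult_mat) (auto intro!: eq_matI)
  qed (auto simp: RR_def)
  finally show "qf (inv_mat (S (inv_mat (Mf RR)) j)) v \<le> qf (RR j) v" .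
 qed
 have letrans: "le B D" if "le B C" "le C D" for B C D
  using that by (force simp: le_def)
 have bnd: "le (A t) RR" for t
 proof (induction t)
  case 0
  show ?case unfolding A0 by (rule letrans[OF Fmono[OF Q Mfpd[OF RRgood] Mfge[OF RRgood]] Fle])
 next
  case (Suc t)
  show ?case unfolding AS by (rule letrans[OF Fmono[OF Mfpd Mfpd Mfmono] Fle]) (use good RRgood Suc in auto)
 qed
 have "\<forall>j. \<exists>Y. j < m \<longrightarrow> mconv (d j) (d j) (\<lambda>t. A t j) Y \<and> Y\<^sup>T = Y"
 proof
  fix j
  show "\<exists>Y. j < m \<longrightarrow> mconv (d j) (d j) (\<lambda>t. A t j) Y \<and> Y\<^sup>T = Y"
  proof (cases "j < m")
   case True
   have pd: "pos_def_mat (d j) (A t j)" for t using good True by (simp add: good_def)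
   obtain Y where "mconv (d j) (d j) (\<lambda>t. A t j) Y" "Y\<^sup>T = Y"
   proof (rule mconv_of_quadratic)
    show "A t j \<in> rmat (d j) (d j)" "(A t j)\<^sup>T = A t j" for t
     using pd_carrier[OF pd] pd_sym[OF pd] by auto
    fix x assume x: "x \<in> rvec (d j)"
    have "incseq (\<lambda>t. qf (A t j) x)"
     using inc True x by (intro incseq_SucI) (auto simp: le_def)
    moreover have "\<forall>t. qf (A t j) x \<le> qf (RR j) x" using bnd True x by (auto simp: le_def)
    ultimately show "convergent (\<lambda>t. qf (A t j) x)"
     using incseq_convergent by (metis convergentI)
   qed
   thus ?thesis by blast
  qed simp
 qed
 then obtain Y where Y: "\<And>j. j < m \<Longrightarrow> mconv (d j) (d j) (\<lambda>t. A t j) (Y j)" "\<And>j. j < m \<Longrightarrow> (Y j)\<^sup>T = Y j"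
  by metis
 define N where "N t = inv_mat (Mf (A t))" for t
 have Npd: "pos_def_mat K (N t)" for t unfolding N_def by (rule pd_inv(4)[OF Mfpd[OF good]])
 \<comment> \<open>The inverses converge by monotonicity of their own. Passing to the limit in the
   identity Mf (A t) N t = 1 then identifies their limit, in place of an appeal to continuity of
   inversion.\<close>
 obtain N' where N': "mconv K K N N'"
 proof (rule mconv_of_quadratic)
  show "N t \<in> rmat K K" "(N t)\<^sup>T = N t" for t
   using pd_carrier[OF Npd] pd_sym[OF Npd] by auto
  fix x assume x: "x \<in> rvec K"
  have "decseq (\<lambda>t. qf (N t) x)"
   unfolding N_def
   by (intro decseq_SucI bilf_inv_antimono[OF Mfpd[OF good] Mfpd[OF good] x] Mfmono good inc)
  moreover have "\<forall>t. 0 \<le> qf (N t) x" using pd_nonneg[OF Npd x] by blast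
  ultimately show "convergent (\<lambda>t. qf (N t) x)"
   using decseq_convergent by (metis convergentI)
 qed
 \<comment> \<open>The limit stays above the first iterate and is therefore positive definite; the
   same comparison gives the bound on the inverse in the conclusion.\<close>
 have Yge: "qf (F Q j) v \<le> qf (Y j) v" if j: "j < m" and v: "v \<in> rvec (d j)" for j v
 proof (rule LIMSEQ_le_const[OF mconv_bilf[OF Y(1)[OF j] v v]])
  have "qf (A 0 j) v \<le> qf (A t j) v" for t
  proof (induction t)
   case (Suc t)
   thus ?case using inc[of t] j v by (force simp: le_def)
  qed simp
  thus "\<exists>n0. \<forall>t\<ge>n0. qf (F Q j) v \<le> qf (A t j) v" by (simp add: A0)
 qed
 have FQ: "pos_def_mat (d j) (F Q j)" if "j < m" for j using Fgood[OF Q] that by (simp add: good_def)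
 have Ypd: "pos_def_mat (d j) (Y j)" if j: "j < m" for j
 proof (rule pdI[OF _ Y(2)[OF j]])
  show "Y j \<in> rmat (d j) (d j)" using Y(1)[OF j] by (simp add: mconv_def)
  fix v assume "v \<in> rvec (d j)" "v \<noteq> 0\<^sub>v (d j)"
  thus "0 < qf (Y j) v" using Yge[OF j, of v] pd_pos[OF FQ[OF j], of v] by linarith
 qed
 hence Ygood: "good Y" by (simp add: good_def)
 have Mconv: "mconv K K (\<lambda>t. Mf (A t)) (Mf Y)"
  unfolding Mf_def by (intro mconv_add mconv_const[OF Qc] mconv_BL_form[of m L d]) (use L Y in auto)
 have "mconv K K (\<lambda>t. Mf (A t) * N t) (Mf Y * N')" by (rule mconv_mult[OF Mconv N'])
 moreover have "(\<lambda>t. Mf (A t) * N t) = (\<lambda>t. 1\<^sub>m K)"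
  unfolding N_def using pd_inv(2)[OF Mfpd[OF good]] by auto
 ultimately have "Mf Y * N' = 1\<^sub>m K" using mconv_unique[OF _ mconv_const[of "1\<^sub>m K" K K]] by auto
 hence N'eq: "inv_mat (Mf Y) = N'"
  using N' by (intro inv_mat_eqI[OF pd_carrier[OF Mfpd[OF Ygood]]]) (auto simp: mconv_def)
 have fp: "Y j * S N' j = 1\<^sub>m (d j)" if j: "j < m" for j
 proof -
  have "mconv (d j) (d j) (\<lambda>t. A (Suc t) j * S (N t) j) (Y j * S N' j)"
  proof (rule mconv_mult)
   show "mconv (d j) (d j) (\<lambda>t. A (Suc t) j) (Y j)"
    using Y(1)[OF j] by (auto simp: mconv_def intro: LIMSEQ_Suc)
   show "mconv (d j) (d j) (\<lambda>t. S (N t) j) (S N' j)"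
    unfolding S_def using L[OF j] by (intro mconv_mult[of "d j" K] mconv_const N') auto
  qed
  moreover have "(\<lambda>t. A (Suc t) j * S (N t) j) = (\<lambda>t. 1\<^sub>m (d j))"
   using pd_inv(3)[OF Spd[OF Npd j]] by (auto simp: AS F_def N_def)
  ultimately show ?thesis using mconv_unique[OF _ mconv_const[of "1\<^sub>m (d j)" "d j" "d j"]] by auto
 qed
 show thesis
 proof (rule that[of Y])
  show "pos_def_mat K (Q + BL_form K m L p Y)" using Mfpd[OF Ygood] by (simp add: Mf_def)
  fix j assume j: "j < m"
  show "pos_def_mat (d j) (Y j)" by (rule Ypd[OF j])
  show "Y j * (L j * inv_mat (Q + BL_form K m L p Y) * (L j)\<^sup>T) = 1\<^sub>m (d j)"
   using fp[OF j] N'eq by (simp add: S_def Mf_def)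
  fix v assume v: "v \<in> rvec (d j)"
  have "qf (inv_mat (Y j)) v \<le> qf (inv_mat (F Q j)) v"
   by (rule bilf_inv_antimono[OF FQ[OF j] Ypd[OF j] v Yge[OF j]])
  also have "inv_mat (F Q j) = S (inv_mat Q) j"
   unfolding F_def by (rule inv_mat_inv_mat[OF Spd[OF pd_inv(4)[OF Q] j]])
  finally show "qf (inv_mat (Y j)) v \<le> qf (L j * inv_mat Q * (L j)\<^sup>T) v" by (simp add: S_def)
 qed
qed

section \<open>Block vectors\<close>

lemma sum_lessThan_add: "(\<Sum>k<a + b. g k) = (\<Sum>k<a. g k) + (\<Sum>k<b. g (a + k))" for g :: "nat \<Rightarrow> real"
 by (induction b) simp_all

lemma measurable_append_vec [measurable (raw)]:
 assumes "f \<in> N \<rightarrow>\<^sub>M leb a" "g \<in> N \<rightarrow>\<^sub>M leb b"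
 shows "(\<lambda>x. f x @\<^sub>v g x) \<in> N \<rightarrow>\<^sub>M leb (a + b)"
proof (rule measurable_lebI)
 note c = measurable_leb_carrier[OF assms(1)] measurable_leb_carrier[OF assms(2)]
 show "f x @\<^sub>v g x \<in> rvec (a + b)" if "x \<in> space N" for x using c[OF that] by simp
 fix i assume i: "i < a + b"
 have "(\<lambda>x. if i < a then f x $ i else g x $ (i - a)) \<in> borel_measurable N"
  using measurable_leb_index[OF assms(1), of i] measurable_leb_index[OF assms(2), of "i - a"] i
  by (cases "i < a") auto
 thus "(\<lambda>x. (f x @\<^sub>v g x) $ i) \<in> borel_measurable N"
 proof (rule measurable_cong[THEN iffD1, rotated])
  fix x assume "x \<in> space N"
  hence "f x \<in> rvec a" "g x \<in> rvec b" using c by auto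
  thus "(if i < a then f x $ i else g x $ (i - a)) = (f x @\<^sub>v g x) $ i" using i by auto
 qed
qed

lemma nn_integral_leb_append:
 assumes "f \<in> bmeas (a + b)"
 shows "(\<integral>\<^sup>+z. f z \<partial>leb (a + b)) = (\<integral>\<^sup>+x. \<integral>\<^sup>+y. f (x @\<^sub>v y) \<partial>leb b \<partial>leb a)"
 using assms
proof (induction b arbitrary: f)
 case 0
 have "(\<integral>\<^sup>+x. \<integral>\<^sup>+y. f (x @\<^sub>v y) \<partial>leb 0 \<partial>leb a) = (\<integral>\<^sup>+x. f x \<partial>leb a)"
  unfolding nn_integral_leb_0
 proof (rule nn_integral_cong)
  fix x assume "x \<in> space (leb a)"
  hence "x @\<^sub>v 0\<^sub>v 0 = x" by (intro eq_vecI) auto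
  thus "f (x @\<^sub>v 0\<^sub>v 0) = f x" by simp
 qed
 thus ?case by simp
next
 case (Suc b)
 have [measurable]: "f \<in> bmeas (Suc (a + b))" using Suc.prems by simp
 interpret sb: sigma_finite_measure "leb b" by (rule sigma_finite_leb)
 have "(\<integral>\<^sup>+z. f z \<partial>leb (a + Suc b)) = (\<integral>\<^sup>+z. \<integral>\<^sup>+t. f (vsnoc z t) \<partial>lborel \<partial>leb (a + b))"
  by (simp add: nn_integral_leb_Suc)
 also have "... = (\<integral>\<^sup>+x. \<integral>\<^sup>+y. \<integral>\<^sup>+t. f (vsnoc (x @\<^sub>v y) t) \<partial>lborel \<partial>leb b \<partial>leb a)"
  by (rule Suc.IH) measurable
 also have "... = (\<integral>\<^sup>+x. \<integral>\<^sup>+y. \<integral>\<^sup>+t. f (x @\<^sub>v vsnoc y t) \<partial>lborel \<partial>leb b \<partial>leb a)"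
 proof (intro nn_integral_cong arg_cong[of _ _ f])
  fix x y t assume "x \<in> space (leb a)" "y \<in> space (leb b)"
  thus "vsnoc (x @\<^sub>v y) t = x @\<^sub>v vsnoc y t"
   by (intro eq_vecI) (auto simp: vsnoc_def)
 qed
 also have "... = (\<integral>\<^sup>+x. \<integral>\<^sup>+y. f (x @\<^sub>v y) \<partial>leb (Suc b) \<partial>leb a)"
 proof (rule nn_integral_cong)
  fix x assume "x \<in> space (leb a)"
  hence "(\<lambda>y. x @\<^sub>v y) \<in> leb (Suc b) \<rightarrow>\<^sub>M leb (a + Suc b)"
   by (intro measurable_append_vec) auto
  hence "(\<lambda>y. f (x @\<^sub>v y)) \<in> bmeas (Suc b)"
   by (rule measurable_compose) (rule Suc.prems)
  thus "(\<integral>\<^sup>+y. \<integral>\<^sup>+t. f (x @\<^sub>v vsnoc y t) \<partial>lborel \<partial>leb b) = (\<integral>\<^sup>+y. f (x @\<^sub>v y) \<partial>leb (Suc b))"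
   by (simp add: nn_integral_leb_Suc)
 qed
 finally show ?case .
qed

text \<open>The position at which block m starts when blocks of sizes d 0, d 1, ... are
  concatenated, equally the total length of the first m blocks.\<close>

definition off :: "(nat \<Rightarrow> nat) \<Rightarrow> nat \<Rightarrow> nat" where
 "off d m = (\<Sum>i<m. d i)"

lemma off_0 [simp]: "off d 0 = 0" and off_Suc [simp]: "off d (Suc m) = off d m + d m"
 by (simp_all add: off_def)

lemma off_less: "j < m \<Longrightarrow> i < d j \<Longrightarrow> off d j + i < off d m"
 by (induction m) (auto simp: less_Suc_eq)

definition vblock :: "(nat \<Rightarrow> nat) \<Rightarrow> nat \<Rightarrow> real vec \<Rightarrow> real vec" where
 "vblock d j w = vec (d j) (\<lambda>i. w $ (off d j + i))"

lemma vblock_carrier [simp]: "vblock d j w \<in> rvec (d j)"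
 by (simp add: vblock_def)

lemma measurable_vblock: "j < m \<Longrightarrow> vblock d j \<in> leb (off d m) \<rightarrow>\<^sub>M leb (d j)"
 by (rule measurable_lebI) (auto simp: vblock_def intro!: measurable_vec_index off_less)

lemma sum_off: "(\<Sum>k<off d m. g k) = (\<Sum>j<m. \<Sum>i<d j. g (off d j + i))" for g :: "nat \<Rightarrow> real"
 by (induction m) (simp_all add: sum_lessThan_add)

lemma scalar_prod_vblock:
 assumes "w \<in> rvec (off d m)" shows "nsq w = (\<Sum>j<m. vblock d j w \<bullet> vblock d j w)"
 unfolding scalar_prod_eq_sum[OF assms] scalar_prod_eq_sum[OF vblock_carrier] sum_off by (simp add: vblock_def)

text \<open>Fubini's theorem, by induction on the number of blocks with the last block split
  off.\<close>

lemma nn_integral_vblock_prod: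
 assumes "\<And>j. j < m \<Longrightarrow> \<phi> j \<in> bmeas (d j)"
 shows "(\<integral>\<^sup>+w. (\<Prod>j<m. \<phi> j (vblock d j w)) \<partial>leb (off d m)) = (\<Prod>j<m. \<integral>\<^sup>+y. \<phi> j y \<partial>leb (d j) :: ennreal)"
 using assms
proof (induction m)
 case 0
 show ?case by (simp only: off_0 nn_integral_leb_0) simp
next
 case (Suc m)
 have pm: "(\<lambda>w. \<Prod>j<m'. \<phi> j (vblock d j w)) \<in> bmeas (off d m')" if "m' \<le> Suc m" for m'
  by (intro borel_measurable_prod_ennreal measurable_compose[OF measurable_vblock]) (use that Suc.prems in auto)
 have "(\<integral>\<^sup>+w. (\<Prod>j<Suc m. \<phi> j (vblock d j w)) \<partial>leb (off d (Suc m)))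
  = (\<integral>\<^sup>+x. \<integral>\<^sup>+y. (\<Prod>j<Suc m. \<phi> j (vblock d j (x @\<^sub>v y))) \<partial>leb (d m) \<partial>leb (off d m))"
  using nn_integral_leb_append[OF pm[of "Suc m", simplified off_Suc]] by simp
 also have "... = (\<integral>\<^sup>+x. (\<Prod>j<m. \<phi> j (vblock d j x)) * (\<integral>\<^sup>+y. \<phi> m y \<partial>leb (d m)) \<partial>leb (off d m))"
 proof (rule nn_integral_cong)
  fix x assume "x \<in> space (leb (off d m))"
  hence x: "x \<in> rvec (off d m)" by simp
  have "(\<integral>\<^sup>+y. (\<Prod>j<Suc m. \<phi> j (vblock d j (x @\<^sub>v y))) \<partial>leb (d m))
   = (\<integral>\<^sup>+y. (\<Prod>j<m. \<phi> j (vblock d j x)) * \<phi> m y \<partial>leb (d m))"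
  proof (rule nn_integral_cong)
   fix y assume "y \<in> space (leb (d m))"
   hence y: "y \<in> rvec (d m)" by simp
   have "vblock d j (x @\<^sub>v y) = vblock d j x" if "j < m" for j
    using x y off_less[OF that] by (intro eq_vecI) (auto simp: vblock_def trans_less_add1)
   moreover have "vblock d m (x @\<^sub>v y) = y"
    using x y by (intro eq_vecI) (auto simp: vblock_def)
   ultimately show "(\<Prod>j<Suc m. \<phi> j (vblock d j (x @\<^sub>v y))) = (\<Prod>j<m. \<phi> j (vblock d j x)) * \<phi> m y" by simp
  qed
  also have "... = (\<Prod>j<m. \<phi> j (vblock d j x)) * (\<integral>\<^sup>+y. \<phi> m y \<partial>leb (d m))"
   using Suc.prems by (intro nn_integral_cmult) simp
  finally show "(\<integral>\<^sup>+y. (\<Prod>j<Suc m. \<phi> j (vblock d j (x @\<^sub>v y))) \<partial>leb (d m))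
   = (\<Prod>j<m. \<phi> j (vblock d j x)) * (\<integral>\<^sup>+y. \<phi> m y \<partial>leb (d m))" .
 qed
 also have "... = (\<integral>\<^sup>+x. (\<Prod>j<m. \<phi> j (vblock d j x)) \<partial>leb (off d m)) * (\<integral>\<^sup>+y. \<phi> m y \<partial>leb (d m))"
  by (rule nn_integral_multc[OF pm]) simp
 also have "... = (\<Prod>j<Suc m. \<integral>\<^sup>+y. \<phi> j y \<partial>leb (d j))" using Suc.IH Suc.prems by simp
 finally show ?case .
qed

section \<open>Extension by auxiliary variables\<close>

text \<open>The matrix of (x, w) -> L_j x + mu w_j, where w_j is the j-th block of w. Each map
  receives its own auxiliary block.\<close>

definition ext_map :: "nat \<Rightarrow> nat \<Rightarrow> (nat \<Rightarrow> nat) \<Rightarrow> (nat \<Rightarrow> real mat) \<Rightarrow> real \<Rightarrow> nat \<Rightarrow> real mat" where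
 "ext_map n m d L \<mu> j = mat (d j) (n + off d m) (\<lambda>(i, k). if k < n then L j $$ (i, k) else if k = n + off d j + i then \<mu> else 0)"

text \<open>The matrix of eps |x|^2 + |w|^2. Only the weight of x is sent to 0; the Gaussian in w
  survives in the limit and integrates to 1.\<close>

definition ext_form :: "nat \<Rightarrow> nat \<Rightarrow> real \<Rightarrow> real mat" where
 "ext_form n D \<epsilon> = diagm (n + D) (\<lambda>i. if i < n then \<epsilon> else 1)"

lemma ext_map_carrier [simp]: "ext_map n m d L \<mu> j \<in> rmat (d j) (n + off d m)"
 by (simp add: ext_map_def)

lemma ext_form_carrier [simp]: "ext_form n D \<epsilon> \<in> rmat (n + D) (n + D)"
 by (simp add: ext_form_def)

lemma ext_map_mult:
 assumes j: "j < m" and L: "L j \<in> rmat (d j) n" and x: "x \<in> rvec n" and w: "w \<in> rvec (off d m)"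
 shows "ext_map n m d L \<mu> j *\<^sub>v (x @\<^sub>v w) = L j *\<^sub>v x + \<mu> \<cdot>\<^sub>v vblock d j w"
proof (rule eq_vecI)
 show "dim_vec (ext_map n m d L \<mu> j *\<^sub>v (x @\<^sub>v w)) = dim_vec (L j *\<^sub>v x + \<mu> \<cdot>\<^sub>v vblock d j w)"
  by (simp add: ext_map_def vblock_def)
 fix i assume "i < dim_vec (L j *\<^sub>v x + \<mu> \<cdot>\<^sub>v vblock d j w)"
 hence i: "i < d j" by (simp add: vblock_def)
 have xw: "x @\<^sub>v w \<in> rvec (n + off d m)" using x w by simp
 have "(ext_map n m d L \<mu> j *\<^sub>v (x @\<^sub>v w)) $ i = (\<Sum>k<n + off d m. ext_map n m d L \<mu> j $$ (i, k) * (x @\<^sub>v w) $ k)"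
  by (rule mult_vec_index[OF ext_map_carrier xw i])
 also have "... = (\<Sum>k<n. L j $$ (i, k) * x $ k) + (\<Sum>k<off d m. (if k = off d j + i then \<mu> else 0) * w $ k)"
  unfolding sum_lessThan_add using x w i by (intro arg_cong2[of _ _ _ _ "(+)"] sum.cong) (auto simp: ext_map_def)
 also have "(\<Sum>k<off d m. (if k = off d j + i then \<mu> else 0) * w $ k) = (\<Sum>k<off d m. if k = off d j + i then \<mu> * w $ k else 0)"
  by (intro sum.cong) auto
 also have "... = \<mu> * w $ (off d j + i)" using off_less[of j m i d] j i by simp
 also have "(\<Sum>k<n. L j $$ (i, k) * x $ k) = (L j *\<^sub>v x) $ i" by (rule mult_vec_index[OF L x i, symmetric])
 finally show "(ext_map n m d L \<mu> j *\<^sub>v (x @\<^sub>v w)) $ i = (L j *\<^sub>v x + \<mu> \<cdot>\<^sub>v vblock d j w) $ i"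
  using i L by (simp add: vblock_def)
qed

lemma bilf_ext_form:
 assumes x: "x \<in> rvec n" and w: "w \<in> rvec D"
 shows "qf (ext_form n D \<epsilon>) (x @\<^sub>v w) = \<epsilon> * nsq x + nsq w"
proof -
 have xw: "x @\<^sub>v w \<in> rvec (n + D)" using x w by simp
 hence c: "ext_form n D \<epsilon> *\<^sub>v (x @\<^sub>v w) \<in> rvec (n + D)" by (rule mult_mat_vec_carrier[OF ext_form_carrier])
 have "qf (ext_form n D \<epsilon>) (x @\<^sub>v w) = (\<Sum>k<n + D. (x @\<^sub>v w) $ k * ((if k < n then \<epsilon> else 1) * (x @\<^sub>v w) $ k))"
  unfolding bilf_def scalar_prod_eq_sum[OF c]
  by (intro sum.cong refl) (simp only: ext_form_def lessThan_iff diagm_mult_vec[OF _ xw])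
 also have "... = (\<Sum>k<n. \<epsilon> * (x $ k * x $ k)) + (\<Sum>k<D. w $ k * w $ k)"
  unfolding sum_lessThan_add using x w by (intro arg_cong2[of _ _ _ _ "(+)"] sum.cong) auto
 finally show ?thesis
  by (simp add: scalar_prod_eq_sum[OF x] scalar_prod_eq_sum[OF w] sum_distrib_left)
qed

lemma pos_def_ext_form:
 assumes "0 < \<epsilon>" shows "pos_def_mat (n + D) (ext_form n D \<epsilon>)"
proof (rule pdI)
 show "(ext_form n D \<epsilon>)\<^sup>T = ext_form n D \<epsilon>"
  by (rule eq_matI) (auto simp: ext_form_def diagm_def)
 fix v assume v: "v \<in> rvec (n + D)" "v \<noteq> 0\<^sub>v (n + D)"
 define x w where "x = vec_first v n" and "w = vec_last v D"
 have xw: "x \<in> rvec n" "w \<in> rvec D" "v = x @\<^sub>v w" using v by (auto simp: x_def w_def)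
 have "x \<noteq> 0\<^sub>v n \<or> w \<noteq> 0\<^sub>v D" using v xw by auto
 hence "0 < nsq x \<or> 0 < nsq w"
  using nsq_eq_0[OF xw(1)] nsq_eq_0[OF xw(2)] nsq_nonneg[of x] nsq_nonneg[of w] by linarith
 thus "0 < qf (ext_form n D \<epsilon>) v"
  unfolding xw(3) bilf_ext_form[OF xw(1,2)]
  using assms nsq_nonneg[of x] nsq_nonneg[of w]
  by (auto intro: add_pos_nonneg add_nonneg_pos)
qed simp

text \<open>Completing the square in \<open>w\<close>.\<close>
lemma nn_integral_gauss_block:
 assumes A: "pos_def_mat k A" and s: "0 \<le> s"
 obtains B c where "pos_def_mat k B" "1 \<le> c" "det A = det B * c"
  "\<And>u. u \<in> rvec k \<Longrightarrow>
   (\<integral>\<^sup>+w. ennreal (exp (- pi * (nsq w + s * qf A (u + \<mu> \<cdot>\<^sub>v w)))) \<partial>leb k)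
    = ennreal (1 / sqrt c * exp (- pi * (s * qf B u)))"
  "\<And>\<kappa>. 0 < \<kappa> \<Longrightarrow> (\<And>v. v \<in> rvec k \<Longrightarrow> qf (inv_mat A) v \<le> \<kappa> * nsq v) \<Longrightarrow>
   (1 / (\<kappa> + s * \<mu>\<^sup>2)) ^ k \<le> det B"
proof -
 obtain U l where U: "orth_mat k U" "A = spec_mat k U l" "\<And>i. i < k \<Longrightarrow> 0 < l i"
  using pos_def_spec_mat[OF A] by blast
 \<comment> \<open>The entries of \<open>r\<close> are the eigenvalues of C = 1 + s mu^2 A, and B =
   A C^(-1), so that B^(-1) = A^(-1) + s mu^2. The determinant of \<open>C\<close> is the c of the
   conclusion.\<close>
 define r where "r i = 1 + s * \<mu>\<^sup>2 * l i" for i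
 have r1: "1 \<le> r i" if "i < k" for i using s U(3)[OF that] by (simp add: r_def)
 have r: "0 < r i" if "i < k" for i using r1[OF that] by simp
 define B where "B = spec_mat k U (\<lambda>i. l i / r i)"
 define C where "C = spec_mat k U r"
 have Bpd: "pos_def_mat k B" unfolding B_def by (rule spec_mat_pos_def[OF U(1)]) (use U(3) r in simp)
 have Cpd: "pos_def_mat k C" unfolding C_def by (rule spec_mat_pos_def[OF U(1) r])
 note Uc = orth_mat_carrier[OF U(1)]
 have UTc: "U\<^sup>T \<in> rmat k k" using Uc by simp
 have dC: "det C = (\<Prod>i<k. r i)" unfolding C_def by (rule det_spec_mat[OF U(1)])
 have dB: "det B = (\<Prod>i<k. l i / r i)" unfolding B_def by (rule det_spec_mat[OF U(1)])
 have dA: "det A = (\<Prod>i<k. l i)" unfolding U(2) by (rule det_spec_mat[OF U(1)])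
 have 1: "det A = det B * det C"
  unfolding dA dB dC prod.distrib[symmetric] by (intro prod.cong refl) (use r in force)
 have 2: "1 \<le> det C" unfolding dC by (rule prod_ge_1) (use r1 in auto)
 have 3: "(\<integral>\<^sup>+w. ennreal (exp (- pi * (nsq w + s * qf A (u + \<mu> \<cdot>\<^sub>v w)))) \<partial>leb k)
    = ennreal (1 / sqrt (det C) * exp (- pi * (s * qf B u)))" if u: "u \<in> rvec k" for u
 proof -
  \<comment> \<open>The shift of w that removes the cross term between u and w, computed in
    eigencoordinates.\<close>
  define a where "a = U *\<^sub>v vec k (\<lambda>i. s * \<mu> * l i / r i * (U\<^sup>T *\<^sub>v u) $ i)"
  have a: "a \<in> rvec k" unfolding a_def using Uc by simp
  have Ua: "U\<^sup>T *\<^sub>v a = vec k (\<lambda>i. s * \<mu> * l i / r i * (U\<^sup>T *\<^sub>v u) $ i)"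
   unfolding a_def by (rule mult_right_inv_vec[OF UTc Uc]) (use U(1) in \<open>auto simp: orth_mat_def\<close>)
  have sq: "nsq w + s * qf A (u + \<mu> \<cdot>\<^sub>v w) = qf C (w + a) + s * qf B u"
   if w: "w \<in> rvec k" for w
  proof -
   define y z where "y = U\<^sup>T *\<^sub>v u" and "z = U\<^sup>T *\<^sub>v w"
   have yz: "y \<in> rvec k" "z \<in> rvec k" using UTc u w by (auto simp: y_def z_def)
   have c1: "U\<^sup>T *\<^sub>v (u + \<mu> \<cdot>\<^sub>v w) = y + \<mu> \<cdot>\<^sub>v z"
    using UTc u w by (simp add: mult_add_distrib_mat_vec[of _ k k] mult_mat_vec[of _ k k] y_def z_def)
   have c2: "U\<^sup>T *\<^sub>v (w + a) = z + U\<^sup>T *\<^sub>v a"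
    using UTc a w by (simp add: mult_add_distrib_mat_vec[of _ k k] z_def)
   have "u + \<mu> \<cdot>\<^sub>v w \<in> rvec k" "w + a \<in> rvec k" using u w a by auto
   note b = bilf_spec_mat[OF U(1) this(1), of l] bilf_spec_mat[OF U(1) this(2), of r] bilf_spec_mat[OF U(1) u, of "\<lambda>i. l i / r i"]
   have "nsq w + s * qf A (u + \<mu> \<cdot>\<^sub>v w) = (\<Sum>i<k. (z $ i)\<^sup>2 + s * (l i * (y $ i + \<mu> * z $ i)\<^sup>2))"
    unfolding U(2) b(1) c1 orth_mat_norm[OF U(1) w, symmetric] z_def[symmetric]
    using yz by (simp add: sum.distrib sum_distrib_left)
   also have "... = (\<Sum>i<k. r i * (z $ i + s * \<mu> * l i / r i * y $ i)\<^sup>2 + s * (l i / r i * (y $ i)\<^sup>2))"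
   proof (intro sum.cong refl)
    fix i assume "i \<in> {..<k}"
    hence ri: "r i \<noteq> 0" using r[of i] by auto
    have "r i * (z $ i + s * \<mu> * l i / r i * y $ i)\<^sup>2 + s * (l i / r i * (y $ i)\<^sup>2)
     = r i * (z $ i)\<^sup>2 + 2 * s * \<mu> * l i * y $ i * z $ i + (s * l i * (y $ i)\<^sup>2) * ((1 + s * \<mu>\<^sup>2 * l i) / r i)"
     using ri by (simp add: power2_eq_square field_simps)
    also have "(1 + s * \<mu>\<^sup>2 * l i) / r i = 1" using ri by (simp add: r_def)
    also have "r i * (z $ i)\<^sup>2 + 2 * s * \<mu> * l i * y $ i * z $ i + (s * l i * (y $ i)\<^sup>2) * 1 = (z $ i)\<^sup>2 + s * (l i * (y $ i + \<mu> * z $ i)\<^sup>2)"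
     by (simp add: r_def power2_eq_square algebra_simps)
    finally show "(z $ i)\<^sup>2 + s * (l i * (y $ i + \<mu> * z $ i)\<^sup>2) = r i * (z $ i + s * \<mu> * l i / r i * y $ i)\<^sup>2 + s * (l i / r i * (y $ i)\<^sup>2)" ..
   qed
   also have "... = qf C (w + a) + s * qf B u"
    unfolding C_def B_def b(2,3) c2 Ua y_def[symmetric]
    using yz by (simp add: sum.distrib sum_distrib_left)
   finally show ?thesis .
  qed
  note [measurable] = meas_qf[OF pd_carrier[OF Cpd]]
  have Cm: "(\<lambda>w. ennreal (gker C w)) \<in> bmeas k" by measurable
  have ta: "(\<lambda>w. w + a) \<in> leb k \<rightarrow>\<^sub>M leb k" using a by (intro measurable_vec_add) auto
  have "(\<integral>\<^sup>+w. ennreal (exp (- pi * (nsq w + s * qf A (u + \<mu> \<cdot>\<^sub>v w)))) \<partial>leb k)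
   = (\<integral>\<^sup>+w. ennreal (gker C (w + a)) * ennreal (exp (- pi * (s * qf B u))) \<partial>leb k)"
   by (intro nn_integral_cong) (simp add: sq ennreal_mult'[symmetric] distrib_left exp_add[symmetric])
  also have "... = (\<integral>\<^sup>+w. ennreal (gker C (w + a)) \<partial>leb k) * ennreal (exp (- pi * (s * qf B u)))"
   by (rule nn_integral_multc[OF measurable_compose[OF ta Cm]])
  also have "(\<integral>\<^sup>+w. ennreal (gker C (w + a)) \<partial>leb k) = ennreal (1 / sqrt (det C))"
   unfolding nn_integral_leb_translate[OF Cm a] by (rule nn_integral_gauss[OF Cpd])
  finally have "(\<integral>\<^sup>+w. ennreal (exp (- pi * (nsq w + s * qf A (u + \<mu> \<cdot>\<^sub>v w)))) \<partial>leb k)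
   = ennreal (1 / sqrt (det C)) * ennreal (exp (- pi * (s * qf B u)))" .
  moreover have "0 \<le> 1 / sqrt (det C)" using 2 by simp
  ultimately show ?thesis by (simp only: ennreal_mult')
 qed
 \<comment> \<open>A bound kappa for A^(-1) bounds the eigenvalues of B^(-1) by kappa + s mu^2,
   hence those of B from below.\<close>
 have 4: "(1 / (\<kappa> + s * \<mu>\<^sup>2)) ^ k \<le> det B"
  if \<kappa>: "0 < \<kappa>" "\<And>v. v \<in> rvec k \<Longrightarrow> qf (inv_mat A) v \<le> \<kappa> * nsq v" for \<kappa>
 proof -
  have "(\<Prod>i<k. 1 / (\<kappa> + s * \<mu>\<^sup>2)) \<le> (\<Prod>i<k. l i / r i)"
  proof (rule prod_mono, intro conjI)
   fix i assume "i \<in> {..<k}"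
   hence i: "i < k" by simp
   have l: "0 < l i" by (rule U(3)[OF i])
   note e = spec_mat_eigenvector(1,2)[OF U(1) i] spec_mat_eigenvector(3)[OF U(1) i, of "\<lambda>i. 1 / l i"]
   have "inv_mat A = spec_mat k U (\<lambda>i. 1 / l i)" unfolding U(2) by (rule inv_mat_spec_mat[OF U(1)]) (use U(3) in force)
   hence "qf (inv_mat A) (U *\<^sub>v unit_vec k i) = 1 / l i"
    using e by (simp add: bilf_def)
   hence "1 / l i \<le> \<kappa>" using \<kappa>(2)[OF e(1)] e(2) by simp
   hence "1 \<le> \<kappa> * l i" using l by (simp add: field_simps)
   hence "r i \<le> l i * (\<kappa> + s * \<mu>\<^sup>2)" by (simp add: r_def algebra_simps)
   moreover have "0 < \<kappa> + s * \<mu>\<^sup>2" using \<kappa>(1) s by (intro add_pos_nonneg) auto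
   ultimately show "1 / (\<kappa> + s * \<mu>\<^sup>2) \<le> l i / r i" "0 \<le> 1 / (\<kappa> + s * \<mu>\<^sup>2)"
    using r[OF i] by (simp_all add: field_simps)
  qed
  thus ?thesis by (simp add: dB)
 qed
 show thesis by (rule that[OF Bpd 2 1 3 4])
qed

text \<open>Determinants are compared through the Gaussian integrals, whose integrands are ordered
  pointwise.\<close>

lemma det_mono_pos_def:
 assumes M: "pos_def_mat k M" "pos_def_mat k M'" and le: "\<And>v. v \<in> rvec k \<Longrightarrow> qf M v \<le> qf M' v"
 shows "det M \<le> det M'"
proof -
 have d: "0 < det M" "0 < det M'" using M by (auto intro: pd_det_pos)
 have "ennreal (1 / sqrt (det M')) \<le> ennreal (1 / sqrt (det M))"
  unfolding nn_integral_gauss[OF M(1), symmetric] nn_integral_gauss[OF M(2), symmetric]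
  by (rule nn_integral_mono) (simp add: le ennreal_leI)
 hence "1 / sqrt (det M') \<le> 1 / sqrt (det M)" using d by (simp add: ennreal_le_iff)
 thus ?thesis using d by (simp add: field_simps)
qed

lemma pos_semidef_det_imp_pos_def:
 assumes X: "X \<in> rmat n n" "X\<^sup>T = X" "\<And>v. v \<in> rvec n \<Longrightarrow> 0 \<le> qf X v" and "det X \<noteq> 0"
 shows "pos_def_mat n X"
proof -
 obtain U l where U: "orth_mat n U" "X = spec_mat n U l" by (fact symmetric_spec_mat[OF X(1,2)])
 have "0 < l i" if i: "i < n" for i
 proof -
  note e = spec_mat_eigenvector(1,2)[OF U(1) i] spec_mat_eigenvector(3)[OF U(1) i, of l]
  have "0 \<le> l i" using X(3)[OF e(1)] e by (simp add: bilf_def U(2))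
  moreover have "l i \<noteq> 0" using assms(4) i unfolding U(2) det_spec_mat[OF U(1)] by auto
  ultimately show ?thesis by simp
 qed
 thus ?thesis unfolding U(2) by (rule spec_mat_pos_def[OF U(1)])
qed

lemma bilf_le_norm:
 assumes "A \<in> rmat k k" "A\<^sup>T = A"
 shows "\<exists>c\<ge>0. \<forall>v\<in>rvec k. qf A v \<le> c * nsq v"
proof -
 obtain U l where U: "orth_mat k U" "A = spec_mat k U l" by (fact symmetric_spec_mat[OF assms])
 define c where "c = (\<Sum>i<k. \<bar>l i\<bar>)"
 have "qf A v \<le> c * nsq v" if v: "v \<in> rvec k" for v
 proof -
  have "qf A v \<le> (\<Sum>i<k. c * ((U\<^sup>T *\<^sub>v v) $ i)\<^sup>2)"
   unfolding U(2) bilf_spec_mat[OF U(1) v]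
  proof (intro sum_mono mult_right_mono)
   fix i assume "i \<in> {..<k}"
   hence "\<bar>l i\<bar> \<le> c" unfolding c_def by (intro member_le_sum) auto
   thus "l i \<le> c" by simp
  qed simp
  thus ?thesis by (simp add: sum_distrib_left[symmetric] orth_mat_norm[OF U(1) v])
 qed
 thus ?thesis by (intro exI[of _ c]) (auto simp: c_def sum_nonneg)
qed

lemma scalar_prod_Young:
 fixes a b :: "real vec"
 assumes a: "a \<in> rvec k" and b: "b \<in> rvec k" and e: "0 < \<epsilon>"
 shows "2 * (a \<bullet> b) \<le> nsq a / \<epsilon> + \<epsilon> * nsq b"
proof -
 have "(\<Sum>i<k. 2 * (a $ i * b $ i)) \<le> (\<Sum>i<k. a $ i * a $ i / \<epsilon> + \<epsilon> * (b $ i * b $ i))"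
 proof (rule sum_mono)
  fix i
  have "0 \<le> (a $ i - \<epsilon> * b $ i)\<^sup>2 / \<epsilon>" using e by simp
  also have "... = a $ i * a $ i / \<epsilon> + \<epsilon> * (b $ i * b $ i) - 2 * (a $ i * b $ i)"
   using e by (simp add: power2_eq_square field_simps)
  finally show "2 * (a $ i * b $ i) \<le> a $ i * a $ i / \<epsilon> + \<epsilon> * (b $ i * b $ i)" by simp
 qed
 thus ?thesis
  unfolding scalar_prod_eq_sum[OF a] scalar_prod_eq_sum[OF b]
  by (simp add: sum.distrib sum_distrib_left sum_divide_distrib)
qed

text \<open>In the application \<open>I\<close> is the infimum of \<open>gform\<close>; when that
  infimum is 0 the bound to be shown is trivial.\<close>

locale BL_positive =
 fixes n m :: nat and d :: "nat \<Rightarrow> nat" and L :: "nat \<Rightarrow> real mat" and p :: "nat \<Rightarrow> real" and I :: real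
 assumes L: "\<And>j. j < m \<Longrightarrow> L j \<in> rmat (d j) n"
  and surj: "\<And>j. j < m \<Longrightarrow> \<forall>y\<in>rvec (d j). \<exists>x\<in>rvec n. L j *\<^sub>v x = y"
  and p: "\<And>j. j < m \<Longrightarrow> 0 \<le> p j" "\<And>j. j < m \<Longrightarrow> p j \<le> 1"
  and I: "0 < I" and lower: "\<And>A. (\<And>j. j < m \<Longrightarrow> pos_def_mat (d j) (A j)) \<Longrightarrow> I \<le> gform n m L p A"
begin

abbreviation "E \<equiv> ext_map n m d L"
abbreviation "D \<equiv> off d m"

lemma Emult:
 assumes "j < m" "x \<in> rvec n" "w \<in> rvec D"
 shows "E \<mu> j *\<^sub>v (x @\<^sub>v w) = L j *\<^sub>v x + \<mu> \<cdot>\<^sub>v vblock d j w"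
 by (rule ext_map_mult) (use assms L in auto)

text \<open>The auxiliary variables may be set to 0.\<close>

lemma E_surj:
 assumes j: "j < m" shows "\<forall>y\<in>rvec (d j). \<exists>z\<in>rvec (n + D). E \<mu> j *\<^sub>v z = y"
proof
 fix y assume y: "y \<in> rvec (d j)"
 then obtain x where x: "x \<in> rvec n" "L j *\<^sub>v x = y" using surj[OF j] by blast
 have "vblock d j (0\<^sub>v D) = 0\<^sub>v (d j)" using off_less[OF j, of _ d] by (intro eq_vecI) (auto simp: vblock_def)
 moreover have "y + \<mu> \<cdot>\<^sub>v 0\<^sub>v (d j) = y" using y by (intro eq_vecI) auto
 ultimately have "E \<mu> j *\<^sub>v (x @\<^sub>v 0\<^sub>v D) = y" using Emult[OF j x(1), of "0\<^sub>v D"] x(2) by simp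
 moreover have "x @\<^sub>v 0\<^sub>v D \<in> rvec (n + D)" using x(1) by simp
 ultimately show "\<exists>z\<in>rvec (n + D). E \<mu> j *\<^sub>v z = y" by blast
qed

text \<open>For fixed x the form is a sum of terms each containing a single block of w, so the
  blocks can be integrated out independently.\<close>

lemma bilf_ext:
 assumes A: "\<And>j. j < m \<Longrightarrow> A j \<in> rmat (d j) (d j)" and x: "x \<in> rvec n" and w: "w \<in> rvec D"
 shows "qf (ext_form n D \<epsilon> + BL_form (n + D) m (E \<mu>) q A) (x @\<^sub>v w)
  = \<epsilon> * nsq x + (\<Sum>j<m. vblock d j w \<bullet> vblock d j w
    + q j * qf (A j) (L j *\<^sub>v x + \<mu> \<cdot>\<^sub>v vblock d j w))"
proof -
 have z: "x @\<^sub>v w \<in> rvec (n + D)" using x w by simp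
 have "qf (BL_form (n + D) m (E \<mu>) q A) (x @\<^sub>v w)
   = (\<Sum>j<m. q j * qf (A j) (E \<mu> j *\<^sub>v (x @\<^sub>v w)))"
  by (rule bilf_BL_form[of m _ d]) (use A z in auto)
 also have "... = (\<Sum>j<m. q j * qf (A j) (L j *\<^sub>v x + \<mu> \<cdot>\<^sub>v vblock d j w))"
  using Emult x w by (intro sum.cong refl) simp
 finally show ?thesis
  unfolding bilf_add_mat[OF ext_form_carrier BL_form_carrier z z] bilf_ext_form[OF x w] scalar_prod_vblock[OF w]
  by (simp add: sum.distrib)
qed

text \<open>This is the form in x that is left once the auxiliary variables have been integrated
  out.\<close>

lemma pos_def_reduced_form:
 assumes e: "0 < \<epsilon>" and q: "\<And>j. j < m \<Longrightarrow> 0 \<le> q j" and B: "\<And>j. j < m \<Longrightarrow> pos_def_mat (d j) (B j)"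
 shows "pos_def_mat n (\<epsilon> \<cdot>\<^sub>m 1\<^sub>m n + BL_form n m L q B)"
  and "x \<in> rvec n \<Longrightarrow> qf (\<epsilon> \<cdot>\<^sub>m 1\<^sub>m n + BL_form n m L q B) x
   = \<epsilon> * nsq x + (\<Sum>j<m. q j * qf (B j) (L j *\<^sub>v x))"
proof -
 note Q = pos_def_smult[OF pos_def_one e]
 show "pos_def_mat n (\<epsilon> \<cdot>\<^sub>m 1\<^sub>m n + BL_form n m L q B)"
  by (rule pos_def_add_BL_form(1)[of n _ m L d]) (use Q L q B in auto)
 assume x: "x \<in> rvec n"
 have "qf (\<epsilon> \<cdot>\<^sub>m 1\<^sub>m n + BL_form n m L q B) x
   = qf (\<epsilon> \<cdot>\<^sub>m 1\<^sub>m n) x + (\<Sum>j<m. q j * qf (B j) (L j *\<^sub>v x))"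
  by (rule pos_def_add_BL_form(2)[of n _ m L d]) (use Q L q B x in auto)
 thus "qf (\<epsilon> \<cdot>\<^sub>m 1\<^sub>m n + BL_form n m L q B) x
   = \<epsilon> * nsq x + (\<Sum>j<m. q j * qf (B j) (L j *\<^sub>v x))"
  unfolding bilf_smult_mat[OF one_carrier_mat x x] bilf_one[OF x x] .
qed

text \<open>The Gaussian integral of the extended form is computed by integrating out the blocks first.\<close>
lemma ext_det:
 assumes e: "0 < \<epsilon>" and q: "\<And>j. j < m \<Longrightarrow> 0 \<le> q j" and A: "\<And>j. j < m \<Longrightarrow> pos_def_mat (d j) (A j)"
  and M: "M = ext_form n D \<epsilon> + BL_form (n + D) m (E \<mu>) q A" "pos_def_mat (n + D) M"
  and \<kappa>: "0 < \<kappa>" "\<And>j v. j < m \<Longrightarrow> v \<in> rvec (d j) \<Longrightarrow> qf (inv_mat (A j)) v \<le> \<kappa> * nsq v"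
 shows "\<exists>B c. (\<forall>j<m. pos_def_mat (d j) (B j) \<and> 1 \<le> c j \<and> det (A j) = det (B j) * c j \<and> (1 / (\<kappa> + q j * \<mu>\<^sup>2)) ^ d j \<le> det (B j))
  \<and> det M = (\<Prod>j<m. c j) * det (\<epsilon> \<cdot>\<^sub>m 1\<^sub>m n + BL_form n m L q B)"
proof -
 note Ac = pd_carrier[OF A]
 \<comment> \<open>What \<open>nn_integral_gauss_block\<close> provides for the j-th block with s =
   q_j; a pair is used so that all blocks can be chosen at once.\<close>
 define P where "P j Bc \<longleftrightarrow> pos_def_mat (d j) (fst Bc) \<and> 1 \<le> snd Bc \<and> det (A j) = det (fst Bc) * snd Bc \<and>
  (\<forall>u\<in>rvec (d j).
   (\<integral>\<^sup>+w. ennreal (exp (- pi * (nsq w + q j * qf (A j) (u + \<mu> \<cdot>\<^sub>v w)))) \<partial>leb (d j))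
    = ennreal (1 / sqrt (snd Bc) * exp (- pi * (q j * qf (fst Bc) u)))) \<and>
  (1 / (\<kappa> + q j * \<mu>\<^sup>2)) ^ d j \<le> det (fst Bc)" for j and Bc :: "real mat \<times> real"
 have "\<forall>j. \<exists>Bc. j < m \<longrightarrow> P j Bc"
 proof
  fix j
  show "\<exists>Bc. j < m \<longrightarrow> P j Bc"
  proof (cases "j < m")
   case True
   obtain B c where Bc: "pos_def_mat (d j) B" "1 \<le> c" "det (A j) = det B * c"
    "\<And>u. u \<in> rvec (d j) \<Longrightarrow>
     (\<integral>\<^sup>+w. ennreal (exp (- pi * (nsq w + q j * qf (A j) (u + \<mu> \<cdot>\<^sub>v w)))) \<partial>leb (d j))
      = ennreal (1 / sqrt c * exp (- pi * (q j * qf B u)))"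
    "\<And>\<kappa>. 0 < \<kappa> \<Longrightarrow> (\<And>v. v \<in> rvec (d j) \<Longrightarrow> qf (inv_mat (A j)) v \<le> \<kappa> * nsq v) \<Longrightarrow>
     (1 / (\<kappa> + q j * \<mu>\<^sup>2)) ^ d j \<le> det B"
    by (fact nn_integral_gauss_block[OF A[OF True] q[OF True]])
   have "P j (B, c)"
    unfolding P_def fst_conv snd_conv
    by (intro conjI ballI Bc(1-4) Bc(5)[OF \<kappa>(1) \<kappa>(2)[OF True]])
   thus ?thesis by (intro exI impI)
  qed simp
 qed
 from choice[OF this] obtain Bc where "\<forall>j. j < m \<longrightarrow> P j (Bc j)" ..
 hence Bc: "P j (Bc j)" if "j < m" for j using that by simp
 define B c where "B j = fst (Bc j)" and "c j = snd (Bc j)" for j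
 have Bpd: "pos_def_mat (d j) (B j)" and c1: "1 \<le> c j" if "j < m" for j using Bc[OF that] by (simp_all add: P_def B_def c_def)
 have inner: "(\<integral>\<^sup>+w. ennreal (exp (- pi * (nsq w + q j * qf (A j) (u + \<mu> \<cdot>\<^sub>v w)))) \<partial>leb (d j))
    = ennreal (1 / sqrt (c j) * exp (- pi * (q j * qf (B j) u)))" if "j < m" "u \<in> rvec (d j)" for j u
  using Bc[OF that(1)] that(2) unfolding P_def B_def c_def by blast
 define N where "N = \<epsilon> \<cdot>\<^sub>m 1\<^sub>m n + BL_form n m L q B"
 have Npd: "pos_def_mat n N" unfolding N_def by (rule pos_def_reduced_form(1)[OF e q Bpd])
 have Nx: "qf N x = \<epsilon> * nsq x + (\<Sum>j<m. q j * qf (B j) (L j *\<^sub>v x))" if "x \<in> rvec n" for x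
  unfolding N_def by (rule pos_def_reduced_form(2)[OF e q Bpd that])
 note [measurable] = meas_qf[OF pd_carrier[OF M(2)]] meas_qf[OF pd_carrier[OF Npd]]
 have Mm: "(\<lambda>z. ennreal (gker M z)) \<in> bmeas (n + D)" by measurable
 have Nm: "(\<lambda>z. ennreal (gker N z)) \<in> bmeas n" by measurable
 have c0: "0 < (\<Prod>j<m. c j)" by (rule prod_pos) (use c1 in force)
 have sc: "(\<Prod>j<m. 1 / sqrt (c j)) = 1 / sqrt (\<Prod>j<m. c j)"
  by (induction m) (simp_all add: real_sqrt_mult)
 have "ennreal (1 / sqrt (det M)) = (\<integral>\<^sup>+z. ennreal (gker M z) \<partial>leb (n + D))"
  by (rule nn_integral_gauss[OF M(2), symmetric])
 also have "... = (\<integral>\<^sup>+x. \<integral>\<^sup>+w. ennreal (gker M (x @\<^sub>v w)) \<partial>leb D \<partial>leb n)"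
  by (rule nn_integral_leb_append[OF Mm])
 \<comment> \<open>For fixed x the integrand factors over the blocks. Integrating over block j
   replaces A_j by B_j and leaves the factor 1 / sqrt(c_j).\<close>
 also have "... = (\<integral>\<^sup>+x. ennreal (1 / sqrt (\<Prod>j<m. c j)) * ennreal (gker N x) \<partial>leb n)"
 proof (rule nn_integral_cong)
  fix x assume "x \<in> space (leb n)"
  hence x: "x \<in> rvec n" by simp
  have u: "L j *\<^sub>v x \<in> rvec (d j)" if "j < m" for j using L[OF that] x by simp
  define \<phi> where "\<phi> j w = ennreal (exp (- pi * (nsq w + q j * qf (A j) (L j *\<^sub>v x + \<mu> \<cdot>\<^sub>v w))))" for j w
  have \<phi>m: "\<phi> j \<in> bmeas (d j)" if j: "j < m" for j
  proof -
   have "(\<lambda>w. L j *\<^sub>v x + \<mu> \<cdot>\<^sub>v w) \<in> leb (d j) \<rightarrow>\<^sub>M leb (d j)" by (intro measurable_vec_add measurable_vec_smult measurable_const measurable_ident_sets) (use u[OF j] in auto)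
   note [measurable] = measurable_bilf[OF Ac[OF j] this this]
   show ?thesis unfolding \<phi>_def by measurable
  qed
  have "(\<integral>\<^sup>+w. ennreal (gker M (x @\<^sub>v w)) \<partial>leb D)
   = (\<integral>\<^sup>+w. ennreal (exp (- pi * (\<epsilon> * nsq x))) * (\<Prod>j<m. \<phi> j (vblock d j w)) \<partial>leb D)"
  proof (rule nn_integral_cong)
   fix w assume "w \<in> space (leb D)"
   hence w: "w \<in> rvec D" by simp
   have "qf M (x @\<^sub>v w) = \<epsilon> * nsq x + (\<Sum>j<m. vblock d j w \<bullet> vblock d j w
     + q j * qf (A j) (L j *\<^sub>v x + \<mu> \<cdot>\<^sub>v vblock d j w))"
    unfolding M(1) by (rule bilf_ext[OF _ x w]) (rule Ac)
   thus "ennreal (gker M (x @\<^sub>v w)) = ennreal (exp (- pi * (\<epsilon> * nsq x))) * (\<Prod>j<m. \<phi> j (vblock d j w))"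
    unfolding \<phi>_def
    by (simp add: prod_ennreal exp_sum[symmetric] ennreal_mult'[symmetric] exp_add[symmetric] distrib_left sum_distrib_left sum_negf sum.distrib sum_subtractf)
  qed
  also have "... = ennreal (exp (- pi * (\<epsilon> * nsq x))) * (\<integral>\<^sup>+w. (\<Prod>j<m. \<phi> j (vblock d j w)) \<partial>leb D)"
   by (intro nn_integral_cmult borel_measurable_prod_ennreal measurable_compose[OF measurable_vblock]) (use \<phi>m in auto)
  also have "(\<integral>\<^sup>+w. (\<Prod>j<m. \<phi> j (vblock d j w)) \<partial>leb D) = (\<Prod>j<m. \<integral>\<^sup>+y. \<phi> j y \<partial>leb (d j))"
   by (rule nn_integral_vblock_prod[OF \<phi>m])
  also have "... = (\<Prod>j<m. ennreal (1 / sqrt (c j) * exp (- pi * (q j * qf (B j) (L j *\<^sub>v x)))))"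
   unfolding \<phi>_def by (intro prod.cong refl inner u) auto
  also have "... = ennreal (\<Prod>j<m. 1 / sqrt (c j) * exp (- pi * (q j * qf (B j) (L j *\<^sub>v x))))"
   by (rule prod_ennreal) (use c1 in force)
  also have "(\<Prod>j<m. 1 / sqrt (c j) * exp (- pi * (q j * qf (B j) (L j *\<^sub>v x))))
   = 1 / sqrt (\<Prod>j<m. c j) * exp (\<Sum>j<m. - pi * (q j * qf (B j) (L j *\<^sub>v x)))"
   unfolding prod.distrib sc by (simp add: exp_sum)
  also have "ennreal (exp (- pi * (\<epsilon> * nsq x))) * ennreal ... = ennreal (exp (- pi * (\<epsilon> * nsq x)) * (1 / sqrt (\<Prod>j<m. c j) * exp (\<Sum>j<m. - pi * (q j * qf (B j) (L j *\<^sub>v x)))))"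
   by (rule ennreal_mult'[symmetric]) simp
  also have "exp (- pi * (\<epsilon> * nsq x)) * (1 / sqrt (\<Prod>j<m. c j) * exp (\<Sum>j<m. - pi * (q j * qf (B j) (L j *\<^sub>v x))))
   = 1 / sqrt (\<Prod>j<m. c j) * gker N x"
   unfolding Nx[OF x] distrib_left exp_add sum_distrib_left by (simp only: mult_ac)
  also have "ennreal ... = ennreal (1 / sqrt (\<Prod>j<m. c j)) * ennreal (gker N x)"
   by (rule ennreal_mult') (use c0 in simp)
  finally show "(\<integral>\<^sup>+w. ennreal (gker M (x @\<^sub>v w)) \<partial>leb D)
   = ennreal (1 / sqrt (\<Prod>j<m. c j)) * ennreal (gker N x)" .
 qed
 also have "... = ennreal (1 / sqrt (\<Prod>j<m. c j)) * ennreal (1 / sqrt (det N))"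
  by (simp only: nn_integral_cmult[OF Nm] nn_integral_gauss[OF Npd])
 also have "... = ennreal (1 / sqrt (\<Prod>j<m. c j) * (1 / sqrt (det N)))"
  by (rule ennreal_mult'[symmetric]) (use c0 in simp)
 finally have "1 / sqrt (det M) = 1 / sqrt (\<Prod>j<m. c j) * (1 / sqrt (det N))"
  using pd_det_pos[OF M(2)] pd_det_pos[OF Npd] c0 by (subst (asm) ennreal_inj) auto
 hence "sqrt (det M) = sqrt ((\<Prod>j<m. c j) * det N)" by (simp add: real_sqrt_mult)
 hence "det M = (\<Prod>j<m. c j) * det N" by (simp only: real_sqrt_eq_iff)
 moreover have "\<forall>j<m. pos_def_mat (d j) (B j) \<and> 1 \<le> c j \<and> det (A j) = det (B j) * c j \<and> (1 / (\<kappa> + q j * \<mu>\<^sup>2)) ^ d j \<le> det (B j)"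
  using Bc unfolding P_def B_def c_def by blast
 ultimately show ?thesis unfolding N_def by blast
qed

end

section \<open>Comparison of determinants and the supersolution\<close>

text \<open>The adjoint of \<open>vblock d j\<close>; it supplies the test vector in
  \<open>ext_supersolution\<close>.\<close>

definition vembed :: "(nat \<Rightarrow> nat) \<Rightarrow> nat \<Rightarrow> nat \<Rightarrow> real vec \<Rightarrow> real vec" where
 "vembed d m j v = vec (off d m) (\<lambda>k. if off d j \<le> k \<and> k < off d j + d j then v $ (k - off d j) else 0)"

lemma vembed_carrier [simp]: "vembed d m j v \<in> rvec (off d m)"
 by (simp add: vembed_def)

lemma off_mono: "i \<le> j \<Longrightarrow> off d i \<le> off d j"
 unfolding off_def by (rule sum_mono2) auto

lemma vblock_vembed:
 assumes v: "v \<in> rvec (d j)" and i: "i < m"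
 shows "vblock d i (vembed d m j v) = (if i = j then v else 0\<^sub>v (d i))"
proof (rule eq_vecI)
 fix a assume "a < dim_vec (if i = j then v else 0\<^sub>v (d i))"
 hence a: "a < d i" using v by (simp split: if_splits)
 have "i \<noteq> j \<Longrightarrow> \<not> (off d j \<le> off d i + a \<and> off d i + a < off d j + d j)"
  using off_less[of i j a d] off_mono[of "Suc j" i d] a by (cases "i < j") auto
 thus "vblock d i (vembed d m j v) $ a = (if i = j then v else 0\<^sub>v (d i)) $ a"
  using a off_less[of i m a d] i by (auto simp: vblock_def vembed_def)
qed (use v in \<open>auto simp: vblock_def\<close>)

context BL_positive
begin

text \<open>The form dominates theta X, where X has the exponents p; theta comes out of the
  determinant as theta^n, and \<open>lower\<close> bounds det X. To compare determinants X must be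
  positive definite: it is semidefinite, and its determinant is nonzero because I > 0.\<close>

lemma reduced_det_lower:
 assumes e: "0 < \<epsilon>" and t: "0 < \<theta>" and B: "\<And>j. j < m \<Longrightarrow> pos_def_mat (d j) (B j)"
 shows "\<theta> ^ n * (I * (\<Prod>j<m. det (B j) powr p j)) \<le> det (\<epsilon> \<cdot>\<^sub>m 1\<^sub>m n + BL_form n m L (\<lambda>j. \<theta> * p j) B)"
proof -
 let ?N = "\<epsilon> \<cdot>\<^sub>m 1\<^sub>m n + BL_form n m L (\<lambda>j. \<theta> * p j) B"
 define X where "X = BL_form n m L p B"
 have Xc: "X \<in> rmat n n" unfolding X_def by (rule BL_form_carrier)
 have P: "0 < (\<Prod>j<m. det (B j) powr p j)" by (rule prod_det_powr_pos[OF B])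
 have le: "I * (\<Prod>j<m. det (B j) powr p j) \<le> det X"
  using lower[of B] B P by (simp add: gform_def X_def pos_le_divide_eq)
 hence dX: "det X \<noteq> 0" using I P by (smt (verit) mult_pos_pos)
 have Xx: "qf X x = (\<Sum>j<m. p j * qf (B j) (L j *\<^sub>v x))" if x: "x \<in> rvec n" for x
  unfolding X_def by (rule bilf_BL_form[of m L d]) (use L pd_carrier[OF B] x in auto)
 have Xpd: "pos_def_mat n X"
 proof (rule pos_semidef_det_imp_pos_def[OF Xc _ _ dX])
  show "X\<^sup>T = X" unfolding X_def
   by (rule BL_form_sym[of m L d]) (use L pd_carrier[OF B] pd_sym[OF B] in auto)
  fix x assume x: "x \<in> rvec n"
  show "0 \<le> qf X x" unfolding Xx[OF x]
  proof (intro sum_nonneg mult_nonneg_nonneg)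
   fix j assume "j \<in> {..<m}"
   hence j: "j < m" by simp
   show "0 \<le> p j" by (rule p(1)[OF j])
   show "0 \<le> qf (B j) (L j *\<^sub>v x)" by (rule pd_nonneg[OF B[OF j]]) (use L[OF j] x in simp)
  qed
 qed
 have q: "0 \<le> \<theta> * p j" if "j < m" for j using t p(1)[OF that] by simp
 have "\<theta> ^ n * det X = det (\<theta> \<cdot>\<^sub>m X)" using Xc by simp
 also have "... \<le> det ?N"
 proof (rule det_mono_pos_def)
  show "pos_def_mat n (\<theta> \<cdot>\<^sub>m X)" by (rule pos_def_smult[OF Xpd t])
  show "pos_def_mat n ?N" by (rule pos_def_reduced_form(1)[OF e q B])
  fix v assume v: "v \<in> rvec n"
  have "qf (\<theta> \<cdot>\<^sub>m X) v = (\<Sum>j<m. \<theta> * p j * qf (B j) (L j *\<^sub>v v))"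
   unfolding bilf_smult_mat[OF Xc v v] Xx[OF v] by (simp add: sum_distrib_left mult.assoc)
  also have "... \<le> qf ?N v"
   by (subst pos_def_reduced_form(2)[OF e q B v]) (use e nsq_nonneg[of v] in auto)
  finally show "qf (\<theta> \<cdot>\<^sub>m X) v \<le> qf ?N v" .
 qed
 finally show ?thesis using le t by (smt (verit) mult_left_mono zero_le_power)
qed

text \<open>The cost of passing from the exponent theta s to s. The missing power of b has a
  nonpositive exponent and is controlled by the lower bound for b; c >= 1 may be raised to the power
  1 because theta s <= 1.\<close>

lemma det_powr_shift:
 fixes b c \<kappa> s \<theta> :: real
 assumes k: "1 \<le> \<kappa>" and b: "(1 / \<kappa>) ^ k \<le> b" and c: "1 \<le> c" and s: "0 \<le> s" "s \<le> 1" and t: "0 < \<theta>" "\<theta> < 1"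
 shows "(b * c) powr (\<theta> * s) \<le> b powr s * \<kappa> powr ((1 - \<theta>) * k) * c"
proof -
 have b0: "0 < b" using b k by (smt (verit) divide_pos_pos zero_less_power)
 have "b powr (\<theta> * s) = b powr s * b powr (- ((1 - \<theta>) * s))"
  unfolding powr_add[symmetric] by (simp add: algebra_simps)
 also have "b powr (- ((1 - \<theta>) * s)) \<le> ((1 / \<kappa>) ^ k) powr (- ((1 - \<theta>) * s))"
  using t s k by (intro powr_mono2' b) auto
 also have "(1 / \<kappa>) ^ k = \<kappa> powr (- real k)"
  using k by (simp add: powr_minus powr_realpow power_one_over inverse_eq_divide)
 also have "(\<kappa> powr (- real k)) powr (- ((1 - \<theta>) * s)) = \<kappa> powr ((1 - \<theta>) * k * s)"
  by (simp add: powr_powr mult_ac)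
 also have "... \<le> \<kappa> powr ((1 - \<theta>) * k)"
  using k t s by (intro powr_mono) (auto intro: mult_left_le)
 finally have 1: "b powr (\<theta> * s) \<le> b powr s * \<kappa> powr ((1 - \<theta>) * k)" by (simp add: mult_left_mono)
 have "\<theta> * s \<le> 1" using t s by (simp add: mult_le_one)
 hence 2: "c powr (\<theta> * s) \<le> c" using c powr_mono[of "\<theta> * s" 1 c] by simp
 have "(b * c) powr (\<theta> * s) = b powr (\<theta> * s) * c powr (\<theta> * s)" using b0 c by (simp add: powr_mult)
 also have "... \<le> (b powr s * \<kappa> powr ((1 - \<theta>) * k)) * c" using 1 2 by (intro mult_mono) auto
 finally show ?thesis .
qed

text \<open>The factors c_j contributed by the det A_j cancel those in det M. What remains is the
  ratio for the B_j, governed by \<open>reduced_det_lower\<close>, and the product of the costs from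
  \<open>det_powr_shift\<close>.\<close>

lemma det_ratio:
 assumes e: "0 < \<epsilon>" and k: "1 \<le> \<kappa>" and t: "0 < \<theta>" "\<theta> < 1"
  and B: "\<forall>j<m. pos_def_mat (d j) (B j) \<and> 1 \<le> c j \<and> det (A j) = det (B j) * c j \<and> (1 / \<kappa>) ^ d j \<le> det (B j)"
  and M: "det M = (\<Prod>j<m. c j) * det (\<epsilon> \<cdot>\<^sub>m 1\<^sub>m n + BL_form n m L (\<lambda>j. \<theta> * p j) B)"
 shows "(\<Prod>j<m. det (A j) powr (\<theta> * p j)) / det M \<le> \<kappa> powr ((1 - \<theta>) * D) / (\<theta> ^ n * I)"
proof -
 have Bpd: "pos_def_mat (d j) (B j)" if "j < m" for j using B that by blast
 have P: "0 < (\<Prod>j<m. det (B j) powr p j)" by (rule prod_det_powr_pos[OF Bpd])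
 have c: "0 < (\<Prod>j<m. c j)" by (rule prod_pos) (use B in force)
 have "(\<Prod>j<m. det (A j) powr (\<theta> * p j)) \<le> (\<Prod>j<m. det (B j) powr p j * \<kappa> powr ((1 - \<theta>) * d j) * c j)"
  using B p t k by (intro prod_mono conjI) (auto intro!: det_powr_shift)
 also have "... = (\<Prod>j<m. det (B j) powr p j) * \<kappa> powr ((1 - \<theta>) * D) * (\<Prod>j<m. c j)"
 proof -
  have "(\<Prod>j<m. \<kappa> powr ((1 - \<theta>) * d j)) = \<kappa> powr ((1 - \<theta>) * D)"
   using k by (simp add: powr_sum[symmetric] off_def sum_distrib_left)
  thus ?thesis by (simp add: prod.distrib)
 qed
 finally have num: "(\<Prod>j<m. det (A j) powr (\<theta> * p j)) \<le> ..." .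
 have den: "(\<Prod>j<m. c j) * (\<theta> ^ n * (I * (\<Prod>j<m. det (B j) powr p j))) \<le> det M"
  unfolding M using c by (intro mult_left_mono reduced_det_lower[OF e t(1) Bpd]) auto
 have "(\<Prod>j<m. det (A j) powr (\<theta> * p j)) / det M
  \<le> ((\<Prod>j<m. det (B j) powr p j) * \<kappa> powr ((1 - \<theta>) * D) * (\<Prod>j<m. c j)) / ((\<Prod>j<m. c j) * (\<theta> ^ n * (I * (\<Prod>j<m. det (B j) powr p j))))"
  using num den P c t I by (intro frac_le) auto
 also have "... = \<kappa> powr ((1 - \<theta>) * D) / (\<theta> ^ n * I)"
 proof -
  have "x * k * y / (y * (t * (I * x))) = k / (t * I)" if "0 < x" "0 < y" for x y k t :: real
   using that by simp
  from this[OF P c] show ?thesis .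
 qed
 finally show ?thesis .
qed

text \<open>By the variational formula one test vector z is enough: x = 0, and v / (mu R) in block
  j. It has E z = v / R, so the linear term contributes (2/R) |v|^2. The form at z is (1/R) (1 /
  (mu^2 R) + theta p_j) |v|^2, and \<open>R\<close> is chosen so that 1 / (mu^2 R) = 1 - theta;
  since p_j <= 1, the form is at most (1/R) |v|^2.\<close>

lemma ext_supersolution:
 assumes e: "0 < \<epsilon>" and \<mu>: "0 < \<mu>" and t: "0 < \<theta>" "\<theta> < 1" and R: "R = 1 / (\<mu>\<^sup>2 * (1 - \<theta>))"
  and j: "j < m" and v: "v \<in> rvec (d j)"
 shows "1 / R * nsq v \<le> qf (E \<mu> j * inv_mat (ext_form n D \<epsilon> + BL_form (n + D) m (E \<mu>) (\<lambda>j. \<theta> * p j) (\<lambda>j. R \<cdot>\<^sub>m 1\<^sub>m (d j))) * (E \<mu> j)\<^sup>T) v"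
proof -
 let ?V = "(1 / (\<mu> * R)) \<cdot>\<^sub>v v"
 let ?W = "vembed d m j ?V"
 define q where "q j = \<theta> * p j" for j
 define M where "M = ext_form n D \<epsilon> + BL_form (n + D) m (E \<mu>) q (\<lambda>j. R \<cdot>\<^sub>m 1\<^sub>m (d j))"
 have R0: "0 < R" using R \<mu> t by simp
 have Mpd: "pos_def_mat (n + D) M"
  unfolding M_def q_def
  by (rule pos_def_add_BL_form(1)[of _ _ m "E \<mu>" d]) (use pos_def_ext_form[OF e] p t pos_def_smult[OF pos_def_one R0] in auto)
 define y where "y = (E \<mu> j)\<^sup>T *\<^sub>v v"
 define z where "z = 0\<^sub>v n @\<^sub>v ?W"
 have ET: "(E \<mu> j)\<^sup>T \<in> rmat (n + D) (d j)" by simp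
 have y: "y \<in> rvec (n + D)" unfolding y_def by (rule mult_mat_vec_carrier[OF ET v])
 have z: "z \<in> rvec (n + D)" unfolding z_def by simp
 have tv: "?V \<in> rvec (d j)" using v by simp
 have vb: "vblock d i ?W = (if i = j then ?V else 0\<^sub>v (d i))" if "i < m" for i
  by (rule vblock_vembed) (use tv that in auto)
 have L0: "L i *\<^sub>v 0\<^sub>v n = 0\<^sub>v (d i)" if "i < m" for i
  using L[OF that] by (intro eq_vecI) auto
 have Ez: "E \<mu> j *\<^sub>v z = (1 / R) \<cdot>\<^sub>v v"
  unfolding z_def Emult[OF j zero_carrier_vec vembed_carrier] vb[OF j] L0[OF j]
  using v \<mu> by (intro eq_vecI) auto
 have "y \<bullet> z = z \<bullet> y" by (rule comm_scalar_prod[OF y z])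
 also have "... = (E \<mu> j *\<^sub>v z) \<bullet> v" unfolding y_def by (rule scalar_prod_transpose_mult[OF ext_map_carrier z v])
 finally have yz: "y \<bullet> z = 1 / R * nsq v" unfolding Ez using v by simp
 have "qf M z = \<epsilon> * (0\<^sub>v n \<bullet> 0\<^sub>v n) + (\<Sum>i<m. vblock d i ?W \<bullet> vblock d i ?W
    + q i * qf (R \<cdot>\<^sub>m 1\<^sub>m (d i)) (L i *\<^sub>v 0\<^sub>v n + \<mu> \<cdot>\<^sub>v vblock d i ?W))"
  unfolding M_def z_def by (rule bilf_ext) auto
 also have "... = (\<Sum>i<m. if i = j then (1 / (\<mu> * R))\<^sup>2 * nsq v + q j * (R * ((1 / R)\<^sup>2 * nsq v)) else 0)"
 proof -
  have "vblock d i ?W \<bullet> vblock d i ?W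
    + q i * qf (R \<cdot>\<^sub>m 1\<^sub>m (d i)) (L i *\<^sub>v 0\<^sub>v n + \<mu> \<cdot>\<^sub>v vblock d i ?W)
   = (if i = j then (1 / (\<mu> * R))\<^sup>2 * nsq v + q j * (R * ((1 / R)\<^sup>2 * nsq v)) else 0)" if i: "i < m" for i
  proof (cases "i = j")
   case True
   have a: "0\<^sub>v (d j) + \<mu> \<cdot>\<^sub>v ?V = (1 / R) \<cdot>\<^sub>v v" using v \<mu> by (intro eq_vecI) auto
   have b: "qf (R \<cdot>\<^sub>m 1\<^sub>m (d j)) ((1 / R) \<cdot>\<^sub>v v) = R * ((1 / R)\<^sup>2 * nsq v)"
    using v by (simp add: bilf_smult_mat[of _ "d j"] bilf_one power2_eq_square)
   show ?thesis unfolding True vb[OF j] L0[OF j] if_P[OF refl] a b using v by (simp add: power2_eq_square)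
  next
   case False
   have a: "0\<^sub>v (d i) + \<mu> \<cdot>\<^sub>v 0\<^sub>v (d i) = 0\<^sub>v (d i)" by (intro eq_vecI) auto
   have b: "qf (R \<cdot>\<^sub>m 1\<^sub>m (d i)) (0\<^sub>v (d i)) = 0" by (rule bilf_zero_left) auto
   show ?thesis unfolding vb[OF i] L0[OF i] if_not_P[OF False] a b by simp
  qed
  thus ?thesis by simp
 qed
 also have "... = (1 / (\<mu> * R))\<^sup>2 * nsq v + q j * (R * ((1 / R)\<^sup>2 * nsq v))" using j by simp
 also have "... = 1 / R * ((1 / (\<mu>\<^sup>2 * R) + q j) * nsq v)" using R0 \<mu> by (simp add: power2_eq_square field_simps)
 also have "1 / (\<mu>\<^sup>2 * R) = 1 - \<theta>" using \<mu> t by (simp add: R)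
 finally have Mz: "qf M z = 1 / R * ((1 - \<theta> + q j) * nsq v)" .
 have "q j \<le> \<theta>" using p[OF j] t by (simp add: q_def mult_left_le)
 hence "(1 - \<theta> + q j) * nsq v \<le> 1 * nsq v" by (intro mult_right_mono nsq_nonneg) simp
 hence "qf M z \<le> 1 / R * nsq v" unfolding Mz using R0 by (intro mult_left_mono) auto
 moreover have "2 * (y \<bullet> z) - qf M z \<le> qf (inv_mat M) y" by (rule bilf_inv_variational(1)[OF Mpd y z])
 ultimately have "1 / R * nsq v \<le> qf (inv_mat M) y" unfolding yz by linarith
 also have "... = qf (E \<mu> j * inv_mat M * (E \<mu> j)\<^sup>T) v"
  unfolding y_def by (rule bilf_congruence'[OF ext_map_carrier pd_inv(1)[OF Mpd] v v, symmetric])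
 finally show ?thesis unfolding M_def q_def .
qed

text \<open>The matrix on the left is L_j L_j^T / eps + mu^2. The bound follows from the variational
  formula at its maximiser, with Young's inequality applied separately to x and to the j-th
  block.\<close>

lemma ext_inverse_bound:
 assumes e: "0 < \<epsilon>" and \<Lambda>: "nsq ((L j)\<^sup>T *\<^sub>v v) \<le> \<Lambda> * nsq v"
  and j: "j < m" and v: "v \<in> rvec (d j)"
 shows "qf (E \<mu> j * inv_mat (ext_form n D \<epsilon>) * (E \<mu> j)\<^sup>T) v \<le> (\<Lambda> / \<epsilon> + \<mu>\<^sup>2) * nsq v"
proof -
 note Q = pos_def_ext_form[OF e, of n D]
 define y where "y = (E \<mu> j)\<^sup>T *\<^sub>v v"
 define z where "z = inv_mat (ext_form n D \<epsilon>) *\<^sub>v y"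
 have ET: "(E \<mu> j)\<^sup>T \<in> rmat (n + D) (d j)" by simp
 have y: "y \<in> rvec (n + D)" unfolding y_def by (rule mult_mat_vec_carrier[OF ET v])
 have z: "z \<in> rvec (n + D)" unfolding z_def by (rule mult_mat_vec_carrier[OF pd_inv(1)[OF Q] y])
 define x w where "x = vec_first z n" and "w = vec_last z D"
 have xw: "x \<in> rvec n" "w \<in> rvec D" "z = x @\<^sub>v w" using z by (auto simp: x_def w_def)
 define b where "b = vblock d j w"
 have b: "b \<in> rvec (d j)" by (simp add: b_def)
 define a where "a = (L j)\<^sup>T *\<^sub>v v"
 have a: "a \<in> rvec n" unfolding a_def using L[OF j] v by simp
 have Lx: "L j *\<^sub>v x \<in> rvec (d j)" using L[OF j] xw by simp
 have "y \<bullet> z = z \<bullet> y" by (rule comm_scalar_prod[OF y z])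
 also have "... = (E \<mu> j *\<^sub>v z) \<bullet> v" unfolding y_def by (rule scalar_prod_transpose_mult[OF ext_map_carrier z v])
 also have "E \<mu> j *\<^sub>v z = L j *\<^sub>v x + \<mu> \<cdot>\<^sub>v b" unfolding xw(3) b_def by (rule Emult[OF j xw(1,2)])
 also have "(L j *\<^sub>v x + \<mu> \<cdot>\<^sub>v b) \<bullet> v = (L j *\<^sub>v x) \<bullet> v + \<mu> * (b \<bullet> v)"
  using Lx b v by (simp add: add_scalar_prod_distrib[of _ "d j"])
 also have "(L j *\<^sub>v x) \<bullet> v = a \<bullet> x"
  unfolding a_def scalar_prod_transpose_mult[OF L[OF j] xw(1) v, symmetric] by (rule comm_scalar_prod[OF xw(1) a[unfolded a_def]])
 also have "b \<bullet> v = v \<bullet> b" by (rule comm_scalar_prod[OF b v])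
 finally have yz: "y \<bullet> z = a \<bullet> x + \<mu> * (v \<bullet> b)" .
 have "nsq b \<le> nsq w"
  unfolding scalar_prod_vblock[OF xw(2)] b_def by (rule member_le_sum) (use j nsq_nonneg in auto)
 moreover have "2 * (a \<bullet> x) \<le> nsq a / \<epsilon> + \<epsilon> * nsq x" by (rule scalar_prod_Young[OF a xw(1) e])
 moreover have "2 * (\<mu> * (v \<bullet> b)) \<le> \<mu>\<^sup>2 * nsq v + nsq b"
  using scalar_prod_Young[of "\<mu> \<cdot>\<^sub>v v" "d j" b 1] v b by (simp add: power2_eq_square)
 moreover have "nsq a / \<epsilon> \<le> \<Lambda> / \<epsilon> * nsq v" using \<Lambda> e by (simp add: a_def divide_right_mono)
 moreover have "qf (ext_form n D \<epsilon>) z = \<epsilon> * nsq x + nsq w" unfolding xw(3) by (rule bilf_ext_form[OF xw(1,2)])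
 ultimately have "2 * (y \<bullet> z) - qf (ext_form n D \<epsilon>) z \<le> (\<Lambda> / \<epsilon> + \<mu>\<^sup>2) * nsq v"
  unfolding yz by (simp add: distrib_right)
 hence "qf (inv_mat (ext_form n D \<epsilon>)) y \<le> (\<Lambda> / \<epsilon> + \<mu>\<^sup>2) * nsq v"
  using bilf_inv_variational(2)[OF Q y z] by (simp add: z_def)
 thus ?thesis
  unfolding y_def using bilf_congruence'[OF ext_map_carrier pd_inv(1)[OF Q] v v] by simp
qed

text \<open>The auxiliary variables \<open>w\<close> make the fixed point map have a supersolution for every \<open>\<theta> < 1\<close>.\<close>
lemma regularised_Brascamp_Lieb:
 assumes f: "\<And>j. j < m \<Longrightarrow> nice_fun (d j) (f j)" and e: "0 < \<epsilon>" and \<mu>: "0 < \<mu>" and t: "0 < \<theta>" "\<theta> < 1"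
  and \<Lambda>: "0 \<le> \<Lambda>" "\<And>j v. j < m \<Longrightarrow> v \<in> rvec (d j) \<Longrightarrow> nsq ((L j)\<^sup>T *\<^sub>v v) \<le> \<Lambda> * nsq v"
  and \<kappa>: "\<Lambda> / \<epsilon> + 2 * \<mu>\<^sup>2 \<le> \<kappa>" "1 \<le> \<kappa>"
 shows "(\<integral>\<^sup>+z. ennreal (gker (ext_form n D \<epsilon>) z * (\<Prod>j<m. rpow (f j (E \<mu> j *\<^sub>v z)) (\<theta> * p j))) \<partial>leb (n + D))
  \<le> ennreal (sqrt (\<kappa> powr ((1 - \<theta>) * D) / (\<theta> ^ n * I)) * (\<Prod>j<m. rpow (\<integral>y. f j y \<partial>leb (d j)) (\<theta> * p j)))"
proof -
 define q where "q = (\<lambda>j. \<theta> * p j)"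
 have q: "0 \<le> q j" "q j \<le> 1" if "j < m" for j using t p[OF that] by (auto simp: q_def mult_le_one)
 define R where "R = 1 / (\<mu>\<^sup>2 * (1 - \<theta>))"
 have R0: "0 < R" using \<mu> t by (simp add: R_def)
 note Q = pos_def_ext_form[OF e, of n D]
 obtain A where A: "\<And>j. j < m \<Longrightarrow> pos_def_mat (d j) (A j)" "pos_def_mat (n + D) (ext_form n D \<epsilon> + BL_form (n + D) m (E \<mu>) q A)"
  "\<And>j. j < m \<Longrightarrow> A j * (E \<mu> j * inv_mat (ext_form n D \<epsilon> + BL_form (n + D) m (E \<mu>) q A) * (E \<mu> j)\<^sup>T) = 1\<^sub>m (d j)"
  "\<And>j v. j < m \<Longrightarrow> v \<in> rvec (d j) \<Longrightarrow> qf (inv_mat (A j)) v \<le> qf (E \<mu> j * inv_mat (ext_form n D \<epsilon>) * (E \<mu> j)\<^sup>T) v"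
 proof (rule gaussian_fixed_point[of "n + D" "ext_form n D \<epsilon>" m "E \<mu>" d q R])
  fix j and v :: "real vec" assume "j < m" "v \<in> rvec (d j)"
  thus "1 / R * nsq v \<le> qf (E \<mu> j * inv_mat (ext_form n D \<epsilon> + BL_form (n + D) m (E \<mu>) q (\<lambda>j. R \<cdot>\<^sub>m 1\<^sub>m (d j))) * (E \<mu> j)\<^sup>T) v"
   unfolding q_def by (rule ext_supersolution[OF e \<mu> t R_def])
 next
  fix j assume "j < m"
  thus "\<forall>y\<in>rvec (d j). \<exists>x\<in>rvec (n + D). E \<mu> j *\<^sub>v x = y" by (rule E_surj)
 qed (use Q q R0 in auto)
 define M where "M = ext_form n D \<epsilon> + BL_form (n + D) m (E \<mu>) q A"
 have k0: "0 < \<Lambda> / \<epsilon> + \<mu>\<^sup>2" using \<Lambda>(1) e \<mu> by (intro add_nonneg_pos) auto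
 have Ainv: "qf (inv_mat (A j)) v \<le> (\<Lambda> / \<epsilon> + \<mu>\<^sup>2) * nsq v" if "j < m" "v \<in> rvec (d j)" for j v
  using A(4)[OF that] ext_inverse_bound[OF e \<Lambda>(2)[OF that] that, of \<mu>] by linarith
 obtain B c where B: "\<forall>j<m. pos_def_mat (d j) (B j) \<and> 1 \<le> c j \<and> det (A j) = det (B j) * c j \<and> (1 / ((\<Lambda> / \<epsilon> + \<mu>\<^sup>2) + q j * \<mu>\<^sup>2)) ^ d j \<le> det (B j)"
  and dM: "det M = (\<Prod>j<m. c j) * det (\<epsilon> \<cdot>\<^sub>m 1\<^sub>m n + BL_form n m L q B)"
  using ext_det[OF e q(1) A(1) M_def A(2)[folded M_def] k0 Ainv] by auto
 \<comment> \<open>By construction B_j^(-1) is A_j^(-1) + q_j mu^2, at most Lambda / eps + 2 mu^2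
   because q_j <= 1; \<open>\<kappa>\<close> dominates this.\<close>
 have B': "\<forall>j<m. pos_def_mat (d j) (B j) \<and> 1 \<le> c j \<and> det (A j) = det (B j) * c j \<and> (1 / \<kappa>) ^ d j \<le> det (B j)"
 proof (intro allI impI)
  fix j assume j: "j < m"
  have "q j * \<mu>\<^sup>2 \<le> \<mu>\<^sup>2" using q[OF j] mult_right_mono[of "q j" 1 "\<mu>\<^sup>2"] by simp
  hence le: "(\<Lambda> / \<epsilon> + \<mu>\<^sup>2) + q j * \<mu>\<^sup>2 \<le> \<kappa>" using \<kappa>(1) by linarith
  have "0 \<le> q j * \<mu>\<^sup>2" using q[OF j] by simp
  hence pos: "0 < (\<Lambda> / \<epsilon> + \<mu>\<^sup>2) + q j * \<mu>\<^sup>2" using k0 by linarith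
  have "(1 / \<kappa>) ^ d j \<le> (1 / ((\<Lambda> / \<epsilon> + \<mu>\<^sup>2) + q j * \<mu>\<^sup>2)) ^ d j"
   using le pos \<kappa>(2) by (intro power_mono divide_left_mono) auto
  thus "pos_def_mat (d j) (B j) \<and> 1 \<le> c j \<and> det (A j) = det (B j) * c j \<and> (1 / \<kappa>) ^ d j \<le> det (B j)"
   using B j by (meson order_trans)
 qed
 have ratio: "(\<Prod>j<m. det (A j) powr q j) / det M \<le> \<kappa> powr ((1 - \<theta>) * D) / (\<theta> ^ n * I)"
  unfolding q_def by (rule det_ratio[OF e \<kappa>(2) t B' dM[unfolded q_def]])
 have "(\<integral>\<^sup>+z. ennreal (gker (ext_form n D \<epsilon>) z * (\<Prod>j<m. rpow (f j (E \<mu> j *\<^sub>v z)) (q j))) \<partial>leb (n + D))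
  \<le> ennreal (sqrt ((\<Prod>j<m. det (A j) powr q j) / det M) * (\<Prod>j<m. rpow (\<integral>y. f j y \<partial>leb (d j)) (q j)))"
  by (rule kernel_Brascamp_Lieb[of _ _ m d A "E \<mu>"]) (use Q A q f in \<open>auto simp: M_def\<close>)
 also have "... \<le> ennreal (sqrt (\<kappa> powr ((1 - \<theta>) * D) / (\<theta> ^ n * I)) * (\<Prod>j<m. rpow (\<integral>y. f j y \<partial>leb (d j)) (q j)))"
  by (intro ennreal_leI mult_right_mono real_sqrt_le_mono ratio prod_nonneg rpow_nonneg) 
 finally show ?thesis unfolding q_def .
qed

end

section \<open>Removal of the regularisation\<close>

text \<open>As a function of base and exponent, \<open>rpow\<close> is discontinuous at (0, 0). The
  exponents theta_k a avoid this point: they are all 0, or they tend to a positive number.\<close>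

lemma tendsto_rpow_scaled:
 fixes \<theta> :: "nat \<Rightarrow> real"
 assumes f: "f \<longlonglongrightarrow> x" "\<And>k. 0 \<le> f k" and t: "\<theta> \<longlonglongrightarrow> 1" "\<And>k. 0 < \<theta> k" and a: "0 \<le> a"
 shows "(\<lambda>k. rpow (f k) (\<theta> k * a)) \<longlonglongrightarrow> rpow x a"
proof (cases "a = 0")
 case False
 have "(\<lambda>k. \<theta> k * a) \<longlonglongrightarrow> 1 * a" by (intro tendsto_mult t tendsto_const)
 hence "(\<lambda>k. f k powr (\<theta> k * a)) \<longlonglongrightarrow> x powr (1 * a)"
  by (rule tendsto_powr'[OF f(1)]) (use f a False in auto)
 moreover have "\<theta> k * a \<noteq> 0" for k using t(2)[of k] False by simp
 ultimately show ?thesis using False by (simp add: rpow_def)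
qed (simp add: rpow_def)

lemma measurable_rpow [measurable]: "(\<lambda>x. rpow x a) \<in> borel_measurable borel"
 unfolding rpow_def by measurable

text \<open>The base is \<open>\<kappa>\<close>, which grows linearly in k, and the exponent
  contains 1 - theta = 1 / (k + 2)^2. The logarithm is estimated crudely by its argument, so the
  exponent is of order 1/k.\<close>

lemma powr_correction_tendsto:
 fixes \<Lambda> c :: real
 assumes "0 \<le> \<Lambda>" "0 \<le> c"
 shows "(\<lambda>k. (\<Lambda> * real (Suc k) + 2) powr ((1 / (real k + 2)\<^sup>2) * c)) \<longlonglongrightarrow> 1"
proof -
 have pos: "0 < \<Lambda> * real (Suc k) + 2" for k using assms by (intro add_nonneg_pos) auto
 have "(\<lambda>k. (1 / (real k + 2)\<^sup>2) * ln (\<Lambda> * real (Suc k) + 2)) \<longlonglongrightarrow> 0"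
 proof (rule tendsto_sandwich)
  show "(\<lambda>k. 0 :: real) \<longlonglongrightarrow> 0" by simp
  have "(\<lambda>k. (\<Lambda> + 2) * (1 / real (Suc (Suc k)))) \<longlonglongrightarrow> (\<Lambda> + 2) * 0"
   by (intro tendsto_mult tendsto_const LIMSEQ_Suc lim_1_over_n)
  thus "(\<lambda>k. (\<Lambda> + 2) * (1 / (real k + 2))) \<longlonglongrightarrow> 0" by (simp add: add.commute)
  show "\<forall>\<^sub>F k in sequentially. 0 \<le> (1 / (real k + 2)\<^sup>2) * ln (\<Lambda> * real (Suc k) + 2)"
  proof (rule always_eventually, intro allI mult_nonneg_nonneg)
   fix k show "0 \<le> ln (\<Lambda> * real (Suc k) + 2)" using assms by (intro ln_ge_zero) (simp add: add_increasing)
  qed simp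
  show "\<forall>\<^sub>F k in sequentially. (1 / (real k + 2)\<^sup>2) * ln (\<Lambda> * real (Suc k) + 2) \<le> (\<Lambda> + 2) * (1 / (real k + 2))"
  proof (rule always_eventually, intro allI)
   fix k
   have "ln (\<Lambda> * real (Suc k) + 2) \<le> \<Lambda> * real (Suc k) + 2" using ln_bound[OF pos[of k]] .
   also have "... \<le> (\<Lambda> + 2) * (real k + 2)" using assms by (simp add: algebra_simps)
   finally have "(1 / (real k + 2)\<^sup>2) * ln (\<Lambda> * real (Suc k) + 2) \<le> (1 / (real k + 2)\<^sup>2) * ((\<Lambda> + 2) * (real k + 2))"
    by (intro mult_left_mono) auto
   also have "... = (\<Lambda> + 2) * (1 / (real k + 2))" by (simp add: power2_eq_square)
   finally show "(1 / (real k + 2)\<^sup>2) * ln (\<Lambda> * real (Suc k) + 2) \<le> (\<Lambda> + 2) * (1 / (real k + 2))" .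
  qed
 qed
 hence "(\<lambda>k. exp (c * ((1 / (real k + 2)\<^sup>2) * ln (\<Lambda> * real (Suc k) + 2)))) \<longlonglongrightarrow> exp (c * 0)"
  by (intro tendsto_intros)
 moreover have "(\<Lambda> * real (Suc k) + 2) powr ((1 / (real k + 2)\<^sup>2) * c) = exp (c * ((1 / (real k + 2)\<^sup>2) * ln (\<Lambda> * real (Suc k) + 2)))" for k
  using pos[of k] by (simp add: powr_def mult_ac)
 ultimately show ?thesis by simp
qed

context BL_positive
begin

lemma transpose_bounded:
 obtains \<Lambda> where "1 \<le> \<Lambda>"
  "\<And>j v. j < m \<Longrightarrow> v \<in> rvec (d j) \<Longrightarrow> nsq ((L j)\<^sup>T *\<^sub>v v) \<le> \<Lambda> * nsq v"
proof -
 have "\<forall>j. \<exists>c. j < m \<longrightarrow> 0 \<le> c \<and> (\<forall>v\<in>rvec (d j). qf (L j * 1\<^sub>m n * (L j)\<^sup>T) v \<le> c * nsq v)"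
 proof
  fix j
  show "\<exists>c. j < m \<longrightarrow> 0 \<le> c \<and> (\<forall>v\<in>rvec (d j). qf (L j * 1\<^sub>m n * (L j)\<^sup>T) v \<le> c * nsq v)"
  proof (cases "j < m")
   case True
   note S = pos_def_congruence[OF L[OF True] surj[OF True] pos_def_one]
   show ?thesis using bilf_le_norm[OF pd_carrier[OF S] pd_sym[OF S]] by blast
  qed simp
 qed
 from choice[OF this] obtain c where c: "\<forall>j. j < m \<longrightarrow> 0 \<le> c j \<and> (\<forall>v\<in>rvec (d j). qf (L j * 1\<^sub>m n * (L j)\<^sup>T) v \<le> c j * nsq v)" ..
 show thesis
 proof (rule that[of "1 + (\<Sum>j<m. c j)"])
  show "1 \<le> 1 + (\<Sum>j<m. c j)" using c sum_nonneg[of "{..<m}" c] by simp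
  fix j and v :: "real vec" assume j: "j < m" and v: "v \<in> rvec (d j)"
  have LT: "(L j)\<^sup>T *\<^sub>v v \<in> rvec n" using L[OF j] v by simp
  have "c j \<le> (\<Sum>j<m. c j)" by (rule member_le_sum) (use c j in auto)
  hence "c j * nsq v \<le> (1 + (\<Sum>j<m. c j)) * nsq v"
   by (intro mult_right_mono nsq_nonneg) simp
  moreover have "qf (L j * 1\<^sub>m n * (L j)\<^sup>T) v \<le> c j * nsq v" using c j v by blast
  ultimately show "nsq ((L j)\<^sup>T *\<^sub>v v) \<le> (1 + (\<Sum>j<m. c j)) * nsq v"
   unfolding bilf_congruence'[OF L[OF j] one_carrier_mat v v] bilf_one[OF LT LT] by linarith
 qed
qed

text \<open>The regularised integrands tend pointwise to exp(-pi |w|^2) times the integrand in x.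
  The Gaussian in w has integral 1, and Fatou's lemma turns the pointwise limit into the
  inequality.\<close>

theorem nice_Brascamp_Lieb:
 assumes f: "\<And>j. j < m \<Longrightarrow> nice_fun (d j) (f j)"
 shows "(\<integral>\<^sup>+x. ennreal (\<Prod>j<m. rpow (f j (L j *\<^sub>v x)) (p j)) \<partial>leb n)
  \<le> ennreal (sqrt (1 / I) * (\<Prod>j<m. rpow (\<integral>y. f j y \<partial>leb (d j)) (p j)))"
proof -
 obtain \<Lambda> where \<Lambda>: "1 \<le> \<Lambda>"
  "\<And>j v. j < m \<Longrightarrow> v \<in> rvec (d j) \<Longrightarrow> nsq ((L j)\<^sup>T *\<^sub>v v) \<le> \<Lambda> * nsq v"
  by (fact transpose_bounded)
 have fm: "f j \<in> bmeas (d j)" if "j < m" for j using f[OF that] by (simp add: nice_fun_def)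
 have f0: "0 \<le> f j v" if "j < m" "v \<in> rvec (d j)" for j v using nice_fun_nonneg[OF f[OF that(1)] that(2)] .
 \<comment> \<open>The same sequence serves as epsilon and as mu.\<close>
 define \<epsilon> where "\<epsilon> k = 1 / real (Suc k)" for k
 \<comment> \<open>The square makes 1 - theta small compared with 1 / ln kappa, as
   \<open>powr_correction_tendsto\<close> needs; the shift by 2 keeps theta positive at k =
   0.\<close>
 define \<theta> where "\<theta> k = 1 - 1 / (real k + 2)\<^sup>2" for k
 have e: "0 < \<epsilon> k" "\<epsilon> k \<le> 1" for k by (auto simp: \<epsilon>_def)
 have t: "0 < \<theta> k" "\<theta> k < 1" for k
 proof -
  have "1 < (real k + 2)\<^sup>2" by (simp add: power2_eq_square algebra_simps add_pos_nonneg)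
  thus "0 < \<theta> k" "\<theta> k < 1" by (auto simp: \<theta>_def)
 qed
 have elim: "\<epsilon> \<longlonglongrightarrow> 0" unfolding \<epsilon>_def by (intro LIMSEQ_Suc lim_1_over_n)
 have "(\<lambda>k. 1 - (1 / real (Suc (Suc k)))\<^sup>2) \<longlonglongrightarrow> 1 - 0\<^sup>2"
  by (intro tendsto_intros LIMSEQ_Suc lim_1_over_n)
 hence tlim: "\<theta> \<longlonglongrightarrow> 1" by (simp add: \<theta>_def[abs_def] power_divide add.commute)
 define J where "J j = (\<integral>y. f j y \<partial>leb (d j))" for j
 have J: "0 \<le> J j" if "j < m" for j unfolding J_def using f0[OF that] by (intro integral_nonneg_AE AE_I2) simp
 define F where "F k z = gker (ext_form n D (\<epsilon> k)) z * (\<Prod>j<m. rpow (f j (E (\<epsilon> k) j *\<^sub>v z)) (\<theta> k * p j))" for k z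
 define C where "C k = sqrt ((\<Lambda> * real (Suc k) + 2) powr ((1 - \<theta> k) * D) / (\<theta> k ^ n * I)) * (\<Prod>j<m. rpow (J j) (\<theta> k * p j))" for k
 have FC: "(\<integral>\<^sup>+z. ennreal (F k z) \<partial>leb (n + D)) \<le> ennreal (C k)" for k
  unfolding F_def C_def J_def
 proof (rule regularised_Brascamp_Lieb[OF f e(1) e(1) t])
  have "(\<epsilon> k)\<^sup>2 \<le> 1" using e[of k] by (simp add: power_le_one)
  thus "\<Lambda> / \<epsilon> k + 2 * (\<epsilon> k)\<^sup>2 \<le> \<Lambda> * real (Suc k) + 2" by (simp add: \<epsilon>_def)
  have "0 \<le> \<Lambda> * real (Suc k)" using \<Lambda>(1) by simp
  thus "1 \<le> \<Lambda> * real (Suc k) + 2" by linarith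
 qed (use \<Lambda> in auto)
 have Flim: "(\<lambda>k. F k (x @\<^sub>v w)) \<longlonglongrightarrow> exp (- pi * nsq w) * (\<Prod>j<m. rpow (f j (L j *\<^sub>v x)) (p j))"
  if x: "x \<in> rvec n" and w: "w \<in> rvec D" for x w
  unfolding F_def
 proof (intro tendsto_mult tendsto_prod)
  have "(\<lambda>k. exp (- pi * (\<epsilon> k * nsq x + nsq w))) \<longlonglongrightarrow> exp (- pi * (0 * nsq x + nsq w))"
   by (intro tendsto_intros elim)
  thus "(\<lambda>k. gker (ext_form n D (\<epsilon> k)) (x @\<^sub>v w)) \<longlonglongrightarrow> exp (- pi * nsq w)"
   by (simp add: bilf_ext_form[OF x w])
  fix j assume "j \<in> {..<m}"
  hence j: "j < m" by simp
  have u: "L j *\<^sub>v x \<in> rvec (d j)" using L[OF j] x by simp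
  hence uk: "L j *\<^sub>v x + \<epsilon> k \<cdot>\<^sub>v vblock d j w \<in> rvec (d j)" for k by simp
  have "(\<lambda>k. f j (L j *\<^sub>v x + \<epsilon> k \<cdot>\<^sub>v vblock d j w)) \<longlonglongrightarrow> f j (L j *\<^sub>v x)"
  proof (rule f[OF j, unfolded nice_fun_def seqcont_def, THEN conjunct2, THEN conjunct1, rule_format])
   fix i assume i: "i < d j"
   have "(\<lambda>k. (L j *\<^sub>v x) $ i + \<epsilon> k * vblock d j w $ i) \<longlonglongrightarrow> (L j *\<^sub>v x) $ i + 0 * vblock d j w $ i"
    by (intro tendsto_intros elim)
   moreover have "(L j *\<^sub>v x + \<epsilon> k \<cdot>\<^sub>v vblock d j w) $ i = (L j *\<^sub>v x) $ i + \<epsilon> k * vblock d j w $ i" for k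
    using i u by (simp add: vblock_def del: index_mult_mat_vec)
   ultimately show "(\<lambda>k. (L j *\<^sub>v x + \<epsilon> k \<cdot>\<^sub>v vblock d j w) $ i) \<longlonglongrightarrow> (L j *\<^sub>v x) $ i" by simp
  qed (use u uk in auto)
  thus "(\<lambda>k. rpow (f j (E (\<epsilon> k) j *\<^sub>v (x @\<^sub>v w))) (\<theta> k * p j)) \<longlonglongrightarrow> rpow (f j (L j *\<^sub>v x)) (p j)"
   unfolding Emult[OF j x w] by (rule tendsto_rpow_scaled[OF _ f0[OF j uk] tlim t(1) p(1)[OF j]])
 qed
 have Clim: "C \<longlonglongrightarrow> sqrt (1 / (1 ^ n * I)) * (\<Prod>j<m. rpow (J j) (p j))"
  unfolding C_def
 proof (intro tendsto_mult tendsto_prod tendsto_real_sqrt tendsto_divide)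
  show "(\<lambda>k. (\<Lambda> * real (Suc k) + 2) powr ((1 - \<theta> k) * D)) \<longlonglongrightarrow> 1"
   using powr_correction_tendsto[of \<Lambda> D] \<Lambda>(1) by (simp add: \<theta>_def)
  show "(\<lambda>k. \<theta> k ^ n) \<longlonglongrightarrow> 1 ^ n" by (intro tendsto_power tlim)
  fix j assume "j \<in> {..<m}"
  hence j: "j < m" by simp
  show "(\<lambda>k. rpow (J j) (\<theta> k * p j)) \<longlonglongrightarrow> rpow (J j) (p j)"
   by (rule tendsto_rpow_scaled[OF tendsto_const J[OF j] tlim t(1) p(1)[OF j]])
 qed (use I in auto)
 have Fm: "(\<lambda>z. ennreal (F k z)) \<in> bmeas (n + D)" for k
 proof -
  have "(\<lambda>z. rpow (f j (E (\<epsilon> k) j *\<^sub>v z)) (\<theta> k * p j)) \<in> bmeas (n + D)" if j: "j < m" for j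
  proof -
   have "(\<lambda>z. E (\<epsilon> k) j *\<^sub>v z) \<in> leb (n + D) \<rightarrow>\<^sub>M leb (d j)"
    by (rule meas_mult_mat_vec[OF ext_map_carrier]) simp
   from measurable_compose[OF measurable_compose[OF this fm[OF j]] measurable_rpow] show ?thesis .
  qed
  hence [measurable]: "(\<lambda>z. \<Prod>j<m. rpow (f j (E (\<epsilon> k) j *\<^sub>v z)) (\<theta> k * p j)) \<in> bmeas (n + D)"
   by (intro borel_measurable_prod) auto
  note [measurable] = meas_qf[OF ext_form_carrier]
  show ?thesis unfolding F_def by measurable
 qed
 define H where "H z = liminf (\<lambda>k. ennreal (F k z))" for z
 have Hm: "H \<in> bmeas (n + D)" unfolding H_def using Fm by measurable
 define P where "P x = (\<Prod>j<m. rpow (f j (L j *\<^sub>v x)) (p j))" for x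
 have "(\<integral>\<^sup>+x. ennreal (P x) \<partial>leb n) = (\<integral>\<^sup>+x. \<integral>\<^sup>+w. H (x @\<^sub>v w) \<partial>leb D \<partial>leb n)"
 proof (rule nn_integral_cong)
  fix x assume "x \<in> space (leb n)"
  hence x: "x \<in> rvec n" by simp
  have P0: "0 \<le> P x" unfolding P_def by (intro prod_nonneg rpow_nonneg)
  note [measurable] = meas_qf[OF one_carrier_mat]
  have m1: "(\<lambda>w. ennreal (gker (1\<^sub>m D) w)) \<in> bmeas D" by measurable
  have "(\<integral>\<^sup>+w. H (x @\<^sub>v w) \<partial>leb D) = (\<integral>\<^sup>+w. ennreal (P x) * ennreal (gker (1\<^sub>m D) w) \<partial>leb D)"
  proof (rule nn_integral_cong)
   fix w assume "w \<in> space (leb D)"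
   hence w: "w \<in> rvec D" by simp
   have "H (x @\<^sub>v w) = ennreal (exp (- pi * nsq w) * P x)"
    unfolding H_def P_def by (rule lim_imp_Liminf[OF _ tendsto_ennrealI[OF Flim[OF x w]]]) simp
   thus "H (x @\<^sub>v w) = ennreal (P x) * ennreal (gker (1\<^sub>m D) w)"
    using P0 by (simp add: bilf_one[OF w w] ennreal_mult'[symmetric] mult.commute)
  qed
  also have "... = ennreal (P x)"
   unfolding nn_integral_cmult[OF m1] nn_integral_gauss[OF pos_def_one] by simp
  finally show "ennreal (P x) = (\<integral>\<^sup>+w. H (x @\<^sub>v w) \<partial>leb D)" ..
 qed
 also have "... = (\<integral>\<^sup>+z. H z \<partial>leb (n + D))" by (rule nn_integral_leb_append[OF Hm, symmetric])
 also have "... \<le> liminf (\<lambda>k. \<integral>\<^sup>+z. ennreal (F k z) \<partial>leb (n + D))"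
  unfolding H_def by (rule nn_integral_liminf[OF Fm])
 also have "... \<le> liminf (\<lambda>k. ennreal (C k))" by (intro Liminf_mono always_eventually allI FC)
 also have "... = ennreal (sqrt (1 / (1 ^ n * I)) * (\<Prod>j<m. rpow (J j) (p j)))"
  by (rule lim_imp_Liminf[OF _ tendsto_ennrealI[OF Clim]]) simp
 finally show ?thesis by (simp add: P_def J_def)
qed

end

section \<open>Density of continuous functions\<close>

text \<open>A continuous substitute for the indicator of a box: 1 on the box, and falling off with
  slope s in each coordinate, so that the support exceeds the box by at most 1/s in every
  direction.\<close>

definition trapezoid :: "nat \<Rightarrow> (nat \<Rightarrow> real) \<Rightarrow> (nat \<Rightarrow> real) \<Rightarrow> real \<Rightarrow> real vec \<Rightarrow> real" where
 "trapezoid k l u s v = (\<Prod>i<k. max 0 (1 - s * max 0 (max (l i - v $ i) (v $ i - u i))))"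

definition box_vec :: "nat \<Rightarrow> (nat \<Rightarrow> real) \<Rightarrow> (nat \<Rightarrow> real) \<Rightarrow> real vec set" where
 "box_vec k l u = {v \<in> rvec k. \<forall>i<k. l i \<le> v $ i \<and> v $ i \<le> u i}"

lemma nice_fun_trapezoid:
 assumes s: "0 < s" shows "nice_fun k (trapezoid k l u s)"
 unfolding nice_fun_def
proof (intro conjI exI ballI impI allI)
 note [measurable] = measurable_vec_index
 show "trapezoid k l u s \<in> bmeas k"
  unfolding trapezoid_def by (intro borel_measurable_prod) measurable
 show "seqcont k (trapezoid k l u s)"
  unfolding seqcont_def trapezoid_def
  by (intro allI impI tendsto_prod tendsto_max tendsto_diff tendsto_mult tendsto_const) auto
 fix v assume v: "v \<in> rvec k"
 show "0 \<le> trapezoid k l u s v" unfolding trapezoid_def by (intro prod_nonneg) auto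
 show "trapezoid k l u s v \<le> 1" unfolding trapezoid_def using s by (intro prod_le_1) auto
 fix i assume nz: "trapezoid k l u s v \<noteq> 0" and i: "i < k"
 have "max 0 (1 - s * max 0 (max (l i - v $ i) (v $ i - u i))) \<noteq> 0"
  using nz i by (auto simp: trapezoid_def)
 hence "s * max 0 (max (l i - v $ i) (v $ i - u i)) < 1" by linarith
 hence "max 0 (max (l i - v $ i) (v $ i - u i)) * s < 1" by (simp only: mult.commute[of s])
 hence "max 0 (max (l i - v $ i) (v $ i - u i)) < 1 / s" by (simp only: pos_less_divide_eq[OF s])
 hence "\<bar>v $ i\<bar> \<le> (\<bar>l i\<bar> + \<bar>u i\<bar>) + 1 / s" by linarith
 also have "\<bar>l i\<bar> + \<bar>u i\<bar> \<le> (\<Sum>i<k. \<bar>l i\<bar> + \<bar>u i\<bar>)" by (rule member_le_sum) (use i in auto)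
 finally show "\<bar>v $ i\<bar> \<le> (\<Sum>i<k. \<bar>l i\<bar> + \<bar>u i\<bar>) + 1 / s" by simp
qed

lemma trapezoid_tendsto:
 assumes v: "v \<in> rvec k"
 shows "(\<lambda>n. trapezoid k l u (real (Suc n)) v) \<longlonglongrightarrow> indicator (box_vec k l u) v"
proof -
 have lim: "(\<lambda>n. max 0 (1 - real (Suc n) * a)) \<longlonglongrightarrow> (if a = 0 then 1 else 0)" if a: "0 \<le> a" for a :: real
 proof (cases "a = 0")
  case False
  hence a0: "0 < a" using a by simp
  obtain N where N: "1 / a < real N" using reals_Archimedean2 by blast
  have "\<forall>\<^sub>F n in sequentially. max 0 (1 - real (Suc n) * a) = 0"
  proof (rule eventually_sequentiallyI)
   fix n assume "N \<le> n"
   hence "1 / a \<le> real (Suc n)" using N by linarith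
   hence "1 \<le> real (Suc n) * a" using a0 by (simp only: pos_divide_le_eq)
   thus "max 0 (1 - real (Suc n) * a) = 0" by linarith
  qed
  thus ?thesis using False by (simp add: tendsto_eventually)
 qed simp
 have "(\<lambda>n. trapezoid k l u (real (Suc n)) v) \<longlonglongrightarrow> (\<Prod>i<k. if max 0 (max (l i - v $ i) (v $ i - u i)) = 0 then 1 else 0)"
  unfolding trapezoid_def by (intro tendsto_prod lim) auto
 also have "(\<Prod>i<k. if max 0 (max (l i - v $ i) (v $ i - u i)) = 0 then 1 else 0) = (indicator (box_vec k l u) v :: real)"
 proof (cases "v \<in> box_vec k l u")
  case True
  hence "max 0 (max (l i - v $ i) (v $ i - u i)) = 0" if "i < k" for i
   using that by (simp add: box_vec_def)
  thus ?thesis using True by simp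
 next
  case False
  then obtain i where "i < k" "\<not> (l i \<le> v $ i \<and> v $ i \<le> u i)" using v by (auto simp: box_vec_def)
  hence "i \<in> {..<k}" "max 0 (max (l i - v $ i) (v $ i - u i)) \<noteq> 0" by auto
  thus ?thesis using False by (intro prod_zero[THEN trans]) auto
 qed
 finally show ?thesis .
qed

lemma trapezoid_mono:
 assumes "1 \<le> s" shows "trapezoid k l u s v \<le> trapezoid k l u 1 v"
 unfolding trapezoid_def
proof (intro prod_mono conjI)
 fix i
 have "1 * max 0 (max (l i - v $ i) (v $ i - u i)) \<le> s * max 0 (max (l i - v $ i) (v $ i - u i))"
  using assms by (intro mult_right_mono) auto
 thus "max 0 (1 - s * max 0 (max (l i - v $ i) (v $ i - u i))) \<le> max 0 (1 - 1 * max 0 (max (l i - v $ i) (v $ i - u i)))" by linarith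
qed auto

lemma trapezoid_nonneg: "0 \<le> trapezoid k l u s v"
 unfolding trapezoid_def by (intro prod_nonneg) auto

text \<open>The signed counterpart of \<open>nice_fun\<close>, which is closed under linear
  combinations.\<close>

definition cc_fun :: "nat \<Rightarrow> (real vec \<Rightarrow> real) \<Rightarrow> bool" where
 "cc_fun k g \<longleftrightarrow> g \<in> bmeas k \<and> seqcont k g \<and>
  (\<exists>b r. \<forall>v\<in>rvec k. \<bar>g v\<bar> \<le> b \<and> (g v \<noteq> 0 \<longrightarrow> (\<forall>i<k. \<bar>v $ i\<bar> \<le> r)))"

lemma nice_fun_cc: "nice_fun k g \<Longrightarrow> cc_fun k g"
 unfolding nice_fun_def cc_fun_def by fastforce

lemma cc_fun_max: 
 assumes "cc_fun k g" shows "nice_fun k (\<lambda>v. max 0 (g v))"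
proof -
 obtain b r where br: "\<forall>v\<in>rvec k. \<bar>g v\<bar> \<le> b \<and> (g v \<noteq> 0 \<longrightarrow> (\<forall>i<k. \<bar>v $ i\<bar> \<le> r))"
  using assms unfolding cc_fun_def by blast
 have [measurable]: "g \<in> bmeas k" and c: "seqcont k g" using assms by (auto simp: cc_fun_def)
 have "seqcont k (\<lambda>v. max 0 (g v))" using c unfolding seqcont_def by (auto intro!: tendsto_max)
 moreover have "\<forall>v\<in>rvec k. 0 \<le> max 0 (g v) \<and> max 0 (g v) \<le> \<bar>b\<bar> \<and> (max 0 (g v) \<noteq> 0 \<longrightarrow> (\<forall>i<k. \<bar>v $ i\<bar> \<le> r))"
 proof
  fix v assume "v \<in> rvec k"
  with br have v: "\<bar>g v\<bar> \<le> b \<and> (g v \<noteq> 0 \<longrightarrow> (\<forall>i<k. \<bar>v $ i\<bar> \<le> r))" by blast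
  thus "0 \<le> max 0 (g v) \<and> max 0 (g v) \<le> \<bar>b\<bar> \<and> (max 0 (g v) \<noteq> 0 \<longrightarrow> (\<forall>i<k. \<bar>v $ i\<bar> \<le> r))"
   by (cases "g v = 0") auto
 qed
 ultimately show ?thesis unfolding nice_fun_def by (intro conjI exI[of _ "\<bar>b\<bar>"] exI[of _ r]) (simp_all, measurable)
qed

lemma cc_fun_linear:
 assumes "cc_fun k g" "cc_fun k h" shows "cc_fun k (\<lambda>v. a * g v + h v)"
proof -
 obtain b r where br: "\<forall>v\<in>rvec k. \<bar>g v\<bar> \<le> b \<and> (g v \<noteq> 0 \<longrightarrow> (\<forall>i<k. \<bar>v $ i\<bar> \<le> r))"
  using assms(1) unfolding cc_fun_def by blast
 obtain b' r' where br': "\<forall>v\<in>rvec k. \<bar>h v\<bar> \<le> b' \<and> (h v \<noteq> 0 \<longrightarrow> (\<forall>i<k. \<bar>v $ i\<bar> \<le> r'))"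
  using assms(2) unfolding cc_fun_def by blast
 have m: "g \<in> bmeas k" "h \<in> bmeas k" and c: "seqcont k g" "seqcont k h"
  using assms by (auto simp: cc_fun_def)
 note [measurable] = m
 have "seqcont k (\<lambda>v. a * g v + h v)" using c unfolding seqcont_def by (auto intro!: tendsto_add tendsto_mult)
 moreover have "(\<lambda>v. a * g v + h v) \<in> bmeas k" by measurable
 moreover have "\<forall>v\<in>rvec k. \<bar>a * g v + h v\<bar> \<le> \<bar>a\<bar> * b + b' \<and> (a * g v + h v \<noteq> 0 \<longrightarrow> (\<forall>i<k. \<bar>v $ i\<bar> \<le> max r r'))"
 proof (intro ballI conjI impI allI)
  fix v assume v: "v \<in> rvec k"
  have "\<bar>a * g v + h v\<bar> \<le> \<bar>a\<bar> * \<bar>g v\<bar> + \<bar>h v\<bar>" using abs_triangle_ineq[of "a * g v" "h v"] by (simp add: abs_mult)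
  also have "... \<le> \<bar>a\<bar> * b + b'" using br br' v by (intro add_mono mult_left_mono) auto
  finally show "\<bar>a * g v + h v\<bar> \<le> \<bar>a\<bar> * b + b'" .
  fix i assume "a * g v + h v \<noteq> 0" and i: "i < k"
  hence "g v \<noteq> 0 \<or> h v \<noteq> 0" by auto
  hence "\<bar>v $ i\<bar> \<le> r \<or> \<bar>v $ i\<bar> \<le> r'" using br br' v i by blast
  thus "\<bar>v $ i\<bar> \<le> max r r'" by linarith
 qed
 ultimately show ?thesis unfolding cc_fun_def by blast
qed

text \<open>The positive parts of g and of -g are covered by
  \<open>nice_fun_integrable\<close>.\<close>

lemma cc_fun_integrable:
 assumes "cc_fun k g" shows "integrable (leb k) g"
proof -
 have "cc_fun k (\<lambda>v. - 1 * g v + (0 * g v + 0 * g v))"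
 proof -
  have "cc_fun k (\<lambda>v. 0)" using assms unfolding cc_fun_def seqcont_def by auto
  from cc_fun_linear[OF assms this, of "- 1"] show ?thesis by simp
 qed
 hence "cc_fun k (\<lambda>v. - g v)" by simp
 from nice_fun_integrable[OF cc_fun_max[OF assms]] nice_fun_integrable[OF cc_fun_max[OF this]]
 have "integrable (leb k) (\<lambda>v. max 0 (g v) - max 0 (- g v))" by (rule Bochner_Integration.integrable_diff)
 moreover have "(\<lambda>v. max 0 (g v) - max 0 (- g v)) = g" by (rule ext) linarith
 ultimately show ?thesis by simp
qed

section \<open>The L1 closure of the continuous functions of compact support\<close>

definition cc_approx :: "nat \<Rightarrow> (real vec \<Rightarrow> real) \<Rightarrow> bool" where
 "cc_approx k f \<longleftrightarrow> integrable (leb k) f \<and> (\<forall>e>0. \<exists>g. cc_fun k g \<and> (\<integral>v. \<bar>f v - g v\<bar> \<partial>leb k) < e)"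

lemma cc_approx_cc: "cc_fun k f \<Longrightarrow> cc_approx k f"
 unfolding cc_approx_def by (auto intro: cc_fun_integrable)

lemma cc_approx_linear:
 assumes "cc_approx k f" "cc_approx k h" shows "cc_approx k (\<lambda>v. a * f v + h v)"
 unfolding cc_approx_def
proof (intro conjI allI impI)
 have [simp]: "integrable (leb k) f" "integrable (leb k) h" using assms by (auto simp: cc_approx_def)
 show "integrable (leb k) (\<lambda>v. a * f v + h v)" by simp
 fix e :: real assume e: "0 < e"
 have "0 < e / 2 / (\<bar>a\<bar> + 1)" using e by simp
 then obtain g where g: "cc_fun k g" "(\<integral>v. \<bar>f v - g v\<bar> \<partial>leb k) < e / 2 / (\<bar>a\<bar> + 1)"
  using assms(1) unfolding cc_approx_def by blast
 obtain g' where g': "cc_fun k g'" "(\<integral>v. \<bar>h v - g' v\<bar> \<partial>leb k) < e / 2"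
  using assms(2) e half_gt_zero unfolding cc_approx_def by blast
 have [simp]: "integrable (leb k) g" "integrable (leb k) g'" using g(1) g'(1) by (auto intro: cc_fun_integrable)
 have "(\<integral>v. \<bar>a * f v + h v - (a * g v + g' v)\<bar> \<partial>leb k) \<le> (\<integral>v. \<bar>a\<bar> * \<bar>f v - g v\<bar> + \<bar>h v - g' v\<bar> \<partial>leb k)"
 proof (rule integral_mono)
  fix v
  have "\<bar>a * (f v - g v) + (h v - g' v)\<bar> \<le> \<bar>a\<bar> * \<bar>f v - g v\<bar> + \<bar>h v - g' v\<bar>"
   using abs_triangle_ineq[of "a * (f v - g v)" "h v - g' v"] by (simp add: abs_mult)
  thus "\<bar>a * f v + h v - (a * g v + g' v)\<bar> \<le> \<bar>a\<bar> * \<bar>f v - g v\<bar> + \<bar>h v - g' v\<bar>" by (simp add: algebra_simps)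
 qed auto
 also have "... = \<bar>a\<bar> * (\<integral>v. \<bar>f v - g v\<bar> \<partial>leb k) + (\<integral>v. \<bar>h v - g' v\<bar> \<partial>leb k)" by simp
 also have "... < e"
 proof -
  have "\<bar>a\<bar> * (\<integral>v. \<bar>f v - g v\<bar> \<partial>leb k) \<le> (\<bar>a\<bar> + 1) * (e / 2 / (\<bar>a\<bar> + 1))"
   using g(2) e by (intro mult_mono) auto
  also have "... = e / 2" by (simp add: field_simps)
  finally show ?thesis using g'(2) by linarith
 qed
 finally show "\<exists>G. cc_fun k G \<and> (\<integral>v. \<bar>a * f v + h v - G v\<bar> \<partial>leb k) < e"
  using cc_fun_linear[OF g(1) g'(1), of a] by blast
qed

lemma cc_approx_lim:
 assumes s: "\<And>i. cc_approx k (s i)" and f: "f \<in> bmeas k" and w: "integrable (leb k) w"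
  and lim: "\<And>v. v \<in> rvec k \<Longrightarrow> (\<lambda>i. s i v) \<longlonglongrightarrow> f v"
  and bnd: "\<And>i v. v \<in> rvec k \<Longrightarrow> \<bar>s i v\<bar> \<le> w v"
 shows "cc_approx k f"
 unfolding cc_approx_def
proof (intro conjI allI impI)
 have si[simp]: "integrable (leb k) (s i)" for i using s by (simp add: cc_approx_def)
 have sm: "s i \<in> bmeas k" for i using si by (rule borel_measurable_integrable)
 show fi[simp]: "integrable (leb k) f"
  by (rule integrable_dominated_convergence[OF f sm w]) (use lim bnd in \<open>auto intro!: AE_I2\<close>)
 have "(\<lambda>i. \<integral>v. \<bar>f v - s i v\<bar> \<partial>leb k) \<longlonglongrightarrow> (\<integral>v. 0 \<partial>leb k)"
 proof (rule integral_dominated_convergence)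
  show "integrable (leb k) (\<lambda>v. 2 * w v)" using w by simp
  show "(\<lambda>v. \<bar>f v - s i v\<bar>) \<in> bmeas k" for i using f sm by measurable
  show "AE v in leb k. (\<lambda>i. \<bar>f v - s i v\<bar>) \<longlonglongrightarrow> 0"
  proof (rule AE_I2)
   fix v assume "v \<in> space (leb k)"
   hence "(\<lambda>i. \<bar>f v - s i v\<bar>) \<longlonglongrightarrow> \<bar>f v - f v\<bar>" by (intro tendsto_intros lim) simp
   thus "(\<lambda>i. \<bar>f v - s i v\<bar>) \<longlonglongrightarrow> 0" by simp
  qed
  show "AE v in leb k. norm \<bar>f v - s i v\<bar> \<le> 2 * w v" for i
  proof (rule AE_I2)
   fix v assume "v \<in> space (leb k)"
   hence v: "v \<in> rvec k" by simp
   have "\<bar>f v\<bar> \<le> w v" by (rule LIMSEQ_le_const2[OF tendsto_rabs[OF lim[OF v]]]) (use bnd[OF v] in auto)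
   thus "norm \<bar>f v - s i v\<bar> \<le> 2 * w v" using bnd[OF v, of i] by simp
  qed
 qed simp
 hence lim0: "(\<lambda>i. \<integral>v. \<bar>f v - s i v\<bar> \<partial>leb k) \<longlonglongrightarrow> 0" by simp
 fix e :: real assume e: "0 < e"
 then obtain i where i: "(\<integral>v. \<bar>f v - s i v\<bar> \<partial>leb k) < e / 2"
  using order_tendstoD(2)[OF lim0, of "e / 2"] by (auto simp: eventually_sequentially)
 obtain g where g: "cc_fun k g" "(\<integral>v. \<bar>s i v - g v\<bar> \<partial>leb k) < e / 2"
  using s[of i] e half_gt_zero unfolding cc_approx_def by blast
 have [simp]: "integrable (leb k) g" using g(1) by (rule cc_fun_integrable)
 have "(\<integral>v. \<bar>f v - g v\<bar> \<partial>leb k) \<le> (\<integral>v. \<bar>f v - s i v\<bar> + \<bar>s i v - g v\<bar> \<partial>leb k)"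
  by (rule integral_mono) auto
 also have "... = (\<integral>v. \<bar>f v - s i v\<bar> \<partial>leb k) + (\<integral>v. \<bar>s i v - g v\<bar> \<partial>leb k)" by simp
 also have "... < e" using i g(2) by linarith
 finally show "\<exists>g. cc_fun k g \<and> (\<integral>v. \<bar>f v - g v\<bar> \<partial>leb k) < e" using g(1) by blast
qed

lemma box_vec_sets: "box_vec k l u \<in> sets (leb k)"
proof -
 note [measurable] = measurable_vec_index
 have "box_vec k l u = {v \<in> space (leb k). \<forall>i\<in>{..<k}. l i \<le> v $ i \<and> v $ i \<le> u i}"
  by (auto simp: box_vec_def)
 also have "... \<in> sets (leb k)" by measurable
 finally show ?thesis .
qed

lemma cc_approx_box: "cc_approx k (indicator (box_vec k l u))"
proof (rule cc_approx_lim)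
 show "cc_approx k (trapezoid k l u (real (Suc i)))" for i by (intro cc_approx_cc nice_fun_cc nice_fun_trapezoid) simp
 show "indicator (box_vec k l u) \<in> bmeas k" using box_vec_sets by simp
 show "integrable (leb k) (trapezoid k l u 1)" by (intro nice_fun_integrable nice_fun_trapezoid) simp
 show "(\<lambda>i. trapezoid k l u (real (Suc i)) v) \<longlonglongrightarrow> indicator (box_vec k l u) v" if "v \<in> rvec k" for v
  by (rule trapezoid_tendsto[OF that])
 show "\<bar>trapezoid k l u (real (Suc i)) v\<bar> \<le> trapezoid k l u 1 v" for i v
  using trapezoid_nonneg trapezoid_mono by simp
qed

abbreviation cube_vec :: "nat \<Rightarrow> real \<Rightarrow> real vec set" where
 "cube_vec k r \<equiv> box_vec k (\<lambda>_. - r) (\<lambda>_. r)"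

text \<open>A generator of the sigma-algebra that is closed under intersection, as Dynkin's argument
  requires.\<close>

definition orthants :: "nat \<Rightarrow> real vec set set" where
 "orthants k = range (\<lambda>a. {v \<in> rvec k. \<forall>i<k. v $ i \<le> a i})"

lemma sets_leb_orthants:
 assumes "A \<in> sets (leb k)" shows "A \<in> sigma_sets (rvec k) (orthants k)"
proof -
 define N where "N = sigma (rvec k) (orthants k)"
 have sub: "orthants k \<subseteq> Pow (rvec k)" by (auto simp: orthants_def)
 have sp: "space N = rvec k" and sets: "sets N = sigma_sets (rvec k) (orthants k)"
  unfolding N_def using sub by auto
 have "(\<lambda>v. v) \<in> N \<rightarrow>\<^sub>M leb k"
 proof (rule measurable_lebI)
  fix i assume i: "i < k"
  show "(\<lambda>v. v $ i) \<in> borel_measurable N"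
   unfolding borel_measurable_iff_le
  proof
   fix c :: real
   \<comment> \<open>The other coordinates are unrestricted in a half space, which is therefore
     exhausted by countably many orthants whose remaining bounds are n.\<close>
   have "{v \<in> space N. v $ i \<le> c} = (\<Union>n::nat. {v \<in> rvec k. \<forall>j<k. v $ j \<le> (if j = i then c else real n)})" (is "?l = ?r")
   proof (intro equalityI subsetI)
    fix v assume v: "v \<in> ?l"
    obtain n :: nat where n: "(\<Sum>j<k. \<bar>v $ j\<bar>) < real n" using reals_Archimedean2 by blast
    have "v $ j \<le> real n" if "j < k" for j
    proof -
     have "\<bar>v $ j\<bar> \<le> (\<Sum>j<k. \<bar>v $ j\<bar>)" by (rule member_le_sum) (use that in auto)
     thus ?thesis using n by linarith
    qed
    thus "v \<in> ?r" using v sp by (auto intro!: exI[of _ n])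
   next
    fix v assume "v \<in> ?r"
    thus "v \<in> ?l" using i sp by force
   qed
   also have "... \<in> sets N" unfolding sets by (intro sigma_sets.Union sigma_sets.Basic) (auto simp: orthants_def)
   finally show "{v \<in> space N. v $ i \<le> c} \<in> sets N" .
  qed
 qed (simp add: sp)
 from measurable_sets[OF this assms] have "A \<inter> rvec k \<in> sets N" by (simp add: sp vimage_def Int_def)
 moreover have "A \<subseteq> rvec k" using sets.sets_into_space[OF assms] by simp
 ultimately show ?thesis by (simp add: sets Int_absorb2)
qed

text \<open>Dynkin's argument. Intersecting with a cube keeps every indicator integrable, so
  complements within the cube and countable disjoint unions stay in the class; an orthant meets the
  cube in a box.\<close>

lemma cc_approx_bounded_set:
 assumes "A \<in> sets (leb k)" shows "cc_approx k (indicator (A \<inter> cube_vec k r))"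
proof -
 have G: "Int_stable (orthants k)"
 proof (rule Int_stableI)
  fix a b assume "a \<in> orthants k" "b \<in> orthants k"
  then obtain x y where "a = {v \<in> rvec k. \<forall>i<k. v $ i \<le> x i}" "b = {v \<in> rvec k. \<forall>i<k. v $ i \<le> y i}"
   by (auto simp: orthants_def)
  hence "a \<inter> b = {v \<in> rvec k. \<forall>i<k. v $ i \<le> min (x i) (y i)}" by auto
  also have "... \<in> orthants k"
   unfolding orthants_def by (rule rangeI[of "\<lambda>a. {v \<in> rvec k. \<forall>i<k. v $ i \<le> a i}" "\<lambda>i. min (x i) (y i)"])
  finally show "a \<inter> b \<in> orthants k" .
 qed
 have sub: "orthants k \<subseteq> Pow (rvec k)" by (auto simp: orthants_def)
 have in_sets: "sigma_sets (rvec k) (orthants k) \<subseteq> sets (leb k)"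
 proof -
  have "orthants k \<subseteq> sets (leb k)"
  proof
   fix B assume "B \<in> orthants k"
   then obtain a where B: "B = {v \<in> rvec k. \<forall>i<k. v $ i \<le> a i}" by (auto simp: orthants_def)
   note [measurable] = measurable_vec_index
   have "B = {v \<in> space (leb k). \<forall>i\<in>{..<k}. v $ i \<le> a i}" by (auto simp: B)
   also have "... \<in> sets (leb k)" by measurable
   finally show "B \<in> sets (leb k)" .
  qed
  from sets.sigma_sets_subset[OF this] show ?thesis by simp
 qed
 have cube: "integrable (leb k) (indicator (cube_vec k r) :: real vec \<Rightarrow> real)"
  using cc_approx_box by (simp add: cc_approx_def)
 show ?thesis
  using G sub sets_leb_orthants[OF assms]
 proof (induction rule: sigma_sets_induct_disjoint)
  case (basic B)
  then obtain a where B: "B = {v \<in> rvec k. \<forall>i<k. v $ i \<le> a i}" by (auto simp: orthants_def)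
  have "B \<inter> cube_vec k r = box_vec k (\<lambda>_. - r) (\<lambda>i. min (a i) r)" by (auto simp: B box_vec_def)
  thus ?case using cc_approx_box by simp
 next
  case empty
  have "cc_fun k (\<lambda>v. 0)" unfolding cc_fun_def seqcont_def by auto
  thus ?case using cc_approx_cc by simp
 next
  case (compl B)
  have "indicator ((rvec k - B) \<inter> cube_vec k r) = (\<lambda>v. - 1 * indicator (B \<inter> cube_vec k r) v + indicator (cube_vec k r) v :: real)"
   by (auto simp: fun_eq_iff box_vec_def split: split_indicator)
  thus ?case using cc_approx_linear[OF compl(2) cc_approx_box, of "- 1"] by simp
 next
  case (union B)
  have Bs: "B i \<in> sets (leb k)" for i using union(2) in_sets by auto
  \<comment> \<open>Finite unions follow from additivity by disjointness; the countable union is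
    then a limit dominated by the indicator of the cube.\<close>
  have fin: "cc_approx k (indicator ((\<Union>i<n. B i) \<inter> cube_vec k r))" for n
  proof (induction n)
   case 0
   have "cc_fun k (\<lambda>v. 0)" unfolding cc_fun_def seqcont_def by auto
   thus ?case using cc_approx_cc by simp
  next
   case (Suc n)
   have "B n \<inter> B i = {}" if "i < n" for i using union(1) that by (simp add: disjoint_family_on_def)
   hence "B n \<inter> (\<Union>i<n. B i) = {}" by blast
   hence "indicator ((\<Union>i<Suc n. B i) \<inter> cube_vec k r) = (\<lambda>v. 1 * indicator (B n \<inter> cube_vec k r) v + indicator ((\<Union>i<n. B i) \<inter> cube_vec k r) v :: real)"
    by (auto simp: fun_eq_iff lessThan_Suc split: split_indicator)
   thus ?case using cc_approx_linear[OF union(3) Suc, of 1 n] by simp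
  qed
  show ?case
  proof (rule cc_approx_lim[OF fin _ cube])
   show "indicator ((\<Union>i. B i) \<inter> cube_vec k r) \<in> bmeas k"
    using Bs box_vec_sets by (intro borel_measurable_indicator sets.Int sets.countable_UN) auto
   fix v assume "v \<in> rvec k"
   show "(\<lambda>n. indicator ((\<Union>i<n. B i) \<inter> cube_vec k r) v :: real) \<longlonglongrightarrow> indicator ((\<Union>i. B i) \<inter> cube_vec k r) v"
   proof (cases "v \<in> (\<Union>i. B i) \<inter> cube_vec k r")
    case True
    then obtain i where i: "v \<in> B i" by blast
    have "\<forall>\<^sub>F n in sequentially. indicator ((\<Union>i<n. B i) \<inter> cube_vec k r) v = (1 :: real)"
    proof (rule eventually_sequentiallyI[of "Suc i"])
     fix n assume "Suc i \<le> n"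
     hence "v \<in> (\<Union>i<n. B i) \<inter> cube_vec k r" using i True by (auto intro!: bexI[of _ i])
     thus "indicator ((\<Union>i<n. B i) \<inter> cube_vec k r) v = (1 :: real)" by simp
    qed
    thus ?thesis using True by (simp add: tendsto_eventually)
   qed auto
   show "\<bar>indicator ((\<Union>i<n. B i) \<inter> cube_vec k r) v\<bar> \<le> (indicator (cube_vec k r) v :: real)" for n
    by (auto split: split_indicator)
  qed
 qed
qed

lemma integrable_cc_approx:
 assumes "integrable (leb k) f" shows "cc_approx k f"
 using assms
proof (induction rule: integrable_induct)
 case (base A c)
 have A: "integrable (leb k) (indicator A :: real vec \<Rightarrow> real)"
  using base sets.Int_space_eq2[OF base(1)] by (simp add: integrable_indicator_iff)
 have "cc_approx k (indicator A)"
 proof (rule cc_approx_lim[OF cc_approx_bounded_set[OF base(1)] _ A])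
  show "indicator A \<in> bmeas k" using base by simp
  fix v assume v: "v \<in> rvec k"
  show "\<bar>indicator (A \<inter> cube_vec k (real i)) v\<bar> \<le> (indicator A v :: real)" for i by (auto split: split_indicator)
  obtain N :: nat where N: "(\<Sum>j<k. \<bar>v $ j\<bar>) < real N" using reals_Archimedean2 by blast
  have "v \<in> cube_vec k (real n)" if "N \<le> n" for n
  proof -
   have "- real n \<le> v $ j \<and> v $ j \<le> real n" if "j < k" for j
   proof -
    have "\<bar>v $ j\<bar> \<le> (\<Sum>j<k. \<bar>v $ j\<bar>)" by (rule member_le_sum) (use that in auto)
    thus ?thesis using N \<open>N \<le> n\<close> by linarith
   qed
   thus ?thesis using v by (simp add: box_vec_def)
  qed
  hence "\<forall>\<^sub>F n in sequentially. indicator (A \<inter> cube_vec k (real n)) v = (indicator A v :: real)"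
   by (intro eventually_sequentiallyI[of N]) (auto split: split_indicator)
  thus "(\<lambda>n. indicator (A \<inter> cube_vec k (real n)) v :: real) \<longlonglongrightarrow> indicator A v" by (rule tendsto_eventually)
 qed
 moreover have "cc_approx k (\<lambda>v. 0)" by (rule cc_approx_cc) (auto simp: cc_fun_def seqcont_def)
 ultimately have "cc_approx k (\<lambda>v. c * indicator A v + 0)" by (rule cc_approx_linear)
 thus ?case by (simp add: mult.commute)
next
 case (add f g)
 thus ?case using cc_approx_linear[of k f g 1] by simp
next
 case (lim f s)
 have "integrable (leb k) (\<lambda>v. 2 * norm (f v))"
  by (intro integrable_mult_right integrable_norm lim)
 thus ?case
  by (rule cc_approx_lim[OF lim.IH borel_measurable_integrable[OF lim.hyps(4)]]) (use lim.hyps in auto)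
qed

text \<open>Approximation in L1 gives convergence almost everywhere along a subsequence. Replacing g
  by its positive part does not increase the distance to f, because f is nonnegative.\<close>

lemma nice_fun_approx:
 assumes f: "integrable (leb k) f" and f0: "\<forall>v\<in>rvec k. 0 \<le> f v"
 obtains g where "\<And>i::nat. nice_fun k (g i)" "AE v in leb k. (\<lambda>i. g i v) \<longlonglongrightarrow> f v"
  "(\<lambda>i. \<integral>v. g i v \<partial>leb k) \<longlonglongrightarrow> (\<integral>v. f v \<partial>leb k)"
proof -
 have "\<exists>g. nice_fun k g \<and> (\<integral>v. \<bar>f v - g v\<bar> \<partial>leb k) \<le> e" if e: "0 < e" for e
 proof -
  obtain g where g: "cc_fun k g" "(\<integral>v. \<bar>f v - g v\<bar> \<partial>leb k) < e"
   using integrable_cc_approx[OF f] e unfolding cc_approx_def by blast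
  have n: "nice_fun k (\<lambda>v. max 0 (g v))" by (rule cc_fun_max[OF g(1)])
  have "(\<integral>v. \<bar>f v - max 0 (g v)\<bar> \<partial>leb k) \<le> (\<integral>v. \<bar>f v - g v\<bar> \<partial>leb k)"
  proof (rule integral_mono)
   fix v assume "v \<in> space (leb k)"
   hence "0 \<le> f v" using f0 by simp
   thus "\<bar>f v - max 0 (g v)\<bar> \<le> \<bar>f v - g v\<bar>" by linarith
  qed (use f cc_fun_integrable[OF g(1)] nice_fun_integrable[OF n] in auto)
  thus ?thesis using n g(2) by (intro exI[of _ "\<lambda>v. max 0 (g v)"]) simp
 qed
 hence "\<forall>i::nat. \<exists>g. nice_fun k g \<and> (\<integral>v. \<bar>f v - g v\<bar> \<partial>leb k) \<le> 1 / real (Suc i)" by simp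
 from choice[OF this] obtain h where h: "\<And>i. nice_fun k (h i)" "\<And>i. (\<integral>v. \<bar>f v - h i v\<bar> \<partial>leb k) \<le> 1 / real (Suc i)"
  by blast
 have hi[simp]: "integrable (leb k) (h i)" for i by (rule nice_fun_integrable[OF h(1)])
 have d: "integrable (leb k) (\<lambda>v. f v - h i v)" for i using f by simp
 have l0: "(\<lambda>i. \<integral>v. norm (f v - h i v) \<partial>leb k) \<longlonglongrightarrow> 0"
 proof (rule tendsto_sandwich[OF _ _ tendsto_const LIMSEQ_Suc[OF lim_1_over_n]])
  show "\<forall>\<^sub>F i in sequentially. 0 \<le> (\<integral>v. norm (f v - h i v) \<partial>leb k)" by (intro always_eventually allI integral_nonneg_AE) auto
  show "\<forall>\<^sub>F i in sequentially. (\<integral>v. norm (f v - h i v) \<partial>leb k) \<le> 1 / real (Suc i)" using h(2) by simp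
 qed
 obtain r where r: "strict_mono r" "AE v in leb k. (\<lambda>i. f v - h (r i) v) \<longlonglongrightarrow> 0"
  using tendsto_L1_AE_subseq[OF d l0] by blast
 show thesis
 proof (rule that[of "\<lambda>i. h (r i)"])
  show "nice_fun k (h (r i))" for i by (rule h(1))
  show "AE v in leb k. (\<lambda>i. h (r i) v) \<longlonglongrightarrow> f v"
   using r(2)
  proof eventually_elim
   fix v assume "(\<lambda>i. f v - h (r i) v) \<longlonglongrightarrow> 0"
   hence "(\<lambda>i. f v - (f v - h (r i) v)) \<longlonglongrightarrow> f v - 0" by (intro tendsto_intros)
   thus "(\<lambda>i. h (r i) v) \<longlonglongrightarrow> f v" by simp
  qed
  have "(\<lambda>i. \<integral>v. f v - h i v \<partial>leb k) \<longlonglongrightarrow> 0"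
   by (rule Lim_null_comparison[OF _ l0]) (intro always_eventually allI integral_norm_bound)
  hence "(\<lambda>i. \<integral>v. f v - h (r i) v \<partial>leb k) \<longlonglongrightarrow> 0" by (rule LIMSEQ_subseq_LIMSEQ[OF _ r(1), unfolded comp_def])
  hence "(\<lambda>i. (\<integral>v. f v \<partial>leb k) - (\<integral>v. f v - h (r i) v \<partial>leb k)) \<longlonglongrightarrow> (\<integral>v. f v \<partial>leb k) - 0" by (intro tendsto_intros)
  thus "(\<lambda>i. \<integral>v. h (r i) v \<partial>leb k) \<longlonglongrightarrow> (\<integral>v. f v \<partial>leb k)" using f by simp
 qed
qed

section \<open>The Brascamp--Lieb constant\<close>

text \<open>Lebesgue measure and a Gaussian have the same null sets, and a surjective L maps the
  standard Gaussian to a Gaussian.\<close>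

lemma AE_lborel_vec_surj:
 assumes L: "L \<in> rmat d n" "\<forall>y\<in>rvec d. \<exists>x\<in>rvec n. L *\<^sub>v x = y"
  and P: "AE y in leb d. P y"
 shows "AE x in leb n. P (L *\<^sub>v x)"
proof -
 have AE_gauss: "(AE x in gauss k M. R x) \<longleftrightarrow> (AE x in leb k. R x)" if M: "pos_def_mat k M" for k M R
 proof -
  note [measurable] = meas_qf[OF pd_carrier[OF M]]
  have "(\<lambda>v. ennreal (sqrt (det M) * gker M v)) \<in> bmeas k" by measurable
  from AE_density[OF this] show ?thesis
   unfolding gauss_def using pd_det_pos[OF M] by simp
 qed
 define S where "S = L * inv_mat (1\<^sub>m n) * L\<^sup>T"
 have S: "pos_def_mat d S" unfolding S_def by (rule pos_def_congruence[OF L pd_inv(4)[OF pos_def_one]])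
 have "AE y in gauss d (inv_mat S). P y" unfolding AE_gauss[OF pd_inv(4)[OF S]] by (rule P)
 also have "gauss d (inv_mat S) = distr (gauss n (1\<^sub>m n)) (leb d) (\<lambda>z. L *\<^sub>v z)"
  by (rule distr_gauss_linear[OF pos_def_one pd_inv(4)[OF S] L(1), symmetric]) (use pd_inv(3)[OF S] in \<open>simp add: S_def\<close>)
 finally have "AE y in distr (gauss n (1\<^sub>m n)) (leb d) (\<lambda>z. L *\<^sub>v z). P y" .
 moreover have "(\<lambda>z. L *\<^sub>v z) \<in> gauss n (1\<^sub>m n) \<rightarrow>\<^sub>M leb d"
  using meas_mult_mat_vec[OF L(1) measurable_ident_sets[of "gauss n (1\<^sub>m n)" "leb n"]] by simp
 ultimately have "AE x in gauss n (1\<^sub>m n). P (L *\<^sub>v x)" by (rule AE_distrD[rotated])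
 thus ?thesis unfolding AE_gauss[OF pos_def_one] .
qed

context BL_positive
begin

text \<open>The approximations converge almost everywhere on each target space, and by
  \<open>AE_lborel_vec_surj\<close> also after composition with L_j. Fatou's lemma carries the
  inequality over, since the integrals of the approximations converge.\<close>

theorem integrable_Brascamp_Lieb:
 assumes f: "\<forall>j<m. integrable (leb (d j)) (f j) \<and> (\<forall>y\<in>rvec (d j). 0 \<le> f j y)"
 shows "(\<integral>\<^sup>+x. ennreal (\<Prod>j<m. rpow (f j (L j *\<^sub>v x)) (p j)) \<partial>leb n)
  \<le> ennreal (sqrt (1 / I)) * ennreal (\<Prod>j<m. rpow (\<integral>y. f j y \<partial>leb (d j)) (p j))"
proof -
 have "\<forall>j. \<exists>g. j < m \<longrightarrow> (\<forall>i::nat. nice_fun (d j) (g i)) \<and> (AE v in leb (d j). (\<lambda>i. g i v) \<longlonglongrightarrow> f j v) \<and>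
  (\<lambda>i. \<integral>v. g i v \<partial>leb (d j)) \<longlonglongrightarrow> (\<integral>v. f j v \<partial>leb (d j))"
 proof
  fix j
  show "\<exists>g. j < m \<longrightarrow> (\<forall>i::nat. nice_fun (d j) (g i)) \<and> (AE v in leb (d j). (\<lambda>i. g i v) \<longlonglongrightarrow> f j v) \<and>
   (\<lambda>i. \<integral>v. g i v \<partial>leb (d j)) \<longlonglongrightarrow> (\<integral>v. f j v \<partial>leb (d j))"
  proof (cases "j < m")
   case True
   hence fj: "integrable (leb (d j)) (f j)" "\<forall>y\<in>rvec (d j). 0 \<le> f j y" using f by auto
   obtain g where "\<And>i::nat. nice_fun (d j) (g i)" "AE v in leb (d j). (\<lambda>i. g i v) \<longlonglongrightarrow> f j v"
    "(\<lambda>i. \<integral>v. g i v \<partial>leb (d j)) \<longlonglongrightarrow> (\<integral>v. f j v \<partial>leb (d j))"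
    by (fact nice_fun_approx[OF fj])
   thus ?thesis by blast
  qed simp
 qed
 from choice[OF this] obtain g where
  g: "\<forall>j. j < m \<longrightarrow> (\<forall>i::nat. nice_fun (d j) (g j i)) \<and> (AE v in leb (d j). (\<lambda>i. g j i v) \<longlonglongrightarrow> f j v) \<and>
  (\<lambda>i. \<integral>v. g j i v \<partial>leb (d j)) \<longlonglongrightarrow> (\<integral>v. f j v \<partial>leb (d j))" ..
 hence gn: "nice_fun (d j) (g j i)" and gae: "AE v in leb (d j). (\<lambda>i. g j i v) \<longlonglongrightarrow> f j v"
  and gint: "(\<lambda>i. \<integral>v. g j i v \<partial>leb (d j)) \<longlonglongrightarrow> (\<integral>v. f j v \<partial>leb (d j))" if "j < m" for i j
  using that by simp_all
 define F where "F i x = (\<Prod>j<m. rpow (g j i (L j *\<^sub>v x)) (p j))" for i x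
 define C where "C i = sqrt (1 / I) * (\<Prod>j<m. rpow (\<integral>y. g j i y \<partial>leb (d j)) (p j))" for i
 have Fm: "(\<lambda>x. ennreal (F i x)) \<in> bmeas n" for i
 proof -
  have "(\<lambda>x. rpow (g j i (L j *\<^sub>v x)) (p j)) \<in> bmeas n" if j: "j < m" for j
  proof -
   have gm: "g j i \<in> bmeas (d j)" using gn[OF j, of i] by (simp add: nice_fun_def)
   have "(\<lambda>z. L j *\<^sub>v z) \<in> leb n \<rightarrow>\<^sub>M leb (d j)"
    by (rule meas_mult_mat_vec[OF L[OF j]]) simp
   from measurable_compose[OF measurable_compose[OF this gm] measurable_rpow] show ?thesis .
  qed
  hence [measurable]: "F i \<in> bmeas n"
   unfolding F_def by (intro borel_measurable_prod) auto
  show ?thesis by measurable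
 qed
 have Clim: "C \<longlonglongrightarrow> sqrt (1 / I) * (\<Prod>j<m. rpow (\<integral>y. f j y \<partial>leb (d j)) (p j))"
  unfolding C_def
 proof (intro tendsto_mult tendsto_const tendsto_prod)
  fix j assume "j \<in> {..<m}"
  hence j: "j < m" by simp
  have "0 \<le> (\<integral>y. g j i y \<partial>leb (d j))" for i
   using nice_fun_nonneg[OF gn[OF j, of i]] by (intro integral_nonneg_AE AE_I2) simp
  thus "(\<lambda>i. rpow (\<integral>y. g j i y \<partial>leb (d j)) (p j)) \<longlonglongrightarrow> rpow (\<integral>y. f j y \<partial>leb (d j)) (p j)"
   by (intro tendsto_rpow gint[OF j] always_eventually allI p(1)[OF j])
 qed
 have "AE x in leb n. \<forall>j\<in>{..<m}. (\<lambda>i. g j i (L j *\<^sub>v x)) \<longlonglongrightarrow> f j (L j *\<^sub>v x)"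
 proof (rule AE_finite_allI)
  fix j assume "j \<in> {..<m}"
  hence j: "j < m" by simp
  show "AE x in leb n. (\<lambda>i. g j i (L j *\<^sub>v x)) \<longlonglongrightarrow> f j (L j *\<^sub>v x)"
   by (rule AE_lborel_vec_surj[OF L[OF j] surj[OF j] gae[OF j]])
 qed simp
 with AE_space have ae: "AE x in leb n. ennreal (\<Prod>j<m. rpow (f j (L j *\<^sub>v x)) (p j)) = liminf (\<lambda>i. ennreal (F i x))"
 proof eventually_elim
  fix x assume "x \<in> space (leb n)" and lim: "\<forall>j\<in>{..<m}. (\<lambda>i. g j i (L j *\<^sub>v x)) \<longlonglongrightarrow> f j (L j *\<^sub>v x)"
  hence x: "x \<in> rvec n" by simp
  have "(\<lambda>i. F i x) \<longlonglongrightarrow> (\<Prod>j<m. rpow (f j (L j *\<^sub>v x)) (p j))"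
   unfolding F_def
  proof (rule tendsto_prod)
   fix j assume jm: "j \<in> {..<m}"
   hence j: "j < m" by simp
   have "L j *\<^sub>v x \<in> rvec (d j)" using L[OF j] x by simp
   hence "0 \<le> g j i (L j *\<^sub>v x)" for i by (rule nice_fun_nonneg[OF gn[OF j]])
   thus "(\<lambda>i. rpow (g j i (L j *\<^sub>v x)) (p j)) \<longlonglongrightarrow> rpow (f j (L j *\<^sub>v x)) (p j)"
    using lim jm by (intro tendsto_rpow always_eventually allI p(1)[OF j]) auto
  qed
  from lim_imp_Liminf[OF _ tendsto_ennrealI[OF this]]
  show "ennreal (\<Prod>j<m. rpow (f j (L j *\<^sub>v x)) (p j)) = liminf (\<lambda>i. ennreal (F i x))" by simp
 qed
 have "(\<integral>\<^sup>+x. ennreal (\<Prod>j<m. rpow (f j (L j *\<^sub>v x)) (p j)) \<partial>leb n) = (\<integral>\<^sup>+x. liminf (\<lambda>i. ennreal (F i x)) \<partial>leb n)"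
  by (rule nn_integral_cong_AE[OF ae])
 also have "... \<le> liminf (\<lambda>i. \<integral>\<^sup>+x. ennreal (F i x) \<partial>leb n)" by (rule nn_integral_liminf[OF Fm])
 also have "... \<le> liminf (\<lambda>i. ennreal (C i))"
  unfolding F_def C_def by (intro Liminf_mono always_eventually allI nice_Brascamp_Lieb gn)
 also have "... = ennreal (sqrt (1 / I) * (\<Prod>j<m. rpow (\<integral>y. f j y \<partial>leb (d j)) (p j)))"
  by (rule lim_imp_Liminf[OF _ tendsto_ennrealI[OF Clim]]) simp
 also have "... = ennreal (sqrt (1 / I)) * ennreal (\<Prod>j<m. rpow (\<integral>y. f j y \<partial>leb (d j)) (p j))"
  by (rule ennreal_mult') (use I in simp)
 finally show ?thesis .
qed

lemma BL_le: "BL n m d L p \<le> ennreal (sqrt (1 / I))"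
 unfolding BL_def by (intro Inf_lower CollectI allI impI) (rule integrable_Brascamp_Lieb)

text \<open>A constant 0 would have inverse square infinity, and the constant is finite by
  \<open>BL_le\<close>; in the remaining case the bound BL <= I^(-1/2) is squared and
  inverted.\<close>

lemma inv_sq_BL_ge: "ennreal I \<le> inv_sq (BL n m d L p)"
proof (cases "BL n m d L p")
 case (real b)
 show ?thesis
 proof (cases "b = 0")
  case True
  thus ?thesis using real by (simp add: inv_sq_def)
 next
  case False
  hence b: "0 < b" "b \<le> sqrt (1 / I)" using BL_le real I by (simp_all add: ennreal_le_iff)
  have "b\<^sup>2 \<le> (sqrt (1 / I))\<^sup>2" using b by (intro power_mono) auto
  hence "b\<^sup>2 \<le> 1 / I" using I by simp
  hence "I \<le> (inverse b)\<^sup>2" using b I by (simp add: field_simps)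
  thus ?thesis using b real by (simp add: inv_sq_def inverse_ennreal ennreal_power ennreal_leI)
 qed
next
 case top
 thus ?thesis using BL_le by (simp add: top_unique)
qed

end

theorem theorem1p3:
  fixes n m :: nat and d :: "nat \<Rightarrow> nat" and p :: "nat \<Rightarrow> real"
  assumes "1 \<le> n"
    and "\<And>j. j < m \<Longrightarrow> 1 \<le> d j"
    and "\<And>j. j < m \<Longrightarrow> 0 \<le> p j \<and> p j \<le> 1"
  shows "\<exists>(N::nat) (\<delta>\<^sub>0::real). 0 < \<delta>\<^sub>0 \<and>
    (\<forall>\<delta> L. 0 < \<delta> \<longrightarrow> \<delta> < \<delta>\<^sub>0 \<longrightarrow> admissible n m d L \<longrightarrow>
      (INF A\<in>bounded_tuples m d L (1 / \<delta> ^ N). inv_sq (BL_g n m L p A))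
        \<le> inv_sq (BL n m d L p)
          + ennreal (\<delta> * (\<Prod>j<m. det (L j * transpose_mat (L j)) powr p j)))"
proof -
 have p: "\<forall>j<m. 0 \<le> p j \<and> p j \<le> 1" using assms(3) by blast
 obtain \<delta>0 :: real and N :: nat where \<delta>0: "0 < \<delta>0"
  and cutoff: "\<And>\<delta> L A. 0 < \<delta> \<Longrightarrow> \<delta> < \<delta>0 \<Longrightarrow> admissible n m d L \<Longrightarrow> (\<And>j. j < m \<Longrightarrow> pos_def_mat (d j) (A j)) \<Longrightarrow>
   \<exists>A'\<in>bounded_tuples m d L (1 / \<delta> ^ N).
    gform n m L p A' \<le> gform n m L p A + \<delta> * (\<Prod>j<m. det (L j * (L j)\<^sup>T) powr p j)"
  by (fact gform_cutoff[OF p])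
 show ?thesis
 proof (intro exI[of _ N] exI[of _ \<delta>0] conjI allI impI)
  fix \<delta> :: real and L :: "nat \<Rightarrow> real mat"
  assume \<delta>: "0 < \<delta>" "\<delta> < \<delta>0" and adm: "admissible n m d L"
  have L: "L j \<in> rmat (d j) n" "\<forall>y\<in>rvec (d j). \<exists>x\<in>rvec n. L j *\<^sub>v x = y" if "j < m" for j
   using adm that by (auto simp: admissible_def)
  define X where "X = (INF A\<in>bounded_tuples m d L (1 / \<delta> ^ N). inv_sq (BL_g n m L p A))"
  define \<rho> where "\<rho> = \<delta> * (\<Prod>j<m. det (L j * (L j)\<^sup>T) powr p j)"
  \<comment> \<open>The values at all positive definite tuples, without a bound on their size; the
    cutoff leads from these to the bounded tuples at the cost \<open>\<rho>\<close>.\<close>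
  define G where "G = {gform n m L p A |A. \<forall>j<m. pos_def_mat (d j) (A j)}"
  have pd_bounded: "pos_def_mat (d j) (A j)" if "A \<in> bounded_tuples m d L R" "j < m" for A R j
   using that by (simp add: bounded_tuples_def)
  have \<rho>0: "0 \<le> \<rho>" unfolding \<rho>_def using \<delta> by (intro mult_nonneg_nonneg prod_nonneg) auto
  have G0: "0 \<le> g" if gG: "g \<in> G" for g
  proof -
   obtain A where A: "\<forall>j<m. pos_def_mat (d j) (A j)" "g = gform n m L p A" using gG by (auto simp: G_def)
   thus ?thesis
    using det_BL_form_nonneg[of m L d n A p] L(1) p prod_nonneg[of "{..<m}" "\<lambda>j. det (A j) powr p j"] by (simp add: gform_def)
  qed
  have Gne: "G \<noteq> {}" using pos_def_one by (auto simp: G_def intro!: exI[of _ "\<lambda>j. 1\<^sub>m (d j)"])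
  have bdd: "bdd_below G" using G0 by (rule bdd_belowI)
  define I where "I = Inf G"
  have I0: "0 \<le> I" unfolding I_def by (rule cInf_greatest[OF Gne G0])
  have XA: "X \<le> ennreal (g + \<rho>)" if gG: "g \<in> G" for g
  proof -
   obtain A where A: "\<forall>j<m. pos_def_mat (d j) (A j)" "g = gform n m L p A" using gG by (auto simp: G_def)
   obtain A' where A': "A' \<in> bounded_tuples m d L (1 / \<delta> ^ N)" "gform n m L p A' \<le> g + \<rho>"
    using cutoff[OF \<delta> adm, of A] A by (auto simp: \<rho>_def)
   have "X \<le> inv_sq (BL_g n m L p A')" unfolding X_def by (rule INF_lower[OF A'(1)])
   also have "... = ennreal (gform n m L p A')"
    by (rule inv_sq_BL_g[of m L d]) (use L(1) pd_bounded[OF A'(1)] p in auto)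
   also have "... \<le> ennreal (g + \<rho>)" by (rule ennreal_leI[OF A'(2)])
   finally show ?thesis .
  qed
  \<comment> \<open>The infimum of \<open>G\<close> need not be attained and is approached up to
    e.\<close>
  have "X \<le> ennreal (I + \<rho>)"
  proof (rule ennreal_le_epsilon)
   fix e :: real assume e: "0 < e"
   then obtain g where g: "g \<in> G" "g < I + e" using cInf_lessD[OF Gne, of "I + e"] by (auto simp: I_def)
   have "X \<le> ennreal (g + \<rho>)" by (rule XA[OF g(1)])
   also have "... \<le> ennreal ((I + \<rho>) + e)" using g(2) by (intro ennreal_leI) simp
   also have "... = ennreal (I + \<rho>) + ennreal e" using I0 \<rho>0 e by (intro ennreal_plus) auto
   finally show "X \<le> ennreal (I + \<rho>) + ennreal e" .
  qed
  also have "... = ennreal I + ennreal \<rho>" using I0 \<rho>0 by (rule ennreal_plus)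
  \<comment> \<open>For I = 0 the bound is trivial; otherwise the infimum meets the assumptions of
    \<open>BL_positive\<close>.\<close>
  also have "ennreal I \<le> inv_sq (BL n m d L p)"
  proof (cases "I = 0")
   case False
   interpret BL_positive n m d L p I
   proof
    show "0 < I" using I0 False by simp
    show "I \<le> gform n m L p A" if "\<And>j. j < m \<Longrightarrow> pos_def_mat (d j) (A j)" for A
     unfolding I_def by (rule cInf_lower[OF _ bdd]) (use that in \<open>auto simp: G_def\<close>)
   qed (use L p in auto)
   show ?thesis by (rule inv_sq_BL_ge)
  qed simp
  finally show "X \<le> inv_sq (BL n m d L p) + ennreal \<rho>" by (simp add: add_right_mono)
 qed (rule \<delta>0)
qed

end
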